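(* Let $\Omega\subseteq\mathbb{R}^d$ be an open set and let $p,q\in(1,\infty)$. Let $\{T(t,s):s,t\in\mathbb{R}\}$ be a family of bounded linear operators on $L^q(\Omega)$ such that for every $\phi\in L^q(\Omega)$ the map $(t,s)\mapsto T(t,s)\phi$ is measurable. Assume that for all $A_q$-weights $w$ on $\mathbb{R}^d$, $$\|T(t,s)\|_{\mathcal{L}(L^q(\Omega,w))}\le C,\qquad s,t\in\mathbb{R},$$ where $C$ is $A_q$-consistent. For $k\in\mathcal{K}$ define $$(I_kf)(t)=\int_{\mathbb{R}}k(t-s)\,T(t,s)f(s)\,ds,\qquad f\in L^p(\mathbb{R};L^q(\Omega)).$$ Then the family $\{I_k:k\in\mathcal{K}\}\subseteq\mathcal{L}(L^p(\mathbb{R};L^q(\Omega)))$ is $\mathcal{R}$-bounded.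
   Context: A weight on $\mathbb{R}^d$ is a locally integrable function $w$ with $w(x)\in(0,\infty)$ for a.e. $x$. For $q\in(1,\infty)$, $w$ is an $A_q$-weight if $$[w]_{A_q}=\sup_Q\Big(\frac1{|Q|}\int_Qw\,dx\Big)\Big(\frac1{|Q|}\int_Qw^{-\frac1{q-1}}\,dx\Big)^{q-1}<\infty,$$ the supremum being over all cubes $Q\subseteq\mathbb{R}^d$ with axes parallel to the coordinate axes. $L^q(\Omega,w)$ is the space of measurable $f$ on $\Omega$ with $\|f\|_{L^q(\Omega,w)}^q=\int_\Omega|f|^qw\,dx<\infty$. $\mathcal{L}(X)$ denotes the bounded linear operators on a Banach space $X$. The assumption $\|T(t,s)\|_{\mathcal{L}(L^q(\Omega,w))}\le C$ means $\|T(t,s)\phi\|_{L^q(\Omega,w)}\le C\|\phi\|_{L^q(\Omega,w)}$ for all $\phi\in L^q(\Omega)\cap L^q(\Omega,w)$. The constant $C$ is called $A_q$-consistent if it is independent of $s,t$ and depends on $w$ only through $[w]_{A_q}$, in an increasing way: $C=C([w]_{A_q})$ with $C([w_0]_{A_q})\le C([w_1]_{A_q})$ whenever $[w_0]_{A_q}\le[w_1]_{A_q}$. (If $T(t,s)$ is only given for $s\le t$, one sets $T(t,s)=0$ for $t<s$.) $\mathcal{K}$ is the set of all $k\in L^1(\mathbb{R})$ such that $|k|*f\le Mf$ a.e. for all simple $f:\mathbb{R}\to[0,\infty)$, where $Mf(x)=\sup_{Q\ni x}\frac1{|Q|}\int_Q|f(y)|\,dy$ ($Q$ ranging over intervals)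 is the Hardy–Littlewood maximal function. Let $X$ be a Banach space and let $(\varepsilon_n)_{n\ge1}$ be a Rademacher sequence on a probability space $(A,\mathscr{A},\mathbb{P})$. A family $\mathscr{S}\subseteq\mathcal{L}(X)$ is $\mathcal{R}$-bounded if there is a constant $C'$ such that for all $N$, all $S_1,\dots,S_N\in\mathscr{S}$ and all $x_1,\dots,x_N\in X$, $$\Big\|\sum_{n=1}^N\varepsilon_nS_nx_n\Big\|_{L^2(A;X)}\le C'\Big\|\sum_{n=1}^N\varepsilon_nx_n\Big\|_{L^2(A;X)}.$$ *)

theory Defs
  imports "HOL-Probability.Probability" "HOL-Library.Function_Algebras"
begin

text \<open>
  Lebesgue and Lebesgue--Bochner spaces are given by representatives: a space is a set of vectors
  with a seminorm, and two vectors at seminorm distance 0 (functions equal almost everywhere)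
  stand for the same element. Vectors are added by the (pointwise) addition of
  \<^theory>\<open>HOL-Library.Function_Algebras\<close>. The scalars are a type \<open>'k\<close> of class
  \<open>{real_normed_field, euclidean_space}\<close>, such as \<^typ>\<open>real\<close> or \<^typ>\<open>complex\<close>.
\<close>

record ('k, 'v) seminormed_space =
  vectors :: "'v set"
  nrm :: "'v \<Rightarrow> real"
  scl :: "'k \<Rightarrow> 'v \<Rightarrow> 'v"

definition bounded_ops :: "('k, 'v::ab_group_add) seminormed_space \<Rightarrow> ('v \<Rightarrow> 'v) set" where
  "bounded_ops X = {S. (\<forall>x\<in>vectors X. S x \<in> vectors X)
     \<and> (\<forall>x\<in>vectors X. \<forall>y\<in>vectors X. nrm X (S (x + y) - (S x + S y)) = 0)
     \<and> (\<forall>c. \<forall>x\<in>vectors X. nrm X (S (scl X c x) - scl X c (S x)) = 0)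
     \<and> (\<exists>B. \<forall>x\<in>vectors X. nrm X (S x) \<le> B * nrm X x)}"


section \<open>Lebesgue spaces, strong measurability, Bochner integral, Bochner spaces\<close>

definition Leb_space :: "'a measure \<Rightarrow> real \<Rightarrow>
    ('k::{real_normed_field, euclidean_space}, 'a \<Rightarrow> 'k) seminormed_space" where
  "Leb_space M q = \<lparr>
     vectors = {f \<in> borel_measurable M. integrable M (\<lambda>x. norm (f x) powr q)},
     nrm = (\<lambda>f. (\<integral>x. norm (f x) powr q \<partial>M) powr (1 / q)),
     scl = (\<lambda>c f x. c * f x) \<rparr>"

definition strongly_measurable ::
    "'b measure \<Rightarrow> ('k, 'v::ab_group_add) seminormed_space \<Rightarrow> ('b \<Rightarrow> 'v) \<Rightarrow> bool" where
  "strongly_measurable M X F \<longleftrightarrow> (\<forall>t\<in>space M. F t \<in> vectors X) \<and>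
     (\<exists>\<sigma>. (\<forall>i. simple_function M (\<sigma> i) \<and> (\<forall>t\<in>space M. \<sigma> i t \<in> vectors X)) \<and>
          (AE t in M. (\<lambda>i. nrm X (F t - \<sigma> i t)) \<longlonglongrightarrow> 0))"

text \<open>The next two definitions follow \<open>simple_bochner_integral\<close> and \<open>has_bochner_integral\<close> of
  \<^theory>\<open>HOL-Analysis.Bochner_Integration\<close>, which need the values to lie in a Banach space type.\<close>

definition simple_integral_in ::
    "'b measure \<Rightarrow> ('k::real_algebra_1, 'v::ab_group_add) seminormed_space \<Rightarrow> ('b \<Rightarrow> 'v) \<Rightarrow> 'v" where
  "simple_integral_in M X \<sigma> =
     (\<Sum>v\<in>\<sigma> ` space M. scl X (of_real (measure M {t\<in>space M. \<sigma> t = v})) v)"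

definition has_bochner_integral_in ::
    "'b measure \<Rightarrow> ('k::real_algebra_1, 'v::ab_group_add) seminormed_space
      \<Rightarrow> ('b \<Rightarrow> 'v) \<Rightarrow> 'v \<Rightarrow> bool" where
  "has_bochner_integral_in M X F v \<longleftrightarrow> strongly_measurable M X F \<and> v \<in> vectors X \<and>
     (\<exists>\<sigma>. (\<forall>i. simple_function M (\<sigma> i) \<and> (\<forall>t\<in>space M. \<sigma> i t \<in> vectors X) \<and>
               emeasure M {t\<in>space M. \<sigma> i t \<noteq> 0} \<noteq> \<infinity>) \<and>
          (\<lambda>i. \<integral>\<^sup>+t. ennreal (nrm X (F t - \<sigma> i t)) \<partial>M) \<longlonglongrightarrow> 0 \<and>
          (\<lambda>i. nrm X (simple_integral_in M X (\<sigma> i) - v)) \<longlonglongrightarrow> 0)"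

definition bochner_integrable_in ::
    "'b measure \<Rightarrow> ('k::real_algebra_1, 'v::ab_group_add) seminormed_space \<Rightarrow> ('b \<Rightarrow> 'v) \<Rightarrow> bool" where
  "bochner_integrable_in M X F \<longleftrightarrow> (\<exists>v. has_bochner_integral_in M X F v)"

text \<open>The integral is determined up to seminorm 0, so any value may be selected.\<close>

definition bochner_integral_in ::
    "'b measure \<Rightarrow> ('k::real_algebra_1, 'v::ab_group_add) seminormed_space \<Rightarrow> ('b \<Rightarrow> 'v) \<Rightarrow> 'v" where
  "bochner_integral_in M X F =
     (if bochner_integrable_in M X F then SOME v. has_bochner_integral_in M X F v else 0)"

definition Bochner_space :: "'b measure \<Rightarrow> real \<Rightarrow> ('k, 'v::ab_group_add) seminormed_space
    \<Rightarrow> ('k, 'b \<Rightarrow> 'v) seminormed_space" where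
  "Bochner_space M p X = \<lparr>
     vectors = {F. strongly_measurable M X F \<and> integrable M (\<lambda>t. nrm X (F t) powr p)},
     nrm = (\<lambda>F. (\<integral>t. nrm X (F t) powr p \<partial>M) powr (1 / p)),
     scl = (\<lambda>c F t. scl X c (F t)) \<rparr>"


section \<open>Muckenhoupt weights\<close>

definition cubes :: "'a::euclidean_space set set" where
  "cubes = {cbox a (a + l *\<^sub>R One) | a l. l > 0}"

definition average :: "'a::euclidean_space set \<Rightarrow> ('a \<Rightarrow> real) \<Rightarrow> ennreal" where
  "average Q f = (\<integral>\<^sup>+x\<in>Q. ennreal (f x) \<partial>lebesgue) / emeasure lebesgue Q"

definition weight :: "('a::euclidean_space \<Rightarrow> real) \<Rightarrow> bool" where
  "weight w \<longleftrightarrow> (\<forall>K. compact K \<longrightarrow> set_integrable lebesgue K w) \<and> (AE x in lebesgue. w x > 0)"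

definition ennreal_powr :: "ennreal \<Rightarrow> real \<Rightarrow> ennreal" where  \<comment> \<open>intended for \<open>r > 0\<close>\<close>
  "ennreal_powr a r = (if a = \<infinity> then \<infinity> else ennreal (enn2real a powr r))"

definition A_const :: "real \<Rightarrow> ('a::euclidean_space \<Rightarrow> real) \<Rightarrow> ennreal" where
  "A_const q w =
     (SUP Q\<in>cubes. average Q w * ennreal_powr (average Q (\<lambda>x. w x powr (- 1 / (q - 1)))) (q - 1))"

definition A_weight :: "real \<Rightarrow> ('a::euclidean_space \<Rightarrow> real) \<Rightarrow> bool" where
  "A_weight q w \<longleftrightarrow> weight w \<and> A_const q w < \<infinity>"

definition weighted_measure :: "'a::euclidean_space set \<Rightarrow> ('a \<Rightarrow> real) \<Rightarrow> 'a measure" where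
  "weighted_measure \<Omega> w = density (lebesgue_on \<Omega>) (\<lambda>x. ennreal (w x))"

text \<open>The uniform weighted bound: \<open>C\<close> is a function of the \<open>A\<^sub>q\<close>-constant of the weight only,
  and it is increasing on the values that this constant attains.\<close>

definition A_consistently_bounded :: "real \<Rightarrow> 'a::euclidean_space set \<Rightarrow>
    (real \<Rightarrow> real \<Rightarrow> ('a \<Rightarrow> 'k::{real_normed_field, euclidean_space}) \<Rightarrow> ('a \<Rightarrow> 'k)) \<Rightarrow>
    (real \<Rightarrow> real) \<Rightarrow> bool" where
  "A_consistently_bounded q \<Omega> T C \<longleftrightarrow>
     (\<forall>(w\<^sub>0 :: 'a \<Rightarrow> real) (w\<^sub>1 :: 'a \<Rightarrow> real). A_weight q w\<^sub>0 \<and> A_weight q w\<^sub>1 \<and> A_const q w\<^sub>0 \<le> A_const q w\<^sub>1 \<longrightarrow>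
        C (enn2real (A_const q w\<^sub>0)) \<le> C (enn2real (A_const q w\<^sub>1))) \<and>
     (\<forall>w :: 'a \<Rightarrow> real. A_weight q w \<longrightarrow> (\<forall>t s.
        \<forall>\<phi> \<in> vectors (Leb_space (lebesgue_on \<Omega>) q) \<inter> vectors (Leb_space (weighted_measure \<Omega> w) q).
          T t s \<phi> \<in> vectors (Leb_space (weighted_measure \<Omega> w) q) \<and>
          nrm (Leb_space (weighted_measure \<Omega> w) q) (T t s \<phi>)
            \<le> C (enn2real (A_const q w)) * nrm (Leb_space (weighted_measure \<Omega> w) q) \<phi>))"


section \<open>The kernel class and the integral operators\<close>

definition maximal_fun :: "('a::euclidean_space \<Rightarrow> real) \<Rightarrow> 'a \<Rightarrow> ennreal" where
  "maximal_fun f x = (SUP Q\<in>{Q\<in>cubes. x \<in> Q}. average Q (\<lambda>y. \<bar>f y\<bar>))"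

definition kernels :: "(real \<Rightarrow> 'k::{real_normed_field, euclidean_space}) set" where
  "kernels = {k. integrable lebesgue k \<and>
     (\<forall>f :: real \<Rightarrow> real. simple_function lebesgue f \<and> (\<forall>y. f y \<ge> 0) \<longrightarrow>
        (AE x in lebesgue. (\<integral>\<^sup>+y. ennreal (norm (k (x - y)) * f y) \<partial>lebesgue) \<le> maximal_fun f x))}"

definition integral_op :: "('k::{real_normed_field, euclidean_space}, 'v::ab_group_add) seminormed_space
    \<Rightarrow> (real \<Rightarrow> real \<Rightarrow> 'v \<Rightarrow> 'v) \<Rightarrow> (real \<Rightarrow> 'k) \<Rightarrow> (real \<Rightarrow> 'v) \<Rightarrow> (real \<Rightarrow> 'v)" where
  "integral_op X T k f t = bochner_integral_in lebesgue X (\<lambda>s. scl X (k (t - s)) (T t s (f s)))"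


section \<open>R-boundedness\<close>

definition rademacher_sequence :: "'p measure \<Rightarrow> (nat \<Rightarrow> 'p \<Rightarrow> real) \<Rightarrow> bool" where
  "rademacher_sequence P \<epsilon> \<longleftrightarrow> prob_space P \<and> prob_space.indep_vars P (\<lambda>_. borel) \<epsilon> {1..} \<and>
     (\<forall>n\<ge>1. measure P {a\<in>space P. \<epsilon> n a = 1} = 1 / 2 \<and> measure P {a\<in>space P. \<epsilon> n a = - 1} = 1 / 2)"

definition R_bounded :: "'p measure \<Rightarrow> (nat \<Rightarrow> 'p \<Rightarrow> real) \<Rightarrow>
    ('k::real_algebra_1, 'v::ab_group_add) seminormed_space \<Rightarrow> ('v \<Rightarrow> 'v) set \<Rightarrow> bool" where
  "R_bounded P \<epsilon> X \<S> \<longleftrightarrow> (\<exists>C. \<forall>N S x.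
     (\<forall>n\<in>{1..N}. S n \<in> \<S> \<and> x n \<in> vectors X) \<longrightarrow>
       nrm (Bochner_space P 2 X) (\<lambda>a. \<Sum>n=1..N. scl X (of_real (\<epsilon> n a)) (S n (x n)))
         \<le> C * nrm (Bochner_space P 2 X) (\<lambda>a. \<Sum>n=1..N. scl X (of_real (\<epsilon> n a)) (x n)))"

end

theory Submission
  imports Defs
begin

text \<open>
  A kernel in the class only enters through \<open>\<bar>k\<bar> * f \<le> M f\<close>, and so does its reflection. By duality and the
  Rubio de Francia algorithm, a square function estimate in \<open>L\<^sup>p(\<real>; L\<^sup>q)\<close> follows from weighted \<open>L\<^sup>q\<close> bounds on
  \<open>\<real> \<times> \<real>\<^sup>d\<close> for weights \<open>H\<^sub>2 H\<^sub>1\<^bsup>1-q\<^esup>\<close>, where both \<open>H\<^sub>i\<close> are \<open>A\<^sub>1\<close> for the sum of the maximal operators in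
  \<open>t\<close> and in \<open>x\<close>. The weighted bound for \<open>\<integral> \<bar>k(t - s)\<bar> \<bar>T(t,s) f(s)\<bar> ds\<close> is direct: Hoelder's inequality in \<open>s\<close> costs one
  \<open>A\<^sub>1\<close> bound in time, the assumption on \<open>T(t,s)\<close> is applied with an \<open>A\<^sub>q\<close> weight in space, and integrating
  in \<open>t\<close> costs the other \<open>A\<^sub>1\<close> bound. Khintchine's inequality turns the square function estimate into
  \<open>\<R>\<close>-boundedness. Maximal functions are replaced by sums of maximal functions of nested families (shifted
  dyadic grids), for which the weighted estimates have short proofs, and Bochner integrals are computed from
  jointly measurable representatives.
\<close>

text \<open>The obstacle is that T(t,s) couples two times, while a weight on the product space is
  evaluated at one. Keeping every weight as a product of \<open>A\<^sub>1\<close> factors resolves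
  it, since the two factors may be taken at different times and the result is still an
  \<open>A\<^sub>q\<close> weight in space, with a constant controlled by one number B. So B is the
  only quantity followed through the proof, and every extrapolation states for which B it needs its
  hypothesis. Square functions are reached through exponent 2, where weighted estimates for single
  operators can be added. The assumption controls C only at values that \<open>A\<^sub>q\<close>
  constants attain; a uniform bound for all weights with constant at most N therefore rests on the
  construction of a weight with constant at least N. Since R-boundedness asks for some finite
  constant, sharp inequalities are replaced by versions with a factor 2 or 4 and a one-line reason.
  Vectors are functions with a seminorm, so linearity and Bochner integrals are determined only up
  to null sets; Borel versions in all variables jointly are what makes Fubini's theorem
  applicable.\<close>

abbreviation "epow \<equiv> ennreal_powr"
abbreviation "borel_fun \<equiv> borel_measurable borel"
abbreviation "enorm x \<equiv> ennreal (norm x)"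
abbreviation lebesgue_nn_integral :: "('a::euclidean_space \<Rightarrow> ennreal) \<Rightarrow> ennreal" (binder "NN " 10)
  where "lebesgue_nn_integral f \<equiv> \<integral>\<^sup>+x. f x \<partial>lborel"
abbreviation AE_lborel :: "('a::euclidean_space \<Rightarrow> bool) \<Rightarrow> bool" (binder "ae " 10)
  where "AE_lborel P \<equiv> AE x in lborel. P x"

section \<open>Powers of extended nonnegative reals\<close>

lemma epow_ennreal: "0 \<le> x \<Longrightarrow> epow (ennreal x) r = ennreal (x powr r)"
  by (simp add: ennreal_powr_def)

lemma epow_top [simp]: "epow \<top> r = \<top>"
  by (simp add: ennreal_powr_def)

lemma epow_0 [simp]: "epow 0 r = 0"
  by (simp add: ennreal_powr_def)

lemma epow_one [simp]: "epow a 1 = a"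
  by (cases a) (auto simp: epow_ennreal)

lemma epow_base_one [simp]: "epow 1 r = 1"
  using epow_ennreal[of 1 r] by simp

lemma epow_eq_0_iff [simp]: "epow a r = 0 \<longleftrightarrow> a = 0"
  by (cases a) (auto simp: epow_ennreal)

lemma epow_eq_top_iff [simp]: "epow a r = \<top> \<longleftrightarrow> a = \<top>"
  by (cases a) (auto simp: epow_ennreal)

text \<open>In HOL \<open>0 powr r\<close> is 0 for every real \<open>r\<close>, so
  \<open>epow _ r\<close> fixes 0 and \<top> whatever the sign of \<open>r\<close>. The algebraic
  laws therefore hold unconditionally, including the case 0 times \<top>.\<close>

lemma epow_mult: "epow (a * b) r = epow a r * epow b r"
proof (cases "a = \<top> \<or> b = \<top>")
  case True
  then show ?thesis
    by (cases "a = 0 \<or> b = 0") (auto simp: ennreal_top_mult ennreal_mult_top)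
next
  case False
  then obtain x y where "a = ennreal x" "b = ennreal y" "0 \<le> x" "0 \<le> y"
    by (cases a; cases b) auto
  then show ?thesis
    by (simp add: ennreal_mult[symmetric] epow_ennreal powr_mult)
qed

lemma epow_powr: "epow (epow a r) s = epow a (r * s)"
  by (cases a) (auto simp: epow_ennreal powr_powr)

lemma epow_add: "epow a (r + s) = epow a r * epow a s"
  by (cases a) (auto simp: epow_ennreal powr_add ennreal_mult)

lemma epow_mono: "0 \<le> r \<Longrightarrow> a \<le> b \<Longrightarrow> epow a r \<le> epow b r"
  by (cases a; cases b) (auto simp: epow_ennreal top_unique intro!: ennreal_leI powr_mono2)

lemma epow_le_iff:
  assumes "0 < r" shows "epow a r \<le> epow b r \<longleftrightarrow> a \<le> b"
proof
  assume *: "epow a r \<le> epow b r"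
  show "a \<le> b"
    using epow_mono[OF _ *, of "1 / r"] assms by (simp add: epow_powr)
next
  assume "a \<le> b"
  then show "epow a r \<le> epow b r" using assms by (simp add: epow_mono)
qed

lemma epow_le_iff': "0 < r \<Longrightarrow> epow a r \<le> b \<longleftrightarrow> a \<le> epow b (1 / r)"
  using epow_le_iff[of r a "epow b (1 / r)"] by (simp add: epow_powr)


lemma epow_SUP:
  assumes "0 < r" "I \<noteq> {}"
  shows "epow (SUP i\<in>I. f i) r = (SUP i\<in>I. epow (f i) r)"
proof (rule antisym)
  show "epow (SUP i\<in>I. f i) r \<le> (SUP i\<in>I. epow (f i) r)"
    unfolding epow_le_iff'[OF assms(1)]
    by (rule SUP_least) (auto simp: epow_le_iff'[OF assms(1), symmetric] intro: SUP_upper)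
  show "(SUP i\<in>I. epow (f i) r) \<le> epow (SUP i\<in>I. f i) r"
    using assms by (intro SUP_least epow_mono) (auto intro: SUP_upper)
qed

lemma borel_measurable_epow [measurable]:
  assumes [measurable]: "f \<in> borel_measurable M"
  shows "(\<lambda>x. epow (f x) r) \<in> borel_measurable M"
  unfolding ennreal_powr_def by measurable

text \<open>Young's inequality without the factors 1/r and 1/r': if b \<le> a^(r-1) then a b \<le>
  a^r, and otherwise a b \<le> b^r'.\<close>

lemma ennreal_mult_le_powr_sum:
  fixes a b :: ennreal
  assumes "1 < r" "r' = r / (r - 1)"
  shows "a * b \<le> epow a r + epow b r'"
proof (cases "a = \<top> \<or> b = \<top>")
  case True then show ?thesis by auto
next
  case False
  then obtain x y where [simp]: "a = ennreal x" "b = ennreal y" and xy: "0 \<le> x" "0 \<le> y"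
    by (cases a; cases b) auto
  note [simp] = xy
  have "x * y \<le> x powr r + y powr r'"
  proof (cases "x = 0 \<or> y = 0")
    case False
    then have pos: "0 < x" "0 < y" using xy by (auto simp: order_less_le)
    show ?thesis
    proof (cases "y \<le> x powr (r - 1)")
      case True
      have "x * y \<le> x powr 1 * x powr (r - 1)" using True pos by (simp add: mult_left_mono)
      also have "\<dots> = x powr r" by (subst powr_add[symmetric]) simp
      finally show ?thesis by (smt (verit) powr_ge_zero)
    next
      case False
      have e: "1 / (r - 1) + 1 = r / (r - 1)" using assms(1) by (simp add: field_simps)
      have "x = (x powr (r - 1)) powr (1 / (r - 1))" using pos assms by (simp add: powr_powr)
      also have "\<dots> \<le> y powr (1 / (r - 1))" using False assms by (intro powr_mono2) auto
      finally have "x * y \<le> y powr (1 / (r - 1)) * y powr 1" using pos by (simp add: mult_right_mono)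
      also have "\<dots> = y powr r'" using e by (subst powr_add[symmetric]) (simp add: assms(2))
      finally show ?thesis by (smt (verit) powr_ge_zero)
    qed
  qed auto
  then show ?thesis
    by (simp add: ennreal_mult[symmetric] epow_ennreal flip: ennreal_plus)
qed

text \<open>Scaling one factor by \<Lambda> and the other by 1/\<Lambda> makes the coefficient of
  the second term as small as desired, which is what the absorption arguments below rely on.\<close>

lemma ennreal_mult_le_scaled_powr_sum:
  fixes a b :: ennreal
  assumes "1 < r" "r' = r / (r - 1)" "0 < \<Lambda>"
  shows "a * b \<le> ennreal (\<Lambda> powr r) * epow a r + ennreal (\<Lambda> powr - r') * epow b r'"
proof -
  have "a * b = (ennreal \<Lambda> * a) * (ennreal (1 / \<Lambda>) * b)"
    using assms(3) by (simp add: mult.assoc mult.left_commute[of a] flip: ennreal_mult mult.assoc[of "ennreal \<Lambda>"])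
  also have "\<dots> \<le> epow (ennreal \<Lambda> * a) r + epow (ennreal (1 / \<Lambda>) * b) r'"
    by (rule ennreal_mult_le_powr_sum) fact+
  also have "\<dots> = ennreal (\<Lambda> powr r) * epow a r + ennreal (\<Lambda> powr - r') * epow b r'"
    using assms(3) by (simp add: epow_mult epow_ennreal powr_divide powr_minus_divide)
  finally show ?thesis .
qed

lemma powr_average_le:
  assumes "1 \<le> r" "0 \<le> x" "0 \<le> y"
  shows "((x + y) / 2) powr r \<le> (x powr r + y powr r) / (2::real)"
proof (cases "x = 0 \<or> y = 0")
  case True
  have "(1 / 2) powr r \<le> (1 / 2 :: real) powr 1" using assms by (intro powr_mono') auto
  then have "(z / 2) powr r \<le> z powr r / 2" if "0 \<le> z" for z
    using that mult_left_mono[of "(1/2) powr r" "1/2" "z powr r"]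
    by (simp add: powr_divide)
  with True assms show ?thesis by auto
next
  case False
  then have "0 < x" "0 < y" using assms by auto
  then show ?thesis
    using convex_onD[OF powr_convex[OF assms(1)], of "1/2" x y] by (simp add: field_simps)
qed

lemma epow_average_le:
  assumes "1 \<le> r"
  shows "epow ((a + b) / 2) r \<le> (epow a r + epow b r) / 2"
proof (cases "a = \<top> \<or> b = \<top>")
  case True then show ?thesis by (auto simp: ennreal_top_divide)
next
  case False
  then obtain x y where [simp]: "a = ennreal x" "b = ennreal y" "0 \<le> x" "0 \<le> y"
    by (cases a; cases b) auto
  have half: "ennreal z / 2 = ennreal (z / 2)" if "0 \<le> z" for z
    using that divide_ennreal[of z 2] by simp
  show ?thesis
    using powr_average_le[OF assms, of x y]
    by (simp add: half epow_ennreal flip: ennreal_plus)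
qed

lemma epow_sum_le:
  assumes "0 < r" "finite I"
  shows "epow (\<Sum>i\<in>I. f i) r \<le> ennreal (real (card I) powr r) * (\<Sum>i\<in>I. epow (f i) r)"
proof (cases "I = {}")
  case False
  define m where "m = Max (f ` I)"
  have "m \<in> f ` I" using False assms unfolding m_def by (intro Max_in) auto
  then obtain i where i: "i \<in> I" "m = f i" by auto
  have "(\<Sum>i\<in>I. f i) \<le> of_nat (card I) * m"
    by (rule sum_bounded_above) (use assms in \<open>auto simp: m_def\<close>)
  then have "epow (\<Sum>i\<in>I. f i) r \<le> epow (of_nat (card I) * m) r"
    using assms by (intro epow_mono) auto
  also have "\<dots> = ennreal (real (card I) powr r) * epow m r"
    by (simp add: epow_mult ennreal_of_nat_eq_real_of_nat epow_ennreal)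
  also have "\<dots> \<le> ennreal (real (card I) powr r) * (\<Sum>i\<in>I. epow (f i) r)"
    using i assms by (intro mult_left_mono) (auto intro: member_le_sum)
  finally show ?thesis .
qed simp

section \<open>Maximal functions of nested families\<close>

definition nested :: "'a set set \<Rightarrow> bool" where
  "nested \<D> \<longleftrightarrow> (\<forall>P\<in>\<D>. \<forall>Q\<in>\<D>. P \<inter> Q = {} \<or> P \<subseteq> Q \<or> Q \<subseteq> P)"

definition mean :: "'a measure \<Rightarrow> 'a set \<Rightarrow> ('a \<Rightarrow> ennreal) \<Rightarrow> ennreal" where
  "mean M Q f = (\<integral>\<^sup>+y\<in>Q. f y \<partial>M) / emeasure M Q"

text \<open>Doob's maximal function when the sets are the atoms of a filtration. The measure is a
  parameter because the weighted theorem applies it to densities as well; a point outside all sets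
  gets the value 0.\<close>

definition nested_max :: "'a measure \<Rightarrow> 'a set set \<Rightarrow> ('a \<Rightarrow> ennreal) \<Rightarrow> 'a \<Rightarrow> ennreal" where
  "nested_max M \<D> f x = (SUP Q\<in>\<D>. mean M Q f * indicator Q x)"

lemma ennreal_divide_mult_cancel:
  fixes a b :: ennreal
  assumes "b \<noteq> 0" "b \<noteq> \<top>" shows "a / b * b = a"
proof -
  have "a / b * b = a * b / b" by (simp only: divide_ennreal_def ac_simps)
  then show ?thesis using ennreal_mult_divide_eq[of b a] assms by simp
qed

lemma mean_le_nested_max: "Q \<in> \<D> \<Longrightarrow> x \<in> Q \<Longrightarrow> mean M Q f \<le> nested_max M \<D> f x"
  unfolding nested_max_def by (rule SUP_upper2) auto

lemma nested_max_le:
  assumes "\<And>Q. Q \<in> \<D> \<Longrightarrow> x \<in> Q \<Longrightarrow> mean M Q f \<le> c"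
  shows "nested_max M \<D> f x \<le> c"
  unfolding nested_max_def using assms by (auto intro!: SUP_least split: split_indicator)

lemma borel_measurable_nested_max:
  assumes "countable \<D>" "\<D> \<subseteq> sets M"
  shows "nested_max M \<D> f \<in> borel_measurable M"
  unfolding nested_max_def[abs_def]
proof (rule borel_measurable_SUP[OF assms(1)])
  fix Q assume "Q \<in> \<D>"
  then have [measurable]: "Q \<in> sets M" using assms(2) by blast
  show "(\<lambda>x. mean M Q f * indicator Q x) \<in> borel_measurable M" by measurable
qed

text \<open>In a finite family the sets whose mean exceeds \<open>c\<close> have maximal members; by
  nestedness these are disjoint, and their union is the level set. Keeping \<open>f\<close>
  restricted to the level set on the right is what the passage to strong type needs.\<close>

lemma nested_max_weak_type:
  assumes fin: "finite \<D>" and "nested \<D>" and sets: "\<D> \<subseteq> sets M"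
    and pos: "\<And>Q. Q \<in> \<D> \<Longrightarrow> emeasure M Q \<noteq> 0" and fm: "\<And>Q. Q \<in> \<D> \<Longrightarrow> emeasure M Q \<noteq> \<top>"
    and f [measurable]: "f \<in> borel_measurable M"
  shows "c * emeasure M {x\<in>space M. c < nested_max M \<D> f x}
     \<le> (\<integral>\<^sup>+x. f x * indicator {x. c < nested_max M \<D> f x} x \<partial>M)"
proof -
  define \<C> where "\<C> = {Q\<in>\<D>. c < mean M Q f}"
  define \<M> where "\<M> = {Q\<in>\<C>. \<forall>R\<in>\<C>. Q \<subseteq> R \<longrightarrow> Q = R}"
  have "finite \<C>" using fin by (simp add: \<C>_def)
  have "finite \<M>" using \<open>finite \<C>\<close> by (simp add: \<M>_def)
  have "\<Union>\<M> = \<Union>\<C>"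
  proof (rule antisym)
    show "\<Union>\<C> \<subseteq> \<Union>\<M>"
    proof
      fix x assume "x \<in> \<Union>\<C>"
      then obtain Q where "Q \<in> \<C>" "x \<in> Q" by auto
      with finite_has_maximal2[OF \<open>finite \<C>\<close> \<open>Q \<in> \<C>\<close>] show "x \<in> \<Union>\<M>"
        unfolding \<M>_def by blast
    qed
  qed (auto simp: \<M>_def)
  moreover have level: "{x. c < nested_max M \<D> f x} = \<Union>\<C>"
    unfolding \<C>_def nested_max_def
    by (auto simp: less_SUP_iff split: split_indicator_asm) (auto simp: less_SUP_iff intro!: bexI split: split_indicator)
  ultimately have eq: "{x. c < nested_max M \<D> f x} = \<Union>\<M>" by simp
  have sub: "\<M> \<subseteq> sets M" "\<M> \<subseteq> \<D>" using sets by (auto simp: \<M>_def \<C>_def)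
  have disj: "disjoint_family_on (\<lambda>Q. Q) \<M>"
  proof (unfold disjoint_family_on_def, intro ballI impI)
    fix P Q assume PQ: "P \<in> \<M>" "Q \<in> \<M>" "P \<noteq> Q"
    then have "P \<inter> Q = {} \<or> P \<subseteq> Q \<or> Q \<subseteq> P"
      using \<open>nested \<D>\<close> sub(2) by (auto simp: nested_def)
    with PQ show "P \<inter> Q = {}" unfolding \<M>_def by auto
  qed
  have "{x\<in>space M. c < nested_max M \<D> f x} = \<Union>\<M>"
    using eq sets.sets_into_space[of _ M] sub(1) by auto
  then have "c * emeasure M {x\<in>space M. c < nested_max M \<D> f x} = c * (\<Sum>Q\<in>\<M>. emeasure M Q)"
    using sum_emeasure[OF _ disj \<open>finite \<M>\<close>] sub(1) by simp
  also have "\<dots> \<le> (\<Sum>Q\<in>\<M>. \<integral>\<^sup>+y\<in>Q. f y \<partial>M)"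
    unfolding sum_distrib_left
  proof (rule sum_mono)
    fix Q assume Q: "Q \<in> \<M>"
    then have "c * emeasure M Q \<le> mean M Q f * emeasure M Q"
      by (intro mult_right_mono) (auto simp: \<M>_def \<C>_def)
    also have "\<dots> = (\<integral>\<^sup>+y\<in>Q. f y \<partial>M)"
      unfolding mean_def using Q sub pos fm by (intro ennreal_divide_mult_cancel) auto
    finally show "c * emeasure M Q \<le> (\<integral>\<^sup>+y\<in>Q. f y \<partial>M)" .
  qed
  also have "\<dots> = (\<integral>\<^sup>+x. (\<Sum>Q\<in>\<M>. f x * indicator Q x) \<partial>M)"
    using sub by (intro nn_integral_sum[symmetric]) auto
  also have "\<dots> = (\<integral>\<^sup>+x. f x * indicator {x. c < nested_max M \<D> f x} x \<partial>M)"
  proof -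
    have "indicator (\<Union>\<M>) x = (\<Sum>Q\<in>\<M>. indicator Q x :: ennreal)" for x
      using indicator_UN_disjoint[OF \<open>finite \<M>\<close> disj, of x] by simp
    then show ?thesis unfolding eq by (simp only: sum_distrib_left)
  qed
  finally show ?thesis .
qed

section \<open>Strong type bounds for nested families\<close>

lemma nn_integral_power_layer:
  assumes "0 \<le> b" "1 < s"
  shows "(NN \<mu>. ennreal (s * \<mu> powr (s - 1)) * indicator {0<..} \<mu> * indicator {\<mu>. \<mu> < b} \<mu>) = ennreal (b powr s)"
proof -
  have "((\<lambda>x. x powr (s - 1)) has_integral b powr (s - 1 + 1) / (s - 1 + 1)) {0..b}"
    using assms by (intro has_integral_powr_from_0) auto
  then have "((\<lambda>x. s * x powr (s - 1)) has_integral s * (b powr s / s)) {0..b}"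
    by (intro has_integral_mult_right) auto
  then have "((\<lambda>x. s * x powr (s - 1)) has_integral b powr s) {0..b}" using assms by simp
  moreover have "(\<lambda>x. indicator {0..b} x * (s * x powr (s - 1))) = (\<lambda>x. if x \<in> {0..b} then s * x powr (s - 1) else 0)"
    by (auto split: split_indicator)
  ultimately have I: "((\<lambda>x. indicator {0..b} x * (s * x powr (s - 1))) has_integral b powr s) UNIV"
    by (simp only: has_integral_restrict_UNIV)
  have "(NN x. ennreal (indicator {0..b} x * (s * x powr (s - 1)))) = ennreal (b powr s)"
    by (rule nn_integral_has_integral_lborel[OF _ _ I]) (measurable, use assms in simp)
  moreover have "(NN \<mu>. ennreal (s * \<mu> powr (s - 1)) * indicator {0<..} \<mu> * indicator {\<mu>. \<mu> < b} \<mu>)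
     = (NN x. ennreal (indicator {0..b} x * (s * x powr (s - 1))))"
  proof (rule nn_integral_cong_AE)
    have "ae \<mu>. \<mu> \<noteq> b \<and> \<mu> \<noteq> 0"
      using AE_lborel_singleton[of b] AE_lborel_singleton[of 0] by eventually_elim simp
    then show "ae \<mu>. ennreal (s * \<mu> powr (s - 1)) * indicator {0<..} \<mu> * indicator {\<mu>. \<mu> < b} \<mu>
      = ennreal (indicator {0..b} \<mu> * (s * \<mu> powr (s - 1)))"
      by (rule AE_mp) (rule AE_I2, simp add: indicator_def)
  qed
  ultimately show ?thesis by simp
qed

text \<open>Half of X is subtracted from both sides, which is legitimate because X is finite; for
  this reason the strong type bound is proved for finite families first.\<close>

lemma ennreal_absorb_half:
  fixes X Y :: ennreal
  assumes "X \<noteq> \<top>" "X \<le> Y + X / 2" shows "X \<le> 2 * Y"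
proof (cases Y)
  case (real y)
  obtain x where x: "X = ennreal x" "0 \<le> x" using assms(1) by (cases X) auto
  have "X / 2 = ennreal (x / 2)" using x divide_ennreal[of x 2] by simp
  then have "x \<le> y + x / 2" using assms(2) real x by (simp flip: ennreal_plus)
  then have "ennreal x \<le> ennreal (2 * y)" by (intro ennreal_leI) simp
  then show ?thesis using real x by (simp add: ennreal_mult)
qed (simp add: ennreal_mult_top)

text \<open>With \<Lambda> = (2p')^(1/p') this is 2 p' \<Lambda>^p. The choice of \<Lambda> makes p'
  \<Lambda>^(-p') = 1/2 in Young's inequality, and the factor 2 comes from absorbing that
  half.\<close>

definition doob_const :: "real \<Rightarrow> real" where
  "doob_const p = (let p' = p / (p - 1) in 2 * p' * ((2 * p') powr (1 / p')) powr p)"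

lemma doob_const_nonneg: "1 < p \<Longrightarrow> 0 \<le> doob_const p"
  by (simp add: doob_const_def Let_def)

text \<open>Let F be the maximal function. F^p is written as (F^(p-1))^p' and cut into layers \<mu>
  < F^(p-1). Such a layer is the set where F exceeds c = \<mu>^(p'-1), so the weak type bound for
  this c uses up the density \<mu>^(p'-1) exactly and leaves p' times the integral of f F^(p-1).
  Young's inequality then allows half of the left side to be absorbed.\<close>

lemma nested_max_strong_type_finite:
  assumes "sigma_finite_measure M"
    and fin: "finite \<D>" and "nested \<D>" and sets: "\<D> \<subseteq> sets M"
    and pos: "\<And>Q. Q \<in> \<D> \<Longrightarrow> emeasure M Q \<noteq> 0" and fm: "\<And>Q. Q \<in> \<D> \<Longrightarrow> emeasure M Q \<noteq> \<top>"
    and f [measurable]: "f \<in> borel_measurable M" and p: "1 < p"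
  shows "(\<integral>\<^sup>+x. epow (nested_max M \<D> f x) p \<partial>M)
    \<le> ennreal (doob_const p) * (\<integral>\<^sup>+x. epow (f x) p \<partial>M)"
proof (cases "(\<integral>\<^sup>+x. epow (f x) p \<partial>M) = \<top>")
  case True
  have "0 < doob_const p" using p by (simp add: doob_const_def Let_def)
  then show ?thesis using True by (simp add: ennreal_mult_top)
next
  case False
  interpret sigma_finite_measure M by fact
  interpret L: pair_sigma_finite M "lborel :: real measure" ..
  define p' where "p' = p / (p - 1)"
  have p': "1 < p'" "p' - 1 = 1 / (p - 1)" "p' / (p' - 1) = p" "(p - 1) * p' = p"
    using p by (auto simp: p'_def field_simps)
  let ?F = "nested_max M \<D> f"
  note [measurable] = borel_measurable_nested_max[OF countable_finite[OF fin] sets, of f]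
  \<comment> \<open>Young's inequality against the constant 1 gives f \<le> f^p + 1, so f is
    integrable on sets of finite measure.\<close>
  have mean_fin: "mean M Q f \<noteq> \<top>" if Q: "Q \<in> \<D>" for Q
  proof -
    have [measurable]: "Q \<in> sets M" using Q sets by auto
    have "(\<integral>\<^sup>+y\<in>Q. f y \<partial>M) \<le> (\<integral>\<^sup>+y. epow (f y) p + indicator Q y \<partial>M)"
      using ennreal_mult_le_powr_sum[OF p p'_def, of _ 1]
      by (intro nn_integral_mono) (auto split: split_indicator)
    also have "\<dots> = (\<integral>\<^sup>+y. epow (f y) p \<partial>M) + emeasure M Q"
      by (subst nn_integral_add) auto
    also have "\<dots> < \<top>" using False fm[OF Q] by (simp add: less_top)
    finally show ?thesis
      unfolding mean_def using pos[OF Q] by (auto simp: ennreal_divide_eq_top_iff)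
  qed
  have F_fin: "?F x \<noteq> \<top>" for x
  proof -
    have "?F x \<le> (\<Sum>Q\<in>\<D>. mean M Q f)"
      by (rule nested_max_le) (use fin in \<open>auto intro: member_le_sum\<close>)
    also have "\<dots> < \<top>" using mean_fin fin by (simp add: less_top)
    finally show ?thesis by simp
  qed
  let ?X = "\<integral>\<^sup>+x. epow (?F x) p \<partial>M"
  \<comment> \<open>With finitely many sets, the power of the maximal function is at most a finite
    combination of indicators of sets of finite measure.\<close>
  have "?X \<noteq> \<top>"
  proof -
    have "?X \<le> (\<integral>\<^sup>+x. (\<Sum>Q\<in>\<D>. epow (mean M Q f) p * indicator Q x) \<partial>M)"
    proof (rule nn_integral_mono)
      fix x
      have "?F x \<le> epow (\<Sum>Q\<in>\<D>. epow (mean M Q f) p * indicator Q x) (1 / p)"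
      proof (rule nested_max_le)
        fix Q assume Q: "Q \<in> \<D>" "x \<in> Q"
        have "epow (mean M Q f) p * indicator Q x \<le> (\<Sum>Q\<in>\<D>. epow (mean M Q f) p * indicator Q x)"
          using Q fin by (intro member_le_sum) auto
        then show "mean M Q f \<le> epow (\<Sum>Q\<in>\<D>. epow (mean M Q f) p * indicator Q x) (1 / p)"
          using p Q by (subst epow_le_iff'[symmetric]) auto
      qed
      then show "epow (?F x) p \<le> (\<Sum>Q\<in>\<D>. epow (mean M Q f) p * indicator Q x)"
        using p by (subst epow_le_iff') auto
    qed
    also have "\<dots> = (\<Sum>Q\<in>\<D>. epow (mean M Q f) p * emeasure M Q)"
    proof (subst nn_integral_sum)
      show "(\<Sum>Q\<in>\<D>. \<integral>\<^sup>+x. epow (mean M Q f) p * indicator Q x \<partial>M)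
          = (\<Sum>Q\<in>\<D>. epow (mean M Q f) p * emeasure M Q)"
        using sets by (intro sum.cong refl nn_integral_cmult_indicator) blast
      show "(\<lambda>x. epow (mean M Q f) p * indicator Q x) \<in> borel_measurable M" if "Q \<in> \<D>" for Q
      proof -
        have [measurable]: "Q \<in> sets M" using that sets by blast
        show ?thesis by measurable
      qed
    qed
    also have "\<dots> < \<top>"
      unfolding less_top[symmetric] ennreal_sum_eq_top[OF fin] using mean_fin fm
      by (simp add: ennreal_mult_eq_top_iff)
    finally show ?thesis by simp
  qed
  define \<Lambda> where "\<Lambda> = (2 * p') powr (1 / p')"
  have "0 < \<Lambda>" using p' by (simp add: \<Lambda>_def)
  define G where "G x = enn2real (epow (?F x) (p - 1))" for x
  have G: "epow (?F x) (p - 1) = ennreal (G x)" "0 \<le> G x" for x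
    using F_fin[of x] unfolding G_def by (simp_all add: less_top[symmetric])
  have [measurable]: "G \<in> borel_measurable M" unfolding G_def by measurable
  have [measurable]: "(\<lambda>(x, \<mu>). indicator {\<mu>. \<mu> < G x} \<mu> :: ennreal) \<in> borel_measurable (M \<Otimes>\<^sub>M lborel)"
    unfolding indicator_def mem_Collect_eq of_bool_def by measurable
  have lt: "\<mu> < G x \<longleftrightarrow> ennreal (\<mu> powr (p' - 1)) < ?F x" if "0 < \<mu>" for \<mu> x
  proof -
    have "\<mu> < G x \<longleftrightarrow> \<not> epow (?F x) (p - 1) \<le> ennreal \<mu>"
      using that G[of x] by auto
    also have "\<dots> \<longleftrightarrow> \<not> ?F x \<le> epow (ennreal \<mu>) (1 / (p - 1))"
      using p by (subst epow_le_iff') auto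
    finally show ?thesis using that p' by (simp add: epow_ennreal not_le)
  qed
  have "?X = (\<integral>\<^sup>+x. (NN \<mu>. ennreal (p' * \<mu> powr (p' - 1)) * indicator {0<..} \<mu> * indicator {\<mu>. \<mu> < G x} \<mu>) \<partial>M)"
  proof (intro nn_integral_cong)
    fix x
    have "epow (?F x) p = epow (ennreal (G x)) p'"
      using p' unfolding G(1)[symmetric] by (simp add: epow_powr)
    then show "epow (?F x) p = (NN \<mu>. ennreal (p' * \<mu> powr (p' - 1)) * indicator {0<..} \<mu> * indicator {\<mu>. \<mu> < G x} \<mu>)"
      using p' G(2)[of x] by (subst nn_integral_power_layer) (auto simp: epow_ennreal)
  qed
  also have "\<dots> = (NN \<mu>. \<integral>\<^sup>+x. ennreal (p' * \<mu> powr (p' - 1)) * indicator {0<..} \<mu> * indicator {\<mu>. \<mu> < G x} \<mu> \<partial>M)"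
    by (rule L.Fubini'[symmetric]) measurable
  also have "\<dots> \<le> (NN \<mu>. \<integral>\<^sup>+x. ennreal p' * (f x * (indicator {0<..} \<mu> * indicator {\<mu>. \<mu> < G x} \<mu>)) \<partial>M)"
  proof (rule nn_integral_mono)
    fix \<mu> :: real
    show "(\<integral>\<^sup>+x. ennreal (p' * \<mu> powr (p' - 1)) * indicator {0<..} \<mu> * indicator {\<mu>. \<mu> < G x} \<mu> \<partial>M)
        \<le> (\<integral>\<^sup>+x. ennreal p' * (f x * (indicator {0<..} \<mu> * indicator {\<mu>. \<mu> < G x} \<mu>)) \<partial>M)"
    proof (cases "0 < \<mu>")
      case True
      let ?c = "ennreal (\<mu> powr (p' - 1))"
      have "(\<integral>\<^sup>+x. ennreal (p' * \<mu> powr (p' - 1)) * indicator {0<..} \<mu> * indicator {\<mu>. \<mu> < G x} \<mu> \<partial>M)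
        = (\<integral>\<^sup>+x. ennreal (p' * \<mu> powr (p' - 1)) * indicator {x\<in>space M. ?c < ?F x} x \<partial>M)"
        using True by (intro nn_integral_cong) (auto simp: lt split: split_indicator)
      also have "\<dots> = ennreal p' * (?c * emeasure M {x\<in>space M. ?c < ?F x})"
        using p' by (subst nn_integral_cmult_indicator) (auto simp: ennreal_mult mult.assoc)
      also have "\<dots> \<le> ennreal p' * (\<integral>\<^sup>+x. f x * indicator {x. ?c < ?F x} x \<partial>M)"
        by (intro mult_left_mono nested_max_weak_type[OF fin \<open>nested \<D>\<close> sets pos fm]) auto
      also have "\<dots> = (\<integral>\<^sup>+x. ennreal p' * (f x * indicator {x. ?c < ?F x} x) \<partial>M)"
        by (subst nn_integral_cmult) (auto simp: indicator_def)
      also have "\<dots> = (\<integral>\<^sup>+x. ennreal p' * (f x * (indicator {0<..} \<mu> * indicator {\<mu>. \<mu> < G x} \<mu>)) \<partial>M)"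
        using True by (intro nn_integral_cong) (auto simp: lt split: split_indicator)
      finally show ?thesis .
    qed simp
  qed
  also have "\<dots> = (\<integral>\<^sup>+x. (NN \<mu>. ennreal p' * (f x * (indicator {0<..} \<mu> * indicator {\<mu>. \<mu> < G x} \<mu>))) \<partial>M)"
    by (rule L.Fubini') measurable
  also have "\<dots> = (\<integral>\<^sup>+x. ennreal p' * (f x * epow (?F x) (p - 1)) \<partial>M)"
  proof (intro nn_integral_cong)
    fix x
    have "(NN \<mu>. (indicator {0<..} \<mu> * indicator {\<mu>. \<mu> < G x} \<mu> :: ennreal)) = (NN \<mu>. indicator {0<..<G x} \<mu>)"
      by (intro nn_integral_cong) (auto split: split_indicator)
    also have "\<dots> = ennreal (G x)" using G(2)[of x] by simp
    also have "\<dots> = epow (?F x) (p - 1)" by (simp only: G(1))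
    finally have eq: "(NN \<mu>. (indicator {0<..} \<mu> * indicator {\<mu>. \<mu> < G x} \<mu> :: ennreal))
      = epow (?F x) (p - 1)" .
    have H: "(\<lambda>\<mu>. indicator {0<..} \<mu> * indicator {\<mu>. \<mu> < G x} \<mu> :: ennreal) \<in> borel_measurable lborel"
      by measurable
    show "(NN \<mu>. ennreal p' * (f x * (indicator {0<..} \<mu> * indicator {\<mu>. \<mu> < G x} \<mu>)))
       = ennreal p' * (f x * epow (?F x) (p - 1))"
      using nn_integral_cmult[OF H, of "ennreal p' * f x"] by (simp only: eq mult.assoc)
  qed
  also have "\<dots> \<le> (\<integral>\<^sup>+x. ennreal (p' * \<Lambda> powr p) * epow (f x) p + ennreal (1 / 2) * epow (?F x) p \<partial>M)"
  proof (rule nn_integral_mono)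
    fix x
    have "ennreal p' * (f x * epow (?F x) (p - 1))
      \<le> ennreal p' * (ennreal (\<Lambda> powr p) * epow (f x) p + ennreal (\<Lambda> powr - p') * epow (epow (?F x) (p - 1)) p')"
      by (intro mult_left_mono ennreal_mult_le_scaled_powr_sum) (use p p'_def \<open>0 < \<Lambda>\<close> in auto)
    also have "\<dots> = ennreal (p' * \<Lambda> powr p) * epow (f x) p + ennreal (p' * \<Lambda> powr - p') * epow (?F x) p"
      using p'(1,4) by (simp add: epow_powr distrib_left ennreal_mult mult.assoc)
    also have "p' * \<Lambda> powr - p' = 1 / 2"
      using p'(1) unfolding \<Lambda>_def by (simp add: powr_powr powr_minus)
    finally show "ennreal p' * (f x * epow (?F x) (p - 1))
      \<le> ennreal (p' * \<Lambda> powr p) * epow (f x) p + ennreal (1 / 2) * epow (?F x) p" .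
  qed
  also have "\<dots> = ennreal (p' * \<Lambda> powr p) * (\<integral>\<^sup>+x. epow (f x) p \<partial>M) + ?X / 2"
  proof -
    have "ennreal (1 / 2) * ?X = ?X / 2"
      using divide_ennreal[of 1 2] by (simp add: divide_ennreal_def mult.commute)
    then show ?thesis by (subst nn_integral_add, measurable) (simp add: nn_integral_cmult)
  qed
  finally have "?X \<le> 2 * (ennreal (p' * \<Lambda> powr p) * (\<integral>\<^sup>+x. epow (f x) p \<partial>M))"
    by (rule ennreal_absorb_half[OF \<open>?X \<noteq> \<top>\<close>])
  also have "\<dots> = ennreal (doob_const p) * (\<integral>\<^sup>+x. epow (f x) p \<partial>M)"
    using p'(1) by (simp add: doob_const_def Let_def p'_def[symmetric] \<Lambda>_def[symmetric] ennreal_mult mult.assoc)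
  finally show ?thesis .
qed

text \<open>Subfamilies of a nested family are nested, and the bound for finite families does not
  depend on the family; so it passes to the union of an increasing sequence of finite subfamilies by
  monotone convergence.\<close>

theorem nested_max_strong_type:
  assumes "sigma_finite_measure M"
    and count: "countable \<D>" and "nested \<D>" and sets: "\<D> \<subseteq> sets M"
    and pos: "\<And>Q. Q \<in> \<D> \<Longrightarrow> emeasure M Q \<noteq> 0" and fm: "\<And>Q. Q \<in> \<D> \<Longrightarrow> emeasure M Q \<noteq> \<top>"
    and f [measurable]: "f \<in> borel_measurable M" and p: "1 < p"
  shows "(\<integral>\<^sup>+x. epow (nested_max M \<D> f x) p \<partial>M)
    \<le> ennreal (doob_const p) * (\<integral>\<^sup>+x. epow (f x) p \<partial>M)"
proof (cases "\<D> = {}")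
  case True
  then show ?thesis by (simp add: nested_max_def bot_ennreal)
next
  case False
  define E where "E n = from_nat_into \<D> ` {..n::nat}" for n
  have E: "finite (E n)" "E n \<subseteq> \<D>" "E n \<noteq> {}" for n
    using from_nat_into[OF False] by (auto simp: E_def)
  have UE: "(\<Union>n. E n) = \<D>"
    unfolding E_def image_UN[symmetric] using range_from_nat_into[OF False count] by (simp add: UN_atMost_UNIV)
  have SUP_eq: "nested_max M \<D> f x = (SUP n. nested_max M (E n) f x)" for x
    unfolding nested_max_def UE[symmetric] by (rule SUP_UNION)
  have incE: "E m \<subseteq> E n" if "m \<le> n" for m n using that by (auto simp: E_def)
  have "(\<integral>\<^sup>+x. epow (nested_max M \<D> f x) p \<partial>M)
      = (\<integral>\<^sup>+x. (SUP n. epow (nested_max M (E n) f x) p) \<partial>M)"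
    using p by (simp add: SUP_eq epow_SUP)
  also have "\<dots> = (SUP n. \<integral>\<^sup>+x. epow (nested_max M (E n) f x) p \<partial>M)"
  proof (rule nn_integral_monotone_convergence_SUP)
    show "incseq (\<lambda>n x. epow (nested_max M (E n) f x) p)"
      using incE p unfolding nested_max_def
      by (auto simp: incseq_def le_fun_def intro!: epow_mono SUP_subset_mono)
    show "(\<lambda>x. epow (nested_max M (E n) f x) p) \<in> borel_measurable M" for n
      using E(1,2)[of n] sets countable_finite[OF E(1)[of n]]
      by (intro borel_measurable_epow borel_measurable_nested_max) auto
  qed
  also have "\<dots> \<le> ennreal (doob_const p) * (\<integral>\<^sup>+x. epow (f x) p \<partial>M)"
  proof (rule SUP_least)
    fix n
    show "(\<integral>\<^sup>+x. epow (nested_max M (E n) f x) p \<partial>M)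
      \<le> ennreal (doob_const p) * (\<integral>\<^sup>+x. epow (f x) p \<partial>M)"
      using E[of n] sets pos fm \<open>nested \<D>\<close>
      by (intro nested_max_strong_type_finite[OF assms(1)]) (auto simp: nested_def subset_iff f p)
  qed
  finally show ?thesis .
qed

section \<open>The weighted maximal theorem\<close>

text \<open>The factored form of an \<open>A\<^sub>r\<close> weight with \<open>A\<^sub>1\<close>
  factors. It makes duality mechanical: the dual weight is of the same form, with the factors
  swapped and \<open>r\<close> replaced by its conjugate.\<close>

definition wt :: "real \<Rightarrow> ('a \<Rightarrow> real) \<Rightarrow> ('a \<Rightarrow> real) \<Rightarrow> 'a \<Rightarrow> real" where
  "wt r h1 h2 x = h2 x * h1 x powr (1 - r)"

lemma borel_measurable_wt [measurable]:
  assumes [measurable]: "h1 \<in> borel_measurable M" "h2 \<in> borel_measurable M"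
  shows "wt r h1 h2 \<in> borel_measurable M"
  unfolding wt_def[abs_def] by measurable

lemma wt_pos: "0 < h1 x \<Longrightarrow> 0 < h2 x \<Longrightarrow> 0 < wt r h1 h2 x"
  by (simp add: wt_def)

lemma conjugate_exponent:
  assumes "1 < r" "r' = r / (r - 1)"
  shows "1 < r'" "r = r' / (r' - 1)" "(r - 1) * r' = r" "(r' - 1) * (r - 1) = 1" "(1 - r) * (1 - r') = (1::real)"
proof -
  have *: "r' - 1 = 1 / (r - 1)" using assms(1) unfolding assms(2) by (simp add: field_simps)
  have "0 < r' - 1" unfolding * using assms(1) by simp
  then show "1 < r'" by simp
  show "(r - 1) * r' = r" using assms by simp
  show "(r' - 1) * (r - 1) = 1" using assms(1) unfolding * by simp
  then show "(1 - r) * (1 - r') = 1" by (simp add: algebra_simps)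
  have "r' / (r' - 1) = r' * (r - 1)" unfolding * by simp
  also have "\<dots> = r" using assms by simp
  finally show "r = r' / (r' - 1)" by simp
qed

lemma wt_dual:
  assumes "1 < r" "r' = r / (r - 1)" "0 < h1 x" "0 < h2 x"
  shows "wt r h1 h2 x powr (1 - r') = wt r' h2 h1 x"
  using conjugate_exponent(5)[OF assms(1,2)] assms(3,4) by (simp add: wt_def powr_mult powr_powr)

lemma mean_mono: "(\<And>x. x \<in> Q \<Longrightarrow> f x \<le> g x) \<Longrightarrow> mean M Q f \<le> mean M Q g"
  unfolding mean_def by (intro divide_right_mono_ennreal nn_integral_mono) (auto split: split_indicator)

lemma mean_const:
  "Q \<in> sets M \<Longrightarrow> emeasure M Q \<noteq> 0 \<Longrightarrow> emeasure M Q \<noteq> \<top> \<Longrightarrow> mean M Q (\<lambda>x. c) = c"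
  by (simp add: mean_def nn_integral_cmult_indicator ennreal_mult_divide_eq)

lemma mean_cmult:
  assumes [measurable]: "f \<in> borel_measurable M" "Q \<in> sets M"
  shows "mean M Q (\<lambda>x. c * f x) = c * mean M Q f"
  unfolding mean_def by (simp add: mult.assoc nn_integral_cmult ennreal_times_divide)


lemma mean_mono_AE:
  assumes "AE x in M. x \<in> Q \<longrightarrow> f x \<le> g x"
  shows "mean M Q f \<le> mean M Q g"
  unfolding mean_def using assms
  by (intro divide_right_mono_ennreal nn_integral_mono_AE) (auto split: split_indicator)

text \<open>An infinite mean would violate the bound at every point of \<open>Q\<close>, and
  \<open>Q\<close> is not null; a zero mean would contradict the positivity of
  \<open>h\<close>.\<close>

lemma mean_pos_finite:
  assumes [measurable]: "Q \<in> sets M" and "emeasure M Q \<noteq> 0" "emeasure M Q \<noteq> \<top>"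
    and [measurable]: "h \<in> borel_measurable M" and pos: "\<And>x. 0 < h x"
    and A: "AE x in M. x \<in> Q \<longrightarrow> mean M Q (\<lambda>y. ennreal (h y)) \<le> ennreal (B * h x)"
  obtains a where "0 < a" "mean M Q (\<lambda>y. ennreal (h y)) = ennreal a" "AE x in M. x \<in> Q \<longrightarrow> a \<le> B * h x"
proof -
  have notAE: "\<not> (AE x in M. x \<notin> Q)"
    using assms(2) by (simp add: AE_iff_measurable[of Q] sets.sets_into_space[THEN Int_absorb1] Int_def[symmetric] Collect_conj_eq Int_commute)
  have "mean M Q (\<lambda>y. ennreal (h y)) \<noteq> \<top>"
  proof
    assume "mean M Q (\<lambda>y. ennreal (h y)) = \<top>"
    then have "AE x in M. x \<notin> Q" using A by (auto simp: top_unique)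
    then show False using notAE by simp
  qed
  moreover have "mean M Q (\<lambda>y. ennreal (h y)) \<noteq> 0"
  proof
    assume "mean M Q (\<lambda>y. ennreal (h y)) = 0"
    then have "(\<integral>\<^sup>+x\<in>Q. ennreal (h x) \<partial>M) = 0"
      using assms(3) by (simp add: mean_def)
    then have "AE x in M. ennreal (h x) * indicator Q x = 0"
      by (subst (asm) nn_integral_0_iff_AE) auto
    then have "AE x in M. x \<notin> Q"
    proof eventually_elim
      case (elim x)
      then show ?case using pos[of x] by (auto simp: indicator_def split: if_splits)
    qed
    then show False using notAE by simp
  qed
  ultimately obtain a where a: "0 < a" "mean M Q (\<lambda>y. ennreal (h y)) = ennreal a"
    by (cases "mean M Q (\<lambda>y. ennreal (h y))") (auto simp: order_less_le)
  moreover have "AE x in M. x \<in> Q \<longrightarrow> a \<le> B * h x"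
    using A a by (auto simp: ennreal_le_iff2)
  ultimately show ?thesis using that by blast
qed

text \<open>The easy direction of Jones' factorization of \<open>A\<^sub>r\<close>-weights, on a single set.\<close>

lemma mean_wt_product_le:
  assumes Q [measurable]: "Q \<in> sets M" "emeasure M Q \<noteq> 0" "emeasure M Q \<noteq> \<top>"
    and [measurable]: "h1 \<in> borel_measurable M" "h2 \<in> borel_measurable M"
    and pos: "\<And>x. 0 < h1 x" "\<And>x. 0 < h2 x"
    and A: "AE x in M. x \<in> Q \<longrightarrow> mean M Q (\<lambda>y. ennreal (h1 y)) \<le> ennreal (B * h1 x)"
      "AE x in M. x \<in> Q \<longrightarrow> mean M Q (\<lambda>y. ennreal (h2 y)) \<le> ennreal (B * h2 x)"
    and B: "0 < B" and r: "1 < r" "r' = r / (r - 1)"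
  shows "mean M Q (\<lambda>x. ennreal (wt r h1 h2 x)) * epow (mean M Q (\<lambda>x. ennreal (wt r' h2 h1 x))) (r - 1)
     \<le> ennreal (B powr r)" and "mean M Q (\<lambda>x. ennreal (wt r h1 h2 x)) < \<top>"
proof -
  note cj = conjugate_exponent[OF r]
  obtain a1 where a1: "0 < a1" "mean M Q (\<lambda>y. ennreal (h1 y)) = ennreal a1" "AE x in M. x \<in> Q \<longrightarrow> a1 \<le> B * h1 x"
    by (rule mean_pos_finite[OF Q _ pos(1) A(1)]) auto
  obtain a2 where a2: "0 < a2" "mean M Q (\<lambda>y. ennreal (h2 y)) = ennreal a2" "AE x in M. x \<in> Q \<longrightarrow> a2 \<le> B * h2 x"
    by (rule mean_pos_finite[OF Q _ pos(2) A(2)]) auto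
  \<comment> \<open>The factor with negative exponent is bounded by a constant through its
    \<open>A\<^sub>1\<close> inequality, and the other factor is averaged. This serves for the
    weight and, with the factors swapped, for its dual.\<close>
  have one_side: "mean M Q (\<lambda>x. ennreal (wt s k1 k2 x)) \<le> ennreal (b2 * (b1 / B) powr (1 - s))"
    if "1 < s" "0 < b1" "mean M Q (\<lambda>y. ennreal (k2 y)) = ennreal b2" "AE x in M. x \<in> Q \<longrightarrow> b1 \<le> B * k1 x"
      "\<And>x. 0 < k1 x" "\<And>x. 0 < k2 x" and [measurable]: "k1 \<in> borel_measurable M" "k2 \<in> borel_measurable M"
    for s b1 b2 and k1 k2 :: "'a \<Rightarrow> real"
  proof -
    have "mean M Q (\<lambda>x. ennreal (wt s k1 k2 x)) \<le> mean M Q (\<lambda>x. ennreal ((b1 / B) powr (1 - s)) * ennreal (k2 x))"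
    proof (rule mean_mono_AE, use that(4) in eventually_elim, intro impI)
      fix x assume "x \<in> Q \<longrightarrow> b1 \<le> B * k1 x" "x \<in> Q"
      then have "b1 / B \<le> k1 x" using B by (simp add: field_simps)
      then have "k1 x powr (1 - s) \<le> (b1 / B) powr (1 - s)"
        using that B by (intro powr_mono2') auto
      then have "wt s k1 k2 x \<le> (b1 / B) powr (1 - s) * k2 x"
        using that(6)[of x] by (simp add: wt_def mult.commute mult_right_mono)
      then show "ennreal (wt s k1 k2 x) \<le> ennreal ((b1 / B) powr (1 - s)) * ennreal (k2 x)"
        using that(6)[of x] by (simp flip: ennreal_mult)
    qed
    also have "\<dots> = ennreal ((b1 / B) powr (1 - s)) * ennreal b2"
      by (subst mean_cmult) (auto simp: that)
    finally show ?thesis by (simp add: ennreal_mult'' mult.commute flip: ennreal_mult')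
  qed
  have W: "mean M Q (\<lambda>x. ennreal (wt r h1 h2 x)) \<le> ennreal (a2 * (a1 / B) powr (1 - r))"
    by (rule one_side) (use a1 a2 pos r in auto)
  have S: "mean M Q (\<lambda>x. ennreal (wt r' h2 h1 x)) \<le> ennreal (a1 * (a2 / B) powr (1 - r'))"
    by (rule one_side) (use a1 a2 pos cj in auto)
  show "mean M Q (\<lambda>x. ennreal (wt r h1 h2 x)) < \<top>" using W by (simp add: le_less_trans)
  have "mean M Q (\<lambda>x. ennreal (wt r h1 h2 x)) * epow (mean M Q (\<lambda>x. ennreal (wt r' h2 h1 x))) (r - 1)
     \<le> ennreal (a2 * (a1 / B) powr (1 - r)) * epow (ennreal (a1 * (a2 / B) powr (1 - r'))) (r - 1)"
    using W S r by (intro mult_mono epow_mono) auto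
  also have "\<dots> = ennreal (a2 * (a1 / B) powr (1 - r) * (a1 * (a2 / B) powr (1 - r')) powr (r - 1))"
    using a1 a2 B by (simp add: epow_ennreal flip: ennreal_mult)
  also have "a2 * (a1 / B) powr (1 - r) * (a1 * (a2 / B) powr (1 - r')) powr (r - 1) = B powr r"
  proof -
    have e: "(1 - r') * (r - 1) = -1" using cj(5) by (simp add: algebra_simps)
    have "(a1 * (a2 / B) powr (1 - r')) powr (r - 1) = a1 powr (r - 1) * (B / a2)"
      using a1 a2 B by (simp add: powr_mult powr_powr e powr_minus_divide)
    moreover have "(a1 / B) powr (1 - r) * a1 powr (r - 1) = B powr (r - 1)"
      using a1 B by (simp add: powr_divide powr_diff field_simps)
    moreover have "a2 * u * (v * (B / a2)) = u * v * B" for u v using a2(1) by simp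
    ultimately have "a2 * (a1 / B) powr (1 - r) * (a1 * (a2 / B) powr (1 - r')) powr (r - 1) = B powr (r - 1) * B"
      by (simp only:)
    then show ?thesis using B by (simp add: powr_diff)
  qed
  finally show "mean M Q (\<lambda>x. ennreal (wt r h1 h2 x)) * epow (mean M Q (\<lambda>x. ennreal (wt r' h2 h1 x))) (r - 1)
     \<le> ennreal (B powr r)" .
qed

lemma AE_mean_le:
  assumes "P \<in> \<D>" "AE x in M. nested_max M \<D> f x \<le> g x"
  shows "AE x in M. x \<in> P \<longrightarrow> mean M P f \<le> g x"
  using assms(2)
proof eventually_elim
  case (elim x)
  then show ?case using mean_le_nested_max[OF assms(1), of x M f] by (auto intro: order_trans)
qed

lemma ennreal_mult_divide_cancel:
  fixes a m e :: ennreal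
  assumes "e \<noteq> 0" "e \<noteq> \<top>" shows "a * (m * e) / e = m * a"
proof -
  have "a * (m * e) = (m * a) * e" by (simp only: ac_simps)
  then show ?thesis using ennreal_mult_divide_eq[of e "m * a"] assms by simp
qed

text \<open>The product estimate \<open>B powr r\<close> is raised to the power r' when the
  pointwise domination is integrated; the two \<open>doob_const\<close> belong to the maximal
  functions with respect to the weight and its dual.\<close>

definition weighted_const :: "real \<Rightarrow> real \<Rightarrow> real" where
  "weighted_const r B = (let r' = r / (r - 1) in (B powr r) powr r' * doob_const r' * doob_const r)"

lemma weighted_const_nonneg: "1 < r \<Longrightarrow> 0 \<le> weighted_const r B"
  using conjugate_exponent(1)[of r, OF _ refl]
  by (auto simp: weighted_const_def Let_def intro!: mult_nonneg_nonneg doob_const_nonneg)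

lemma nn_integral_density_real:
  assumes [measurable]: "f \<in> borel_measurable M" "w \<in> borel_measurable M"
  shows "(\<integral>\<^sup>+x. f x \<partial>density M (\<lambda>x. ennreal (w x))) = (\<integral>\<^sup>+x. f x * ennreal (w x) \<partial>M)"
  by (subst nn_integral_density) (auto simp: mult.commute)

text \<open>Lerner's argument: two unweighted-looking maximal functions, one with respect to the dual
  weight \<open>\<sigma>\<close> and one with respect to \<open>w\<close>, dominate the maximal function pointwise.\<close>

theorem nested_max_weighted:
  assumes sf: "sigma_finite_measure M"
    and count: "countable \<D>" and nest: "nested \<D>" and sets: "\<D> \<subseteq> sets M"
    and Q: "\<And>Q. Q \<in> \<D> \<Longrightarrow> emeasure M Q \<noteq> 0" "\<And>Q. Q \<in> \<D> \<Longrightarrow> emeasure M Q \<noteq> \<top>"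
    and h [measurable]: "h1 \<in> borel_measurable M" "h2 \<in> borel_measurable M"
    and pos: "\<And>x. 0 < h1 x" "\<And>x. 0 < h2 x"
    and A: "AE x in M. nested_max M \<D> (\<lambda>y. ennreal (h1 y)) x \<le> ennreal (B * h1 x)"
      "AE x in M. nested_max M \<D> (\<lambda>y. ennreal (h2 y)) x \<le> ennreal (B * h2 x)"
    and B: "0 < B" and r: "1 < r" and f [measurable]: "f \<in> borel_measurable M"
  shows "(\<integral>\<^sup>+x. epow (nested_max M \<D> f x) r * ennreal (wt r h1 h2 x) \<partial>M)
    \<le> ennreal (weighted_const r B) * (\<integral>\<^sup>+x. epow (f x) r * ennreal (wt r h1 h2 x) \<partial>M)"
proof -
  interpret sigma_finite_measure M by fact
  define r' where "r' = r / (r - 1)"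
  note cj = conjugate_exponent[OF r r'_def]
  define w where "w = wt r h1 h2"
  define \<sigma> where "\<sigma> = wt r' h2 h1"
  have [measurable]: "w \<in> borel_measurable M" "\<sigma> \<in> borel_measurable M"
    by (simp_all add: w_def \<sigma>_def)
  have wpos: "0 < w x" "0 < \<sigma> x" for x by (simp_all add: w_def \<sigma>_def wt_pos pos)
  have w_\<sigma>: "w x powr (1 - r') = \<sigma> x" "\<sigma> x powr (1 - r) = w x" for x
    unfolding w_def \<sigma>_def by (simp_all add: wt_dual[OF r r'_def] wt_dual[OF cj(1,2)] pos)
  define W where "W = density M (\<lambda>x. ennreal (w x))"
  define S where "S = density M (\<lambda>x. ennreal (\<sigma> x))"
  have sfW: "sigma_finite_measure W" "sigma_finite_measure S"
    unfolding W_def S_def by (simp_all add: sigma_finite_iff_density_finite)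
  have [simp]: "sets W = sets M" "sets S = sets M" by (auto simp: W_def S_def)
  have [simp]: "borel_measurable W = (borel_measurable M :: ('a \<Rightarrow> ennreal) set)"
    "borel_measurable S = (borel_measurable M :: ('a \<Rightarrow> ennreal) set)"
    by (auto intro!: measurable_cong_sets)
  have em: "emeasure W P = mean M P (\<lambda>x. ennreal (w x)) * emeasure M P"
      "emeasure S P = mean M P (\<lambda>x. ennreal (\<sigma> x)) * emeasure M P" if P: "P \<in> \<D>" for P
  proof -
    have [measurable]: "P \<in> sets M" using P sets by blast
    show "emeasure W P = mean M P (\<lambda>x. ennreal (w x)) * emeasure M P"
      "emeasure S P = mean M P (\<lambda>x. ennreal (\<sigma> x)) * emeasure M P"
      unfolding W_def S_def mean_def ennreal_divide_mult_cancel[OF Q[OF P]]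
      by (simp_all add: emeasure_density)
  qed
  have AQ: "AE x in M. x \<in> P \<longrightarrow> mean M P (\<lambda>y. ennreal (h1 y)) \<le> ennreal (B * h1 x)"
      "AE x in M. x \<in> P \<longrightarrow> mean M P (\<lambda>y. ennreal (h2 y)) \<le> ennreal (B * h2 x)" if "P \<in> \<D>" for P
    by (rule AE_mean_le[OF that A(1)], rule AE_mean_le[OF that A(2)])
  have key: "mean M P (\<lambda>x. ennreal (w x)) * epow (mean M P (\<lambda>x. ennreal (\<sigma> x))) (r - 1) \<le> ennreal (B powr r)"
      "mean M P (\<lambda>x. ennreal (w x)) < \<top>" "mean M P (\<lambda>x. ennreal (\<sigma> x)) < \<top>" if P: "P \<in> \<D>" for P
  proof -
    have Ps: "P \<in> sets M" using sets P by auto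
    show "mean M P (\<lambda>x. ennreal (w x)) * epow (mean M P (\<lambda>x. ennreal (\<sigma> x))) (r - 1) \<le> ennreal (B powr r)"
      "mean M P (\<lambda>x. ennreal (w x)) < \<top>"
      using mean_wt_product_le[OF Ps Q[OF P] h pos AQ[OF P] B r r'_def] by (simp_all add: w_def \<sigma>_def)
    show "mean M P (\<lambda>x. ennreal (\<sigma> x)) < \<top>"
      using mean_wt_product_le(2)[OF Ps Q[OF P] h(2,1) pos(2,1) AQ(2,1)[OF P] B cj(1,2)] by (simp add: \<sigma>_def)
  qed
  have mean0: "mean M P (\<lambda>x. ennreal (v x)) \<noteq> 0"
    if P: "P \<in> \<D>" and v: "\<And>x. 0 < v x" and [measurable]: "v \<in> borel_measurable M" for P v
  proof
    have [measurable]: "P \<in> sets M" using sets P by auto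
    assume "mean M P (\<lambda>x. ennreal (v x)) = 0"
    then have "(\<integral>\<^sup>+x\<in>P. ennreal (v x) \<partial>M) = 0" using Q[OF P] by (simp add: mean_def)
    then have "AE x in M. ennreal (v x) * indicator P x = 0"
      by (subst (asm) nn_integral_0_iff_AE) auto
    then have "AE x in M. x \<notin> P"
    proof eventually_elim
      case (elim x)
      then show ?case using v[of x] by (auto simp: indicator_def split: if_splits)
    qed
    then show False
      using Q(1)[OF P] sets.sets_into_space[of P M]
      by (subst (asm) AE_iff_measurable[of P]) auto
  qed
  have QW: "emeasure W P \<noteq> 0" "emeasure W P \<noteq> \<top>" "emeasure S P \<noteq> 0" "emeasure S P \<noteq> \<top>" if P: "P \<in> \<D>" for P
    using key[OF P] Q[OF P] mean0[OF P wpos(1)] mean0[OF P wpos(2)]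
    by (auto simp: em[OF P] ennreal_mult_eq_top_iff)
  \<comment> \<open>Dividing by \<sigma> turns integrals of f with respect to M into integrals of g
    with respect to \<open>S\<close>.\<close>
  define g where "g x = f x * ennreal (1 / \<sigma> x)" for x
  have [measurable]: "g \<in> borel_measurable M" by (simp add: g_def[abs_def])
  have g\<sigma>: "g x * ennreal (\<sigma> x) = f x" for x
    using wpos(2)[of x] by (simp add: g_def mult.assoc flip: ennreal_mult)
  \<comment> \<open>Chosen so that u w is the power r - 1 of the \<open>S\<close>-maximal function
    of g; its M-mean over a cell is then a multiple of a \<open>W\<close>-mean of u.\<close>
  define u where "u x = epow (nested_max S \<D> g x) (r - 1) * ennreal (1 / w x)" for x
  have [measurable]: "nested_max S \<D> g \<in> borel_measurable M" "nested_max W \<D> u \<in> borel_measurable M" "nested_max M \<D> f \<in> borel_measurable M"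
    using borel_measurable_nested_max[OF count, of S g] borel_measurable_nested_max[OF count, of W u]
      borel_measurable_nested_max[OF count, of M f] sets
    by (simp_all add: measurable_def space_density W_def S_def)
  have [measurable]: "u \<in> borel_measurable M" by (simp add: u_def[abs_def])
  let ?K = "ennreal (B powr r)"
  \<comment> \<open>On a cell P the \<open>S\<close>-mean of g is below the \<open>S\<close>-maximal
    function at every point of P, so this constant may be averaged over P with respect to M. The
    product estimate trades the mean of \<sigma> for the mean of w, which occurs on both sides and
    cancels.\<close>
  have pw: "epow (nested_max M \<D> f x) (r - 1) \<le> ?K * nested_max W \<D> u x" for x
  proof -
    have "nested_max M \<D> f x \<le> epow (?K * nested_max W \<D> u x) (1 / (r - 1))"
    proof (rule nested_max_le)
      fix P assume P: "P \<in> \<D>" "x \<in> P"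
      have [measurable]: "P \<in> sets M" using P sets by auto
      let ?m = "mean M P (\<lambda>x. ennreal (\<sigma> x))" and ?n = "mean M P (\<lambda>x. ennreal (w x))"
      have "mean M P f = (\<integral>\<^sup>+x\<in>P. g x \<partial>S) / emeasure M P"
        unfolding mean_def S_def
        by (subst nn_integral_density_real) (auto simp: g\<sigma>[symmetric] ac_simps)
      also have "\<dots> = mean S P g * emeasure S P / emeasure M P"
        unfolding mean_def using QW[OF P(1)] by (simp add: ennreal_divide_mult_cancel)
      also have "\<dots> = ?m * mean S P g"
        using Q[OF P(1)] unfolding em[OF P(1)] by (rule ennreal_mult_divide_cancel)
      finally have "?n * epow (mean M P f) (r - 1)
          = (?n * epow ?m (r - 1)) * epow (mean S P g) (r - 1)"
        by (simp add: epow_mult mult.assoc)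
      also have "\<dots> \<le> ?K * epow (mean S P g) (r - 1)"
        by (intro mult_right_mono key P) simp
      also have "epow (mean S P g) (r - 1) \<le> ?n * mean W P u"
      proof -
        have "epow (mean S P g) (r - 1) = mean M P (\<lambda>x. epow (mean S P g) (r - 1))"
          using Q[OF P(1)] by (simp add: mean_const)
        also have "\<dots> \<le> mean M P (\<lambda>x. u x * ennreal (w x))"
        proof (rule mean_mono)
          fix y assume "y \<in> P"
          then have "epow (mean S P g) (r - 1) \<le> epow (nested_max S \<D> g y) (r - 1)"
            using r P by (intro epow_mono mean_le_nested_max) auto
          also have "\<dots> = u y * ennreal (w y)"
            using wpos(1)[of y] by (simp add: u_def mult.assoc flip: ennreal_mult)
          finally show "epow (mean S P g) (r - 1) \<le> u y * ennreal (w y)" .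
        qed
        also have "\<dots> = (\<integral>\<^sup>+x\<in>P. u x \<partial>W) / emeasure M P"
          unfolding mean_def W_def
          by (subst nn_integral_density_real) (auto simp: ac_simps)
        also have "\<dots> = mean W P u * emeasure W P / emeasure M P"
          unfolding mean_def using QW[OF P(1)] by (simp add: ennreal_divide_mult_cancel)
        also have "\<dots> = ?n * mean W P u"
          using Q[OF P(1)] unfolding em[OF P(1)] by (rule ennreal_mult_divide_cancel)
        finally show ?thesis .
      qed
      also have "?K * (?n * mean W P u) \<le> ?n * (?K * nested_max W \<D> u x)"
        unfolding mult.left_commute[of ?K] by (intro mult_left_mono mean_le_nested_max P) auto
      finally have "?n * epow (mean M P f) (r - 1) \<le> ?n * (?K * nested_max W \<D> u x)"
        by (simp add: mult_left_mono)
      then have "epow (mean M P f) (r - 1) \<le> ?K * nested_max W \<D> u x"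
        using mean0[OF P(1) wpos(1)] key(2)[OF P(1)] by (subst (asm) ennreal_mult_le_mult_iff) auto
      then show "mean M P f \<le> epow (?K * nested_max W \<D> u x) (1 / (r - 1))"
        using r by (subst epow_le_iff'[symmetric]) auto
    qed
    then show ?thesis using r by (subst epow_le_iff') auto
  qed
  have "(\<integral>\<^sup>+x. epow (nested_max M \<D> f x) r * ennreal (w x) \<partial>M)
      = (\<integral>\<^sup>+x. epow (nested_max M \<D> f x) r \<partial>W)"
    unfolding W_def by (subst nn_integral_density_real) auto
  also have "\<dots> \<le> (\<integral>\<^sup>+x. epow ?K r' * epow (nested_max W \<D> u x) r' \<partial>W)"
  proof (rule nn_integral_mono)
    fix x
    have "epow (nested_max M \<D> f x) r = epow (epow (nested_max M \<D> f x) (r - 1)) r'"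
      by (simp add: epow_powr cj(3))
    also have "\<dots> \<le> epow (?K * nested_max W \<D> u x) r'"
      using cj(1) by (intro epow_mono pw) simp
    finally show "epow (nested_max M \<D> f x) r \<le> epow ?K r' * epow (nested_max W \<D> u x) r'"
      by (simp add: epow_mult)
  qed
  also have "\<dots> = epow ?K r' * (\<integral>\<^sup>+x. epow (nested_max W \<D> u x) r' \<partial>W)"
    by (rule nn_integral_cmult) simp
  also have "\<dots> \<le> epow ?K r' * (ennreal (doob_const r') * (\<integral>\<^sup>+x. epow (u x) r' \<partial>W))"
    using sets QW cj(1) count nest
    by (intro mult_left_mono nested_max_strong_type[OF sfW(1)]) auto
  also have "(\<integral>\<^sup>+x. epow (u x) r' \<partial>W) = (\<integral>\<^sup>+x. epow (nested_max S \<D> g x) r \<partial>S)"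
    unfolding W_def S_def
  proof (subst (1 2) nn_integral_density_real)
    have "epow (u x) r' * ennreal (w x) = epow (nested_max S \<D> g x) r * ennreal (\<sigma> x)" for x
    proof -
      have "(1 / w x) powr r' * w x = \<sigma> x"
        using wpos(1)[of x] unfolding w_\<sigma>(1)[symmetric] by (simp add: powr_divide powr_diff)
      then show ?thesis
        using wpos(1)[of x]
        by (simp add: u_def epow_mult epow_powr cj(3) epow_ennreal mult.assoc flip: ennreal_mult)
    qed
    then show "(\<integral>\<^sup>+x. epow (u x) r' * ennreal (w x) \<partial>M)
      = (\<integral>\<^sup>+x. epow (nested_max (density M (\<lambda>x. ennreal (\<sigma> x))) \<D> g x) r * ennreal (\<sigma> x) \<partial>M)"
      by (simp add: S_def)
  qed (auto simp: S_def[symmetric])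
  also have "\<dots> \<le> ennreal (doob_const r) * (\<integral>\<^sup>+x. epow (g x) r \<partial>S)"
    using sets QW r count nest
    by (intro nested_max_strong_type[OF sfW(2)]) auto
  also have "(\<integral>\<^sup>+x. epow (g x) r \<partial>S) = (\<integral>\<^sup>+x. epow (f x) r * ennreal (w x) \<partial>M)"
    unfolding S_def
  proof (subst nn_integral_density_real)
    have "epow (g x) r * ennreal (\<sigma> x) = epow (f x) r * ennreal (w x)" for x
    proof -
      have "(1 / \<sigma> x) powr r * \<sigma> x = w x"
        using wpos(2)[of x] unfolding w_\<sigma>(2)[symmetric, of x] by (simp add: powr_divide powr_diff)
      then show ?thesis
        using wpos(2)[of x]
        by (simp add: g_def epow_mult epow_ennreal mult.assoc flip: ennreal_mult)
    qed
    then show "(\<integral>\<^sup>+x. epow (g x) r * ennreal (\<sigma> x) \<partial>M) = (\<integral>\<^sup>+x. epow (f x) r * ennreal (w x) \<partial>M)"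
      by simp
  qed auto
  finally show ?thesis
    using doob_const_nonneg[OF r] doob_const_nonneg[OF cj(1)]
    unfolding w_def[symmetric] weighted_const_def Let_def r'_def[symmetric]
    by (simp add: ennreal_mult epow_ennreal mult.assoc mult_left_mono)
qed

section \<open>Extrapolation\<close>

text \<open>The \<open>A\<^sub>1\<close> condition relative to an arbitrary operator in place of the
  maximal function over cubes. Positivity at every point, and not just almost everywhere, keeps
  negative powers of \<open>h\<close> free of case distinctions.\<close>

definition A1_class :: "'z measure \<Rightarrow> (('z \<Rightarrow> ennreal) \<Rightarrow> 'z \<Rightarrow> ennreal) \<Rightarrow> real \<Rightarrow> ('z \<Rightarrow> real) set" where
  "A1_class \<mu> MM B = {h \<in> borel_measurable \<mu>. (\<forall>z. 0 < h z) \<and>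
     (AE z in \<mu>. MM (\<lambda>y. ennreal (h y)) z \<le> ennreal (B * h z))}"

lemma A1_classD:
  assumes "h \<in> A1_class \<mu> MM B"
  shows "h \<in> borel_measurable \<mu>" "0 < h z" "AE z in \<mu>. MM (\<lambda>y. ennreal (h y)) z \<le> ennreal (B * h z)"
  using assms by (auto simp: A1_class_def)

lemma A1_class_mono:
  assumes "B \<le> B'" "h \<in> A1_class \<mu> MM B" shows "h \<in> A1_class \<mu> MM B'"
proof -
  have "AE z in \<mu>. MM (\<lambda>y. ennreal (h y)) z \<le> ennreal (B' * h z)"
    using A1_classD(3)[OF assms(2)]
  proof eventually_elim
    case (elim z)
    have "B * h z \<le> B' * h z" using A1_classD(2)[OF assms(2), of z] assms(1) by simp
    then show ?case using elim by (meson ennreal_leI order_trans)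
  qed
  then show ?thesis using assms(2) by (simp add: A1_class_def)
qed

text \<open>Jensen's inequality for the weights 2^(-j-1), whose total is below 1. Peeling off the
  first term leaves the average of two numbers, so the two-point case suffices.\<close>

lemma epow_dyadic_sum_le:
  assumes "1 \<le> r"
  shows "epow (\<Sum>j<n. ennreal ((1/2)^Suc j) * f j) r \<le> (\<Sum>j<n. ennreal ((1/2)^Suc j) * epow (f j) r)"
proof (induction n arbitrary: f)
  case (Suc n)
  have half: "ennreal (1 / 2) * a = a / 2" for a
    using divide_ennreal[of 1 2] by (simp add: divide_ennreal_def mult.commute)
  have split: "(\<Sum>j<Suc n. ennreal ((1/2)^Suc j) * g j) = (g 0 + (\<Sum>j<n. ennreal ((1/2)^Suc j) * g (Suc j))) / 2" for g
  proof -
    have c: "ennreal ((1/2)^Suc (Suc j)) = ennreal (1/2) * ennreal ((1/2)^Suc j)" for j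
      by (subst power_Suc) (rule ennreal_mult, auto)
    show ?thesis
      unfolding sum.lessThan_Suc_shift half[symmetric] c
      by (simp only: distrib_left sum_distrib_left mult.assoc power_Suc0_right)
  qed
  have "epow (\<Sum>j<Suc n. ennreal ((1/2)^Suc j) * f j) r
      \<le> (epow (f 0) r + epow (\<Sum>j<n. ennreal ((1/2)^Suc j) * f (Suc j)) r) / 2"
    unfolding split by (rule epow_average_le[OF assms])
  also have "\<dots> \<le> (epow (f 0) r + (\<Sum>j<n. ennreal ((1/2)^Suc j) * epow (f (Suc j)) r)) / 2"
    by (intro divide_right_mono_ennreal add_left_mono Suc.IH)
  finally show ?case unfolding split .
qed simp

lemma suminf_half_power: "(\<Sum>j. ennreal ((1/2)^Suc j)) = 1"
proof -
  have "(\<Sum>j. ennreal ((1/2)^Suc j)) = ennreal (\<Sum>j. (1/2)^Suc j)"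
    by (rule suminf_ennreal2[OF _ sums_summable[OF power_half_series]]) auto
  then show ?thesis by (simp only: sums_unique[OF power_half_series, symmetric] ennreal_1)
qed

text \<open>A \<sigma>-finite space carries a positive integrable function; dividing it by
  \<open>v\<close> and rescaling gives a positive function of prescribed small weighted norm. It
  serves to make functions positive at small cost and to truncate them at a level of finite
  norm.\<close>

lemma (in sigma_finite_measure) small_positive_function:
  assumes "0 < r" and [measurable]: "v \<in> borel_measurable M" and "\<And>z. 0 < v z" and "0 < d"
  obtains e where "e \<in> borel_measurable M" "\<And>z. 0 < e z" "\<And>z. e z < (\<top>::ennreal)"
    "(\<integral>\<^sup>+z. epow (e z) r * ennreal (v z) \<partial>M) \<le> ennreal d"
proof -
  obtain k where k [measurable]: "k \<in> borel_measurable M" and "integral\<^sup>N M k \<noteq> \<infinity>"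
    and "\<forall>z\<in>space M. 0 < k z \<and> k z < \<infinity>"
    using Ex_finite_integrable_function by blast
  define k' where "k' z = (if z \<in> space M then k z else 1)" for z
  have k'm [measurable]: "k' \<in> borel_measurable M" using k by (simp add: k'_def cong: measurable_cong)
  have k'I: "integral\<^sup>N M k' \<noteq> \<top>"
    using \<open>integral\<^sup>N M k \<noteq> \<infinity>\<close> by (simp add: k'_def cong: nn_integral_cong)
  have k'p: "0 < k' z" "k' z < \<top>" for z using \<open>\<forall>z\<in>space M. 0 < k z \<and> k z < \<infinity>\<close> by (auto simp: k'_def)
  obtain J where J: "integral\<^sup>N M k' = ennreal J" "0 \<le> J" using k'I by (cases "integral\<^sup>N M k'") auto
  define b where "b = d / (J + 1)"
  have b: "0 < b" "b * J \<le> d" using J \<open>0 < d\<close> by (auto simp: b_def field_simps)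
  define e where "e z = epow (ennreal b * k' z * ennreal (1 / v z)) (1 / r)" for z
  show ?thesis
  proof
    show "e \<in> borel_measurable M" unfolding e_def[abs_def] by measurable
    show "0 < e z" for z
      using k'p[of z] b assms(3)[of z] by (simp add: e_def zero_less_iff_neq_zero)
    show "e z < \<top>" for z
      using k'p[of z] b by (simp add: e_def less_top[symmetric] ennreal_mult_eq_top_iff)
    have "epow (e z) r * ennreal (v z) = ennreal b * k' z" for z
      using assms(1) assms(3)[of z] by (simp add: e_def epow_powr mult.assoc flip: ennreal_mult)
    then have "(\<integral>\<^sup>+z. epow (e z) r * ennreal (v z) \<partial>M) = ennreal b * ennreal J"
      by (simp add: nn_integral_cmult J)
    also have "\<dots> \<le> ennreal d" using b J by (simp add: ennreal_leI flip: ennreal_mult)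
    finally show "(\<integral>\<^sup>+z. epow (e z) r * ennreal (v z) \<partial>M) \<le> ennreal d" .
  qed
qed

text \<open>The properties on which the Rubio de Francia algorithm rests: monotonicity, countable
  sublinearity, and boundedness for all factored weights with a constant depending on r and B alone.
  \<open>MM_mono\<close> compares functions ordered at every point, so null sets have to be repaired
  before it is applied. The instances are \<open>grid_max\<close> and
  \<open>max_prod\<close>.\<close>

locale maximal_operator = sigma_finite_measure \<mu> for \<mu> :: "'z measure" +
  fixes MM :: "('z \<Rightarrow> ennreal) \<Rightarrow> 'z \<Rightarrow> ennreal" and K :: "real \<Rightarrow> real \<Rightarrow> real"
  assumes measurable_MM [measurable]: "\<And>f. f \<in> borel_measurable \<mu> \<Longrightarrow> MM f \<in> borel_measurable \<mu>"
    and MM_mono: "\<And>f g z. (\<And>z. f z \<le> g z) \<Longrightarrow> MM f z \<le> MM g z"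
    and MM_suminf: "\<And>(f :: nat \<Rightarrow> 'z \<Rightarrow> ennreal) z. (\<And>j. f j \<in> borel_measurable \<mu>) \<Longrightarrow> MM (\<lambda>z. \<Sum>j. f j z) z \<le> (\<Sum>j. MM (f j) z)"
    and MM_cmult: "\<And>f c z. f \<in> borel_measurable \<mu> \<Longrightarrow> MM (\<lambda>z. c * f z) z \<le> c * MM f z"
    and MM_bound: "\<And>r B h1 h2 f. 1 < r \<Longrightarrow> 0 < B \<Longrightarrow> h1 \<in> A1_class \<mu> MM B \<Longrightarrow> h2 \<in> A1_class \<mu> MM B \<Longrightarrow>
      f \<in> borel_measurable \<mu> \<Longrightarrow>
      (\<integral>\<^sup>+z. epow (MM f z) r * ennreal (wt r h1 h2 z) \<partial>\<mu>)
        \<le> ennreal (K r B) * (\<integral>\<^sup>+z. epow (f z) r * ennreal (wt r h1 h2 z) \<partial>\<mu>)"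
begin

abbreviation nn_integral_mu :: "('z \<Rightarrow> ennreal) \<Rightarrow> ennreal" (binder "II " 10)
  where "nn_integral_mu f \<equiv> \<integral>\<^sup>+z. f z \<partial>\<mu>"

abbreviation "A1 \<equiv> A1_class \<mu> MM"

text \<open>Twice a bound for the operator norm on the weighted space; the maximum with 1 keeps the
  divisor in the iteration positive.\<close>

definition rdf_const :: "real \<Rightarrow> real \<Rightarrow> real" where
  "rdf_const r B = 2 * (max 1 (K r B)) powr (1 / r)"

lemma rdf_const_pos: "0 < rdf_const r B"
  by (simp add: rdf_const_def max_def)

text \<open>The Rubio de Francia iteration \<open>\<Sum>\<^sub>j 2\<^bsup>-j-1\<^esup> a\<^bsup>-j\<^esup> MM\<^bsup>j\<^esup> h\<close>, where \<open>a\<close> bounds the operator norm of \<open>MM\<close>.\<close>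

lemma rubio_de_francia:
  assumes r: "1 < r" and B: "0 < B" and h12: "h1 \<in> A1 B" "h2 \<in> A1 B"
    and h [measurable]: "h \<in> borel_measurable \<mu>" and hpos: "\<And>z. 0 < h z"
    and fin: "(II z. epow (h z) r * ennreal (wt r h1 h2 z)) \<noteq> \<top>"
  obtains H where "H \<in> A1 (rdf_const r B)" "AE z in \<mu>. h z \<le> 2 * ennreal (H z)"
    "(II z. epow (ennreal (H z)) r * ennreal (wt r h1 h2 z))
      \<le> (II z. epow (h z) r * ennreal (wt r h1 h2 z))"
proof -
  note [measurable] = A1_classD(1)[OF h12(1)] A1_classD(1)[OF h12(2)]
  define w where "w = wt r h1 h2"
  have [measurable]: "w \<in> borel_measurable \<mu>" by (simp add: w_def)
  have wpos: "0 < w z" for z using h12 by (simp add: w_def wt_pos A1_classD(2))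
  define A where "A = max 1 (K r B)"
  define a where "a = A powr (1 / r)"
  have a: "0 < a" "a powr r = A" "1 \<le> A" "K r B \<le> A" using r by (auto simp: a_def A_def powr_powr max_def)
  let ?N = "II z. epow (h z) r * ennreal (w z)"
  \<comment> \<open>Iterates of the operator divided by the norm bound at each stage, so that no
    \<open>g j\<close> has larger weighted norm than h.\<close>
  define g where "g = rec_nat h (\<lambda>_ f z. ennreal (1 / a) * MM f z)"
  have g0: "g 0 = h" and gS: "g (Suc j) = (\<lambda>z. ennreal (1 / a) * MM (g j) z)" for j
    by (simp_all add: g_def)
  have gm [measurable]: "g j \<in> borel_measurable \<mu>" for j
    by (induction j) (simp_all add: g0 gS)
  have gN: "(II z. epow (g j z) r * ennreal (w z)) \<le> ?N" for j
  proof (induction j)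
    case (Suc j)
    have "(II z. epow (g (Suc j) z) r * ennreal (w z))
        = (II z. ennreal (1 / A) * (epow (MM (g j) z) r * ennreal (w z)))"
      using a by (simp add: gS epow_mult epow_ennreal powr_divide mult.assoc)
    also have "\<dots> = ennreal (1 / A) * (II z. epow (MM (g j) z) r * ennreal (w z))"
      by (rule nn_integral_cmult) simp
    also have "\<dots> \<le> ennreal (1 / A) * (ennreal A * (II z. epow (g j z) r * ennreal (w z)))"
    proof (rule mult_left_mono)
      have "(II z. epow (MM (g j) z) r * ennreal (w z))
         \<le> ennreal (K r B) * (II z. epow (g j z) r * ennreal (w z))"
        unfolding w_def by (rule MM_bound[OF r B h12 gm])
      also have "\<dots> \<le> ennreal A * (II z. epow (g j z) r * ennreal (w z))"
        using a by (intro mult_right_mono ennreal_leI) auto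
      finally show "(II z. epow (MM (g j) z) r * ennreal (w z))
         \<le> ennreal A * (II z. epow (g j z) r * ennreal (w z))" .
    qed simp
    also have "\<dots> = (II z. epow (g j z) r * ennreal (w z))"
      using a by (simp add: mult.assoc[symmetric] flip: ennreal_mult)
    finally show ?case using Suc.IH by (rule order_trans)
  qed (simp add: g0)
  let ?c = "\<lambda>j. ennreal ((1/2)^Suc j)"
  define H0 where "H0 z = (\<Sum>j. ?c j * g j z)" for z
  have [measurable]: "H0 \<in> borel_measurable \<mu>" unfolding H0_def by measurable
  have H0_ge: "h z / 2 \<le> H0 z" for z
  proof -
    have "ennreal (1 / 2) * h z = h z / 2"
      using divide_ennreal[of 1 2] by (simp add: divide_ennreal_def mult.commute)
    then have "h z / 2 = (\<Sum>j<1. ?c j * g j z)" by (simp add: g0)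
    also have "\<dots> \<le> H0 z" unfolding H0_def by (rule sum_le_suminf) auto
    finally show ?thesis .
  qed
  have MM_H0: "MM H0 z \<le> ennreal (2 * a) * H0 z" for z
  proof -
    have "MM H0 z \<le> (\<Sum>j. MM (\<lambda>z. ?c j * g j z) z)"
      unfolding H0_def[abs_def] by (rule MM_suminf) measurable
    also have "\<dots> \<le> (\<Sum>j. ?c j * MM (g j) z)"
      by (intro suminf_le MM_cmult) auto
    \<comment> \<open>The factor 2 a undoes one halving and one division by a; applying the operator
      therefore only shifts the index of the series.\<close>
    also have "\<dots> = (\<Sum>j. ennreal (2 * a) * (?c (Suc j) * g (Suc j) z))"
    proof (rule suminf_cong)
      fix j
      have "ennreal (2 * a) * (?c (Suc j) * ennreal (1 / a)) = ?c j"
        using a by (simp flip: ennreal_mult)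
      then have "?c j * MM (g j) z = ennreal (2 * a) * (?c (Suc j) * ennreal (1 / a)) * MM (g j) z" by simp
      then show "?c j * MM (g j) z = ennreal (2 * a) * (?c (Suc j) * g (Suc j) z)"
        by (simp only: gS mult.assoc)
    qed
    also have "\<dots> = ennreal (2 * a) * (\<Sum>j. ?c (Suc j) * g (Suc j) z)"
      by (rule ennreal_suminf_cmult)
    also have "\<dots> \<le> ennreal (2 * a) * H0 z"
    proof (rule mult_left_mono)
      have "H0 z = (\<Sum>j. ?c (j + 1) * g (j + 1) z) + (\<Sum>j<1. ?c j * g j z)"
        unfolding H0_def by (rule suminf_offset) simp
      then show "(\<Sum>j. ?c (Suc j) * g (Suc j) z) \<le> H0 z" by (simp only: Suc_eq_plus1 add_increasing2 order_refl zero_le)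
    qed simp
    finally show ?thesis .
  qed
  have H0_N: "(II z. epow (H0 z) r * ennreal (w z)) \<le> ?N"
  proof -
    let ?S = "\<lambda>n z. \<Sum>j<n. ?c j * g j z"
    have "epow (H0 z) r * ennreal (w z) = (SUP n. epow (?S n z) r * ennreal (w z))" for z
      unfolding H0_def suminf_eq_SUP using r by (subst epow_SUP) (auto simp: SUP_mult_right_ennreal)
    then have "(II z. epow (H0 z) r * ennreal (w z))
        = (II z. (SUP n. epow (?S n z) r * ennreal (w z)))" by simp
    also have "\<dots> = (SUP n. II z. epow (?S n z) r * ennreal (w z))"
      using r by (intro nn_integral_monotone_convergence_SUP)
        (auto simp: incseq_def le_fun_def intro!: mult_right_mono epow_mono sum_mono2)
    also have "\<dots> \<le> ?N"
    proof (rule SUP_least)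
      fix n
      have "(II z. epow (?S n z) r * ennreal (w z))
          \<le> (II z. (\<Sum>j<n. ?c j * (epow (g j z) r * ennreal (w z))))"
        unfolding mult.assoc[symmetric] sum_distrib_right[symmetric]
        using r by (intro nn_integral_mono mult_right_mono epow_dyadic_sum_le) auto
      also have "\<dots> = (\<Sum>j<n. ?c j * (II z. epow (g j z) r * ennreal (w z)))"
        by (subst nn_integral_sum) (auto intro!: sum.cong nn_integral_cmult)
      also have "\<dots> \<le> (\<Sum>j<n. ?c j) * ?N"
        unfolding sum_distrib_right by (intro sum_mono mult_left_mono gN) auto
      also have "\<dots> \<le> 1 * ?N"
        unfolding suminf_half_power[symmetric] by (intro mult_right_mono sum_le_suminf) auto
      finally show "(II z. epow (?S n z) r * ennreal (w z)) \<le> ?N" by simp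
    qed
    finally show ?thesis .
  qed
  have "AE z in \<mu>. epow (H0 z) r * ennreal (w z) \<noteq> \<infinity>"
    using H0_N fin by (intro nn_integral_PInf_AE) (auto simp: w_def top_unique)
  then have H0_fin: "AE z in \<mu>. H0 z \<noteq> \<top>"
  proof eventually_elim
    case (elim z)
    then show ?case using wpos[of z] by (auto simp: ennreal_top_mult)
  qed
  \<comment> \<open>The value 1 on the null set where H0 is infinite keeps H positive and below H0
    at every point, as \<open>MM_mono\<close> requires.\<close>
  define H where "H z = (if H0 z = \<top> then 1 else enn2real (H0 z))" for z
  have H0_pos: "0 < H0 z" for z
  proof -
    have "0 < h z / 2" using hpos[of z] by (auto simp: ennreal_zero_less_divide)
    then show ?thesis using H0_ge by (rule less_le_trans)
  qed
  have H_le: "ennreal (H z) \<le> H0 z" for z by (auto simp: H_def ennreal_enn2real_if)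
  have H_eq: "H0 z \<noteq> \<top> \<Longrightarrow> ennreal (H z) = H0 z" for z by (auto simp: H_def ennreal_enn2real_if)
  have [measurable]: "H \<in> borel_measurable \<mu>" unfolding H_def by measurable
  show ?thesis
  proof
    show "H \<in> A1 (rdf_const r B)"
      unfolding A1_class_def mem_Collect_eq
    proof (intro conjI allI)
      show "0 < H z" for z using H0_pos[of z] by (auto simp: H_def enn2real_positive_iff less_top)
      show "AE z in \<mu>. MM (\<lambda>y. ennreal (H y)) z \<le> ennreal (rdf_const r B * H z)"
        using H0_fin
      proof eventually_elim
        case (elim z)
        have "MM (\<lambda>y. ennreal (H y)) z \<le> MM H0 z" by (rule MM_mono[OF H_le])
        also have "\<dots> \<le> ennreal (2 * a) * ennreal (H z)" using MM_H0[of z] elim by (simp add: H_eq)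
        finally show ?case using a by (simp add: rdf_const_def a_def A_def ennreal_mult' mult.assoc)
      qed
    qed measurable
    show "AE z in \<mu>. h z \<le> 2 * ennreal (H z)"
      using H0_fin
    proof eventually_elim
      case (elim z)
      have "2 * (h z / 2) = h z" using ennreal_divide_mult_cancel[of 2 "h z"] by (simp add: mult.commute)
      then show ?case using mult_left_mono[OF H0_ge[of z], of 2] H_eq[OF elim] by simp
    qed
    have "(II z. epow (ennreal (H z)) r * ennreal (w z)) \<le> (II z. epow (H0 z) r * ennreal (w z))"
      using r by (intro nn_integral_mono mult_right_mono epow_mono H_le) auto
    also note H0_N
    finally show "(II z. epow (ennreal (H z)) r * ennreal (wt r h1 h2 z))
      \<le> (II z. epow (h z) r * ennreal (wt r h1 h2 z))" by (simp add: w_def)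
  qed
qed


text \<open>One constant is for the majorant built in L^r(w), the other for the majorant built in
  the dual space L^r'(\<sigma>).\<close>

definition extrap_class :: "real \<Rightarrow> real \<Rightarrow> real" where
  "extrap_class r B = max (rdf_const r B) (rdf_const (r / (r - 1)) B)"

text \<open>k collects the losses of the duality estimate: 2 from g \<le> 2 H2 and 2^r0 from G \<le>
  2 H1. \<Lambda> is determined by k \<Lambda>^(-r') = 1/2, and the leading 2 comes from
  absorption.\<close>

definition extrap_const :: "real \<Rightarrow> real \<Rightarrow> real \<Rightarrow> real" where
  "extrap_const r0 r c = (let r' = r / (r - 1); k = 2 * (1 + c * 2 powr r0); \<Lambda> = (2 * k) powr (1 / r')
     in 2 * (k * \<Lambda> powr r))"

lemma extrap_const_nonneg: "0 \<le> c \<Longrightarrow> 0 \<le> extrap_const r0 r c"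
  by (simp add: extrap_const_def Let_def)

text \<open>F is tested against g = F^(r-1) w, for which the integral of F g is that of F^r w. Rubio
  de Francia majorants H1 of G and H2 of g yield a weight of exponent r0 to which the hypothesis
  applies, and everything is then compared with the integral of H1 H2. Young's inequality splits
  that integral into the norms of G and of g; the norm of g in the dual space is that of F and is
  absorbed, which is where finiteness enters.\<close>

lemma extrapolation_finite:
  assumes r0: "1 < r0" and r: "1 < r" and B: "0 < B" and c: "0 \<le> c"
    and F [measurable]: "F \<in> borel_measurable \<mu>" and G [measurable]: "G \<in> borel_measurable \<mu>"
    and h12: "h1 \<in> A1 B" "h2 \<in> A1 B"
    and hyp: "\<And>H1 H2. H1 \<in> A1 (extrap_class r B) \<Longrightarrow> H2 \<in> A1 (extrap_class r B) \<Longrightarrow>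
      (II z. epow (F z) r0 * ennreal (wt r0 H1 H2 z))
        \<le> ennreal c * (II z. epow (G z) r0 * ennreal (wt r0 H1 H2 z))"
    and fin: "(II z. epow (F z) r * ennreal (wt r h1 h2 z)) \<noteq> \<top>"
  shows "(II z. epow (F z) r * ennreal (wt r h1 h2 z))
    \<le> ennreal (extrap_const r0 r c) * (II z. epow (G z) r * ennreal (wt r h1 h2 z))"
proof -
  note [measurable] = A1_classD(1)[OF h12(1)] A1_classD(1)[OF h12(2)]
  define r' where "r' = r / (r - 1)"
  note cj = conjugate_exponent[OF r r'_def]
  define w where "w = wt r h1 h2"
  define \<sigma> where "\<sigma> = wt r' h2 h1"
  have wm [measurable]: "w \<in> borel_measurable \<mu>" "\<sigma> \<in> borel_measurable \<mu>" by (simp_all add: w_def \<sigma>_def)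
  have wpos: "0 < w z" "0 < \<sigma> z" for z using h12 by (simp_all add: w_def \<sigma>_def wt_pos A1_classD(2))
  have w\<sigma>: "w z powr (1 - r') = \<sigma> z" for z
    unfolding w_def \<sigma>_def by (rule wt_dual[OF r r'_def]) (use h12 in \<open>auto simp: A1_classD(2)\<close>)
  define X where "X = (II z. epow (F z) r * ennreal (w z))"
  define Y where "Y = (II z. epow (G z) r * ennreal (w z))"
  define k where "k = 2 * (1 + c * 2 powr r0)"
  define \<Lambda> where "\<Lambda> = (2 * k) powr (1 / r')"
  have k: "0 < k" using c by (simp add: k_def add_pos_nonneg)
  have \<Lambda>: "0 < \<Lambda>" "k * \<Lambda> powr - r' = 1 / 2"
    using k cj(1) by (auto simp: \<Lambda>_def powr_powr powr_minus)
  have Xfin: "X \<noteq> \<top>" using fin by (simp add: X_def w_def)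
  \<comment> \<open>Majorants are built from positive functions only; d is the price of making G and
    g positive, and it is sent to 0 at the end.\<close>
  have main: "X \<le> ennreal (k * \<Lambda> powr r) * (Y + ennreal d) + ennreal (1 / 2) * (X + ennreal d)"
    if d: "0 < d" and Yfin: "Y \<noteq> \<top>" for d
  proof -
    obtain e where e [measurable]: "e \<in> borel_measurable \<mu>" and epos: "\<And>z. 0 < e z" and
      eI: "(II z. epow (e z) r * ennreal (w z)) \<le> ennreal d"
      using small_positive_function[of r w d] r wpos d wm by (metis less_trans zero_less_one)
    obtain e' where e' [measurable]: "e' \<in> borel_measurable \<mu>" and e'pos: "\<And>z. 0 < e' z" and
      e'I: "(II z. epow (e' z) r' * ennreal (\<sigma> z)) \<le> ennreal d"
      using small_positive_function[of r' \<sigma> d] cj(1) wpos d wm by (metis less_trans zero_less_one)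
    define g where "g z = epow (F z) (r - 1) * ennreal (w z)" for z
    have [measurable]: "g \<in> borel_measurable \<mu>" unfolding g_def by measurable
    have Fg: "F z * g z = epow (F z) r * ennreal (w z)" for z
      using epow_add[of "F z" 1 "r - 1"] by (simp add: g_def mult.assoc)
    have g\<sigma>: "epow (g z) r' * ennreal (\<sigma> z) = epow (F z) r * ennreal (w z)" for z
    proof -
      have "w z powr r' * \<sigma> z = w z"
        unfolding w\<sigma>[symmetric] using wpos(1)[of z] by (simp add: powr_add[symmetric])
      then show ?thesis
        using wpos[of z] by (simp add: g_def epow_mult epow_powr cj(3) epow_ennreal mult.assoc flip: ennreal_mult)
    qed
    have max_le: "epow (max a b) s \<le> epow a s + epow b s" for a b and s :: real
      by (auto simp: max_def)
    define a where "a z = max (G z) (e z)" for z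
    define b where "b z = max (g z) (e' z)" for z
    have [measurable]: "a \<in> borel_measurable \<mu>" "b \<in> borel_measurable \<mu>" unfolding a_def b_def by measurable
    have apos: "0 < a z" and bpos: "0 < b z" for z
      using epos[of z] e'pos[of z] by (auto simp: a_def b_def less_max_iff_disj)
    have aI: "(II z. epow (a z) r * ennreal (w z)) \<le> Y + ennreal d"
    proof -
      have "(II z. epow (a z) r * ennreal (w z))
        \<le> (II z. epow (G z) r * ennreal (w z) + epow (e z) r * ennreal (w z))"
        unfolding distrib_right[symmetric] a_def by (intro nn_integral_mono mult_right_mono max_le) simp
      also have "\<dots> = Y + (II z. epow (e z) r * ennreal (w z))"
        unfolding Y_def by (rule nn_integral_add) measurable
      also have "\<dots> \<le> Y + ennreal d" by (intro add_left_mono eI)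
      finally show ?thesis .
    qed
    have bI: "(II z. epow (b z) r' * ennreal (\<sigma> z)) \<le> X + ennreal d"
    proof -
      have "(II z. epow (b z) r' * ennreal (\<sigma> z))
        \<le> (II z. epow (g z) r' * ennreal (\<sigma> z) + epow (e' z) r' * ennreal (\<sigma> z))"
        unfolding distrib_right[symmetric] b_def by (intro nn_integral_mono mult_right_mono max_le) simp
      also have "\<dots> = (II z. epow (g z) r' * ennreal (\<sigma> z)) + (II z. epow (e' z) r' * ennreal (\<sigma> z))"
        by (rule nn_integral_add) measurable
      also have "\<dots> \<le> X + ennreal d" unfolding g\<sigma> X_def[symmetric] by (intro add_left_mono e'I)
      finally show ?thesis .
    qed
    obtain H1 where H1: "H1 \<in> A1 (rdf_const r B)" "AE z in \<mu>. a z \<le> 2 * ennreal (H1 z)"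
      "(II z. epow (ennreal (H1 z)) r * ennreal (w z)) \<le> (II z. epow (a z) r * ennreal (w z))"
      unfolding w_def
    proof (rule rubio_de_francia[OF r B h12 _ apos])
      show "(II z. epow (a z) r * ennreal (wt r h1 h2 z)) \<noteq> \<top>"
        using aI Yfin by (auto simp: w_def top_unique)
    qed measurable
    obtain H2 where H2: "H2 \<in> A1 (rdf_const r' B)" "AE z in \<mu>. b z \<le> 2 * ennreal (H2 z)"
      "(II z. epow (ennreal (H2 z)) r' * ennreal (\<sigma> z)) \<le> (II z. epow (b z) r' * ennreal (\<sigma> z))"
      unfolding \<sigma>_def
    proof (rule rubio_de_francia[OF cj(1) B h12(2,1) _ bpos])
      show "(II z. epow (b z) r' * ennreal (wt r' h2 h1 z)) \<noteq> \<top>"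
        using bI Xfin by (auto simp: \<sigma>_def top_unique)
    qed measurable
    have H12: "H1 \<in> A1 (extrap_class r B)" "H2 \<in> A1 (extrap_class r B)"
      using H1(1) H2(1) by (auto simp: extrap_class_def r'_def intro: A1_class_mono[rotated])
    note [measurable] = A1_classD(1)[OF H1(1)] A1_classD(1)[OF H2(1)]
    have Hpos: "0 < H1 z" "0 < H2 z" for z using A1_classD(2)[OF H1(1)] A1_classD(2)[OF H2(1)] by auto
    define I where "I = (II z. ennreal (H1 z * H2 z))"
    \<comment> \<open>Where F \<le> H1 the first term suffices; elsewhere F = F^r0 F^(1-r0), and the
      negative power is at most that of H1.\<close>
    have pw: "F z * ennreal (H2 z) \<le> ennreal (H1 z * H2 z) + epow (F z) r0 * ennreal (wt r0 H1 H2 z)" for z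
    proof (cases "F z")
      case (real x)
      have "x \<le> H1 z + x powr r0 * H1 z powr (1 - r0)"
      proof (cases "x \<le> H1 z")
        case True then show ?thesis by (smt (verit) mult_nonneg_nonneg powr_ge_zero)
      next
        case False
        then have "0 < x" using Hpos[of z] by simp
        then have "x = x powr r0 * x powr (1 - r0)" by (simp flip: powr_add)
        also have "\<dots> \<le> x powr r0 * H1 z powr (1 - r0)"
          using False Hpos[of z] r0 by (intro mult_left_mono powr_mono2') auto
        finally show ?thesis using Hpos[of z] by simp
      qed
      then have "x * H2 z \<le> H1 z * H2 z + x powr r0 * wt r0 H1 H2 z"
        using mult_right_mono[of x "H1 z + x powr r0 * H1 z powr (1 - r0)" "H2 z"] Hpos[of z]
        by (simp add: wt_def algebra_simps)
      then show ?thesis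
        using real Hpos[of z] wt_pos[of H1 z H2 r0]
        by (simp add: epow_ennreal flip: ennreal_mult ennreal_plus)
    next
      case top
      then show ?thesis using wt_pos[of H1 z H2 r0] Hpos[of z] by (simp add: ennreal_top_mult)
    qed
    have "X = (II z. F z * g z)" by (simp add: X_def Fg)
    also have "\<dots> \<le> (II z. 2 * (F z * ennreal (H2 z)))"
      using H2(2)
    proof (intro nn_integral_mono_AE, eventually_elim)
      case (elim z)
      then have "g z \<le> 2 * ennreal (H2 z)" by (simp add: b_def)
      then have "F z * g z \<le> F z * (2 * ennreal (H2 z))" by (rule mult_left_mono) simp
      then show ?case by (simp only: mult.left_commute)
    qed
    also have "\<dots> = 2 * (II z. F z * ennreal (H2 z))" by (rule nn_integral_cmult) measurable
    also have "\<dots> \<le> 2 * (I + (II z. epow (F z) r0 * ennreal (wt r0 H1 H2 z)))"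
      unfolding I_def using pw by (intro mult_left_mono, subst nn_integral_add[symmetric]) (auto intro!: nn_integral_mono)
    also have "\<dots> \<le> 2 * (I + ennreal c * (II z. epow (G z) r0 * ennreal (wt r0 H1 H2 z)))"
      by (intro mult_left_mono add_left_mono hyp H12) simp
    also have "\<dots> \<le> 2 * (I + ennreal c * (ennreal (2 powr r0) * I))"
    proof -
      have "(II z. epow (G z) r0 * ennreal (wt r0 H1 H2 z))
        \<le> (II z. ennreal (2 powr r0) * ennreal (H1 z * H2 z))"
        using H1(2)
      proof (intro nn_integral_mono_AE, eventually_elim)
        case (elim z)
        then have "G z \<le> 2 * ennreal (H1 z)" by (simp add: a_def)
        then have "epow (G z) r0 \<le> epow (ennreal (2 * H1 z)) r0"
          using r0 Hpos[of z] by (intro epow_mono) (auto simp: ennreal_mult)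
        then have "epow (G z) r0 * ennreal (wt r0 H1 H2 z)
          \<le> epow (ennreal (2 * H1 z)) r0 * ennreal (wt r0 H1 H2 z)" by (rule mult_right_mono) simp
        also have "\<dots> = ennreal ((2 * H1 z) powr r0 * wt r0 H1 H2 z)"
          using Hpos[of z] wt_pos[of H1 z H2 r0] by (simp add: epow_ennreal flip: ennreal_mult)
        also have "(2 * H1 z) powr r0 * wt r0 H1 H2 z = 2 powr r0 * (H1 z * H2 z)"
          using Hpos[of z] by (simp add: wt_def powr_mult powr_diff)
        finally show ?case using Hpos[of z] by (simp add: ennreal_mult')
      qed
      also have "\<dots> = ennreal (2 powr r0) * I" unfolding I_def by (rule nn_integral_cmult) measurable
      finally show ?thesis by (intro mult_left_mono add_left_mono) auto
    qed
    also have "\<dots> = ennreal k * I"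
    proof -
      have "ennreal k = 2 * (1 + ennreal c * ennreal (2 powr r0))"
        using c by (simp add: k_def ennreal_mult ennreal_plus)
      then show ?thesis by (simp add: distrib_left distrib_right mult.assoc)
    qed
    \<comment> \<open>The product is read as (H1 w^(1/r)) (H2 w^(-1/r)); the powers r and r' of the
      factors carry the weights w and \<sigma>.\<close>
    also have "I \<le> ennreal (\<Lambda> powr r) * (Y + ennreal d) + ennreal (\<Lambda> powr - r') * (X + ennreal d)"
    proof -
      have "I \<le> (II z. ennreal (\<Lambda> powr r) * (epow (ennreal (H1 z)) r * ennreal (w z))
          + ennreal (\<Lambda> powr - r') * (epow (ennreal (H2 z)) r' * ennreal (\<sigma> z)))"
        unfolding I_def
      proof (rule nn_integral_mono)
        fix z
        let ?a = "H1 z * w z powr (1 / r)" and ?b = "H2 z * w z powr - (1 / r)"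
        have ab: "?a powr r = H1 z powr r * w z" "?b powr r' = H2 z powr r' * \<sigma> z"
        proof -
          show "?a powr r = H1 z powr r * w z" using r Hpos[of z] wpos(1)[of z] by (simp add: powr_mult powr_powr)
          have "r' / r = r' - 1" using r by (simp add: r'_def field_simps)
          then show "?b powr r' = H2 z powr r' * \<sigma> z"
            unfolding w\<sigma>[symmetric] using Hpos[of z] wpos(1)[of z] by (simp add: powr_mult powr_powr)
        qed
        have "ennreal (H1 z * H2 z) = ennreal ?a * ennreal ?b"
          using Hpos[of z] wpos(1)[of z] by (simp add: powr_minus flip: ennreal_mult)
        also have "\<dots> \<le> ennreal (\<Lambda> powr r) * epow (ennreal ?a) r + ennreal (\<Lambda> powr - r') * epow (ennreal ?b) r'"
          by (rule ennreal_mult_le_scaled_powr_sum[OF r r'_def \<Lambda>(1)])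
        finally show "ennreal (H1 z * H2 z) \<le> ennreal (\<Lambda> powr r) * (epow (ennreal (H1 z)) r * ennreal (w z))
          + ennreal (\<Lambda> powr - r') * (epow (ennreal (H2 z)) r' * ennreal (\<sigma> z))"
          using Hpos[of z] wpos[of z] by (simp add: epow_ennreal ab flip: ennreal_mult)
      qed
      also have "\<dots> = ennreal (\<Lambda> powr r) * (II z. epow (ennreal (H1 z)) r * ennreal (w z))
          + ennreal (\<Lambda> powr - r') * (II z. epow (ennreal (H2 z)) r' * ennreal (\<sigma> z))"
        by (simp add: nn_integral_add nn_integral_cmult)
      also have "\<dots> \<le> ennreal (\<Lambda> powr r) * (Y + ennreal d) + ennreal (\<Lambda> powr - r') * (X + ennreal d)"
        by (intro add_mono mult_left_mono order_trans[OF H1(3) aI] order_trans[OF H2(3) bI]) auto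
      finally show ?thesis .
    qed
    finally have "X \<le> ennreal k * (ennreal (\<Lambda> powr r) * (Y + ennreal d) + ennreal (\<Lambda> powr - r') * (X + ennreal d))"
      by (simp add: mult_left_mono)
    also have "\<dots> = ennreal (k * \<Lambda> powr r) * (Y + ennreal d) + ennreal (k * \<Lambda> powr - r') * (X + ennreal d)"
      using k by (simp only: distrib_left[of "ennreal k"] mult.assoc[symmetric]) (simp add: ennreal_mult)
    finally show ?thesis unfolding \<Lambda>(2) .
  qed
  have "X \<le> ennreal (2 * (k * \<Lambda> powr r)) * Y"
  proof (cases Y)
    case (real y)
    obtain x where x: "X = ennreal x" "0 \<le> x" using Xfin by (cases X) auto
    have kL: "0 < k * \<Lambda> powr r" using k \<Lambda>(1) by simp
    have "x \<le> 2 * (k * \<Lambda> powr r) * y + e" if "0 < e" for e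
    proof -
      define d where "d = e / (2 * (k * \<Lambda> powr r) + 1)"
      have d: "0 < d" "(2 * (k * \<Lambda> powr r) + 1) * d = e" using that kL by (auto simp: d_def)
      have "ennreal x \<le> ennreal (k * \<Lambda> powr r * (y + d) + 1 / 2 * (x + d))"
      proof -
        have "ennreal (k * \<Lambda> powr r * (y + d) + b * (x + d))
            = ennreal (k * \<Lambda> powr r) * (ennreal y + ennreal d) + ennreal b * (ennreal x + ennreal d)" if "0 \<le> b" for b
          using that real x kL d(1) by (simp add: ennreal_mult ennreal_plus)
        from this[of "1/2"] main[OF d(1)] real x show ?thesis by (simp only: ennreal_neq_top) simp
      qed
      then have "x \<le> k * \<Lambda> powr r * (y + d) + 1 / 2 * (x + d)"
        using real x kL d(1) by (subst (asm) ennreal_le_iff) (auto intro!: add_nonneg_nonneg mult_nonneg_nonneg)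
      moreover define p where "p = k * \<Lambda> powr r"
      ultimately have "x \<le> 2 * (p * y) + (2 * p * d + d)" by (simp add: distrib_left)
      then show ?thesis using d(2) by (simp add: p_def algebra_simps)
    qed
    then have "x \<le> 2 * (k * \<Lambda> powr r) * y" by (rule field_le_epsilon)
    then show ?thesis using real x kL by (simp add: ennreal_leI flip: ennreal_mult)
  next
    case top
    then show ?thesis using k \<Lambda>(1) by (simp add: ennreal_mult_top)
  qed
  then show ?thesis
    unfolding X_def Y_def w_def \<Lambda>_def k_def r'_def extrap_const_def Let_def .
qed

text \<open>F is truncated at multiples of a positive function of finite weighted norm. The
  hypothesis survives because truncation decreases F, and monotone convergence removes the
  truncation.\<close>

theorem extrapolation:
  assumes r0: "1 < r0" and r: "1 < r" and B: "0 < B" and c: "0 \<le> c"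
    and F [measurable]: "F \<in> borel_measurable \<mu>" and G [measurable]: "G \<in> borel_measurable \<mu>"
    and h12: "h1 \<in> A1 B" "h2 \<in> A1 B"
    and hyp: "\<And>H1 H2. H1 \<in> A1 (extrap_class r B) \<Longrightarrow> H2 \<in> A1 (extrap_class r B) \<Longrightarrow>
      (II z. epow (F z) r0 * ennreal (wt r0 H1 H2 z))
        \<le> ennreal c * (II z. epow (G z) r0 * ennreal (wt r0 H1 H2 z))"
  shows "(II z. epow (F z) r * ennreal (wt r h1 h2 z))
    \<le> ennreal (extrap_const r0 r c) * (II z. epow (G z) r * ennreal (wt r h1 h2 z))"
proof -
  note [measurable] = A1_classD(1)[OF h12(1)] A1_classD(1)[OF h12(2)]
  define w where "w = wt r h1 h2"
  have wm [measurable]: "w \<in> borel_measurable \<mu>" by (simp add: w_def)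
  have wpos: "0 < w z" for z using h12 by (simp add: w_def wt_pos A1_classD(2))
  obtain e where e [measurable]: "e \<in> borel_measurable \<mu>" and epos: "\<And>z. 0 < e z" and
    eI: "(II z. epow (e z) r * ennreal (w z)) \<le> ennreal 1"
    using small_positive_function[of r w 1] r wpos wm by (metis less_trans zero_less_one)
  define F' where "F' n z = min (F z) (of_nat n * e z)" for n z
  have [measurable]: "F' n \<in> borel_measurable \<mu>" for n unfolding F'_def by measurable
  have SUP_F': "(SUP n. F' n z) = F z" for z
  proof -
    have "(SUP n. of_nat n * e z) = \<top>"
      using epos[of z] by (simp add: SUP_mult_right_ennreal[symmetric] ennreal_SUP_of_nat_eq_top ennreal_top_mult zero_less_iff_neq_zero)
    then have "(SUP n. inf (F z) (of_nat n * e z)) = F z" by (simp only: inf_SUP[symmetric] inf_top_right)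
    then show ?thesis by (simp add: F'_def inf_min)
  qed
  have F'_le: "F' n z \<le> F z" for n z by (simp add: F'_def)
  have incF': "F' m z \<le> F' n z" if "m \<le> n" for m n z
    using that unfolding F'_def by (intro min.mono mult_right_mono) auto
  have "(II z. epow (F z) r * ennreal (w z)) = (II z. (SUP n. epow (F' n z) r * ennreal (w z)))"
    using r by (simp add: SUP_F'[symmetric] epow_SUP SUP_mult_right_ennreal)
  also have "\<dots> = (SUP n. II z. epow (F' n z) r * ennreal (w z))"
    using r incF' by (intro nn_integral_monotone_convergence_SUP)
      (auto simp: incseq_def le_fun_def intro!: mult_right_mono epow_mono)
  also have "\<dots> \<le> ennreal (extrap_const r0 r c) * (II z. epow (G z) r * ennreal (w z))"
  proof (rule SUP_least)
    fix n
    show "(II z. epow (F' n z) r * ennreal (w z)) \<le> ennreal (extrap_const r0 r c) * (II z. epow (G z) r * ennreal (w z))"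
      unfolding w_def
    proof (rule extrapolation_finite[OF r0 r B c _ G h12])
      fix H1 H2 assume H: "H1 \<in> A1 (extrap_class r B)" "H2 \<in> A1 (extrap_class r B)"
      have "(II z. epow (F' n z) r0 * ennreal (wt r0 H1 H2 z))
         \<le> (II z. epow (F z) r0 * ennreal (wt r0 H1 H2 z))"
        using r0 by (intro nn_integral_mono mult_right_mono epow_mono F'_le) auto
      also note hyp[OF H]
      finally show "(II z. epow (F' n z) r0 * ennreal (wt r0 H1 H2 z))
        \<le> ennreal c * (II z. epow (G z) r0 * ennreal (wt r0 H1 H2 z))" .
    next
      have "(II z. epow (F' n z) r * ennreal (w z))
         \<le> (II z. epow (of_nat n) r * (epow (e z) r * ennreal (w z)))"
        unfolding mult.assoc[symmetric] epow_mult[symmetric]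
        using r by (intro nn_integral_mono mult_right_mono epow_mono) (auto simp: F'_def)
      also have "\<dots> = epow (of_nat n) r * (II z. epow (e z) r * ennreal (w z))"
        by (rule nn_integral_cmult) measurable
      also have "\<dots> \<le> epow (of_nat n) r * ennreal 1" by (intro mult_left_mono eI) simp
      also have "\<dots> < \<top>" by (simp add: less_top[symmetric])
      finally show "(II z. epow (F' n z) r * ennreal (wt r h1 h2 z)) \<noteq> \<top>" by (simp add: w_def)
    qed measurable
  qed
  finally show ?thesis by (simp add: w_def)
qed

end

section \<open>Shifted dyadic grids\<close>

definition shift :: "'a set \<Rightarrow> int \<Rightarrow> 'a \<Rightarrow> real" where
  "shift S k i = (if i \<in> S then (if even k then 1/3 else - 1/3) else 0)"

text \<open>Level \<open>k\<close> has mesh 2^(-k), so a larger \<open>k\<close> means smaller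
  cells; \<open>S\<close> is the set of coordinate directions in which the grid is shifted.\<close>

definition gidx :: "'a::euclidean_space set \<Rightarrow> int \<Rightarrow> 'a \<Rightarrow> 'a \<Rightarrow> int" where
  "gidx S k x i = \<lfloor>2 powr real_of_int k * (x \<bullet> i) - shift S k i\<rfloor>"

definition gcell :: "'a::euclidean_space set \<Rightarrow> int \<Rightarrow> 'a \<Rightarrow> 'a set" where
  "gcell S k x = {y. \<forall>i\<in>Basis. gidx S k y i = gidx S k x i}"

definition grid :: "'a::euclidean_space set \<Rightarrow> 'a set set" where
  "grid S = {gcell S k x | k x. True}"

text \<open>Twice the shift 1/3 differs from -1/3 by an integer. Passing from level k + 1 to level k
  is therefore an integer translation followed by halving, and the coarse index is a function of the
  fine one.\<close>

lemma gidx_parent: "gidx S k x i = (gidx S (k + 1) x i - \<lfloor>3 * shift S k i\<rfloor>) div 2"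
proof -
  define u where "u = 2 powr real_of_int (k + 1) * (x \<bullet> i) - shift S (k + 1) i"
  have j: "3 * shift S k i = real_of_int \<lfloor>3 * shift S k i\<rfloor>" "shift S (k + 1) i = - shift S k i"
    by (auto simp: shift_def)
  have p: "2 powr real_of_int (k + 1) = 2 * 2 powr real_of_int k" by (simp add: powr_add)
  have "2 powr real_of_int k * (x \<bullet> i) - shift S k i = (u - 3 * shift S k i) / 2"
    unfolding u_def p j(2) by (simp add: field_simps)
  also have "\<dots> = (u - real_of_int \<lfloor>3 * shift S k i\<rfloor>) / real_of_int 2" using j(1) by simp
  finally have "gidx S k x i = \<lfloor>(u - real_of_int \<lfloor>3 * shift S k i\<rfloor>) / real_of_int 2\<rfloor>"
    unfolding gidx_def by (rule arg_cong)
  also have "\<dots> = \<lfloor>u - real_of_int \<lfloor>3 * shift S k i\<rfloor>\<rfloor> div 2"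
    by (rule floor_divide_real_eq_div) simp
  also have "\<dots> = (\<lfloor>u\<rfloor> - \<lfloor>3 * shift S k i\<rfloor>) div 2" by simp
  finally show ?thesis by (simp add: u_def gidx_def)
qed

lemma gcell_antimono:
  assumes "k \<le> l" shows "gcell S l x \<subseteq> gcell S k x"
proof -
  have "gcell S (k + int n) x \<subseteq> gcell S k x" for n
  proof (induction n)
    case (Suc n)
    have "gcell S (k + int n + 1) x \<subseteq> gcell S (k + int n) x"
      unfolding gcell_def by (auto simp: gidx_parent[of S "k + int n"])
    then show ?case using Suc by (simp add: algebra_simps)
  qed simp
  from this[of "nat (l - k)"] assms show ?thesis by simp
qed

lemma gcell_eq: "y \<in> gcell S k x \<Longrightarrow> gcell S k y = gcell S k x"
  by (auto simp: gcell_def)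

lemma mem_gcell [simp]: "x \<in> gcell S k x"
  by (simp add: gcell_def)

lemma nested_grid: "nested (grid S)"
  unfolding nested_def
proof (intro ballI)
  fix P Q assume "P \<in> grid S" "Q \<in> grid S"
  then obtain k x l z where PQ: "P = gcell S k x" "Q = gcell S l z" by (auto simp: grid_def)
  show "P \<inter> Q = {} \<or> P \<subseteq> Q \<or> Q \<subseteq> P"
  proof (cases "P \<inter> Q = {}")
    case False
    then obtain y where "y \<in> gcell S k x" "y \<in> gcell S l z" unfolding PQ by auto
    then have "P = gcell S k y" "Q = gcell S l y" by (simp_all add: PQ gcell_eq)
    then show ?thesis using gcell_antimono[of k l S y] gcell_antimono[of l k S y] by (cases "k \<le> l") auto
  qed simp
qed

lemma countable_grid: "countable (grid S)"
proof -
  have "countable (Basis \<rightarrow>\<^sub>E (UNIV :: int set))"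
    by (rule countable_PiE) auto
  then have "countable (\<Union>k. (\<lambda>m. {y. \<forall>i\<in>Basis. gidx S k y i = m i}) ` (Basis \<rightarrow>\<^sub>E UNIV))"
    by (intro countable_UN countable_image) auto
  moreover have "grid S \<subseteq> (\<Union>k. (\<lambda>m. {y. \<forall>i\<in>Basis. gidx S k y i = m i}) ` (Basis \<rightarrow>\<^sub>E UNIV))"
  proof
    fix P assume "P \<in> grid S"
    then obtain k x where P: "P = gcell S k x" by (auto simp: grid_def)
    have "P = {y. \<forall>i\<in>Basis. gidx S k y i = restrict (gidx S k x) Basis i}"
      by (auto simp: P gcell_def)
    then show "P \<in> (\<Union>k. (\<lambda>m. {y. \<forall>i\<in>Basis. gidx S k y i = m i}) ` (Basis \<rightarrow>\<^sub>E UNIV))"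
      by (intro UN_I[of k] image_eqI[of _ _ "restrict (gidx S k x) Basis"]) auto
  qed
  ultimately show ?thesis by (rule countable_subset[rotated])
qed

lemma gcell_between_boxes:
  obtains c where "box c (c + (2 powr - real_of_int k) *\<^sub>R One) \<subseteq> gcell S k x"
    "gcell S k x \<subseteq> cbox c (c + (2 powr - real_of_int k) *\<^sub>R One)"
proof -
  define L where "L = 2 powr - real_of_int k"
  have L: "0 < L" "2 powr real_of_int k = 1 / L" by (auto simp: L_def powr_minus_divide)
  define c where "c = (\<Sum>i\<in>Basis. ((real_of_int (gidx S k x i) + shift S k i) * L) *\<^sub>R i)"
  have ci: "c \<bullet> i = (real_of_int (gidx S k x i) + shift S k i) * L" if "i \<in> Basis" for i
    using that by (simp add: c_def)
  have mem: "y \<in> gcell S k x \<longleftrightarrow> (\<forall>i\<in>Basis. c \<bullet> i \<le> y \<bullet> i \<and> y \<bullet> i < c \<bullet> i + L)" for y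
  proof -
    have "gidx S k y i = gidx S k x i \<longleftrightarrow> c \<bullet> i \<le> y \<bullet> i \<and> y \<bullet> i < c \<bullet> i + L" if "i \<in> Basis" for i
      unfolding ci[OF that] gidx_def[of S k y] L(2) floor_eq_iff using L(1) by (simp add: field_simps)
    then show ?thesis by (simp add: gcell_def)
  qed
  show ?thesis
  proof (rule that[of c])
    show "box c (c + (2 powr - real_of_int k) *\<^sub>R One) \<subseteq> gcell S k x"
      unfolding L_def[symmetric] by (auto simp: mem mem_box inner_add_left less_imp_le)
    show "gcell S k x \<subseteq> cbox c (c + (2 powr - real_of_int k) *\<^sub>R One)"
      unfolding L_def[symmetric] by (auto simp: mem mem_box inner_add_left less_imp_le)
  qed
qed

lemma gcell_borel [measurable]: "gcell S k x \<in> sets borel"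
proof -
  have "(\<lambda>y. gidx S k y i) \<in> borel \<rightarrow>\<^sub>M count_space UNIV" for i
    unfolding gidx_def by measurable
  then have "Measurable.pred borel (\<lambda>y. \<forall>i\<in>Basis. gidx S k y i = gidx S k x i)"
    by (intro pred_intros_finite) auto
  then show ?thesis by (simp add: gcell_def pred_def)
qed

lemma emeasure_cube:
  fixes a :: "'a::euclidean_space"
  assumes "0 \<le> l"
  shows "emeasure lborel (cbox a (a + l *\<^sub>R One)) = ennreal (l ^ DIM('a))"
    "emeasure lborel (box a (a + l *\<^sub>R One)) = ennreal (l ^ DIM('a))"
  using assms by (simp_all add: emeasure_lborel_cbox_eq emeasure_lborel_box_eq inner_add_left prod_constant)

lemma emeasure_gcell:
  "emeasure lborel (gcell S k x :: 'a::euclidean_space set) = ennreal ((2 powr - real_of_int k) ^ DIM('a))"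
proof -
  obtain c :: 'a where c: "box c (c + (2 powr - real_of_int k) *\<^sub>R One) \<subseteq> gcell S k x"
    "gcell S k x \<subseteq> cbox c (c + (2 powr - real_of_int k) *\<^sub>R One)"
    by (rule gcell_between_boxes)
  show ?thesis
  proof (rule antisym)
    show "emeasure lborel (gcell S k x) \<le> ennreal ((2 powr - real_of_int k) ^ DIM('a))"
      using emeasure_mono[OF c(2), of lborel] by (simp add: emeasure_cube)
    show "ennreal ((2 powr - real_of_int k) ^ DIM('a)) \<le> emeasure lborel (gcell S k x)"
      using emeasure_mono[OF c(1), of lborel] by (simp add: emeasure_cube)
  qed
qed

lemma grid_cell:
  assumes "Q \<in> grid S"
  shows "Q \<in> sets borel" "emeasure lborel Q \<noteq> 0" "emeasure lborel Q \<noteq> \<top>"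
  using assms by (auto simp: grid_def emeasure_gcell)

text \<open>An interval of length at most 1/3 that crosses an integer lies within 1/3 of it; moving
  it by 1/3 in either direction puts it into a single interval [m, m + 1).\<close>

lemma floor_shift_third:
  fixes u d s :: real
  assumes "0 \<le> d" "d \<le> 1/3" "\<lfloor>u\<rfloor> \<noteq> \<lfloor>u + d\<rfloor>" "s = 1/3 \<or> s = - 1/3"
  shows "\<lfloor>u - s\<rfloor> = \<lfloor>u + d - s\<rfloor>"
proof -
  define n where "n = \<lfloor>u + d\<rfloor>"
  have n: "real_of_int n \<le> u + d" "u + d < real_of_int n + 1" by (auto simp: n_def)
  have "u < real_of_int n"
  proof (rule ccontr)
    assume "\<not> u < real_of_int n"
    then have "\<lfloor>u\<rfloor> = n" using n assms(1) by (simp add: floor_eq_iff)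
    then show False using assms(3) by (simp add: n_def)
  qed
  from assms(4) show ?thesis
  proof
    assume "s = 1/3"
    then have "\<lfloor>u - s\<rfloor> = n - 1" "\<lfloor>u + d - s\<rfloor> = n - 1"
      using n assms(1,2) \<open>u < real_of_int n\<close> by (auto simp: floor_eq_iff)
    then show ?thesis by simp
  next
    assume "s = - 1/3"
    then have "\<lfloor>u - s\<rfloor> = n" "\<lfloor>u + d - s\<rfloor> = n"
      using n assms(1,2) \<open>u < real_of_int n\<close> by (auto simp: floor_eq_iff)
    then show ?thesis by simp
  qed
qed

text \<open>The one-third trick: shifts by \<open>+-1/3\<close> of a cell, with alternating signs so that each grid stays nested.\<close>

lemma cube_in_gcell:
  fixes a :: "'a::euclidean_space"
  assumes l: "0 < l"
  obtains S k where "S \<subseteq> Basis" "cbox a (a + l *\<^sub>R One) \<subseteq> gcell S k a" "2 powr - real_of_int k \<le> 6 * l"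
proof -
  \<comment> \<open>At this level 1/6 < 2^k l \<le> 1/3, so a cell is at least three times and less
    than six times as wide as the cube.\<close>
  define k where "k = \<lfloor>log 2 (1 / (3 * l))\<rfloor>"
  define b where "b = 2 powr real_of_int k"
  have bpos: "0 < b" by (simp add: b_def)
  have "real_of_int k \<le> log 2 (1 / (3 * l))" "log 2 (1 / (3 * l)) < real_of_int k + 1"
    by (auto simp: k_def)
  then have "b \<le> 1 / (3 * l)" "1 / (3 * l) < 2 powr (real_of_int k + 1)"
    using l by (auto simp: b_def le_log_iff log_less_iff)
  then have b: "b * l \<le> 1/3" "1 < 6 * l * b" using l by (auto simp: b_def powr_add field_simps)
  \<comment> \<open>The directions to shift are those in which the cube crosses a wall of the
    unshifted grid.\<close>
  define S where "S = {i\<in>Basis. \<lfloor>b * (a \<bullet> i)\<rfloor> \<noteq> \<lfloor>b * (a \<bullet> i) + b * l\<rfloor>}"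
  have key: "\<lfloor>b * (a \<bullet> i) - shift S k i\<rfloor> = \<lfloor>b * (a \<bullet> i) + b * l - shift S k i\<rfloor>" if "i \<in> Basis" for i
  proof (cases "i \<in> S")
    case True
    then show ?thesis
      using b bpos l by (intro floor_shift_third) (auto simp: S_def shift_def)
  next
    case False
    then show ?thesis using that by (simp add: S_def shift_def)
  qed
  have "gidx S k y i = gidx S k a i" if y: "y \<in> cbox a (a + l *\<^sub>R One)" and i: "i \<in> Basis" for y i
  proof -
    have "a \<bullet> i \<le> y \<bullet> i" "y \<bullet> i \<le> a \<bullet> i + l" using y i by (auto simp: mem_box inner_add_left)
    then have le: "b * (a \<bullet> i) \<le> b * (y \<bullet> i)" "b * (y \<bullet> i) \<le> b * (a \<bullet> i) + b * l"
      using bpos by (auto simp flip: distrib_left)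
    have "\<lfloor>b * (a \<bullet> i) - shift S k i\<rfloor> \<le> \<lfloor>b * (y \<bullet> i) - shift S k i\<rfloor>" using le by (intro floor_mono) simp
    moreover have "\<lfloor>b * (y \<bullet> i) - shift S k i\<rfloor> \<le> \<lfloor>b * (a \<bullet> i) + b * l - shift S k i\<rfloor>" using le by (intro floor_mono) simp
    ultimately show ?thesis using key[OF i] by (simp add: gidx_def b_def)
  qed
  then have "cbox a (a + l *\<^sub>R One) \<subseteq> gcell S k a" by (auto simp: gcell_def)
  moreover have "2 powr - real_of_int k \<le> 6 * l"
    using b(2) bpos by (simp add: powr_minus_divide b_def[symmetric] field_simps)
  ultimately show ?thesis by (intro that) (auto simp: S_def)
qed

section \<open>Maximal operators of the grids\<close>

text \<open>Summing over the 2^d shift patterns, rather than taking the largest value, keeps the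
  sublinearity laws and the measurability termwise, while each single grid is still
  dominated.\<close>

definition grid_max :: "('a::euclidean_space \<Rightarrow> ennreal) \<Rightarrow> 'a \<Rightarrow> ennreal" where
  "grid_max f x = (\<Sum>S\<in>Pow Basis. nested_max lborel (grid S) f x)"

lemma grid_sets: "grid S \<subseteq> sets lborel"
  using grid_cell(1) by auto

text \<open>The cube lies in a cell of one of the shifted grids whose side is at most six times as
  long; 6^d bounds the ratio of the volumes.\<close>

lemma mean_cube_le_grid_max:
  fixes a :: "'a::euclidean_space"
  assumes l: "0 < l" and x: "x \<in> cbox a (a + l *\<^sub>R One)"
  shows "mean lborel (cbox a (a + l *\<^sub>R One)) f \<le> ennreal (6 ^ DIM('a)) * grid_max f x"
proof -
  obtain S k where S: "S \<subseteq> Basis" and sub: "cbox a (a + l *\<^sub>R One) \<subseteq> gcell S k a" and k: "2 powr - real_of_int k \<le> 6 * l"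
    by (rule cube_in_gcell[OF l])
  define L where "L = 2 powr - real_of_int k"
  have L: "0 < L" "L \<le> 6 * l" using k by (auto simp: L_def)
  let ?Q = "cbox a (a + l *\<^sub>R One)" and ?C = "gcell S k a"
  have grid: "?C \<in> grid S" by (auto simp: grid_def)
  have "mean lborel ?Q f = (\<integral>\<^sup>+y\<in>?Q. f y \<partial>lborel) / ennreal (l ^ DIM('a))"
    using l by (simp add: mean_def emeasure_cube)
  also have "\<dots> \<le> (\<integral>\<^sup>+y\<in>?C. f y \<partial>lborel) / ennreal (l ^ DIM('a))"
    using sub by (intro divide_right_mono_ennreal nn_integral_mono) (auto split: split_indicator)
  also have "(\<integral>\<^sup>+y\<in>?C. f y \<partial>lborel) = mean lborel ?C f * ennreal (L ^ DIM('a))"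
    unfolding mean_def L_def emeasure_gcell[of S k a, symmetric]
    by (rule ennreal_divide_mult_cancel[symmetric]) (use grid_cell[OF grid] in auto)
  also have "mean lborel ?C f * ennreal (L ^ DIM('a)) / ennreal (l ^ DIM('a)) = mean lborel ?C f * ennreal (L ^ DIM('a) / l ^ DIM('a))"
    using l L by (subst ennreal_times_divide[symmetric]) (simp add: divide_ennreal)
  also have "\<dots> \<le> mean lborel ?C f * ennreal (6 ^ DIM('a))"
  proof -
    have "L ^ DIM('a) \<le> (6 * l) ^ DIM('a)" using L by (intro power_mono) auto
    then have "L ^ DIM('a) / l ^ DIM('a) \<le> 6 ^ DIM('a)" using l by (simp add: power_mult_distrib divide_le_eq)
    then show ?thesis by (intro mult_left_mono ennreal_leI) auto
  qed
  also have "\<dots> \<le> grid_max f x * ennreal (6 ^ DIM('a))"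
  proof (rule mult_right_mono)
    have "mean lborel ?C f \<le> nested_max lborel (grid S) f x"
      using x sub by (intro mean_le_nested_max grid) auto
    also have "\<dots> \<le> grid_max f x" unfolding grid_max_def using S by (intro member_le_sum) auto
    finally show "mean lborel ?C f \<le> grid_max f x" .
  qed simp
  finally show ?thesis by (simp only: mult.commute)
qed

lemma nested_max_mono: "(\<And>z. f z \<le> g z) \<Longrightarrow> nested_max M \<D> f z \<le> nested_max M \<D> g z"
  unfolding nested_max_def by (intro SUP_mono' mult_right_mono mean_mono) auto

lemma nested_max_suminf:
  assumes [measurable]: "\<And>j::nat. f j \<in> borel_measurable M" and sets: "\<D> \<subseteq> sets M"
  shows "nested_max M \<D> (\<lambda>z. \<Sum>j. f j z) x \<le> (\<Sum>j. nested_max M \<D> (f j) x)"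
proof (rule nested_max_le)
  fix Q assume Q: "Q \<in> \<D>" "x \<in> Q"
  then have [measurable]: "Q \<in> sets M" using sets by blast
  have "(\<integral>\<^sup>+y\<in>Q. (\<Sum>j. f j y) \<partial>M) = (\<Sum>j. \<integral>\<^sup>+y\<in>Q. f j y \<partial>M)"
    unfolding ennreal_suminf_multc[symmetric] by (rule nn_integral_suminf) measurable
  then have "mean M Q (\<lambda>z. \<Sum>j. f j z) = (\<Sum>j. mean M Q (f j))"
    by (simp add: mean_def divide_ennreal_def ennreal_suminf_multc)
  also have "\<dots> \<le> (\<Sum>j. nested_max M \<D> (f j) x)"
    by (intro suminf_le mean_le_nested_max Q) auto
  finally show "mean M Q (\<lambda>z. \<Sum>j. f j z) \<le> (\<Sum>j. nested_max M \<D> (f j) x)" .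
qed

lemma nested_max_cmult:
  assumes [measurable]: "f \<in> borel_measurable M" and sets: "\<D> \<subseteq> sets M"
  shows "nested_max M \<D> (\<lambda>z. c * f z) x \<le> c * nested_max M \<D> f x"
proof (rule nested_max_le)
  fix Q assume Q: "Q \<in> \<D>" "x \<in> Q"
  then have [measurable]: "Q \<in> sets M" using sets by blast
  show "mean M Q (\<lambda>z. c * f z) \<le> c * nested_max M \<D> f x"
    by (subst mean_cmult) (auto intro!: mult_left_mono mean_le_nested_max Q)
qed

lemma borel_measurable_grid_max [measurable]: "grid_max f \<in> borel_fun"
proof -
  have "nested_max lborel (grid S) f \<in> borel_measurable lborel" for S :: "'a set"
    by (rule borel_measurable_nested_max[OF countable_grid grid_sets])
  then have [measurable]: "nested_max lborel (grid S) f \<in> borel_fun" for S :: "'a set" by simp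
  show ?thesis unfolding grid_max_def[abs_def] by measurable
qed

lemma grid_max_mono: "(\<And>z. f z \<le> g z) \<Longrightarrow> grid_max f z \<le> grid_max g z"
  unfolding grid_max_def by (intro sum_mono nested_max_mono) auto

lemma grid_max_suminf:
  assumes "\<And>j::nat. f j \<in> borel_fun"
  shows "grid_max (\<lambda>z. \<Sum>j. f j z) x \<le> (\<Sum>j. grid_max (f j) x)"
proof -
  have "grid_max (\<lambda>z. \<Sum>j. f j z) x \<le> (\<Sum>S\<in>Pow Basis. \<Sum>j. nested_max lborel (grid S) (f j) x)"
    unfolding grid_max_def using assms by (intro sum_mono nested_max_suminf grid_sets) simp
  also have "\<dots> = (\<Sum>j. grid_max (f j) x)"
    unfolding grid_max_def by (rule suminf_sum[symmetric]) simp
  finally show ?thesis .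
qed

lemma grid_max_cmult:
  assumes "f \<in> borel_fun"
  shows "grid_max (\<lambda>z. c * f z) x \<le> c * grid_max f x"
  unfolding grid_max_def sum_distrib_left using assms
  by (intro sum_mono nested_max_cmult grid_sets) simp

text \<open>The number m of grids enters twice: m^r from the power of a sum of m terms, and m from
  adding m equal bounds.\<close>

definition grid_const :: "nat \<Rightarrow> real \<Rightarrow> real \<Rightarrow> real" where
  "grid_const m r B = real m powr r * (real m * weighted_const r B)"

lemma grid_const_nonneg: "1 < r \<Longrightarrow> 0 \<le> grid_const m r B"
  by (simp add: grid_const_def weighted_const_nonneg)

lemma grid_max_weighted:
  fixes f :: "'a::euclidean_space \<Rightarrow> ennreal"
  assumes h [measurable]: "h1 \<in> borel_fun" "h2 \<in> borel_fun"
    and pos: "\<And>x. 0 < h1 x" "\<And>x. 0 < h2 x"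
    and A: "ae x. grid_max (\<lambda>y. ennreal (h1 y)) x \<le> ennreal (B * h1 x)"
      "ae x. grid_max (\<lambda>y. ennreal (h2 y)) x \<le> ennreal (B * h2 x)"
    and B: "0 < B" and r: "1 < r" and f [measurable]: "f \<in> borel_fun"
  shows "(NN x. epow (grid_max f x) r * ennreal (wt r h1 h2 x))
    \<le> ennreal (grid_const (2 ^ DIM('a)) r B) * (NN x. epow (f x) r * ennreal (wt r h1 h2 x))"
proof -
  let ?w = "\<lambda>x. ennreal (wt r h1 h2 x)"
  have card: "card (Pow (Basis :: 'a set)) = 2 ^ DIM('a)" by (simp add: card_Pow)
  have [measurable]: "nested_max lborel (grid S) f \<in> borel_measurable lborel" for S
    by (rule borel_measurable_nested_max[OF countable_grid grid_sets])
  have [measurable]: "wt r h1 h2 \<in> borel_measurable lborel" by simp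
  have le: "nested_max lborel (grid S) g x \<le> grid_max g x" if "S \<in> Pow Basis" for g and S :: "'a set" and x
    unfolding grid_max_def using that by (intro member_le_sum) auto
  have each: "(NN x. epow (nested_max lborel (grid S) f x) r * ?w x)
      \<le> ennreal (weighted_const r B) * (NN x. epow (f x) r * ?w x)" if S: "S \<in> Pow Basis" for S :: "'a set"
  proof (rule nested_max_weighted[OF _ countable_grid nested_grid grid_sets])
    show "sigma_finite_measure (lborel :: 'a measure)" by (rule sigma_finite_lborel)
    show "ae x. nested_max lborel (grid S) (\<lambda>y. ennreal (h1 y)) x \<le> ennreal (B * h1 x)"
      using A(1) by eventually_elim (rule order_trans[OF le[OF S]])
    show "ae x. nested_max lborel (grid S) (\<lambda>y. ennreal (h2 y)) x \<le> ennreal (B * h2 x)"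
      using A(2) by eventually_elim (rule order_trans[OF le[OF S]])
  qed (use grid_cell[of _ S] pos B r in auto)
  have "(NN x. epow (grid_max f x) r * ?w x)
    \<le> (NN x. ennreal (real (2 ^ DIM('a)) powr r) * (\<Sum>S\<in>Pow Basis. epow (nested_max lborel (grid S) f x) r * ?w x))"
  proof (rule nn_integral_mono)
    fix x :: 'a
    show "epow (grid_max f x) r * ?w x \<le> ennreal (real (2 ^ DIM('a)) powr r) * (\<Sum>S\<in>Pow Basis. epow (nested_max lborel (grid S) f x) r * ?w x)"
      unfolding sum_distrib_right[symmetric] mult.assoc[symmetric] grid_max_def card[symmetric]
      using r by (intro mult_right_mono epow_sum_le) auto
  qed
  also have "\<dots> = ennreal (real (2 ^ DIM('a)) powr r) * (\<Sum>S\<in>Pow Basis. NN x. epow (nested_max lborel (grid S) f x) r * ?w x)"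
    by (simp add: nn_integral_cmult nn_integral_sum)
  also have "\<dots> \<le> ennreal (real (2 ^ DIM('a)) powr r) * (\<Sum>S\<in>Pow (Basis :: 'a set). ennreal (weighted_const r B) * (NN x. epow (f x) r * ?w x))"
    by (intro mult_left_mono sum_mono each) auto
  also have "\<dots> = ennreal (grid_const (2 ^ DIM('a)) r B) * (NN x. epow (f x) r * ?w x)"
  proof -
    have "(of_nat (2 ^ DIM('a)) :: ennreal) = ennreal (real (2 ^ DIM('a)))" by (rule ennreal_of_nat_eq_real_of_nat)
    then show ?thesis
      unfolding sum_constant card grid_const_def
      using weighted_const_nonneg[OF r, of B] by (simp only: ennreal_mult mult.assoc powr_ge_zero of_nat_0_le_iff mult_nonneg_nonneg)
  qed
  finally show ?thesis .
qed

lemma maximal_operator_grid_max: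
  "maximal_operator lborel (grid_max :: ('a::euclidean_space \<Rightarrow> ennreal) \<Rightarrow> _) (grid_const (2 ^ DIM('a)))"
proof (intro maximal_operator.intro maximal_operator_axioms.intro)
  show "sigma_finite_measure (lborel :: 'a measure)" by (rule sigma_finite_lborel)
  fix r B :: real and h1 h2 :: "'a \<Rightarrow> real" and f :: "'a \<Rightarrow> ennreal"
  assume *: "1 < r" "0 < B" "h1 \<in> A1_class lborel grid_max B" "h2 \<in> A1_class lborel grid_max B" "f \<in> borel_measurable lborel"
  show "(NN z. epow (grid_max f z) r * ennreal (wt r h1 h2 z))
     \<le> ennreal (grid_const (2 ^ DIM('a)) r B) * (NN z. epow (f z) r * ennreal (wt r h1 h2 z))"
    using A1_classD[OF *(3)] A1_classD[OF *(4)] * by (intro grid_max_weighted) auto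
qed (auto intro: grid_max_mono grid_max_suminf grid_max_cmult)

section \<open>The maximal operator on the product space\<close>

definition max_fst :: "('a::euclidean_space \<times> 'b \<Rightarrow> ennreal) \<Rightarrow> 'a \<times> 'b \<Rightarrow> ennreal" where
  "max_fst f z = grid_max (\<lambda>s. f (s, snd z)) (fst z)"

definition max_snd :: "('a \<times> 'b::euclidean_space \<Rightarrow> ennreal) \<Rightarrow> 'a \<times> 'b \<Rightarrow> ennreal" where
  "max_snd f z = grid_max (\<lambda>y. f (fst z, y)) (snd z)"

text \<open>The \<open>A\<^sub>1\<close> condition for this operator bounds both one-variable
  maximal functions: in time it serves the kernel, in space it yields the weights for T(t,s). The
  weighted bound reduces by Fubini's theorem to that of \<open>grid_max\<close> on sections.\<close>

definition max_prod :: "('a::euclidean_space \<times> 'b::euclidean_space \<Rightarrow> ennreal) \<Rightarrow> 'a \<times> 'b \<Rightarrow> ennreal" where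
  "max_prod f z = max_fst f z + max_snd f z"

lemma borel_measurable_max_snd:
  fixes f :: "'a::euclidean_space \<times> 'b::euclidean_space \<Rightarrow> ennreal"
  assumes "f \<in> borel_fun"
  shows "max_snd f \<in> borel_fun"
proof -
  have [measurable]: "f \<in> borel_measurable (borel \<Otimes>\<^sub>M borel)" using assms by (simp add: borel_prod)
  have *: "(\<lambda>z. mean lborel Q (\<lambda>y. f (fst z, y)) * indicator Q (snd z)) \<in> borel_measurable (borel \<Otimes>\<^sub>M borel)"
    if [measurable]: "Q \<in> sets borel" for Q
    unfolding mean_def by measurable
  have "(\<lambda>z. \<Sum>S\<in>Pow Basis. SUP Q\<in>grid S. mean lborel Q (\<lambda>y. f (fst z, y)) * indicator Q (snd z))
      \<in> borel_measurable (borel \<Otimes>\<^sub>M borel)"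
    by (intro borel_measurable_sum borel_measurable_SUP countable_grid * grid_cell(1))
  then show ?thesis by (simp add: max_snd_def[abs_def] grid_max_def nested_max_def borel_prod)
qed

lemma borel_measurable_max_fst:
  fixes f :: "'a::euclidean_space \<times> 'b::euclidean_space \<Rightarrow> ennreal"
  assumes "f \<in> borel_fun"
  shows "max_fst f \<in> borel_fun"
proof -
  have [measurable]: "f \<in> borel_measurable (borel \<Otimes>\<^sub>M borel)" using assms by (simp add: borel_prod)
  have *: "(\<lambda>z. mean lborel Q (\<lambda>s. f (s, snd z)) * indicator Q (fst z)) \<in> borel_measurable (borel \<Otimes>\<^sub>M borel)"
    if [measurable]: "Q \<in> sets borel" for Q
    unfolding mean_def by measurable
  have "(\<lambda>z. \<Sum>S\<in>Pow Basis. SUP Q\<in>grid S. mean lborel Q (\<lambda>s. f (s, snd z)) * indicator Q (fst z))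
      \<in> borel_measurable (borel \<Otimes>\<^sub>M borel)"
    by (intro borel_measurable_sum borel_measurable_SUP countable_grid * grid_cell(1))
  then show ?thesis by (simp add: max_fst_def[abs_def] grid_max_def nested_max_def borel_prod)
qed

lemma borel_measurable_max_prod [measurable]:
  fixes f :: "'a::euclidean_space \<times> 'b::euclidean_space \<Rightarrow> ennreal"
  assumes "f \<in> borel_fun"
  shows "max_prod f \<in> borel_fun"
  unfolding max_prod_def[abs_def]
  by (intro borel_measurable_add borel_measurable_max_fst borel_measurable_max_snd assms)

lemma epow_add_le:
  assumes "0 < r"
  shows "epow (a + b) r \<le> ennreal (2 powr r) * (epow a r + epow b r)"
  using epow_sum_le[OF assms, of "UNIV :: bool set" "\<lambda>i. if i then a else b"]
  by (simp add: UNIV_bool add.commute)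

lemma nn_integral_prod_borel:
  fixes f :: "'a::euclidean_space \<times> 'b::euclidean_space \<Rightarrow> ennreal"
  assumes "f \<in> borel_fun"
  shows "(NN z. f z) = (NN x. NN y. f (x, y))"
    "(NN z. f z) = (NN y. NN x. f (x, y))"
proof -
  have f: "f \<in> borel_measurable (lborel \<Otimes>\<^sub>M lborel)" using assms by (simp add: lborel_prod)
  show "(NN z. f z) = (NN x. NN y. f (x, y))"
    using lborel.nn_integral_fst[OF f] by (simp add: lborel_prod)
  show "(NN z. f z) = (NN y. NN x. f (x, y))"
    using lborel_pair.nn_integral_snd[OF f] by (simp add: lborel_prod)
qed

lemma AE_prod_borel:
  fixes P :: "'a::euclidean_space \<times> 'b::euclidean_space \<Rightarrow> bool"
  assumes "ae z. P z"
  shows "ae x. ae y. P (x, y)" "ae y. ae x. P (x, y)"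
proof -
  have P: "AE z in lborel \<Otimes>\<^sub>M lborel. P z" using assms unfolding lborel_prod .
  show "ae x. ae y. P (x, y)" by (rule lborel_pair.AE_pair[OF P])
  have "AE z in distr (lborel \<Otimes>\<^sub>M lborel) (lborel \<Otimes>\<^sub>M lborel) (\<lambda>(x, y). (y, x)). P z"
    using P unfolding lborel_pair.distr_pair_swap[symmetric] .
  then have "AE z in (lborel \<Otimes>\<^sub>M lborel). P (case z of (x, y) \<Rightarrow> (y, x))"
    by (rule AE_distrD[rotated]) measurable
  then show "ae y. ae x. P (x, y)"
    using lborel_pair.AE_pair[of "\<lambda>z. P (case z of (x, y) \<Rightarrow> (y, x))"] by simp
qed

lemma max_snd_weighted:
  fixes f :: "'a::euclidean_space \<times> 'b::euclidean_space \<Rightarrow> ennreal"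
  assumes h: "h1 \<in> borel_fun" "h2 \<in> borel_fun"
    and pos: "\<And>z. 0 < h1 z" "\<And>z. 0 < h2 z"
    and A: "ae z. max_snd (\<lambda>z. ennreal (h1 z)) z \<le> ennreal (B * h1 z)"
      "ae z. max_snd (\<lambda>z. ennreal (h2 z)) z \<le> ennreal (B * h2 z)"
    and B: "0 < B" and r: "1 < r" and f: "f \<in> borel_fun"
  shows "(NN z. epow (max_snd f z) r * ennreal (wt r h1 h2 z))
    \<le> ennreal (grid_const (2 ^ DIM('b)) r B) * (NN z. epow (f z) r * ennreal (wt r h1 h2 z))"
proof -
  note [measurable] = h f
  have sec: "(\<lambda>y. g (x, y)) \<in> borel_fun" if "g \<in> borel_fun"
    for g :: "'a \<times> 'b \<Rightarrow> 'c::topological_space" and x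
    by (rule measurable_compose[OF _ that]) (simp add: borel_prod[symmetric])
  have wt: "wt r h1 h2 (x, y) = wt r (\<lambda>y. h1 (x, y)) (\<lambda>y. h2 (x, y)) y" for x y by (simp add: wt_def)
  have [measurable]: "max_snd f \<in> borel_fun" by (rule borel_measurable_max_snd[OF f])
  have m: "(\<lambda>z. epow (max_snd f z) r * ennreal (wt r h1 h2 z)) \<in> borel_fun" by measurable
  have "(NN z. epow (max_snd f z) r * ennreal (wt r h1 h2 z))
    = (NN x. NN y. epow (grid_max (\<lambda>y. f (x, y)) y) r * ennreal (wt r (\<lambda>y. h1 (x, y)) (\<lambda>y. h2 (x, y)) y))"
    unfolding nn_integral_prod_borel(1)[OF m] by (simp add: max_snd_def wt)
  also have "\<dots> \<le> (NN x. ennreal (grid_const (2 ^ DIM('b)) r B) *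
      (NN y. epow (f (x, y)) r * ennreal (wt r (\<lambda>y. h1 (x, y)) (\<lambda>y. h2 (x, y)) y)))"
    using AE_prod_borel(1)[OF A(1)] AE_prod_borel(1)[OF A(2)]
  proof (intro nn_integral_mono_AE, eventually_elim)
    case (elim x)
    then show ?case
      by (intro grid_max_weighted sec h f pos B r) (simp_all add: max_snd_def)
  qed
  also have "\<dots> = ennreal (grid_const (2 ^ DIM('b)) r B) *
    (NN x. NN y. epow (f (x, y)) r * ennreal (wt r h1 h2 (x, y)))"
    unfolding wt[symmetric]
  proof (rule nn_integral_cmult)
    have "(\<lambda>z. epow (f z) r * ennreal (wt r h1 h2 z)) \<in> borel_fun" by measurable
    then have [measurable]: "(\<lambda>z. epow (f z) r * ennreal (wt r h1 h2 z)) \<in> borel_measurable (lborel \<Otimes>\<^sub>M lborel)"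
      by (simp add: lborel_prod)
    show "(\<lambda>x. NN y. epow (f (x, y)) r * ennreal (wt r h1 h2 (x, y))) \<in> borel_measurable lborel"
      using lborel.borel_measurable_nn_integral_fst[of "\<lambda>z. epow (f z) r * ennreal (wt r h1 h2 z)" lborel] by simp
  qed
  also have "(NN x. NN y. epow (f (x, y)) r * ennreal (wt r h1 h2 (x, y)))
      = (NN z. epow (f z) r * ennreal (wt r h1 h2 z))"
    by (subst nn_integral_prod_borel(1)) simp_all
  finally show ?thesis .
qed

lemma borel_swap: "(\<lambda>z. (snd z, fst z)) \<in> borel_measurable (borel :: ('a::euclidean_space \<times> 'b::euclidean_space) measure)"
  unfolding borel_prod[symmetric] by measurable

lemma nn_integral_lborel_swap:
  fixes f :: "'a::euclidean_space \<times> 'b::euclidean_space \<Rightarrow> ennreal"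
  assumes f: "f \<in> borel_fun"
  shows "(NN z. f (snd z, fst z)) = (NN z. f z)"
  using nn_integral_prod_borel[OF f] nn_integral_prod_borel(1)[OF measurable_compose[OF borel_swap f]]
  by simp

lemma AE_lborel_swap:
  fixes P :: "'a::euclidean_space \<times> 'b::euclidean_space \<Rightarrow> bool"
  assumes "ae z. P z"
  shows "ae z. P (snd z, fst z)"
proof -
  have P: "AE z in lborel \<Otimes>\<^sub>M lborel. P z" using assms unfolding lborel_prod .
  have "AE z in distr (lborel \<Otimes>\<^sub>M lborel) (lborel \<Otimes>\<^sub>M lborel) (\<lambda>(x, y). (y, x)). P z"
    using P unfolding lborel_pair.distr_pair_swap[symmetric] .
  then have "AE z in (lborel \<Otimes>\<^sub>M lborel). P (case z of (x, y) \<Rightarrow> (y, x))"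
    by (rule AE_distrD[rotated]) measurable
  then show ?thesis unfolding lborel_prod case_prod_unfold .
qed

lemma max_fst_weighted:
  fixes f :: "'a::euclidean_space \<times> 'b::euclidean_space \<Rightarrow> ennreal"
  assumes h: "h1 \<in> borel_fun" "h2 \<in> borel_fun"
    and pos: "\<And>z. 0 < h1 z" "\<And>z. 0 < h2 z"
    and A: "ae z. max_fst (\<lambda>z. ennreal (h1 z)) z \<le> ennreal (B * h1 z)"
      "ae z. max_fst (\<lambda>z. ennreal (h2 z)) z \<le> ennreal (B * h2 z)"
    and B: "0 < B" and r: "1 < r" and f: "f \<in> borel_fun"
  shows "(NN z. epow (max_fst f z) r * ennreal (wt r h1 h2 z))
    \<le> ennreal (grid_const (2 ^ DIM('a)) r B) * (NN z. epow (f z) r * ennreal (wt r h1 h2 z))"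
proof -
  note [measurable] = h f borel_measurable_max_fst[OF f]
  have comp: "(\<lambda>z. g (snd z, fst z)) \<in> borel_fun" if "g \<in> borel_fun"
    for g :: "'a \<times> 'b \<Rightarrow> 'c::topological_space"
    by (rule measurable_compose[OF borel_swap that])
  have swap: "max_snd (\<lambda>z. g (snd z, fst z)) z = max_fst g (snd z, fst z)" for g :: "'a \<times> 'b \<Rightarrow> ennreal" and z
    by (simp add: max_snd_def max_fst_def)
  have wt: "wt r (\<lambda>z. h1 (snd z, fst z)) (\<lambda>z. h2 (snd z, fst z)) z = wt r h1 h2 (snd z, fst z)" for z
    by (simp add: wt_def)
  have m: "(\<lambda>z. epow (max_fst f z) r * ennreal (wt r h1 h2 z)) \<in> borel_fun"
    "(\<lambda>z. epow (f z) r * ennreal (wt r h1 h2 z)) \<in> borel_fun" by measurable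
  have "(NN z. epow (max_snd (\<lambda>z. f (snd z, fst z)) z) r
        * ennreal (wt r (\<lambda>z. h1 (snd z, fst z)) (\<lambda>z. h2 (snd z, fst z)) z))
    \<le> ennreal (grid_const (2 ^ DIM('a)) r B) * (NN z. epow (f (snd z, fst z)) r
        * ennreal (wt r (\<lambda>z. h1 (snd z, fst z)) (\<lambda>z. h2 (snd z, fst z)) z))"
    using AE_lborel_swap[OF A(1)] AE_lborel_swap[OF A(2)]
      swap[of "\<lambda>z. ennreal (h1 z)"] swap[of "\<lambda>z. ennreal (h2 z)"]
    by (intro max_snd_weighted comp h f pos B r) simp_all
  then show ?thesis
    unfolding swap wt nn_integral_lborel_swap[OF m(1)] nn_integral_lborel_swap[OF m(2)] .
qed

definition prod_const :: "nat \<Rightarrow> nat \<Rightarrow> real \<Rightarrow> real \<Rightarrow> real" where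
  "prod_const m n r B = 2 powr r * (grid_const m r B + grid_const n r B)"

lemma max_prod_A1:
  fixes h :: "'a::euclidean_space \<times> 'b::euclidean_space \<Rightarrow> real"
  assumes "h \<in> A1_class lborel max_prod B"
  shows "ae z. max_fst (\<lambda>z. ennreal (h z)) z \<le> ennreal (B * h z)"
    "ae z. max_snd (\<lambda>z. ennreal (h z)) z \<le> ennreal (B * h z)"
proof -
  have le: "max_fst f z \<le> max_prod f z" "max_snd f z \<le> max_prod f z" for f :: "'a \<times> 'b \<Rightarrow> ennreal" and z
    by (simp_all add: max_prod_def)
  show "ae z. max_fst (\<lambda>z. ennreal (h z)) z \<le> ennreal (B * h z)"
    using A1_classD(3)[OF assms] by eventually_elim (rule order_trans[OF le(1)])
  show "ae z. max_snd (\<lambda>z. ennreal (h z)) z \<le> ennreal (B * h z)"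
    using A1_classD(3)[OF assms] by eventually_elim (rule order_trans[OF le(2)])
qed

lemma maximal_operator_max_prod:
  "maximal_operator lborel (max_prod :: ('a::euclidean_space \<times> 'b::euclidean_space \<Rightarrow> ennreal) \<Rightarrow> _)
     (prod_const (2 ^ DIM('a)) (2 ^ DIM('b)))"
proof (intro maximal_operator.intro maximal_operator_axioms.intro)
  show "sigma_finite_measure (lborel :: ('a \<times> 'b) measure)" by (rule sigma_finite_lborel)
  show "max_prod f \<in> borel_measurable lborel" if "f \<in> borel_measurable lborel" for f :: "'a \<times> 'b \<Rightarrow> ennreal"
    using that by simp
  show "max_prod f z \<le> max_prod g z" if "\<And>z. f z \<le> g z" for f g :: "'a \<times> 'b \<Rightarrow> ennreal" and z
    unfolding max_prod_def max_fst_def max_snd_def by (intro add_mono grid_max_mono that)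
  have sec1: "(\<lambda>y. g (x, y)) \<in> borel_fun" and sec2: "(\<lambda>x. g (x, y)) \<in> borel_fun"
    if "g \<in> borel_measurable lborel" for g :: "'a \<times> 'b \<Rightarrow> ennreal" and x y
    using that by (auto intro!: measurable_compose[of _ borel borel g] simp: borel_prod[symmetric])
  show "max_prod (\<lambda>z. \<Sum>j. f j z) z \<le> (\<Sum>j. max_prod (f j) z)"
    if "\<And>j. f j \<in> borel_measurable lborel" for f :: "nat \<Rightarrow> 'a \<times> 'b \<Rightarrow> ennreal" and z
    unfolding max_prod_def max_fst_def max_snd_def
    using that by (subst suminf_add[symmetric]) (auto intro!: add_mono grid_max_suminf sec1 sec2)
  show "max_prod (\<lambda>z. c * f z) z \<le> c * max_prod f z"
    if "f \<in> borel_measurable lborel" for f :: "'a \<times> 'b \<Rightarrow> ennreal" and c z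
    unfolding max_prod_def max_fst_def max_snd_def distrib_left
    using that by (intro add_mono grid_max_cmult sec1 sec2)
  fix r B :: real and h1 h2 :: "'a \<times> 'b \<Rightarrow> real" and f :: "'a \<times> 'b \<Rightarrow> ennreal"
  assume r: "1 < r" and B: "0 < B" and A1: "h1 \<in> A1_class lborel max_prod B" "h2 \<in> A1_class lborel max_prod B"
    and "f \<in> borel_measurable lborel"
  then have f: "f \<in> borel_fun" by simp
  have h: "h1 \<in> borel_fun" "h2 \<in> borel_fun" "\<And>z. 0 < h1 z" "\<And>z. 0 < h2 z"
    using A1_classD(1,2)[OF A1(1)] A1_classD(1,2)[OF A1(2)] by auto
  note [measurable] = f h(1,2) borel_measurable_max_fst[OF f] borel_measurable_max_snd[OF f]
  let ?w = "\<lambda>z. ennreal (wt r h1 h2 z)"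
  let ?N = "NN z. epow (f z) r * ?w z"
  have "(NN z. epow (max_prod f z) r * ?w z)
    \<le> (NN z. ennreal (2 powr r) * (epow (max_fst f z) r * ?w z + epow (max_snd f z) r * ?w z))"
    unfolding max_prod_def distrib_right[symmetric] mult.assoc[symmetric]
    using r by (intro nn_integral_mono mult_right_mono epow_add_le) auto
  also have "\<dots> = ennreal (2 powr r) * ((NN z. epow (max_fst f z) r * ?w z)
      + (NN z. epow (max_snd f z) r * ?w z))"
    by (simp add: nn_integral_cmult nn_integral_add)
  also have "\<dots> \<le> ennreal (2 powr r) * (ennreal (grid_const (2 ^ DIM('a)) r B) * ?N + ennreal (grid_const (2 ^ DIM('b)) r B) * ?N)"
    by (intro mult_left_mono add_mono max_fst_weighted max_snd_weighted h max_prod_A1 A1 B r f) auto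
  also have "\<dots> = ennreal (prod_const (2 ^ DIM('a)) (2 ^ DIM('b)) r B) * ?N"
  proof -
    have "ennreal a * (ennreal b * n + ennreal c * n) = ennreal (a * (b + c)) * n" if "0 \<le> a" "0 \<le> b" "0 \<le> c" for a b c n
      using that by (simp add: ennreal_mult ennreal_plus distrib_left distrib_right mult.assoc)
    then show ?thesis unfolding prod_const_def using grid_const_nonneg[OF r] by simp
  qed
  finally show "(NN z. epow (max_prod f z) r * ?w z)
     \<le> ennreal (prod_const (2 ^ DIM('a)) (2 ^ DIM('b)) r B) * ?N" .
qed

lemma nested_max_const_le:
  assumes "\<D> \<subseteq> sets M" shows "nested_max M \<D> (\<lambda>_. c) x \<le> c"
proof (rule nested_max_le)
  fix Q assume "Q \<in> \<D>"
  then have [measurable]: "Q \<in> sets M" using assms by blast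
  show "mean M Q (\<lambda>_. c) \<le> c"
    unfolding mean_def nn_integral_cmult_indicator[OF \<open>Q \<in> sets M\<close>]
    by (cases "emeasure M Q = 0 \<or> emeasure M Q = \<top>")
      (auto simp: ennreal_mult_divide_eq)
qed

lemma grid_max_const_le: "grid_max (\<lambda>_::'a::euclidean_space. c) x \<le> ennreal (2 ^ DIM('a)) * c"
proof -
  have "grid_max (\<lambda>_::'a. c) x \<le> (\<Sum>S\<in>Pow (Basis :: 'a set). c)"
    unfolding grid_max_def by (intro sum_mono nested_max_const_le grid_sets)
  also have "\<dots> = ennreal (2 ^ DIM('a)) * c"
    using ennreal_of_nat_eq_real_of_nat[of "2 ^ DIM('a)"] by (simp add: card_Pow)
  finally show ?thesis .
qed

text \<open>A weight of time alone is constant on space sections, where \<open>grid_max\<close>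
  costs the number of grids; this is the summand \<open>2 ^ DIM('b)\<close>. The lemma lets an
  extrapolation in time use estimates on the product space.\<close>

lemma A1_class_prod_fst:
  assumes h: "h \<in> A1_class lborel (grid_max :: ('a::euclidean_space \<Rightarrow> ennreal) \<Rightarrow> _) B" and B: "0 \<le> B"
  shows "(\<lambda>z. h (fst z)) \<in> A1_class lborel (max_prod :: ('a \<times> 'b::euclidean_space \<Rightarrow> ennreal) \<Rightarrow> _) (B + 2 ^ DIM('b))"
  unfolding A1_class_def mem_Collect_eq
proof (intro conjI allI)
  have [measurable]: "h \<in> borel_fun" using A1_classD(1)[OF h] by simp
  have "(\<lambda>z :: 'a \<times> 'b. h (fst z)) \<in> borel_measurable (borel \<Otimes>\<^sub>M borel)" by measurable
  then show m: "(\<lambda>z :: 'a \<times> 'b. h (fst z)) \<in> borel_measurable lborel" by (simp add: borel_prod)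
  show "0 < h (fst z)" for z :: "'a \<times> 'b" using A1_classD(2)[OF h] by simp
  have "AE z in lborel \<Otimes>\<^sub>M (lborel :: 'b measure). grid_max (\<lambda>y. ennreal (h y)) (fst z) \<le> ennreal (B * h (fst z))"
  proof (rule lborel_pair.AE_pair_measure)
    show "{z \<in> space (lborel \<Otimes>\<^sub>M lborel). grid_max (\<lambda>y. ennreal (h y)) (fst z) \<le> ennreal (B * h (fst z))}
      \<in> sets (lborel \<Otimes>\<^sub>M (lborel :: 'b measure))" by measurable
    show "ae x. AE y in (lborel :: 'b measure). grid_max (\<lambda>y. ennreal (h y)) (fst (x, y)) \<le> ennreal (B * h (fst (x, y)))"
      using A1_classD(3)[OF h] by eventually_elim simp
  qed
  then show "AE z in (lborel :: ('a \<times> 'b) measure). max_prod (\<lambda>z. ennreal (h (fst z))) z \<le> ennreal ((B + 2 ^ DIM('b)) * h (fst z))"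
    unfolding lborel_prod
  proof eventually_elim
    case (elim z)
    have "0 < h (fst z)" using A1_classD(2)[OF h] by simp
    have "max_prod (\<lambda>z. ennreal (h (fst z))) z \<le> ennreal (B * h (fst z)) + ennreal (2 ^ DIM('b)) * ennreal (h (fst z))"
      unfolding max_prod_def max_fst_def max_snd_def using elim by (intro add_mono) (simp_all add: grid_max_const_le)
    also have "\<dots> = ennreal ((B + 2 ^ DIM('b)) * h (fst z))"
      using B \<open>0 < h (fst z)\<close> by (simp add: distrib_right ennreal_plus ennreal_mult)
    finally show ?case .
  qed
qed

section \<open>Muckenhoupt weights from the maximal operator\<close>

lemma average_eq_mean:
  assumes "f \<in> borel_fun" "Q \<in> sets borel"
  shows "average Q f = mean lborel Q (\<lambda>x. ennreal (f x))"
  using assms by (simp add: average_def mean_def nn_integral_completion emeasure_completion)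


lemma cubesE:
  assumes "Q \<in> cubes"
  obtains a l where "0 < l" "Q = cbox a (a + l *\<^sub>R One)"
  using assms by (auto simp: cubes_def)

lemma cube_facts:
  assumes "Q \<in> (cubes :: 'a::euclidean_space set set)"
  shows "Q \<in> sets lborel" "emeasure lborel Q \<noteq> 0" "emeasure lborel Q \<noteq> \<top>"
  using assms by (auto simp: cubes_def emeasure_cube)

lemma compact_subset_cube:
  fixes K :: "'a::euclidean_space set"
  assumes "compact K"
  obtains Q where "Q \<in> cubes" "K \<subseteq> Q"
proof -
  obtain b where b: "\<And>x. x \<in> K \<Longrightarrow> norm x \<le> b" "0 < b"
    using compact_imp_bounded[OF assms] bounded_pos by metis
  have "K \<subseteq> cbox (- b *\<^sub>R One) (- b *\<^sub>R One + (2 * b) *\<^sub>R One)"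
  proof
    fix x assume x: "x \<in> K"
    have "\<bar>x \<bullet> i\<bar> \<le> b" if "i \<in> Basis" for i
      using Basis_le_norm[OF that, of x] b(1)[OF x] by simp
    then show "x \<in> cbox (- b *\<^sub>R One) (- b *\<^sub>R One + (2 * b) *\<^sub>R One)"
      by (auto simp: mem_box inner_add_left inner_diff_left abs_le_iff minus_le_iff)
  qed
  moreover have "cbox (- b *\<^sub>R One) (- b *\<^sub>R One + (2 * b) *\<^sub>R One) \<in> (cubes :: 'a set set)"
    using b(2) unfolding cubes_def by (intro CollectI exI[of _ "- b *\<^sub>R One"] exI[of _ "2 * b"]) auto
  ultimately show ?thesis by (rule that[rotated])
qed

lemma weightI:
  fixes w :: "'a::euclidean_space \<Rightarrow> real"
  assumes [measurable]: "w \<in> borel_fun" and pos: "\<And>x. 0 < w x"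
    and fin: "\<And>Q. Q \<in> cubes \<Longrightarrow> mean lborel Q (\<lambda>x. ennreal (w x)) < \<top>"
  shows "weight w"
  unfolding weight_def
proof (intro conjI allI impI)
  show "AE x in lebesgue. 0 < w x" using pos by simp
  fix K :: "'a set" assume "compact K"
  then obtain Q where Q: "Q \<in> cubes" "K \<subseteq> Q" by (rule compact_subset_cube)
  note Qf = cube_facts[OF Q(1)]
  have [measurable]: "K \<in> sets borel" using \<open>compact K\<close> by (simp add: compact_imp_closed)
  have "(\<integral>\<^sup>+x\<in>Q. ennreal (w x) \<partial>lborel) = mean lborel Q (\<lambda>x. ennreal (w x)) * emeasure lborel Q"
    unfolding mean_def by (rule ennreal_divide_mult_cancel[symmetric]) (use Qf in auto)
  also have "\<dots> < \<top>" using fin[OF Q(1)] Qf(3) by (simp add: ennreal_mult_less_top less_top)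
  finally have finQ: "(\<integral>\<^sup>+x\<in>Q. ennreal (w x) \<partial>lborel) < \<top>" .
  have "(NN x. enorm (indicator K x *\<^sub>R w x)) \<le> (\<integral>\<^sup>+x\<in>Q. ennreal (w x) \<partial>lborel)"
    using Q(2) pos by (intro nn_integral_mono) (auto simp: less_imp_le split: split_indicator)
  then have "integrable lborel (\<lambda>x. indicator K x *\<^sub>R w x)"
    using finQ by (intro integrableI_bounded) (auto intro: le_less_trans)
  then show "set_integrable lebesgue K w"
    unfolding set_integrable_def by (subst integrable_completion) auto
qed

text \<open>Passing from cells to cubes costs the volume ratio 6^d in the \<open>A\<^sub>1\<close>
  bounds of the factors, after which the product estimate applies on each cube. The bound involves
  the factors only through B, and this is what allows one constant of the hypothesis on T to serve
  all such weights.\<close>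

lemma A_weight_wt:
  fixes h1 h2 :: "'a::euclidean_space \<Rightarrow> real"
  assumes h [measurable]: "h1 \<in> borel_fun" "h2 \<in> borel_fun"
    and pos: "\<And>x. 0 < h1 x" "\<And>x. 0 < h2 x"
    and A: "ae x. grid_max (\<lambda>y. ennreal (h1 y)) x \<le> ennreal (B * h1 x)"
      "ae x. grid_max (\<lambda>y. ennreal (h2 y)) x \<le> ennreal (B * h2 x)"
    and B: "0 < B" and q: "1 < q"
  shows "A_weight q (wt q h1 h2)" "A_const q (wt q h1 h2) \<le> ennreal ((6 ^ DIM('a) * B) powr q)"
proof -
  define q' where "q' = q / (q - 1)"
  note cj = conjugate_exponent[OF q q'_def]
  let ?w = "wt q h1 h2"
  have [measurable]: "?w \<in> borel_fun" "wt q' h2 h1 \<in> borel_fun" by measurable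
  have dual: "?w x powr (- 1 / (q - 1)) = wt q' h2 h1 x" for x
  proof -
    have "- 1 / (q - 1) = 1 - q'" using q by (simp add: q'_def field_simps)
    then show ?thesis using wt_dual[of q q' h1 x h2, OF q q'_def pos] by simp
  qed
  have cube: "ae x. x \<in> Q \<longrightarrow> mean lborel Q (\<lambda>y. ennreal (h y)) \<le> ennreal ((6 ^ DIM('a) * B) * h x)"
    if Q: "Q \<in> cubes" and h: "ae x. grid_max (\<lambda>y. ennreal (h y)) x \<le> ennreal (B * h x)" for h :: "'a \<Rightarrow> real" and Q
    using h
  proof (eventually_elim, intro impI)
    fix x assume *: "grid_max (\<lambda>y. ennreal (h y)) x \<le> ennreal (B * h x)" "x \<in> Q"
    obtain a l where "0 < l" "Q = cbox a (a + l *\<^sub>R One)" using Q by (rule cubesE)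
    then have "mean lborel Q (\<lambda>y. ennreal (h y)) \<le> ennreal (6 ^ DIM('a)) * grid_max (\<lambda>y. ennreal (h y)) x"
      using mean_cube_le_grid_max[of l x a] * by simp
    also have "\<dots> \<le> ennreal (6 ^ DIM('a)) * ennreal (B * h x)" by (intro mult_left_mono *) simp
    also have "\<dots> = ennreal ((6 ^ DIM('a) * B) * h x)" by (simp add: ennreal_mult'[symmetric] mult.assoc)
    finally show "mean lborel Q (\<lambda>y. ennreal (h y)) \<le> ennreal ((6 ^ DIM('a) * B) * h x)" .
  qed
  have prod: "mean lborel Q (\<lambda>x. ennreal (?w x)) * epow (mean lborel Q (\<lambda>x. ennreal (wt q' h2 h1 x))) (q - 1)
     \<le> ennreal ((6 ^ DIM('a) * B) powr q)" "mean lborel Q (\<lambda>x. ennreal (?w x)) < \<top>" if Q: "Q \<in> cubes" for Q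
    using mean_wt_product_le[OF cube_facts[OF Q] _ _ pos cube[OF Q A(1)] cube[OF Q A(2)] _ q q'_def] B by simp_all
  show const: "A_const q ?w \<le> ennreal ((6 ^ DIM('a) * B) powr q)"
    unfolding A_const_def
  proof (rule SUP_least)
    fix Q :: "'a set" assume Q: "Q \<in> cubes"
    show "average Q ?w * epow (average Q (\<lambda>x. ?w x powr (- 1 / (q - 1)))) (q - 1) \<le> ennreal ((6 ^ DIM('a) * B) powr q)"
      unfolding dual using prod(1)[OF Q] cube_facts[OF Q] by (simp add: average_eq_mean)
  qed
  have "weight ?w" by (rule weightI) (use prod(2) pos in \<open>auto simp: wt_pos\<close>)
  then show "A_weight q ?w" using const by (auto simp: A_weight_def intro: le_less_trans)
qed

text \<open>To bound C for all weights with constant at most N by monotonicity, some weight must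
  have constant at least N. A step function does it: large on a small subcube of the unit cube and 1
  elsewhere, so that on the unit cube both the mean and the dual mean stay away from 0 while the
  first grows.\<close>

lemma exists_large_weight:
  fixes dummy :: "'a::euclidean_space"
  assumes q: "1 < q"
  obtains w :: "'a \<Rightarrow> real" where "A_weight q w" "ennreal N \<le> A_const q w"
proof -
  \<comment> \<open>On the unit cube E contributes L 3^(-d) to the mean of w and F contributes
    2^(-d) to the dual mean. The factor 3^d compensates the former; the factors 2^d and 4^(d (q-1))
    are more than enough for the latter.\<close>
  define L where "L = max 1 (N * 2 ^ DIM('a) * (4 ^ DIM('a)) powr (q - 1) * 3 ^ DIM('a))"
  have L: "1 \<le> L" by (simp add: L_def)
  define E where "E = cbox (0::'a) (0 + (1/3) *\<^sub>R One)"
  define F where "F = cbox ((1/2) *\<^sub>R One :: 'a) ((1/2) *\<^sub>R One + (1/2) *\<^sub>R One)"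
  define Q where "Q = cbox (0::'a) (0 + 1 *\<^sub>R One)"
  have QC: "Q \<in> cubes" unfolding Q_def cubes_def by (intro CollectI exI[of _ 0] exI[of _ 1]) auto
  have emQ: "emeasure lborel Q = 1" "emeasure lborel E = ennreal ((1/3) ^ DIM('a))" "emeasure lborel F = ennreal ((1/2) ^ DIM('a))"
    unfolding Q_def E_def F_def by (subst emeasure_cube; simp)+
  have sub: "E \<subseteq> Q" "F \<subseteq> Q" unfolding E_def F_def Q_def
    by (auto simp: mem_box inner_add_left) force+
  have disj: "E \<inter> F = {}"
  proof -
    obtain i :: 'a where "i \<in> Basis" using SOME_Basis by blast
    then have "x \<bullet> i \<le> 1/3" if "x \<in> E" for x using that by (auto simp: E_def mem_box)
    moreover have "1/2 \<le> x \<bullet> i" if "x \<in> F" for x using that \<open>i \<in> Basis\<close> by (auto simp: F_def mem_box)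
    ultimately show ?thesis by force
  qed
  define w where "w x = (if x \<in> E then L else 1)" for x
  have [measurable]: "E \<in> sets borel" "F \<in> sets borel" by (auto simp: E_def F_def)
  have [measurable]: "w \<in> borel_fun" unfolding w_def by measurable
  have wpos: "0 < w x" and w_le: "w x \<le> L" "1 \<le> w x" for x using L by (auto simp: w_def)
  have mean_le: "mean lborel R (\<lambda>x. ennreal (w x)) \<le> ennreal L" if "R \<in> cubes" for R
  proof -
    have "mean lborel R (\<lambda>x. ennreal (w x)) \<le> mean lborel R (\<lambda>x. ennreal L)"
      by (intro mean_mono ennreal_leI w_le)
    then show ?thesis using cube_facts[OF that] by (simp add: mean_const)
  qed
  have mean'_le: "mean lborel R (\<lambda>x. ennreal (w x powr (- 1 / (q - 1)))) \<le> 1" if "R \<in> cubes" for R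
  proof -
    have "w x powr (- 1 / (q - 1)) \<le> 1" for x
      using powr_mono[of "- 1 / (q - 1)" 0 "w x"] w_le[of x] q by simp
    then have "mean lborel R (\<lambda>x. ennreal (w x powr (- 1 / (q - 1)))) \<le> mean lborel R (\<lambda>x. 1)"
      by (intro mean_mono) (simp add: ennreal_le_1)
    then show ?thesis using cube_facts[OF that] by (simp add: mean_const)
  qed
  have "weight w" by (rule weightI) (use wpos le_less_trans[OF mean_le ennreal_less_top] in auto)
  moreover have "A_const q w \<le> ennreal L"
    unfolding A_const_def
  proof (rule SUP_least)
    fix R :: "'a set" assume R: "R \<in> cubes"
    have "mean lborel R (\<lambda>x. ennreal (w x)) * epow (mean lborel R (\<lambda>x. ennreal (w x powr (- 1 / (q - 1))))) (q - 1)
      \<le> ennreal L * epow 1 (q - 1)"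
      using q by (intro mult_mono mean_le R epow_mono mean'_le) auto
    then show "average R w * epow (average R (\<lambda>x. w x powr (- 1 / (q - 1)))) (q - 1) \<le> ennreal L"
      using cube_facts[OF R] by (simp add: average_eq_mean)
  qed
  ultimately have "A_weight q w" by (auto simp: A_weight_def intro: le_less_trans)
  moreover have "ennreal N \<le> A_const q w"
  proof -
    have m1: "ennreal (L * (1/3) ^ DIM('a)) \<le> mean lborel Q (\<lambda>x. ennreal (w x))"
    proof -
      have "ennreal (L * (1/3) ^ DIM('a)) = (NN x. ennreal L * indicator E x)"
        using L by (simp add: nn_integral_cmult_indicator emQ ennreal_mult)
      also have "\<dots> \<le> (\<integral>\<^sup>+x\<in>Q. ennreal (w x) \<partial>lborel)"
        using sub by (intro nn_integral_mono) (auto simp: w_def split: split_indicator)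
      finally show ?thesis using ennreal_divide_mult_cancel[of 1] by (simp add: mean_def emQ)
    qed
    have m2: "ennreal ((1/2) ^ DIM('a)) \<le> mean lborel Q (\<lambda>x. ennreal (w x powr (- 1 / (q - 1))))"
    proof -
      have "ennreal ((1/2) ^ DIM('a)) = (NN x. indicator F x)" by (simp add: emQ)
      also have "\<dots> \<le> (\<integral>\<^sup>+x\<in>Q. ennreal (w x powr (- 1 / (q - 1))) \<partial>lborel)"
        using sub disj by (intro nn_integral_mono) (auto simp: w_def split: split_indicator)
      finally show ?thesis using ennreal_divide_mult_cancel[of 1] by (simp add: mean_def emQ)
    qed
    have "N \<le> L * (1/3) ^ DIM('a) * ((1/2) ^ DIM('a)) powr (q - 1)"
    proof (cases "0 \<le> N")
      case True
      have "((1/4::real) ^ DIM('a)) powr (q - 1) \<le> ((1/2) ^ DIM('a)) powr (q - 1)"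
        using q by (intro powr_mono2 power_mono) auto
      moreover have "((1/4::real) ^ DIM('a)) powr (q - 1) = 1 / (4 ^ DIM('a)) powr (q - 1)"
        by (simp add: power_one_over powr_divide)
      ultimately have "1 \<le> (4 ^ DIM('a)) powr (q - 1) * ((1/2) ^ DIM('a)) powr (q - 1)"
        by (simp add: divide_le_eq mult.commute)
      then have "N * 1 \<le> N * (2 ^ DIM('a) * ((4 ^ DIM('a)) powr (q - 1) * ((1/2) ^ DIM('a)) powr (q - 1)))"
        using True by (intro mult_left_mono) (auto intro: order_trans[OF _ mult_mono[of 1 "2 ^ DIM('a)" 1]])
      also have "\<dots> = (N * 2 ^ DIM('a) * (4 ^ DIM('a)) powr (q - 1) * 3 ^ DIM('a)) * (1/3) ^ DIM('a) * ((1/2) ^ DIM('a)) powr (q - 1)"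
        by (simp add: power_one_over)
      also have "\<dots> \<le> L * (1/3) ^ DIM('a) * ((1/2) ^ DIM('a)) powr (q - 1)"
        by (intro mult_right_mono) (auto simp: L_def)
      finally show ?thesis by simp
    next
      case False
      have "0 \<le> L * (1/3) ^ DIM('a) * ((1/2) ^ DIM('a)) powr (q - 1)" using L by simp
      then show ?thesis using False by linarith
    qed
    then have "ennreal N \<le> ennreal (L * (1/3) ^ DIM('a)) * epow (ennreal ((1/2) ^ DIM('a))) (q - 1)"
      using L by (simp add: epow_ennreal ennreal_leI flip: ennreal_mult)
    also have "\<dots> \<le> mean lborel Q (\<lambda>x. ennreal (w x)) * epow (mean lborel Q (\<lambda>x. ennreal (w x powr (- 1 / (q - 1))))) (q - 1)"
      using q by (intro mult_mono m1 epow_mono m2) auto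
    also have "\<dots> = average Q w * epow (average Q (\<lambda>x. w x powr (- 1 / (q - 1)))) (q - 1)"
      using cube_facts[OF QC] by (simp add: average_eq_mean)
    also have "\<dots> \<le> A_const q w" unfolding A_const_def by (rule SUP_upper[OF QC])
    finally show ?thesis .
  qed
  ultimately show ?thesis by (rule that)
qed

section \<open>Kernels\<close>

lemma completion_ex_borel_measurable_euclidean:
  fixes f :: "'a \<Rightarrow> 'k::euclidean_space"
  assumes f: "f \<in> borel_measurable (completion M)"
  obtains g where "g \<in> borel_measurable M" "AE x in M. f x = g x"
proof -
  have "\<exists>g'\<in>borel_measurable M. (AE x in M. f x \<bullet> b = g' x)" for b
    using f by (intro completion_ex_borel_measurable_real) simp
  then obtain g' where g': "\<And>b. g' b \<in> borel_measurable M" "\<And>b. AE x in M. f x \<bullet> b = g' b x" by metis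
  note [measurable] = g'(1)
  have "AE x in M. \<forall>b\<in>Basis. f x \<bullet> b = g' b x"
    using g'(2) by (intro AE_finite_allI) auto
  then have "AE x in M. f x = (\<Sum>b\<in>Basis. g' b x *\<^sub>R b)"
  proof eventually_elim
    case (elim x)
    have "f x = (\<Sum>b\<in>Basis. (f x \<bullet> b) *\<^sub>R b)" by (rule euclidean_representation[symmetric])
    also have "\<dots> = (\<Sum>b\<in>Basis. g' b x *\<^sub>R b)" using elim by (intro sum.cong) auto
    finally show ?case .
  qed
  moreover have "(\<lambda>x. \<Sum>b\<in>Basis. g' b x *\<^sub>R b) \<in> borel_measurable M" by measurable
  ultimately show ?thesis by (rule that[rotated])
qed

lemma AE_lborel_affine:
  fixes P :: "real \<Rightarrow> bool"
  assumes "c \<noteq> 0" "ae x. P x"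
  shows "ae x. P (t + c * x)"
proof -
  obtain N where "{x \<in> space lborel. \<not> P x} \<subseteq> N" "emeasure lborel N = 0" "N \<in> sets lborel"
    by (rule AE_E[OF assms(2)])
  then have N: "N \<in> null_sets lborel" "{x. \<not> P x} \<subseteq> N" by auto
  have "ae x. t + c * x \<notin> N"
    using N(1) by (intro AE_borel_affine[OF assms(1)]) (auto simp: pred_def dest: AE_not_in)
  then show ?thesis by eventually_elim (use N(2) in auto)
qed

lemma AE_lborel_uminus:
  fixes P :: "real \<Rightarrow> bool"
  assumes "ae x. P x" shows "ae x. P (- x)"
  using AE_lborel_affine[of "-1" P 0] assms by simp

lemma maximal_fun_le_grid_max:
  fixes f :: "'a::euclidean_space \<Rightarrow> real"
  assumes "f \<in> borel_fun"
  shows "maximal_fun f x \<le> ennreal (6 ^ DIM('a)) * grid_max (\<lambda>y. ennreal \<bar>f y\<bar>) x"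
  unfolding maximal_fun_def
proof (rule SUP_least, safe)
  fix Q :: "'a set" assume Q: "Q \<in> cubes" "x \<in> Q"
  obtain a l where al: "0 < l" "Q = cbox a (a + l *\<^sub>R One)" using Q(1) by (rule cubesE)
  have "average Q (\<lambda>y. \<bar>f y\<bar>) = mean lborel Q (\<lambda>y. ennreal \<bar>f y\<bar>)"
    using assms cube_facts[OF Q(1)] by (intro average_eq_mean) auto
  also have "\<dots> \<le> ennreal (6 ^ DIM('a)) * grid_max (\<lambda>y. ennreal \<bar>f y\<bar>) x"
    unfolding al(2) by (rule mean_cube_le_grid_max[OF al(1)]) (use Q al in auto)
  finally show "average Q (\<lambda>y. \<bar>f y\<bar>) \<le> ennreal (6 ^ DIM('a)) * grid_max (\<lambda>y. ennreal \<bar>f y\<bar>) x" .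
qed

lemma uminus_cube: "uminus ` cbox a (a + l *\<^sub>R One) = cbox (- (a + l *\<^sub>R One)) (- (a + l *\<^sub>R One) + l *\<^sub>R (One :: real))"
proof -
  have "uminus ` cbox a (a + l *\<^sub>R One) = {- (a + l) .. - a}" by (simp add: cbox_interval)
  then show ?thesis by (simp add: cbox_interval)
qed

text \<open>Reflection maps cubes to cubes of the same measure. This carries the kernel bound over
  to the reflected kernel, which governs integration in the other time variable.\<close>

lemma maximal_fun_reflect_le:
  fixes f :: "real \<Rightarrow> real"
  assumes [measurable]: "f \<in> borel_fun"
  shows "maximal_fun (\<lambda>y. f (- y)) x \<le> maximal_fun f (- x)"
  unfolding maximal_fun_def
proof (rule SUP_mono, safe)
  fix Q :: "real set" assume Q: "Q \<in> cubes" "x \<in> Q"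
  obtain a l where al: "0 < l" "Q = cbox a (a + l *\<^sub>R One)" using Q(1) by (rule cubesE)
  let ?R = "uminus ` Q"
  have R: "?R \<in> cubes" unfolding al(2) uminus_cube cubes_def using al(1) by auto
  have [measurable]: "Q \<in> sets borel" "?R \<in> sets borel" using cube_facts(1)[OF Q(1)] cube_facts(1)[OF R] by auto
  have "(\<integral>\<^sup>+y\<in>Q. ennreal \<bar>f (- y)\<bar> \<partial>lborel) = (\<integral>\<^sup>+y\<in>?R. ennreal \<bar>f y\<bar> \<partial>lborel)"
  proof -
    have ind: "indicator ?R (- y) = (indicator Q y :: ennreal)" for y by (auto simp: indicator_def image_iff)
    show ?thesis
      using nn_integral_real_affine[of "\<lambda>y. ennreal \<bar>f y\<bar> * indicator ?R y" "-1" 0] by (simp add: ind)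
  qed
  moreover have "emeasure lborel Q = emeasure lborel ?R"
    unfolding al(2) uminus_cube using al(1) by (simp add: emeasure_cube)
  ultimately have "average Q (\<lambda>y. \<bar>f (- y)\<bar>) = average ?R (\<lambda>y. \<bar>f y\<bar>)"
    by (simp add: average_eq_mean mean_def)
  then show "\<exists>m\<in>{Q \<in> cubes. - x \<in> Q}. average Q (\<lambda>y. \<bar>f (- y)\<bar>) \<le> average m (\<lambda>y. \<bar>f y\<bar>)"
    using R Q by (intro bexI[of _ ?R]) auto
qed

text \<open>The form in which a kernel is used later: a Borel version of its absolute value with
  mass at most 1, and domination in both time variables for arbitrary nonnegative functions. The
  factor 6 is the volume ratio of \<open>mean_cube_le_grid_max\<close> in dimension one.\<close>

definition dominated_kernel :: "(real \<Rightarrow> real) \<Rightarrow> bool" where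
  "dominated_kernel \<kappa> \<longleftrightarrow> \<kappa> \<in> borel_fun \<and> (\<forall>x. 0 \<le> \<kappa> x) \<and>
     (NN x. ennreal (\<kappa> x)) \<le> 1 \<and>
     (\<forall>f :: real \<Rightarrow> ennreal. f \<in> borel_fun \<longrightarrow>
        (ae t. (NN s. ennreal (\<kappa> (t - s)) * f s) \<le> 6 * grid_max f t) \<and>
        (ae s. (NN t. ennreal (\<kappa> (t - s)) * f t) \<le> 6 * grid_max f s))"

lemma nn_integral_reflect_shift:
  fixes f :: "real \<Rightarrow> ennreal"
  assumes "f \<in> borel_fun"
  shows "(NN s. f (t - s)) = (NN s. f s)"
  using nn_integral_real_affine[OF assms, of "-1" t] by simp

text \<open>Testing with simple functions suffices since nonnegative functions are increasing limits
  of them. The second bound follows from the first by changing the signs of both times, and the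
  bound on the mass by testing with the constant 1, whose maximal function is at most 1.\<close>

lemma kernel_ex_borel:
  assumes k: "k \<in> (kernels :: (real \<Rightarrow> 'k::{real_normed_field, euclidean_space}) set)"
  obtains k0 where "k0 \<in> borel_fun" "ae x. k x = k0 x"
    "dominated_kernel (\<lambda>x. norm (k0 x))"
proof -
  have int: "integrable lebesgue k" and dom: "\<And>f :: real \<Rightarrow> real. simple_function lebesgue f \<Longrightarrow> (\<And>y. 0 \<le> f y) \<Longrightarrow>
      AE x in lebesgue. (\<integral>\<^sup>+y. ennreal (norm (k (x - y)) * f y) \<partial>lebesgue) \<le> maximal_fun f x"
    using k by (auto simp: kernels_def)
  obtain k0 where k0: "k0 \<in> borel_measurable lborel" "ae x. k x = k0 x"
    using completion_ex_borel_measurable_euclidean[of k lborel] int by auto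
  then have [measurable]: "k0 \<in> borel_fun" by simp
  define \<kappa> where "\<kappa> x = norm (k0 x)" for x
  have \<kappa>_nonneg: "0 \<le> \<kappa> x" for x by (simp add: \<kappa>_def)
  have [measurable]: "\<kappa> \<in> borel_fun" unfolding \<kappa>_def by measurable
  have k_eq: "ae y. norm (k (x - y)) = \<kappa> (x - y)" for x
  proof -
    have "ae y. k (x + - 1 * y) = k0 (x + - 1 * y)" by (rule AE_lborel_affine[OF _ k0(2)]) simp
    then show ?thesis by eventually_elim (simp add: \<kappa>_def)
  qed
  have dom0: "ae x. (NN y. ennreal (\<kappa> (x - y)) * ennreal (f y)) \<le> maximal_fun f x"
    if f: "simple_function borel f" "\<And>y. 0 \<le> f y" for f :: "real \<Rightarrow> real"
  proof -
    have "simple_function lborel f" using f(1) by (simp add: simple_function_def)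
    then have "AE x in lebesgue. (\<integral>\<^sup>+y. ennreal (norm (k (x - y)) * f y) \<partial>lebesgue) \<le> maximal_fun f x"
      by (intro dom simple_function_completion f)
    then have "ae x. (NN y. ennreal (norm (k (x - y)) * f y)) \<le> maximal_fun f x"
      unfolding nn_integral_completion AE_completion_iff .
    then show ?thesis
    proof eventually_elim
      case (elim x)
      have "(NN y. ennreal (\<kappa> (x - y)) * ennreal (f y)) = (NN y. ennreal (norm (k (x - y)) * f y))"
        using k_eq[of x] by (intro nn_integral_cong_AE, eventually_elim) (simp add: f(2) \<kappa>_nonneg ennreal_mult)
      then show ?case using elim by simp
    qed
  qed
  have approx: "\<exists>u. (\<forall>i. simple_function borel (u i) \<and> (\<forall>y. 0 \<le> u i y)) \<and> (\<forall>y. incseq (\<lambda>i. ennreal (u i y))) \<and> (\<forall>y. (SUP i. ennreal (u i y)) = f y)"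
    if f: "f \<in> borel_fun" for f :: "real \<Rightarrow> ennreal"
  proof -
    obtain U where U: "incseq U" "\<And>i x. U i x < \<top>" "\<And>i. simple_function borel (U i)" "f = (SUP i. U i)"
      using borel_measurable_implies_simple_function_sequence[OF f] by blast
    have e: "ennreal (enn2real (U i y)) = U i y" for i y using U(2)[of i y] by simp
    have "(SUP i. U i y) = f y" for y unfolding U(4) by (rule SUP_apply[symmetric])
    moreover have "incseq (\<lambda>i. U i y)" for y using U(1) unfolding incseq_def le_fun_def by blast
    moreover have "simple_function borel (\<lambda>y. enn2real (U i y))" for i
      by (rule simple_function_compose1[OF U(3)])
    ultimately show ?thesis
      by (intro exI[of _ "\<lambda>i y. enn2real (U i y)"] conjI allI) (simp_all only: e enn2real_nonneg)
  qed
  have sup_int: "(NN s. g s * f s) = (SUP i. NN s. g s * ennreal (u i s))"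
    if u: "\<forall>i. simple_function borel (u i) \<and> (\<forall>y. 0 \<le> u i y)" "\<forall>y. incseq (\<lambda>i. ennreal (u i y))" "\<forall>y. (SUP i. ennreal (u i y)) = f y"
      and [measurable]: "g \<in> borel_fun" for g f and u :: "nat \<Rightarrow> real \<Rightarrow> real"
  proof -
    have [measurable]: "u i \<in> borel_fun" for i using u(1) by (intro borel_measurable_simple_function) auto
    have "(NN s. g s * f s) = (NN s. (SUP i. g s * ennreal (u i s)))"
      using u(3) by (simp add: SUP_mult_left_ennreal[symmetric])
    also have "\<dots> = (SUP i. NN s. g s * ennreal (u i s))"
      using u(2) by (intro nn_integral_monotone_convergence_SUP)
        (auto simp: incseq_def le_fun_def intro!: mult_left_mono)
    finally show ?thesis .
  qed
  have le_max: "maximal_fun (u i) t \<le> 6 * grid_max f t"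
    if u: "\<forall>i. simple_function borel (u i) \<and> (\<forall>y. 0 \<le> u i y)" "\<forall>y. (SUP i. ennreal (u i y)) = f y"
    for f :: "real \<Rightarrow> ennreal" and u :: "nat \<Rightarrow> real \<Rightarrow> real" and i t
  proof -
    have "u i \<in> borel_fun" using u(1) by (intro borel_measurable_simple_function) auto
    then have "maximal_fun (u i) t \<le> ennreal (6 ^ DIM(real)) * grid_max (\<lambda>y. ennreal \<bar>u i y\<bar>) t"
      by (rule maximal_fun_le_grid_max)
    also have "\<dots> \<le> ennreal (6 ^ DIM(real)) * grid_max f t"
    proof (intro mult_left_mono grid_max_mono)
      fix z have "ennreal (u i z) \<le> (SUP i. ennreal (u i z))" by (intro SUP_upper) simp
      then show "ennreal \<bar>u i z\<bar> \<le> f z" using u by simp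
    qed simp
    finally show ?thesis by simp
  qed
  have D1: "ae t. (NN s. ennreal (\<kappa> (t - s)) * f s) \<le> 6 * grid_max f t"
    if f: "f \<in> borel_fun" for f :: "real \<Rightarrow> ennreal"
  proof -
    obtain u where u: "\<forall>i. simple_function borel (u i) \<and> (\<forall>y. 0 \<le> u i y)" "\<forall>y. incseq (\<lambda>i. ennreal (u i y))" "\<forall>y. (SUP i. ennreal (u i y)) = f y"
      using approx[OF f] by blast
    have "ae t. \<forall>i. (NN s. ennreal (\<kappa> (t - s)) * ennreal (u i s)) \<le> maximal_fun (u i) t"
      unfolding AE_all_countable using u(1) by (intro allI dom0) auto
    then show ?thesis
    proof eventually_elim
      case (elim t)
      have "(NN s. ennreal (\<kappa> (t - s)) * f s) = (SUP i. NN s. ennreal (\<kappa> (t - s)) * ennreal (u i s))"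
        by (rule sup_int[OF u]) measurable
      also have "\<dots> \<le> 6 * grid_max f t"
        using elim le_max[OF u(1,3)] by (intro SUP_least) (blast intro: order_trans)
      finally show ?case .
    qed
  qed
  have D2: "ae s. (NN t. ennreal (\<kappa> (t - s)) * f t) \<le> 6 * grid_max f s"
    if f: "f \<in> borel_fun" for f :: "real \<Rightarrow> ennreal"
  proof -
    obtain u where u: "\<forall>i. simple_function borel (u i) \<and> (\<forall>y. 0 \<le> u i y)" "\<forall>y. incseq (\<lambda>i. ennreal (u i y))" "\<forall>y. (SUP i. ennreal (u i y)) = f y"
      using approx[OF f] by blast
    have um [measurable]: "u i \<in> borel_fun" for i using u(1) by (intro borel_measurable_simple_function) auto
    have "simple_function borel (\<lambda>y. u i (- y))" for i
    proof -
      have "simple_function borel (u i)" using u(1) by simp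
      then have "finite (range (u i))" by (simp add: simple_function_def)
      then have "finite (range (\<lambda>y. u i (- y)))" by (rule finite_subset[rotated]) auto
      then show ?thesis by (intro simple_function_borel_measurable) auto
    qed
    then have "ae x. \<forall>i. (NN y. ennreal (\<kappa> (x - y)) * ennreal (u i (- y))) \<le> maximal_fun (\<lambda>y. u i (- y)) x"
      unfolding AE_all_countable using u(1) by (intro allI dom0) auto
    then have "ae s. \<forall>i. (NN y. ennreal (\<kappa> (- s - y)) * ennreal (u i (- y))) \<le> maximal_fun (\<lambda>y. u i (- y)) (- s)"
      by (rule AE_lborel_uminus)
    then show ?thesis
    proof eventually_elim
      case (elim s)
      have "(NN t. ennreal (\<kappa> (t - s)) * f t) = (SUP i. NN t. ennreal (\<kappa> (t - s)) * ennreal (u i t))"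
        by (rule sup_int[OF u]) measurable
      also have "\<dots> \<le> 6 * grid_max f s"
      proof (rule SUP_least)
        fix i
        have "(NN t. ennreal (\<kappa> (t - s)) * ennreal (u i t)) = (NN y. ennreal (\<kappa> (- s - y)) * ennreal (u i (- y)))"
        proof -
          have e: "- s - y = - y - s" for y :: real by simp
          show ?thesis unfolding e
            using nn_integral_reflect_shift[of "\<lambda>t. ennreal (\<kappa> (t - s)) * ennreal (u i t)" 0] by simp
        qed
        also have "\<dots> \<le> maximal_fun (\<lambda>y. u i (- y)) (- s)" using elim by blast
        also have "\<dots> \<le> maximal_fun (u i) s" using maximal_fun_reflect_le[OF um, of i "- s"] by simp
        also have "\<dots> \<le> 6 * grid_max f s" by (rule le_max[OF u(1,3)])
        finally show "(NN t. ennreal (\<kappa> (t - s)) * ennreal (u i t)) \<le> 6 * grid_max f s" .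
      qed
      finally show ?case .
    qed
  qed
  have D0: "(NN x. ennreal (\<kappa> x)) \<le> 1"
  proof -
    have AE: "ae x. (NN y. ennreal (\<kappa> (x - y)) * ennreal 1) \<le> maximal_fun (\<lambda>_. 1) x"
      by (rule dom0) auto
    have one: "maximal_fun (\<lambda>_. 1) x \<le> 1" for x :: real
      unfolding maximal_fun_def
    proof (rule SUP_least, safe)
      fix Q :: "real set" assume "Q \<in> cubes"
      then show "average Q (\<lambda>y. \<bar>1\<bar>) \<le> 1" using cube_facts[of Q] by (simp add: average_eq_mean mean_const)
    qed
    show ?thesis
    proof (rule ccontr)
      assume not: "\<not> ?thesis"
      have "AE x in (lborel :: real measure). False"
        using AE
      proof eventually_elim
        case (elim x)
        have "(NN y. ennreal (\<kappa> (x - y)) * ennreal 1) = (NN x. ennreal (\<kappa> x))"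
          using nn_integral_reflect_shift[of "\<lambda>s. ennreal (\<kappa> s)" x] by simp
        then show ?case using order_trans[OF elim one] not by simp
      qed
      then have "emeasure lborel (space (lborel :: real measure)) = 0"
        by (subst (asm) AE_iff_measurable[OF _ refl]) auto
      then show False by simp
    qed
  qed
  show ?thesis
  proof (rule that)
    show "dominated_kernel (\<lambda>x. norm (k0 x))"
      unfolding dominated_kernel_def \<kappa>_def[symmetric] using D0 D1 D2 by (auto simp: \<kappa>_def)
  qed (use k0 in auto)
qed

lemma dominated_kernelD:
  assumes "dominated_kernel \<kappa>"
  shows "\<kappa> \<in> borel_fun" "0 \<le> \<kappa> x" "(NN x. ennreal (\<kappa> x)) \<le> 1"
    "f \<in> borel_fun \<Longrightarrow> ae t. (NN s. ennreal (\<kappa> (t - s)) * f s) \<le> 6 * grid_max f t"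
    "f \<in> borel_fun \<Longrightarrow> ae s. (NN t. ennreal (\<kappa> (t - s)) * f t) \<le> 6 * grid_max f s"
  using assms by (auto simp: dominated_kernel_def)

section \<open>The weighted bound for the operators\<close>

lemma nrm_Leb_space_powr:
  assumes f: "f \<in> vectors (Leb_space M q)" and q: "0 < q"
  shows "(\<integral>\<^sup>+x. ennreal (norm (f x) powr q) \<partial>M) = ennreal (nrm (Leb_space M q) f powr q)"
proof -
  have i: "integrable M (\<lambda>x. norm (f x) powr q)" using f by (simp add: Leb_space_def)
  have "0 \<le> (\<integral>x. norm (f x) powr q \<partial>M)" by (rule integral_nonneg_AE) auto
  then show ?thesis
    using nn_integral_eq_integral[OF i] q by (simp add: Leb_space_def powr_powr)
qed

lemma vectors_Leb_spaceI:
  assumes [measurable]: "f \<in> borel_measurable M" and "(\<integral>\<^sup>+x. ennreal (norm (f x) powr q) \<partial>M) < \<top>"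
  shows "f \<in> vectors (Leb_space M q)"
  using assms unfolding Leb_space_def
  by (auto intro!: integrableI_bounded simp: abs_of_nonneg)

lemma nrm_Leb_space_nonneg: "0 \<le> nrm (Leb_space M q) f"
  by (simp add: Leb_space_def)

text \<open>By monotonicity of C, its value at a weight with constant at least N bounds the
  operators for all weights with constant at most N. Stated with nonnegative integrals, the bound
  also covers \<phi> of infinite weighted norm.\<close>

lemma A_consistently_bounded_nn:
  fixes U :: "'a::euclidean_space set"
    and T :: "real \<Rightarrow> real \<Rightarrow> ('a \<Rightarrow> 'k::{real_normed_field, euclidean_space}) \<Rightarrow> ('a \<Rightarrow> 'k)"
  assumes U: "open U" and q: "1 < q" and T: "A_consistently_bounded q U T C"
    and V: "\<And>t s \<phi>. \<phi> \<in> vectors (Leb_space (lebesgue_on U) q) \<Longrightarrow> T t s \<phi> \<in> vectors (Leb_space (lebesgue_on U) q)"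
  obtains c where "0 \<le> c"
    "\<And>(w :: 'a \<Rightarrow> real) t s \<phi>. w \<in> borel_fun \<Longrightarrow> (\<And>x. 0 < w x) \<Longrightarrow> A_weight q w \<Longrightarrow> A_const q w \<le> ennreal N \<Longrightarrow>
      \<phi> \<in> vectors (Leb_space (lebesgue_on U) q) \<Longrightarrow>
      (\<integral>\<^sup>+x. ennreal (norm (T t s \<phi> x) powr q) * ennreal (w x) \<partial>lebesgue_on U)
       \<le> ennreal c * (\<integral>\<^sup>+x. ennreal (norm (\<phi> x) powr q) * ennreal (w x) \<partial>lebesgue_on U)"
proof -
  obtain w1 :: "'a \<Rightarrow> real" where w1: "A_weight q w1" "ennreal N \<le> A_const q w1"
    by (rule exists_large_weight[OF q])
  \<comment> \<open>The maximum with 1 makes \<open>D powr q\<close> positive, so the right side is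
    \<top> when the weighted norm of \<phi> is infinite.\<close>
  define D where "D = max 1 (C (enn2real (A_const q w1)))"
  have D: "1 \<le> D" by (simp add: D_def)
  show ?thesis
  proof (rule that[of "D powr q"])
    fix w :: "'a \<Rightarrow> real" and t s and \<phi> :: "'a \<Rightarrow> 'k"
    assume wm: "w \<in> borel_fun" and wpos: "\<And>x. 0 < w x" and w: "A_weight q w" "A_const q w \<le> ennreal N"
      and \<phi>: "\<phi> \<in> vectors (Leb_space (lebesgue_on U) q)"
    have [measurable]: "U \<in> sets lebesgue" using U by auto
    have wm' [measurable]: "w \<in> borel_measurable (lebesgue_on U)"
      using wm by (intro measurable_restrict_space1 measurable_completion) simp
    let ?W = "weighted_measure U w"
    have [simp]: "f \<in> borel_measurable ?W \<longleftrightarrow> f \<in> borel_measurable (lebesgue_on U)" for f :: "'a \<Rightarrow> 'k"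
      by (simp add: weighted_measure_def)
    have den: "(\<integral>\<^sup>+x. ennreal (norm (f x) powr q) \<partial>?W) = (\<integral>\<^sup>+x. ennreal (norm (f x) powr q) * ennreal (w x) \<partial>lebesgue_on U)"
      if [measurable]: "f \<in> borel_measurable (lebesgue_on U)" for f :: "'a \<Rightarrow> 'k"
      unfolding weighted_measure_def by (rule nn_integral_density_real) measurable
    have \<phi>m: "\<phi> \<in> borel_measurable (lebesgue_on U)" and T\<phi>m: "T t s \<phi> \<in> borel_measurable (lebesgue_on U)"
      using \<phi> V[OF \<phi>, of t s] by (auto simp: Leb_space_def)
    show "(\<integral>\<^sup>+x. ennreal (norm (T t s \<phi> x) powr q) * ennreal (w x) \<partial>lebesgue_on U)
       \<le> ennreal (D powr q) * (\<integral>\<^sup>+x. ennreal (norm (\<phi> x) powr q) * ennreal (w x) \<partial>lebesgue_on U)"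
    proof (cases "(\<integral>\<^sup>+x. ennreal (norm (\<phi> x) powr q) * ennreal (w x) \<partial>lebesgue_on U) = \<top>")
      case True
      then show ?thesis using D by (simp add: ennreal_mult_top)
    next
      case False
      then have \<phi>W: "\<phi> \<in> vectors (Leb_space ?W q)"
        using \<phi>m by (intro vectors_Leb_spaceI) (simp_all add: den less_top)
      have TW: "T t s \<phi> \<in> vectors (Leb_space ?W q)"
        and le: "nrm (Leb_space ?W q) (T t s \<phi>) \<le> C (enn2real (A_const q w)) * nrm (Leb_space ?W q) \<phi>"
        using T w(1) \<phi> \<phi>W unfolding A_consistently_bounded_def by blast+
      have "A_const q w \<le> A_const q w1" using w(2) w1(2) by (rule order_trans)
      then have "C (enn2real (A_const q w)) \<le> C (enn2real (A_const q w1))"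
        using T w(1) w1(1) unfolding A_consistently_bounded_def by blast
      then have "C (enn2real (A_const q w)) \<le> D" by (simp add: D_def)
      then have "nrm (Leb_space ?W q) (T t s \<phi>) \<le> D * nrm (Leb_space ?W q) \<phi>"
        by (rule order_trans[OF le mult_right_mono[OF _ nrm_Leb_space_nonneg]])
      then have "nrm (Leb_space ?W q) (T t s \<phi>) powr q \<le> (D * nrm (Leb_space ?W q) \<phi>) powr q"
        using q by (intro powr_mono2 nrm_Leb_space_nonneg) auto
      also have "\<dots> = D powr q * nrm (Leb_space ?W q) \<phi> powr q"
        using D by (simp add: powr_mult nrm_Leb_space_nonneg)
      finally have "ennreal (nrm (Leb_space ?W q) (T t s \<phi>) powr q) \<le> ennreal (D powr q) * ennreal (nrm (Leb_space ?W q) \<phi> powr q)"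
        by (simp add: ennreal_leI flip: ennreal_mult)
      then show ?thesis
        using q nrm_Leb_space_powr[OF TW] nrm_Leb_space_powr[OF \<phi>W] den[OF \<phi>m] den[OF T\<phi>m] by simp
    qed
  qed simp
qed

section \<open>The square function estimate\<close>

text \<open>Hoelder's inequality with an auxiliary weight H, at the price of 2^q. The pointwise
  bound a \<le> l H + l^(1-q) a^q H^(1-q) is integrated, and l is chosen to balance the two
  terms.\<close>

lemma weighted_jensen:
  assumes [measurable]: "\<kappa> \<in> borel_measurable M" "a \<in> borel_measurable M" "H \<in> borel_measurable M"
    and Hpos: "\<And>s. 0 < H s" and h: "(\<integral>\<^sup>+s. \<kappa> s * ennreal (H s) \<partial>M) \<le> ennreal h" "0 < h" and q: "1 < q"
  shows "epow (\<integral>\<^sup>+s. \<kappa> s * a s \<partial>M) q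
    \<le> ennreal (2 powr q * h powr (q - 1)) * (\<integral>\<^sup>+s. \<kappa> s * (epow (a s) q * ennreal (H s powr (1 - q))) \<partial>M)"
    (is "_ \<le> _ * ?J")
proof -
  have pw: "a s \<le> ennreal l * ennreal (H s) + ennreal (l powr (1 - q)) * (epow (a s) q * ennreal (H s powr (1 - q)))"
    if l: "0 < l" for l s
  proof (cases "a s")
    case (real x)
    have "x \<le> l * H s + l powr (1 - q) * (x powr q * H s powr (1 - q))"
    proof (cases "x \<le> l * H s")
      case True
      then show ?thesis by (smt (verit) mult_nonneg_nonneg powr_ge_zero)
    next
      case False
      then have x: "l * H s < x" by simp
      then have "0 < x" using l Hpos[of s] by (smt (verit) mult_pos_pos)
      then have "x = x powr q * x powr (1 - q)" by (simp flip: powr_add)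
      also have "\<dots> \<le> x powr q * (l * H s) powr (1 - q)"
        using x l Hpos[of s] q by (intro mult_left_mono powr_mono2') auto
      also have "\<dots> = l powr (1 - q) * (x powr q * H s powr (1 - q))"
        using l Hpos[of s] by (simp add: powr_mult)
      finally show ?thesis using l Hpos[of s] by (smt (verit) mult_pos_pos)
    qed
    then show ?thesis
      using real l Hpos[of s] by (simp add: epow_ennreal flip: ennreal_mult ennreal_plus)
  next
    case top
    then show ?thesis using l Hpos[of s] by (simp add: ennreal_top_mult ennreal_mult_top)
  qed
  have le: "(\<integral>\<^sup>+s. \<kappa> s * a s \<partial>M) \<le> ennreal l * ennreal h + ennreal (l powr (1 - q)) * ?J" if l: "0 < l" for l
  proof -
    have "(\<integral>\<^sup>+s. \<kappa> s * a s \<partial>M) \<le> (\<integral>\<^sup>+s. ennreal l * (\<kappa> s * ennreal (H s))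
        + ennreal (l powr (1 - q)) * (\<kappa> s * (epow (a s) q * ennreal (H s powr (1 - q)))) \<partial>M)"
    proof (rule nn_integral_mono)
      fix s
      have "\<kappa> s * a s \<le> \<kappa> s * (ennreal l * ennreal (H s) + ennreal (l powr (1 - q)) * (epow (a s) q * ennreal (H s powr (1 - q))))"
        by (intro mult_left_mono pw l) simp
      then show "\<kappa> s * a s \<le> ennreal l * (\<kappa> s * ennreal (H s))
        + ennreal (l powr (1 - q)) * (\<kappa> s * (epow (a s) q * ennreal (H s powr (1 - q))))"
        by (simp only: distrib_left mult.left_commute)
    qed
    also have "\<dots> = ennreal l * (\<integral>\<^sup>+s. \<kappa> s * ennreal (H s) \<partial>M) + ennreal (l powr (1 - q)) * ?J"
      by (simp add: nn_integral_add nn_integral_cmult)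
    also have "\<dots> \<le> ennreal l * ennreal h + ennreal (l powr (1 - q)) * ?J"
      by (intro add_right_mono mult_left_mono h) simp
    finally show ?thesis .
  qed
  show ?thesis
  proof (cases ?J)
    case (real j)
    show ?thesis
    proof (cases "j = 0")
      case True
      have "(\<integral>\<^sup>+s. \<kappa> s * a s \<partial>M) \<le> 0"
      proof (rule ennreal_le_epsilon)
        fix e :: real assume "0 < e"
        then have "(\<integral>\<^sup>+s. \<kappa> s * a s \<partial>M) \<le> ennreal (e / h) * ennreal h"
          using le[of "e / h"] h(2) real True by simp
        also have "\<dots> = ennreal e" using h(2) \<open>0 < e\<close> by (simp flip: ennreal_mult)
        finally show "(\<integral>\<^sup>+s. \<kappa> s * a s \<partial>M) \<le> 0 + ennreal e" by simp
      qed
      then show ?thesis by simp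
    next
      case False
      then have j: "0 < j" using real by simp
      \<comment> \<open>With this choice both terms of \<open>le\<close> are equal to z.\<close>
      define l where "l = (j / h) powr (1 / q)"
      have l: "0 < l" using j h by (simp add: l_def)
      define z where "z = j powr (1 / q) * h powr (1 - 1 / q)"
      have "l * h = z" using j h by (simp add: l_def z_def powr_divide powr_diff)
      moreover have "l powr (1 - q) * j = z"
      proof -
        have e: "1 / q * (1 - q) = 1 / q - 1" using q by (simp add: field_simps)
        have "l powr (1 - q) = (j / h) powr (1 / q - 1)" by (simp only: l_def powr_powr e)
        then show ?thesis using j h by (simp add: z_def powr_divide powr_diff)
      qed
      moreover have J: "?J = ennreal j" using real by simp
      moreover have m: "ennreal l * ennreal h = ennreal (l * h)" "ennreal (l powr (1 - q)) * ennreal j = ennreal (l powr (1 - q) * j)"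
        using l h(2) j by (simp_all add: ennreal_mult)
      ultimately have "(\<integral>\<^sup>+s. \<kappa> s * a s \<partial>M) \<le> ennreal z + ennreal z"
        using le[OF l] by (simp only:)
      also have "\<dots> = ennreal (2 * z)"
      proof -
        have "0 \<le> z" by (simp add: z_def)
        then show ?thesis by (simp only: mult_2 ennreal_plus)
      qed
      finally have "epow (\<integral>\<^sup>+s. \<kappa> s * a s \<partial>M) q \<le> epow (ennreal (2 * z)) q"
        using q by (intro epow_mono) auto
      also have "\<dots> = ennreal (2 powr q * h powr (q - 1) * j)"
      proof -
        have "(1 - 1 / q) * q = q - 1" using q by (simp add: field_simps)
        then have "z powr q = j * h powr (q - 1)" using q j h by (simp add: z_def powr_mult powr_powr)
        moreover have "0 \<le> z" by (simp add: z_def)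
        ultimately show ?thesis by (simp add: epow_ennreal powr_mult mult.commute mult.left_commute)
      qed
      also have "\<dots> = ennreal (2 powr q * h powr (q - 1)) * ?J"
        using real j by (simp add: ennreal_mult)
      finally show ?thesis .
    qed
  next
    case top
    then show ?thesis using h(2) by (simp add: ennreal_mult_top)
  qed
qed

text \<open>The weights are quantified inside the almost everywhere quantifiers, so the exceptional
  times do not depend on them. This matters because the weights inserted later are sections H1(s, .)
  and H2(t, .), which vary with s and t.\<close>

definition weight_dominated :: "real \<Rightarrow> (real \<Rightarrow> real) \<Rightarrow> (real \<times> real \<times> 'a::euclidean_space \<Rightarrow> ennreal) \<Rightarrow> (real \<times> 'a \<Rightarrow> ennreal) \<Rightarrow> bool" where
  "weight_dominated q c u v \<longleftrightarrow> (\<forall>B>0. ae t. ae s. 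
     \<forall>h1\<in>A1_class lborel grid_max B. \<forall>h2\<in>A1_class lborel grid_max B.
       (NN x. epow (u (t, s, x)) q * ennreal (wt q h1 h2 x))
         \<le> ennreal (c B) * (NN x. epow (v (s, x)) q * ennreal (wt q h1 h2 x)))"

definition kernel_integral :: "(real \<Rightarrow> real) \<Rightarrow> (real \<times> real \<times> 'a \<Rightarrow> ennreal) \<Rightarrow> real \<times> 'a \<Rightarrow> ennreal" where
  "kernel_integral \<kappa> u = (\<lambda>(t, x). NN s. ennreal (\<kappa> (t - s)) * u (t, s, x))"

lemma borel_measurable_kernel_integral [measurable]:
  fixes u :: "real \<times> real \<times> 'a::euclidean_space \<Rightarrow> ennreal"
  assumes "\<kappa> \<in> borel_fun" "u \<in> borel_fun"
  shows "kernel_integral \<kappa> u \<in> borel_fun"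
proof -
  have [measurable]: "\<kappa> \<in> borel_fun" "u \<in> borel_measurable (borel \<Otimes>\<^sub>M borel \<Otimes>\<^sub>M borel)"
    using assms by (simp_all add: borel_prod)
  have "kernel_integral \<kappa> u \<in> borel_measurable (borel \<Otimes>\<^sub>M borel)"
    unfolding kernel_integral_def by measurable
  then show ?thesis by (simp add: borel_prod)
qed

text \<open>2^q (6 B)^(q-1) comes from Hoelder's inequality in s, c B from the operators T(t,s), and
  the last 6 B from the integration in t.\<close>

definition step_const :: "real \<Rightarrow> (real \<Rightarrow> real) \<Rightarrow> real \<Rightarrow> real" where
  "step_const q c B = 2 powr q * (6 * B) powr (q - 1) * (c B * (6 * B))"

lemma A1_class_sections:
  fixes H :: "real \<times> 'a::euclidean_space \<Rightarrow> real"
  assumes "H \<in> A1_class lborel max_prod B"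
  shows "ae t. (\<lambda>x. H (t, x)) \<in> A1_class lborel grid_max B"
    "ae x. (\<lambda>t. H (t, x)) \<in> A1_class lborel grid_max B"
proof -
  have [measurable]: "H \<in> borel_measurable (borel \<Otimes>\<^sub>M borel)" using A1_classD(1)[OF assms] by (simp add: borel_prod)
  show "ae t. (\<lambda>x. H (t, x)) \<in> A1_class lborel grid_max B"
    using AE_prod_borel(1)[OF max_prod_A1(2)[OF assms]]
    by eventually_elim (auto simp: A1_class_def max_snd_def A1_classD(2)[OF assms])
  show "ae x. (\<lambda>t. H (t, x)) \<in> A1_class lborel grid_max B"
    using AE_prod_borel(2)[OF max_prod_A1(1)[OF assms]]
    by eventually_elim (auto simp: A1_class_def max_fst_def A1_classD(2)[OF assms])
qed

lemma nn_integral_mono_AE2: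
  assumes "AE x in M. AE y in N. f x y \<le> g x y"
  shows "(\<integral>\<^sup>+x. \<integral>\<^sup>+y. f x y \<partial>N \<partial>M) \<le> (\<integral>\<^sup>+x. \<integral>\<^sup>+y. g x y \<partial>N \<partial>M)"
proof (rule nn_integral_mono_AE)
  show "AE x in M. (\<integral>\<^sup>+y. f x y \<partial>N) \<le> (\<integral>\<^sup>+y. g x y \<partial>N)"
    using assms by eventually_elim (rule nn_integral_mono_AE)
qed

lemma AE_prod_borelI:
  fixes P :: "'a::euclidean_space \<times> 'b::euclidean_space \<Rightarrow> bool"
  assumes "{z. P z} \<in> sets borel" "ae y. ae x. P (x, y)"
  shows "ae z. P z"
proof -
  have m: "{z \<in> space (lborel \<Otimes>\<^sub>M lborel). P z} \<in> sets (lborel \<Otimes>\<^sub>M lborel)"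
    using assms(1) unfolding lborel_prod by simp
  have "{x \<in> space (lborel \<Otimes>\<^sub>M lborel). P (fst x, snd x)} \<in> sets (lborel \<Otimes>\<^sub>M lborel)" using m by simp
  then have "ae x. ae y. P (x, y)"
    using assms(2) lborel_pair.AE_commute[of "\<lambda>x y. P (x, y)"] by simp
  then have "AE z in lborel \<Otimes>\<^sub>M lborel. P z" by (rule lborel_pair.AE_pair_measure[OF m])
  then show ?thesis unfolding lborel_prod .
qed

text \<open>Splitting \<open>u = H1 (u / H1)\<close> in Jensen's inequality leaves the weight
  \<open>H1(s, \<cdot>)\<^bsup>1-q\<^esup> H2(t, \<cdot>)\<close>, an \<open>A\<^sub>q\<close>-weight even though \<open>s \<noteq> t\<close>.\<close>

lemma kernel_integral_weighted:
  fixes u :: "real \<times> real \<times> 'a::euclidean_space \<Rightarrow> ennreal"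
  assumes \<kappa>: "dominated_kernel \<kappa>" and u: "u \<in> borel_fun" and v: "v \<in> borel_fun"
    and dom: "weight_dominated q c u v" and q: "1 < q" and B: "0 < B" and c: "0 \<le> c B"
    and H: "H1 \<in> A1_class lborel max_prod B" "H2 \<in> A1_class lborel max_prod B"
  shows "(NN z. epow (kernel_integral \<kappa> u z) q * ennreal (wt q H1 H2 z))
    \<le> ennreal (step_const q c B) * (NN z. epow (v z) q * ennreal (wt q H1 H2 z))"
proof -
  have [measurable]: "\<kappa> \<in> borel_fun" and \<kappa>pos: "0 \<le> \<kappa> x" for x
    using dominated_kernelD[OF \<kappa>] by auto
  have Hm: "H1 \<in> borel_fun" "H2 \<in> borel_fun"
    using A1_classD(1)[OF H(1)] A1_classD(1)[OF H(2)] by auto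
  have [measurable]: "u \<in> borel_measurable (borel \<Otimes>\<^sub>M borel \<Otimes>\<^sub>M borel)" "v \<in> borel_measurable (borel \<Otimes>\<^sub>M borel)"
    "H1 \<in> borel_measurable (borel \<Otimes>\<^sub>M borel)" "H2 \<in> borel_measurable (borel \<Otimes>\<^sub>M borel)"
    using u v Hm by (simp_all add: borel_prod)
  have Hpos: "0 < H1 z" "0 < H2 z" for z using A1_classD(2)[OF H(1)] A1_classD(2)[OF H(2)] by auto
  let ?F = "kernel_integral \<kappa> u"
  have [measurable]: "?F \<in> borel_measurable (borel \<Otimes>\<^sub>M borel)"
    using borel_measurable_kernel_integral[of \<kappa> u] u by (simp add: borel_prod)
  define b where "b = 2 powr q * (6 * B) powr (q - 1)"
  have b: "0 \<le> b" by (simp add: b_def)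
  have six: "(6 :: ennreal) * ennreal y = ennreal (6 * y)" if "0 \<le> y" for y
    using that by (simp add: ennreal_mult)
  have conv: "ae x. ae t. (NN s. ennreal (\<kappa> (t - s)) * ennreal (H1 (s, x))) \<le> ennreal (6 * B * H1 (t, x))"
    using A1_class_sections(2)[OF H(1)]
  proof eventually_elim
    case (elim x)
    have "ae t. (NN s. ennreal (\<kappa> (t - s)) * ennreal (H1 (s, x))) \<le> 6 * grid_max (\<lambda>s. ennreal (H1 (s, x))) t"
      by (rule dominated_kernelD(4)[OF \<kappa>]) measurable
    then show ?case using A1_classD(3)[OF elim]
    proof eventually_elim
      case (elim t)
      have "6 * grid_max (\<lambda>s. ennreal (H1 (s, x))) t \<le> 6 * ennreal (B * H1 (t, x))"
        by (intro mult_left_mono elim) simp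
      also have "\<dots> = ennreal (6 * B * H1 (t, x))" using B Hpos(1)[of "(t, x)"] by (simp add: six mult.assoc)
      finally show ?case using elim(1) by (rule order_trans[rotated])
    qed
  qed
  have convH2: "ae x. ae s. (NN t. ennreal (\<kappa> (t - s)) * ennreal (H2 (t, x))) \<le> ennreal (6 * B * H2 (s, x))"
    using A1_class_sections(2)[OF H(2)]
  proof eventually_elim
    case (elim x)
    have "ae s. (NN t. ennreal (\<kappa> (t - s)) * ennreal (H2 (t, x))) \<le> 6 * grid_max (\<lambda>t. ennreal (H2 (t, x))) s"
      by (rule dominated_kernelD(5)[OF \<kappa>]) measurable
    then show ?case using A1_classD(3)[OF elim]
    proof eventually_elim
      case (elim s)
      have "6 * grid_max (\<lambda>t. ennreal (H2 (t, x))) s \<le> 6 * ennreal (B * H2 (s, x))"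
        by (intro mult_left_mono elim) simp
      also have "\<dots> = ennreal (6 * B * H2 (s, x))" using B Hpos(2)[of "(s, x)"] by (simp add: six mult.assoc)
      finally show ?case using elim(1) by (rule order_trans[rotated])
    qed
  qed
  have W: "wt q (\<lambda>x. H1 (s, x)) (\<lambda>x. H2 (t, x)) x = H1 (s, x) powr (1 - q) * H2 (t, x)" for s t x
    by (simp add: wt_def)
  have Wpos: "0 \<le> H1 (s, x) powr (1 - q) * H2 (t, x)" for s t x using Hpos(2)[of "(t, x)"] by simp
  have "(NN z. epow (?F z) q * ennreal (wt q H1 H2 z))
      = (NN x. NN t. epow (?F (t, x)) q * ennreal (wt q H1 H2 (t, x)))"
    by (rule nn_integral_prod_borel(2)) (simp add: borel_prod[symmetric])
  also have "\<dots> \<le> (NN x. NN t. ennreal b * (NN s. ennreal (\<kappa> (t - s)) *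
      (epow (u (t, s, x)) q * ennreal (H1 (s, x) powr (1 - q) * H2 (t, x)))))"
  proof (rule nn_integral_mono_AE2, rule eventually_mono[OF conv], erule eventually_mono)
    fix x t
    assume *: "(NN s. ennreal (\<kappa> (t - s)) * ennreal (H1 (s, x))) \<le> ennreal (6 * B * H1 (t, x))"
    let ?h = "6 * B * H1 (t, x)"
    let ?J = "NN s. ennreal (\<kappa> (t - s)) * (epow (u (t, s, x)) q * ennreal (H1 (s, x) powr (1 - q)))"
    have "epow (?F (t, x)) q \<le> ennreal (2 powr q * ?h powr (q - 1)) * ?J"
      unfolding kernel_integral_def prod.case
      by (rule weighted_jensen[OF _ _ _ _ * _ q]) (use B Hpos in auto)
    then have "epow (?F (t, x)) q * ennreal (wt q H1 H2 (t, x)) \<le> ennreal (2 powr q * ?h powr (q - 1)) * ?J * ennreal (wt q H1 H2 (t, x))"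
      by (rule mult_right_mono) simp
    also have "\<dots> = ennreal (2 powr q * ?h powr (q - 1) * wt q H1 H2 (t, x)) * ?J"
      using wt_pos[of H1 "(t, x)" H2 q, OF Hpos] by (simp add: ennreal_mult ac_simps)
    \<comment> \<open>The power q - 1 of H1(t,x) produced by Hoelder's inequality cancels the factor
      H1(t,x)^(1-q) of the weight; at time t only H2 remains.\<close>
    also have "2 powr q * ?h powr (q - 1) * wt q H1 H2 (t, x) = b * H2 (t, x)"
      using B Hpos(1)[of "(t, x)"] by (simp add: b_def wt_def powr_mult powr_diff)
    also have "ennreal (b * H2 (t, x)) * ?J = ennreal b * (NN s. ennreal (\<kappa> (t - s)) *
      (epow (u (t, s, x)) q * ennreal (H1 (s, x) powr (1 - q) * H2 (t, x))))"
    proof -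
      have "ennreal (H2 (t, x)) * ?J = (NN s. ennreal (H2 (t, x)) * (ennreal (\<kappa> (t - s)) * (epow (u (t, s, x)) q * ennreal (H1 (s, x) powr (1 - q)))))"
        by (rule nn_integral_cmult[symmetric]) measurable
      also have "\<dots> = (NN s. ennreal (\<kappa> (t - s)) * (epow (u (t, s, x)) q * ennreal (H1 (s, x) powr (1 - q) * H2 (t, x))))"
        using Hpos(2)[of "(t, x)"] by (intro nn_integral_cong) (simp add: ennreal_mult ac_simps)
      finally show ?thesis using b by (simp add: ennreal_mult' mult.assoc)
    qed
    finally show "epow (?F (t, x)) q * ennreal (wt q H1 H2 (t, x)) \<le> ennreal b * (NN s. ennreal (\<kappa> (t - s)) *
      (epow (u (t, s, x)) q * ennreal (H1 (s, x) powr (1 - q) * H2 (t, x))))" .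
  qed
  also have "\<dots> = ennreal b * (NN x. NN t. NN s. ennreal (\<kappa> (t - s)) *
      (epow (u (t, s, x)) q * ennreal (H1 (s, x) powr (1 - q) * H2 (t, x))))"
    by (simp add: nn_integral_cmult)
  also have "(NN x. NN t. NN s. ennreal (\<kappa> (t - s)) *
      (epow (u (t, s, x)) q * ennreal (H1 (s, x) powr (1 - q) * H2 (t, x))))
    = (NN t. NN x. NN s. ennreal (\<kappa> (t - s)) *
      (epow (u (t, s, x)) q * ennreal (H1 (s, x) powr (1 - q) * H2 (t, x))))"
    by (rule lborel_pair.Fubini') measurable
  also have "\<dots> = (NN t. NN s. NN x. ennreal (\<kappa> (t - s)) *
      (epow (u (t, s, x)) q * ennreal (H1 (s, x) powr (1 - q) * H2 (t, x))))"
    by (intro nn_integral_cong lborel_pair.Fubini') measurable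
  also have "\<dots> \<le> (NN t. NN s. NN x. ennreal (c B) * (ennreal (\<kappa> (t - s)) *
      (epow (v (s, x)) q * ennreal (H1 (s, x) powr (1 - q) * H2 (t, x)))))"
  proof -
    have "ae t. ae s. \<forall>h1\<in>A1_class lborel grid_max B. \<forall>h2\<in>A1_class lborel grid_max B.
       (NN x. epow (u (t, s, x)) q * ennreal (wt q h1 h2 x))
         \<le> ennreal (c B) * (NN x. epow (v (s, x)) q * ennreal (wt q h1 h2 x))"
      using dom B unfolding weight_dominated_def by blast
    then have D2: "ae t. ae s. 
       (NN x. epow (u (t, s, x)) q * ennreal (H1 (s, x) powr (1 - q) * H2 (t, x)))
          \<le> ennreal (c B) * (NN x. epow (v (s, x)) q * ennreal (H1 (s, x) powr (1 - q) * H2 (t, x)))"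
      using A1_class_sections(1)[OF H(2)]
    proof eventually_elim
      case (elim t)
      from elim(1) A1_class_sections(1)[OF H(1)]
      show ?case
      proof eventually_elim
        case inner: (elim s)
        show ?case using inner elim(2) unfolding W[symmetric] by blast
      qed
    qed
    show ?thesis
    proof (rule nn_integral_mono_AE2, rule eventually_mono[OF D2], erule eventually_mono)
      fix t s
      assume "(NN x. epow (u (t, s, x)) q * ennreal (H1 (s, x) powr (1 - q) * H2 (t, x)))
          \<le> ennreal (c B) * (NN x. epow (v (s, x)) q * ennreal (H1 (s, x) powr (1 - q) * H2 (t, x)))"
      then have le: "ennreal (\<kappa> (t - s)) * (NN x. epow (u (t, s, x)) q * ennreal (H1 (s, x) powr (1 - q) * H2 (t, x)))
          \<le> ennreal (\<kappa> (t - s)) * (ennreal (c B) * (NN x. epow (v (s, x)) q * ennreal (H1 (s, x) powr (1 - q) * H2 (t, x))))"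
        by (rule mult_left_mono) simp
      show "(NN x. ennreal (\<kappa> (t - s)) * (epow (u (t, s, x)) q * ennreal (H1 (s, x) powr (1 - q) * H2 (t, x))))
         \<le> (NN x. ennreal (c B) * (ennreal (\<kappa> (t - s)) * (epow (v (s, x)) q * ennreal (H1 (s, x) powr (1 - q) * H2 (t, x)))))"
        using le unfolding mult.left_commute[of "ennreal (\<kappa> (t - s))" "ennreal (c B)"] by (simp add: nn_integral_cmult)
    qed
  qed
  also have "\<dots> = (NN t. NN x. NN s. ennreal (c B) * (ennreal (\<kappa> (t - s)) *
      (epow (v (s, x)) q * ennreal (H1 (s, x) powr (1 - q) * H2 (t, x)))))"
    by (intro nn_integral_cong lborel_pair.Fubini'[symmetric]) measurable
  also have "\<dots> = (NN x. NN t. NN s. ennreal (c B) * (ennreal (\<kappa> (t - s)) *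
      (epow (v (s, x)) q * ennreal (H1 (s, x) powr (1 - q) * H2 (t, x)))))"
    by (rule lborel_pair.Fubini'[symmetric]) measurable
  also have "\<dots> = (NN x. NN s. NN t. ennreal (c B) * (ennreal (\<kappa> (t - s)) *
      (epow (v (s, x)) q * ennreal (H1 (s, x) powr (1 - q) * H2 (t, x)))))"
    by (intro nn_integral_cong lborel_pair.Fubini') measurable
  \<comment> \<open>The only dependence on t left is the kernel times H2(t,x); the
    \<open>A\<^sub>1\<close> bound for the reflected kernel moves H2 to time s, which restores the
    full weight there.\<close>
  also have "\<dots> \<le> (NN x. NN s. ennreal (c B * (6 * B)) * (epow (v (s, x)) q * ennreal (wt q H1 H2 (s, x))))"
  proof (rule nn_integral_mono_AE2, rule eventually_mono[OF convH2], erule eventually_mono)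
    fix x s
    assume *: "(NN t. ennreal (\<kappa> (t - s)) * ennreal (H2 (t, x))) \<le> ennreal (6 * B * H2 (s, x))"
    let ?a = "ennreal (c B) * (epow (v (s, x)) q * ennreal (H1 (s, x) powr (1 - q)))"
    have "(NN t. ennreal (c B) * (ennreal (\<kappa> (t - s)) *
      (epow (v (s, x)) q * ennreal (H1 (s, x) powr (1 - q) * H2 (t, x)))))
      = (NN t. ?a * (ennreal (\<kappa> (t - s)) * ennreal (H2 (t, x))))"
      using Hpos(2) by (intro nn_integral_cong) (simp add: ennreal_mult less_imp_le ac_simps)
    also have "\<dots> = ?a * (NN t. ennreal (\<kappa> (t - s)) * ennreal (H2 (t, x)))"
      by (rule nn_integral_cmult) measurable
    also have "\<dots> \<le> ?a * ennreal (6 * B * H2 (s, x))" by (intro mult_left_mono *) simp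
    also have "\<dots> = ennreal (c B * (6 * B)) * (epow (v (s, x)) q * ennreal (wt q H1 H2 (s, x)))"
    proof -
      have "ennreal (6 * B * H2 (s, x)) = ennreal (6 * B) * ennreal (H2 (s, x))"
        "ennreal (wt q H1 H2 (s, x)) = ennreal (H2 (s, x)) * ennreal (H1 (s, x) powr (1 - q))"
        "ennreal (c B * (6 * B)) = ennreal (c B) * ennreal (6 * B)"
        using B c Hpos(2)[of "(s, x)"] by (simp_all add: wt_def flip: ennreal_mult)
      then show ?thesis by (simp only: ac_simps)
    qed
    finally show "(NN t. ennreal (c B) * (ennreal (\<kappa> (t - s)) *
      (epow (v (s, x)) q * ennreal (H1 (s, x) powr (1 - q) * H2 (t, x)))))
      \<le> ennreal (c B * (6 * B)) * (epow (v (s, x)) q * ennreal (wt q H1 H2 (s, x)))" .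
  qed
  also have "\<dots> = ennreal (c B * (6 * B)) * (NN x. NN s. epow (v (s, x)) q * ennreal (wt q H1 H2 (s, x)))"
    by (simp add: nn_integral_cmult)
  also have "(NN x. NN s. epow (v (s, x)) q * ennreal (wt q H1 H2 (s, x)))
      = (NN z. epow (v z) q * ennreal (wt q H1 H2 z))"
    by (rule nn_integral_prod_borel(2)[symmetric]) (simp add: borel_prod[symmetric])
  finally show ?thesis
    using b c B unfolding step_const_def b_def[symmetric]
    by (simp add: ennreal_mult'[of b] mult.assoc mult_left_mono)
qed

lemma const_one_A1_class: "(\<lambda>_. 1) \<in> A1_class lborel (grid_max :: (real \<Rightarrow> ennreal) \<Rightarrow> _) 2"
  unfolding A1_class_def using grid_max_const_le[of 1, where 'a=real] by simp

lemma (in maximal_operator) extrap_class_pos: "0 < extrap_class r B"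
  using rdf_const_pos by (simp add: extrap_class_def less_max_iff_disj)

text \<open>The weighted bound of exponent q is available for each operator separately. Extrapolated
  to exponent 2 it can be added over n, because the square of the square function is a sum;
  extrapolated back it has exponent q for the square functions. With weights depending on time alone
  this is an estimate for the space norms, and a last extrapolation on the line replaces q by p,
  ending with the weight 1.\<close>

theorem square_function_bound:
  fixes c :: "real \<Rightarrow> real"
  assumes p: "1 < p" and q: "1 < q" and c: "\<And>B. 0 \<le> c B"
  obtains C where "0 \<le> C"
    "\<And>(I :: nat set) \<kappa> (u :: nat \<Rightarrow> real \<times> real \<times> 'a::euclidean_space \<Rightarrow> ennreal) v. finite I \<Longrightarrow>
      (\<And>n. n \<in> I \<Longrightarrow> dominated_kernel (\<kappa> n)) \<Longrightarrow>
      (\<And>n. n \<in> I \<Longrightarrow> u n \<in> borel_fun) \<Longrightarrow> (\<And>n. n \<in> I \<Longrightarrow> v n \<in> borel_fun) \<Longrightarrow>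
      (\<And>n. n \<in> I \<Longrightarrow> weight_dominated q c (u n) (v n)) \<Longrightarrow>
      (NN t. epow (NN x. epow (\<Sum>n\<in>I. epow (kernel_integral (\<kappa> n) (u n) (t, x)) 2) (q / 2)) (p / q))
       \<le> ennreal C * (NN t. epow (NN x. epow (\<Sum>n\<in>I. epow (v n (t, x)) 2) (q / 2)) (p / q))"
proof -
  interpret Z: maximal_operator "lborel :: (real \<times> 'a) measure" max_prod "prod_const (2 ^ DIM(real)) (2 ^ DIM('a))"
    by (rule maximal_operator_max_prod)
  interpret R: maximal_operator "lborel :: real measure" grid_max "grid_const (2 ^ DIM(real))"
    by (rule maximal_operator_grid_max)
  have pos: "0 < Z.extrap_class r B" "0 < R.extrap_class r B" for r B
    by (rule Z.extrap_class_pos, rule R.extrap_class_pos)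
  \<comment> \<open>The classes are fixed from the last extrapolation to the first, since each one
    prescribes the class on which its hypothesis has to hold. The initial 2 is the
    \<open>A\<^sub>1\<close> constant of the weight 1 on the line, where there are two
    grids.\<close>
  define B5 where "B5 = R.extrap_class p 2"
  define B4 where "B4 = B5 + 2 ^ DIM('a)"
  define B3 where "B3 = Z.extrap_class q B4"
  define B2 where "B2 = Z.extrap_class 2 B3"
  have B: "0 < B5" "0 < B4" "0 < B3" "0 < B2"
    using pos by (simp_all add: B2_def B3_def B4_def B5_def add_pos_nonneg)
  define c2 where "c2 = step_const q c B2"
  define c3 where "c3 = Z.extrap_const q 2 c2"
  define c4 where "c4 = Z.extrap_const 2 q c3"
  define c5 where "c5 = R.extrap_const q p c4"
  have c2: "0 \<le> c2" using c B(4) by (simp add: c2_def step_const_def)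
  have c3: "0 \<le> c3" unfolding c3_def by (rule Z.extrap_const_nonneg[OF c2])
  have c4: "0 \<le> c4" unfolding c4_def by (rule Z.extrap_const_nonneg[OF c3])
  have c5: "0 \<le> c5" unfolding c5_def by (rule R.extrap_const_nonneg[OF c4])
  show ?thesis
  proof (rule that[OF c5])
    fix I :: "nat set" and \<kappa> and u :: "nat \<Rightarrow> real \<times> real \<times> 'a \<Rightarrow> ennreal" and v
    assume fin: "finite I" and \<kappa>: "\<And>n. n \<in> I \<Longrightarrow> dominated_kernel (\<kappa> n)"
      and u: "\<And>n. n \<in> I \<Longrightarrow> u n \<in> borel_fun" and v: "\<And>n. n \<in> I \<Longrightarrow> v n \<in> borel_fun"
      and dom: "\<And>n. n \<in> I \<Longrightarrow> weight_dominated q c (u n) (v n)"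
    let ?K = "\<lambda>n. kernel_integral (\<kappa> n) (u n)"
    have K: "?K n \<in> borel_fun" if "n \<in> I" for n
      by (intro borel_measurable_kernel_integral u that dominated_kernelD(1)[OF \<kappa>[OF that]])
    define F where "F z = epow (\<Sum>n\<in>I. epow (?K n z) 2) (1 / 2)" for z
    define G where "G z = epow (\<Sum>n\<in>I. epow (v n z) 2) (1 / 2)" for z
    have Fm [measurable]: "F \<in> borel_fun" and Gm [measurable]: "G \<in> borel_fun"
      unfolding F_def G_def by (intro borel_measurable_epow borel_measurable_sum K v; assumption)+
    have F2: "epow (F z) 2 = (\<Sum>n\<in>I. epow (?K n z) 2)" and G2: "epow (G z) 2 = (\<Sum>n\<in>I. epow (v n z) 2)" for z
      by (simp_all add: F_def G_def epow_powr)
    have one: "(NN z. epow (?K n z) 2 * ennreal (wt 2 H1 H2 z))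
        \<le> ennreal c3 * (NN z. epow (v n z) 2 * ennreal (wt 2 H1 H2 z))"
      if H: "H1 \<in> Z.A1 B3" "H2 \<in> Z.A1 B3" and n: "n \<in> I" for H1 H2 n
      unfolding c3_def
    proof (rule Z.extrapolation[OF q _ B(3) c2 _ _ H])
      fix h1 h2 assume "h1 \<in> Z.A1 (Z.extrap_class 2 B3)" "h2 \<in> Z.A1 (Z.extrap_class 2 B3)"
      then show "(NN z. epow (?K n z) q * ennreal (wt q h1 h2 z))
        \<le> ennreal c2 * (NN z. epow (v n z) q * ennreal (wt q h1 h2 z))"
        unfolding c2_def B2_def[symmetric]
        by (intro kernel_integral_weighted \<kappa> u v dom n q B(4) c)
    qed (use K[OF n] v[OF n] in auto)
    have two: "(NN z. epow (F z) 2 * ennreal (wt 2 H1 H2 z))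
        \<le> ennreal c3 * (NN z. epow (G z) 2 * ennreal (wt 2 H1 H2 z))"
      if H: "H1 \<in> Z.A1 B3" "H2 \<in> Z.A1 B3" for H1 H2
    proof -
      have [measurable]: "H1 \<in> borel_fun" "H2 \<in> borel_fun"
        using A1_classD(1)[OF H(1)] A1_classD(1)[OF H(2)] by auto
      have sum_int: "(NN z. (\<Sum>n\<in>I. epow (g n z) 2) * ennreal (wt 2 H1 H2 z))
          = (\<Sum>n\<in>I. NN z. epow (g n z) 2 * ennreal (wt 2 H1 H2 z))"
        if g: "\<And>n. n \<in> I \<Longrightarrow> g n \<in> borel_fun" for g :: "nat \<Rightarrow> real \<times> 'a \<Rightarrow> ennreal"
        unfolding sum_distrib_right
      proof (rule nn_integral_sum)
        fix n assume "n \<in> I"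
        then have [measurable]: "g n \<in> borel_fun" by (rule g)
        show "(\<lambda>z. epow (g n z) 2 * ennreal (wt 2 H1 H2 z)) \<in> borel_measurable lborel" by measurable
      qed
      have "(\<Sum>n\<in>I. NN z. epow (?K n z) 2 * ennreal (wt 2 H1 H2 z))
        \<le> ennreal c3 * (\<Sum>n\<in>I. NN z. epow (v n z) 2 * ennreal (wt 2 H1 H2 z))"
        unfolding sum_distrib_left by (intro sum_mono one H)
      then show ?thesis
        using sum_int[of ?K] sum_int[of v] K v by (simp add: F2 G2)
    qed
    have three: "(NN z. epow (F z) q * ennreal (wt q H1 H2 z))
        \<le> ennreal c4 * (NN z. epow (G z) q * ennreal (wt q H1 H2 z))"
      if H: "H1 \<in> Z.A1 B4" "H2 \<in> Z.A1 B4" for H1 H2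
      unfolding c4_def
      by (rule Z.extrapolation[OF _ q B(2) c3 _ _ H]) (use two in \<open>auto simp: B3_def\<close>)
    \<comment> \<open>The space norm at time t. Its q-th power against a weight in time is the
      integral of F^q over the product space against the same weight.\<close>
    define F' where "F' t = epow (NN x. epow (F (t, x)) q) (1 / q)" for t
    define G' where "G' t = epow (NN x. epow (G (t, x)) q) (1 / q)" for t
    have [measurable]: "F \<in> borel_measurable (borel \<Otimes>\<^sub>M borel)" "G \<in> borel_measurable (borel \<Otimes>\<^sub>M borel)"
      using Fm Gm by (simp_all add: borel_prod)
    have [measurable]: "F' \<in> borel_fun" "G' \<in> borel_fun"
      unfolding F'_def G'_def by measurable
    have iter: "(NN t. epow (epow (NN x. epow (g (t, x)) q) (1 / q)) q * ennreal (wt q h1 h2 t))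
        = (NN z. epow (g z) q * ennreal (wt q (\<lambda>z. h1 (fst z)) (\<lambda>z. h2 (fst z)) z))"
      if [measurable]: "h1 \<in> borel_fun" "h2 \<in> borel_fun" "g \<in> borel_measurable (borel \<Otimes>\<^sub>M borel)"
      for h1 h2 and g :: "real \<times> 'a \<Rightarrow> ennreal"
    proof -
      have w: "wt q (\<lambda>z. h1 (fst z)) (\<lambda>z. h2 (fst z)) (t, x) = wt q h1 h2 t" for t and x :: 'a by (simp add: wt_def)
      have m: "(\<lambda>z. epow (g z) q * ennreal (wt q (\<lambda>z. h1 (fst z)) (\<lambda>z. h2 (fst z)) z)) \<in> borel_fun"
        unfolding borel_prod[symmetric] by measurable
      have "(NN z. epow (g z) q * ennreal (wt q (\<lambda>z. h1 (fst z)) (\<lambda>z. h2 (fst z)) z))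
        = (NN t. NN x. epow (g (t, x)) q * ennreal (wt q h1 h2 t))"
        unfolding nn_integral_prod_borel(1)[OF m] w ..
      also have "\<dots> = (NN t. epow (epow (NN x. epow (g (t, x)) q) (1 / q)) q * ennreal (wt q h1 h2 t))"
        using q by (simp add: nn_integral_multc epow_powr)
      finally show ?thesis ..
    qed
    have "(NN t. epow (F' t) p * ennreal (wt p (\<lambda>_. 1) (\<lambda>_. 1) t))
       \<le> ennreal c5 * (NN t. epow (G' t) p * ennreal (wt p (\<lambda>_. 1) (\<lambda>_. 1) t))"
      unfolding c5_def
    proof (rule R.extrapolation[OF q p _ c4 _ _ const_one_A1_class const_one_A1_class])
      fix h1 h2 assume h: "h1 \<in> R.A1 (R.extrap_class p 2)" "h2 \<in> R.A1 (R.extrap_class p 2)"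
      have hm: "h1 \<in> borel_fun" "h2 \<in> borel_fun"
        using A1_classD(1)[OF h(1)] A1_classD(1)[OF h(2)] by auto
      have "(\<lambda>z. h1 (fst z)) \<in> Z.A1 B4" "(\<lambda>z. h2 (fst z)) \<in> Z.A1 B4"
        unfolding B4_def B5_def using B(1) by (intro A1_class_prod_fst h; simp add: B5_def)+
      then show "(NN t. epow (F' t) q * ennreal (wt q h1 h2 t))
        \<le> ennreal c4 * (NN t. epow (G' t) q * ennreal (wt q h1 h2 t))"
        unfolding F'_def G'_def using hm by (subst (1 2) iter) (auto intro: three)
    qed auto
    moreover have "epow (epow a (1 / q)) p = epow a (p / q)" for a
      by (simp add: epow_powr)
    moreover have "epow (F z) q = epow (\<Sum>n\<in>I. epow (?K n z) 2) (q / 2)"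
      "epow (G z) q = epow (\<Sum>n\<in>I. epow (v n z) 2) (q / 2)" for z
      by (simp_all add: F_def G_def epow_powr)
    ultimately show "(NN t. epow (NN x. epow (\<Sum>n\<in>I. epow (?K n (t, x)) 2) (q / 2)) (p / q))
       \<le> ennreal c5 * (NN t. epow (NN x. epow (\<Sum>n\<in>I. epow (v n (t, x)) 2) (q / 2)) (p / q))"
      by (simp add: F'_def G'_def wt_def)
  qed
qed

section \<open>Minkowski's integral inequality\<close>

text \<open>The factor 2 comes from \<open>weighted_jensen\<close>; it is irrelevant for what follows.\<close>

lemma minkowski_integral:
  assumes "sigma_finite_measure M" "sigma_finite_measure N"
    and w [measurable]: "w \<in> borel_measurable (M \<Otimes>\<^sub>M N)" and r: "1 < r"
  shows "epow (\<integral>\<^sup>+x. epow (\<integral>\<^sup>+s. w (s, x) \<partial>M) r \<partial>N) (1 / r)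
    \<le> 2 * (\<integral>\<^sup>+s. epow (\<integral>\<^sup>+x. epow (w (s, x)) r \<partial>N) (1 / r) \<partial>M)"
proof -
  interpret M: sigma_finite_measure M by fact
  interpret N: sigma_finite_measure N by fact
  interpret pair_sigma_finite M N ..
  define n where "n s = epow (\<integral>\<^sup>+x. epow (w (s, x)) r \<partial>N) (1 / r)" for s
  have [measurable]: "n \<in> borel_measurable M" unfolding n_def by measurable
  show ?thesis
  proof (cases "(\<integral>\<^sup>+s. n s \<partial>M)")
    case (real R)
    have nfin: "AE s in M. n s \<noteq> \<infinity>"
      using real by (intro nn_integral_PInf_AE) auto
    have "epow (\<integral>\<^sup>+x. epow (\<integral>\<^sup>+s. w (s, x) \<partial>M) r \<partial>N) (1 / r) \<le> 2 * ennreal R"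
    proof (rule ennreal_le_epsilon)
      fix d :: real assume d: "0 < d"
      obtain e where e [measurable]: "e \<in> borel_measurable M" and epos: "\<And>s. 0 < e s" and efin: "\<And>s. e s < (\<top>::ennreal)"
        and eI: "(\<integral>\<^sup>+s. epow (e s) 1 * ennreal 1 \<partial>M) \<le> ennreal (d / 2)"
        using M.small_positive_function[of 1 "\<lambda>_. 1" "d / 2"] d by auto
      \<comment> \<open>The auxiliary weight for Hoelder's inequality is the inner norm n itself,
        made positive by e. Then the integral over x of w^r H^(1-r) is at most H, and everything
        reduces to the integral of H.\<close>
      define H where "H s = enn2real (n s) + enn2real (e s)" for s
      have [measurable]: "H \<in> borel_measurable M" unfolding H_def by measurable
      have Hpos: "0 < H s" for s
        unfolding H_def using epos[of s] efin[of s] by (simp add: enn2real_positive_iff add_nonneg_pos)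
      define h where "h = R + d / 2"
      have h: "0 < h" using real d by (simp add: h_def)
      have HI: "(\<integral>\<^sup>+s. ennreal (H s) \<partial>M) \<le> ennreal h"
      proof -
        have "(\<integral>\<^sup>+s. ennreal (H s) \<partial>M) \<le> (\<integral>\<^sup>+s. n s + e s \<partial>M)"
          unfolding H_def by (intro nn_integral_mono) (auto simp: ennreal_plus ennreal_enn2real_if intro!: add_mono)
        also have "\<dots> = (\<integral>\<^sup>+s. n s \<partial>M) + (\<integral>\<^sup>+s. e s \<partial>M)" by (rule nn_integral_add) measurable
        also have "\<dots> \<le> ennreal R + ennreal (d / 2)" using real eI by (intro add_mono) auto
        also have "\<dots> = ennreal h" using real d by (simp add: h_def ennreal_plus)
        finally show ?thesis .
      qed
      have "(\<integral>\<^sup>+x. epow (\<integral>\<^sup>+s. w (s, x) \<partial>M) r \<partial>N)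
        \<le> (\<integral>\<^sup>+x. ennreal (2 powr r * h powr (r - 1)) * (\<integral>\<^sup>+s. epow (w (s, x)) r * ennreal (H s powr (1 - r)) \<partial>M) \<partial>N)"
      proof (rule nn_integral_mono)
        fix x assume [simp]: "x \<in> space N"
        show "epow (\<integral>\<^sup>+s. w (s, x) \<partial>M) r
          \<le> ennreal (2 powr r * h powr (r - 1)) * (\<integral>\<^sup>+s. epow (w (s, x)) r * ennreal (H s powr (1 - r)) \<partial>M)"
          using weighted_jensen[of "\<lambda>_. 1" M "\<lambda>s. w (s, x)" H h r] Hpos HI h r by simp
      qed
      also have "\<dots> = ennreal (2 powr r * h powr (r - 1)) * (\<integral>\<^sup>+x. \<integral>\<^sup>+s. epow (w (s, x)) r * ennreal (H s powr (1 - r)) \<partial>M \<partial>N)"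
        by (rule nn_integral_cmult) measurable
      also have "(\<integral>\<^sup>+x. \<integral>\<^sup>+s. epow (w (s, x)) r * ennreal (H s powr (1 - r)) \<partial>M \<partial>N)
        = (\<integral>\<^sup>+s. \<integral>\<^sup>+x. epow (w (s, x)) r * ennreal (H s powr (1 - r)) \<partial>N \<partial>M)"
        by (rule Fubini') measurable
      also have "\<dots> = (\<integral>\<^sup>+s. (\<integral>\<^sup>+x. epow (w (s, x)) r \<partial>N) * ennreal (H s powr (1 - r)) \<partial>M)"
        by (intro nn_integral_cong nn_integral_multc) measurable
      also have "\<dots> \<le> (\<integral>\<^sup>+s. ennreal (H s) \<partial>M)"
        using nfin
      proof (intro nn_integral_mono_AE, eventually_elim)
        case (elim s)
        define y where "y = enn2real (n s)"
        have y: "n s = ennreal y" "0 \<le> y" "y \<le> H s" using elim by (auto simp: y_def H_def less_top)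
        have "(\<integral>\<^sup>+x. epow (w (s, x)) r \<partial>N) = epow (n s) r"
          using r by (simp add: n_def epow_powr)
        also have "\<dots> = ennreal (y powr r)" using y by (simp add: epow_ennreal)
        finally have "(\<integral>\<^sup>+x. epow (w (s, x)) r \<partial>N) * ennreal (H s powr (1 - r)) = ennreal (y powr r * H s powr (1 - r))"
          by (simp add: ennreal_mult)
        also have "\<dots> \<le> ennreal (H s powr r * H s powr (1 - r))"
          using y r by (intro ennreal_leI mult_right_mono powr_mono2) auto
        also have "H s powr r * H s powr (1 - r) = H s" using Hpos[of s] by (simp flip: powr_add)
        finally show ?case .
      qed
      also have "\<dots> \<le> ennreal h" by (rule HI)
      also have "ennreal (2 powr r * h powr (r - 1)) * ennreal h = ennreal ((2 * h) powr r)"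
        using h by (simp add: powr_mult powr_diff flip: ennreal_mult)
      finally have "(\<integral>\<^sup>+x. epow (\<integral>\<^sup>+s. w (s, x) \<partial>M) r \<partial>N) \<le> ennreal ((2 * h) powr r)"
        by (simp add: mult_left_mono)
      then have "epow (\<integral>\<^sup>+x. epow (\<integral>\<^sup>+s. w (s, x) \<partial>M) r \<partial>N) (1 / r) \<le> epow (ennreal ((2 * h) powr r)) (1 / r)"
        using r by (intro epow_mono) auto
      also have "\<dots> = ennreal (2 * h)" using r h by (simp add: epow_ennreal powr_powr)
      also have "\<dots> = 2 * ennreal R + ennreal d"
      proof -
        have "2 * h = 2 * R + d" by (simp add: h_def)
        then show ?thesis using real d by (simp add: ennreal_plus ennreal_mult)
      qed
      finally show "epow (\<integral>\<^sup>+x. epow (\<integral>\<^sup>+s. w (s, x) \<partial>M) r \<partial>N) (1 / r) \<le> 2 * ennreal R + ennreal d" .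
    qed
    then show ?thesis using real by (simp add: n_def)
  next
    case top
    then show ?thesis by (simp add: n_def ennreal_mult_top)
  qed
qed

section \<open>Jointly measurable representatives\<close>

definition Lq :: "real \<Rightarrow> ('a::euclidean_space \<Rightarrow> 'k::real_normed_vector) \<Rightarrow> ennreal" where
  "Lq q f = epow (NN x. epow (enorm (f x)) q) (1 / q)"

text \<open>An element of \<open>L\<^sup>q(U)\<close> is only determined up to null sets and its values off \<open>U\<close> are irrelevant;
  \<open>g\<close> is a Borel version on the whole space, jointly in the parameter in the second definition.\<close>

definition represents1 :: "'a::euclidean_space set \<Rightarrow> ('a \<Rightarrow> 'k::{real_normed_field, euclidean_space}) \<Rightarrow> ('a \<Rightarrow> 'k) \<Rightarrow> bool" where
  "represents1 U f g \<longleftrightarrow> g \<in> borel_fun \<and> (\<forall>x. x \<notin> U \<longrightarrow> g x = 0) \<and> (ae x. x \<in> U \<longrightarrow> f x = g x)"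

definition represents :: "'a::euclidean_space set \<Rightarrow> ('b::euclidean_space \<Rightarrow> 'a \<Rightarrow> 'k::{real_normed_field, euclidean_space}) \<Rightarrow> ('b \<times> 'a \<Rightarrow> 'k) \<Rightarrow> bool" where
  "represents U F g \<longleftrightarrow> g \<in> borel_fun \<and> (\<forall>y x. x \<notin> U \<longrightarrow> g (y, x) = 0) \<and>
     (ae y. ae x. x \<in> U \<longrightarrow> F y x = g (y, x))"

lemma borel_section:
  fixes g :: "'b::euclidean_space \<times> 'a::euclidean_space \<Rightarrow> 'c::topological_space"
  assumes "g \<in> borel_fun"
  shows "(\<lambda>x. g (y, x)) \<in> borel_fun" "(\<lambda>y. g (y, x)) \<in> borel_fun"
  by (rule measurable_compose[OF _ assms], simp add: borel_prod[symmetric])+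

lemma representsD:
  assumes "represents U F g"
  shows "g \<in> borel_fun" "x \<notin> U \<Longrightarrow> g (y, x) = 0"
    "ae y. represents1 U (F y) (\<lambda>x. g (y, x))"
  using assms borel_section(1)[of g] by (auto simp: represents_def represents1_def)

lemma representsI:
  assumes "g \<in> borel_fun" "\<And>y x. x \<notin> U \<Longrightarrow> g (y, x) = 0"
    "ae y. represents1 U (F y) (\<lambda>x. g (y, x))"
  shows "represents U F g"
  using assms by (auto simp: represents_def represents1_def)


lemma nn_integral_lebesgue_on:
  assumes "open U"
  shows "(\<integral>\<^sup>+x. f x \<partial>lebesgue_on U) = (NN x. f x * indicator U x)"
  using assms by (subst nn_integral_restrict_space) (auto simp: nn_integral_completion)

lemma represents1_measurable:
  assumes U: "open U" and g: "represents1 U f g"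
  shows "f \<in> borel_measurable (lebesgue_on U)"
proof -
  have "(\<lambda>x. if x \<in> U then f x else 0) \<in> borel_measurable lebesgue"
  proof (rule borel_measurable_AE)
    show "g \<in> borel_measurable lebesgue" using g by (intro measurable_completion) (simp add: represents1_def)
    have "ae x. g x = (if x \<in> U then f x else 0)"
      using g unfolding represents1_def by auto
    then show "AE x in lebesgue. g x = (if x \<in> U then f x else 0)" by (simp add: AE_completion_iff)
  qed
  then show ?thesis using U by (subst (asm) borel_measurable_if) auto
qed

lemma ex_represents1:
  fixes f :: "'a::euclidean_space \<Rightarrow> 'k::{real_normed_field, euclidean_space}"
  assumes U: "open U" and f: "f \<in> borel_measurable (lebesgue_on U)"
  obtains g where "represents1 U f g"
proof -
  have [measurable]: "U \<in> sets borel" using U by simp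
  have "(\<lambda>x. if x \<in> U then f x else 0) \<in> borel_measurable lebesgue"
    using f U by (intro borel_measurable_if_I) auto
  then obtain g where g: "g \<in> borel_measurable lborel" "ae x. (if x \<in> U then f x else 0) = g x"
    by (rule completion_ex_borel_measurable_euclidean)
  have [measurable]: "g \<in> borel_fun" using g(1) by simp
  have "represents1 U f (\<lambda>x. if x \<in> U then g x else 0)"
    unfolding represents1_def
  proof (intro conjI allI impI)
    show "(\<lambda>x. if x \<in> U then g x else 0) \<in> borel_fun" by measurable
    show "ae x. x \<in> U \<longrightarrow> f x = (if x \<in> U then g x else 0)"
      using g(2) by eventually_elim auto
  qed auto
  then show ?thesis by (rule that)
qed

lemma represents1_nn_integral:
  assumes U: "open U" and g: "represents1 U f g" and q: "0 < q"
  shows "(\<integral>\<^sup>+x. ennreal (norm (f x) powr q) \<partial>lebesgue_on U) = (NN x. epow (enorm (g x)) q)"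
  unfolding nn_integral_lebesgue_on[OF U]
proof (rule nn_integral_cong_AE)
  have g0: "x \<notin> U \<Longrightarrow> g x = 0" for x using g by (simp add: represents1_def)
  have "ae x. x \<in> U \<longrightarrow> f x = g x" using g by (simp add: represents1_def)
  then show "ae x. ennreal (norm (f x) powr q) * indicator U x = epow (enorm (g x)) q"
    by eventually_elim (auto simp: g0 epow_ennreal split: split_indicator)
qed

lemma Lq_powr: "0 < q \<Longrightarrow> epow (Lq q f) q = (NN x. epow (enorm (f x)) q)"
  by (simp add: Lq_def epow_powr)

section \<open>Seminorms and strong measurability through representatives\<close>

abbreviation LX :: "real \<Rightarrow> 'a::euclidean_space set \<Rightarrow> ('k::{real_normed_field, euclidean_space}, 'a \<Rightarrow> 'k) seminormed_space" where
  "LX q U \<equiv> Leb_space (lebesgue_on U) q"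

lemma vectors_LX_iff:
  assumes U: "open U" and g: "represents1 U f g" and q: "0 < q"
  shows "f \<in> vectors (LX q U) \<longleftrightarrow> Lq q g < \<top>"
proof -
  have "Lq q g < \<top> \<longleftrightarrow> (\<integral>\<^sup>+x. ennreal (norm (f x) powr q) \<partial>lebesgue_on U) < \<top>"
    unfolding represents1_nn_integral[OF assms] by (simp add: Lq_def less_top[symmetric])
  moreover have "f \<in> borel_measurable (lebesgue_on U)" by (rule represents1_measurable[OF U g])
  moreover have "(\<integral>\<^sup>+x. ennreal (norm (f x) powr q) \<partial>lebesgue_on U) < \<top>" if "f \<in> vectors (LX q U)"
    using nrm_Leb_space_powr[OF that q] by simp
  ultimately show ?thesis using vectors_Leb_spaceI[of f "lebesgue_on U" q] by blast
qed

lemma nrm_LX: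
  assumes U: "open U" and g: "represents1 U f g" and q: "0 < q" and f: "f \<in> vectors (LX q U)"
  shows "ennreal (nrm (LX q U) f) = Lq q g"
proof -
  have "Lq q g = epow (ennreal (nrm (LX q U) f powr q)) (1 / q)"
    unfolding Lq_def represents1_nn_integral[OF U g q, symmetric] nrm_Leb_space_powr[OF f q] ..
  also have "\<dots> = ennreal (nrm (LX q U) f)"
    using q by (simp add: epow_ennreal powr_powr nrm_Leb_space_nonneg)
  finally show ?thesis ..
qed

lemma represents1_vectors_ex:
  assumes "open U" "f \<in> vectors (LX q U)"
  obtains g where "represents1 U f g"
  using assms ex_represents1[of U f] by (auto simp: Leb_space_def)

lemma represents1_add:
  assumes f: "represents1 U f f'" and g: "represents1 U g g'"
  shows "represents1 U (f + g) (\<lambda>x. f' x + g' x)"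
  unfolding represents1_def
proof (intro conjI allI impI)
  show "(\<lambda>x. f' x + g' x) \<in> borel_fun" using f g unfolding represents1_def by (intro borel_measurable_add) auto
  have "ae x. x \<in> U \<longrightarrow> f x = f' x" "ae x. x \<in> U \<longrightarrow> g x = g' x"
    using f g by (auto simp: represents1_def)
  then show "ae x. x \<in> U \<longrightarrow> (f + g) x = f' x + g' x" by eventually_elim simp
qed (use f g in \<open>auto simp: represents1_def\<close>)

lemma represents1_diff:
  assumes f: "represents1 U f f'" and g: "represents1 U g g'"
  shows "represents1 U (f - g) (\<lambda>x. f' x - g' x)"
  unfolding represents1_def
proof (intro conjI allI impI)
  show "(\<lambda>x. f' x - g' x) \<in> borel_fun" using f g unfolding represents1_def by (intro borel_measurable_diff) auto
  have "ae x. x \<in> U \<longrightarrow> f x = f' x" "ae x. x \<in> U \<longrightarrow> g x = g' x"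
    using f g by (auto simp: represents1_def)
  then show "ae x. x \<in> U \<longrightarrow> (f - g) x = f' x - g' x" by eventually_elim (simp add: fun_diff_def)
qed (use f g in \<open>auto simp: represents1_def\<close>)

lemma represents1_cmult:
  fixes c :: "'k::{real_normed_field, euclidean_space}"
  assumes f: "represents1 U f f'"
  shows "represents1 U (\<lambda>x. c * f x) (\<lambda>x. c * f' x)"
  unfolding represents1_def
proof (intro conjI allI impI)
  show "(\<lambda>x. c * f' x) \<in> borel_fun" using f unfolding represents1_def by (intro borel_measurable_times borel_measurable_const) auto
  have "ae x. x \<in> U \<longrightarrow> f x = f' x" using f by (auto simp: represents1_def)
  then show "ae x. x \<in> U \<longrightarrow> c * f x = c * f' x" by eventually_elim simp
qed (use f in \<open>auto simp: represents1_def\<close>)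

lemma Lq_mono:
  assumes "0 < q" "\<And>x. norm (f x) \<le> norm (g x)" shows "Lq q f \<le> Lq q g"
  unfolding Lq_def using assms by (intro epow_mono nn_integral_mono ennreal_leI) auto

lemma Lq_cmult:
  fixes f :: "'a::euclidean_space \<Rightarrow> 'k::real_normed_div_algebra"
  assumes q: "0 < q" and [measurable]: "f \<in> borel_fun"
  shows "Lq q (\<lambda>x. c * f x) = enorm c * Lq q f"
proof -
  have "(NN x. epow (enorm (c * f x)) q)
     = epow (enorm c) q * (NN x. epow (enorm (f x)) q)"
    by (simp add: norm_mult ennreal_mult epow_mult nn_integral_cmult)
  then show ?thesis using q by (simp add: Lq_def epow_mult epow_powr)
qed

text \<open>A factor in the triangle inequality is harmless, and convexity is avoided.\<close>

lemma Lq_triangle: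
  fixes f :: "'a::euclidean_space \<Rightarrow> 'k::real_normed_vector" and g :: "'a \<Rightarrow> 'l::real_normed_vector" and h :: "'a \<Rightarrow> 'm::real_normed_vector"
  assumes q: "1 < q" and [measurable]: "f \<in> borel_fun" "g \<in> borel_fun"
    and le: "\<And>x. norm (h x) \<le> norm (f x) + norm (g x)"
  shows "Lq q h \<le> 4 * (Lq q f + Lq q g)"
proof -
  let ?I = "\<lambda>f :: 'a \<Rightarrow> ennreal. (NN x. epow (f x) q)"
  define a where "a = max (Lq q f) (Lq q g)"
  have "?I (\<lambda>x. enorm (h x)) \<le> (NN x. ennreal (2 powr q) * (epow (enorm (f x)) q + epow (enorm (g x)) q))"
  proof (rule nn_integral_mono)
    fix x
    have "epow (enorm (h x)) q \<le> epow (enorm (f x) + enorm (g x)) q"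
      using le[of x] q by (intro epow_mono) (auto simp: ennreal_leI simp flip: ennreal_plus)
    also have "\<dots> \<le> ennreal (2 powr q) * (epow (enorm (f x)) q + epow (enorm (g x)) q)"
      using q by (intro epow_add_le) auto
    finally show "epow (enorm (h x)) q \<le> ennreal (2 powr q) * (epow (enorm (f x)) q + epow (enorm (g x)) q)" .
  qed
  also have "\<dots> = ennreal (2 powr q) * (epow (Lq q f) q + epow (Lq q g) q)"
    using q by (simp add: nn_integral_cmult nn_integral_add Lq_powr)
  also have "\<dots> \<le> ennreal (2 powr q) * (epow a q + epow a q)"
    using q by (intro mult_left_mono add_mono epow_mono) (auto simp: a_def)
  also have "\<dots> = epow 2 q * (2 * epow a q)"
    using epow_ennreal[of 2 q] by (simp add: mult_2)
  also have "\<dots> \<le> epow 2 q * (epow 2 q * epow a q)"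
  proof (intro mult_left_mono mult_right_mono)
    have "(2::real) powr 1 \<le> 2 powr q" using q by (intro powr_mono) auto
    then have "ennreal 2 \<le> ennreal (2 powr q)" by (intro ennreal_leI) simp
    then show "2 \<le> epow 2 q" using epow_ennreal[of 2 q] by simp
  qed auto
  also have "\<dots> = epow (4 * a) q"
  proof -
    have "(4::ennreal) = 2 * 2" by simp
    then show ?thesis by (simp only: epow_mult mult.assoc)
  qed
  finally have "Lq q h \<le> 4 * a"
    unfolding Lq_def using q by (subst epow_le_iff[of q, symmetric]) (auto simp: epow_powr)
  also have "a \<le> Lq q f + Lq q g" by (auto simp: a_def add_increasing add_increasing2)
  finally show ?thesis by (simp add: mult_left_mono)
qed

lemma borel_measurable_Lq:
  fixes g :: "'b::euclidean_space \<times> 'a::euclidean_space \<Rightarrow> 'k::{real_normed_vector, second_countable_topology}"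
  assumes "g \<in> borel_fun"
  shows "(\<lambda>y. Lq q (\<lambda>x. g (y, x))) \<in> borel_fun"
proof -
  have [measurable]: "g \<in> borel_measurable (borel \<Otimes>\<^sub>M borel)" using assms by (simp add: borel_prod)
  show ?thesis unfolding Lq_def by measurable
qed

text \<open>The level sets are taken from an almost everywhere equal Borel simple function, while
  the sum runs over the values of \<sigma>, which are known to lie in the space.\<close>

lemma represents_simple:
  fixes \<sigma> :: "'b::euclidean_space \<Rightarrow> 'a::euclidean_space \<Rightarrow> 'k::{real_normed_field, euclidean_space}"
  assumes U: "open U" and sf: "simple_function lebesgue \<sigma>" and vec: "\<And>y. \<sigma> y \<in> vectors (LX q U)"
  obtains g where "represents U \<sigma> g"
proof -
  obtain \<sigma>' where \<sigma>': "simple_function lborel \<sigma>'" "ae y. \<sigma> y = \<sigma>' y"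
    using completion_ex_simple_function[OF sf] by blast
  define V where "V = range \<sigma>"
  have V: "finite V" using sf by (simp add: V_def simple_function_def)
  have "\<exists>g. represents1 U v g" if "v \<in> V" for v
    using that vec represents1_vectors_ex[OF U] unfolding V_def by blast
  then obtain r where r: "\<And>v. v \<in> V \<Longrightarrow> represents1 U v (r v)" by metis
  define g where "g z = (\<Sum>v\<in>V. indicator (\<sigma>' -` {v}) (fst z) *\<^sub>R r v (snd z))" for z
  have A: "\<sigma>' -` {v} \<in> sets borel" for v using simple_functionD(2)[OF \<sigma>'(1), of "{v}"] by simp
  have "represents U \<sigma> g"
  proof (rule representsI)
    have "(\<lambda>z. indicator (\<sigma>' -` {v}) (fst z) *\<^sub>R r v (snd z)) \<in> borel_measurable (borel \<Otimes>\<^sub>M borel)" if "v \<in> V" for v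
    proof -
      have [measurable]: "\<sigma>' -` {v} \<in> sets borel" "r v \<in> borel_fun"
        using A r[OF that] by (auto simp: represents1_def)
      show ?thesis by measurable
    qed
    then have "g \<in> borel_measurable (borel \<Otimes>\<^sub>M borel)" unfolding g_def by (intro borel_measurable_sum) auto
    then show "g \<in> borel_fun" by (simp add: borel_prod)
    show "g (y, x) = 0" if "x \<notin> U" for y x
      unfolding g_def using that r by (intro sum.neutral) (auto simp: represents1_def)
    show "ae y. represents1 U (\<sigma> y) (\<lambda>x. g (y, x))"
      using \<sigma>'(2)
    proof eventually_elim
      case (elim y)
      have "g (y, x) = r (\<sigma> y) x" for x
      proof -
        have "g (y, x) = (\<Sum>v\<in>V. if v = \<sigma> y then r v x else 0)"
          unfolding g_def using elim by (intro sum.cong) (auto simp: indicator_def)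
        also have "\<dots> = r (\<sigma> y) x" using V by (simp add: V_def)
        finally show ?thesis .
      qed
      then show ?case using r[of "\<sigma> y"] by (simp add: V_def)
    qed
  qed
  then show ?thesis by (rule that)
qed

text \<open>The geometric rate makes the sum over k of the q-th powers of the errors integrable,
  hence finite almost everywhere, so its terms tend to 0.\<close>

lemma AE_tendsto_of_Lq_summable:
  fixes f :: "'a::euclidean_space \<Rightarrow> 'k::{real_normed_vector, second_countable_topology}" and G :: "nat \<Rightarrow> 'a \<Rightarrow> 'k"
  assumes q: "1 < q" and [measurable]: "f \<in> borel_fun" "\<And>k. G k \<in> borel_fun"
    and le: "\<And>k. Lq q (\<lambda>x. f x - G k x) \<le> ennreal (8 * (1/2)^k)"
  shows "ae x. (\<lambda>k. G k x) \<longlonglongrightarrow> f x"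
proof -
  let ?a = "\<lambda>k x. norm (f x - G k x) powr q"
  have each: "(NN x. ennreal (?a k x)) \<le> ennreal (8 powr q * (1/2)^k)" for k
  proof -
    have "(NN x. ennreal (?a k x)) = epow (Lq q (\<lambda>x. f x - G k x)) q"
      using q by (simp add: Lq_powr epow_ennreal)
    also have "\<dots> \<le> epow (ennreal (8 * (1/2)^k)) q" using q by (intro epow_mono le) auto
    also have "\<dots> = ennreal (8 powr q * ((1/2)^k) powr q)" by (simp add: epow_ennreal powr_mult)
    also have "\<dots> \<le> ennreal (8 powr q * (1/2)^k)"
    proof (intro ennreal_leI mult_left_mono)
      have "((1/2::real)^k) powr q \<le> ((1/2)^k) powr 1"
        using q by (intro powr_mono') (auto simp: power_le_one)
      then show "((1/2::real)^k) powr q \<le> (1/2)^k" by simp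
    qed simp
    finally show ?thesis .
  qed
  have "(NN x. (\<Sum>k. ennreal (?a k x))) = (\<Sum>k. NN x. ennreal (?a k x))"
    by (rule nn_integral_suminf) measurable
  also have "\<dots> \<le> (\<Sum>k. ennreal (8 powr q * (1/2)^k))"
    by (intro suminf_le each) auto
  also have "\<dots> < \<top>"
  proof -
    have "summable (\<lambda>k. 8 powr q * (1/2::real)^k)" by (intro summable_mult summable_geometric) simp
    then have "(\<Sum>k. ennreal (8 powr q * (1/2)^k)) \<noteq> \<top>" by (rule ennreal_suminf_neq_top) simp
    then show ?thesis by (simp only: top.not_eq_extremum)
  qed
  finally have "(NN x. (\<Sum>k. ennreal (?a k x))) \<noteq> \<infinity>" by simp
  then have "ae x. (\<Sum>k. ennreal (?a k x)) \<noteq> \<infinity>"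
    by (intro nn_integral_PInf_AE) measurable
  then show ?thesis
  proof eventually_elim
    case (elim x)
    then have "summable (\<lambda>k. ?a k x)" by (intro summable_suminf_not_top) auto
    then have "(\<lambda>k. ?a k x) \<longlonglongrightarrow> 0" by (rule summable_LIMSEQ_zero)
    from tendsto_zero_powrI[OF this tendsto_const[of "1 / q"]]
    have "(\<lambda>k. ?a k x powr (1 / q)) \<longlonglongrightarrow> 0" using q by simp
    then have "(\<lambda>k. norm (f x - G k x)) \<longlonglongrightarrow> 0" using q by (simp add: powr_powr)
    then have "(\<lambda>k. G k x - f x) \<longlonglongrightarrow> 0" by (subst tendsto_norm_zero_iff[symmetric]) (simp add: norm_minus_commute)
    then show ?case by (rule LIM_zero_cancel)
  qed
qed

lemma four_mult_add: "0 \<le> a \<Longrightarrow> 4 * (ennreal a + ennreal a) = ennreal (8 * a)"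
proof -
  assume a: "0 \<le> a"
  have "ennreal (8 * a) = ennreal (4 * (a + a))" by simp
  also have "\<dots> = ennreal 4 * ennreal (a + a)" using a by (intro ennreal_mult) auto
  also have "\<dots> = 4 * (ennreal a + ennreal a)" using a by (simp only: ennreal_plus ennreal_numeral)
  finally show ?thesis ..
qed

text \<open>The speed of convergence depends on y. A subsequence with y-dependent indices is chosen
  by a Cauchy condition that involves only the Borel functions \<open>g i\<close>, so the choice is
  Borel in y. It converges at a geometric rate for almost every y, hence almost everywhere in x, and
  its pointwise limit is jointly Borel.\<close>

lemma represents_limit:
  fixes F :: "'b::euclidean_space \<Rightarrow> 'a::euclidean_space \<Rightarrow> 'k::{real_normed_field, euclidean_space}"
  assumes q: "1 < q" and g: "\<And>i. g i \<in> borel_fun" "\<And>i x y. x \<notin> U \<Longrightarrow> g i (y, x) = 0"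
    and lim: "ae y. \<exists>F0. represents1 U (F y) F0 \<and> (\<lambda>i. Lq q (\<lambda>x. F0 x - g i (y, x))) \<longlonglongrightarrow> 0"
  obtains h where "represents U F h"
proof -
  define D where "D i j y = Lq q (\<lambda>x. g i (y, x) - g j (y, x))" for i j y
  have [measurable]: "D i j \<in> borel_fun" for i j
    unfolding D_def[abs_def] using g(1) by (intro borel_measurable_Lq[of "\<lambda>z. g i z - g j z"] borel_measurable_diff) auto
  define nk where "nk k y = (LEAST n. \<forall>i\<ge>n. \<forall>j\<ge>n. D i j y \<le> ennreal ((1/2)^k))" for k y
  have [measurable]: "nk k \<in> measurable borel (count_space UNIV)" for k
    unfolding nk_def[abs_def] by measurable
  define G where "G k z = g (nk k (fst z)) z" for k z
  have Gm: "G k \<in> borel_fun" for k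
  proof -
    have [measurable]: "g i \<in> borel_measurable (borel \<Otimes>\<^sub>M borel)" for i using g(1) by (simp add: borel_prod)
    have "G k \<in> borel_measurable (borel \<Otimes>\<^sub>M borel)"
      unfolding G_def[abs_def] by (rule measurable_compose_countable) measurable
    then show ?thesis by (simp add: borel_prod)
  qed
  \<comment> \<open>\<open>lim\<close> of Borel functions is Borel without any assumption of
    convergence, and off U it is 0 because all terms are.\<close>
  define h where "h z = lim (\<lambda>k. G k z)" for z
  have "represents U F h"
  proof (rule representsI)
    show "h \<in> borel_fun" unfolding h_def[abs_def] by (rule borel_measurable_lim_metric[OF Gm])
    then have hs: "(\<lambda>x. h (y, x)) \<in> borel_fun" for y by (rule borel_section)
    show h0: "h (y, x) = 0" if "x \<notin> U" for y x using that g(2) by (simp add: h_def G_def)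
    show "ae y. represents1 U (F y) (\<lambda>x. h (y, x))"
      using lim
    proof eventually_elim
      case (elim y)
      then obtain F0 where F0: "represents1 U (F y) F0" and tend: "(\<lambda>i. Lq q (\<lambda>x. F0 x - g i (y, x))) \<longlonglongrightarrow> 0" by blast
      have F0m: "F0 \<in> borel_fun" using F0 by (simp add: represents1_def)
      have gm: "(\<lambda>x. g i (y, x)) \<in> borel_fun" for i by (rule borel_section[OF g(1)])
      have ev: "\<exists>n. \<forall>i\<ge>n. Lq q (\<lambda>x. F0 x - g i (y, x)) \<le> ennreal e" if "0 < e" for e :: real
      proof -
        have "\<forall>\<^sub>F i in sequentially. Lq q (\<lambda>x. F0 x - g i (y, x)) < ennreal e"
          using tend that by (intro order_tendstoD(2)) auto
        then show ?thesis unfolding eventually_sequentially by (blast intro: less_imp_le)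
      qed
      have ex: "\<exists>n. \<forall>i\<ge>n. \<forall>j\<ge>n. D i j y \<le> ennreal ((1/2)^k)" for k
      proof -
        obtain n where n: "\<And>i. i \<ge> n \<Longrightarrow> Lq q (\<lambda>x. F0 x - g i (y, x)) \<le> ennreal ((1/2)^k / 8)"
          using ev[of "(1/2)^k / 8"] by auto
        have "D i j y \<le> ennreal ((1/2)^k)" if "i \<ge> n" "j \<ge> n" for i j
        proof -
          have "D i j y \<le> 4 * (Lq q (\<lambda>x. F0 x - g i (y, x)) + Lq q (\<lambda>x. F0 x - g j (y, x)))"
            unfolding D_def
          proof (rule Lq_triangle[OF q])
            show "norm (g i (y, x) - g j (y, x)) \<le> norm (F0 x - g i (y, x)) + norm (F0 x - g j (y, x))" for x
              using norm_triangle_ineq4[of "F0 x - g j (y, x)" "F0 x - g i (y, x)"] by (simp add: algebra_simps)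
          qed (intro borel_measurable_diff F0m gm)+
          also have "\<dots> \<le> 4 * (ennreal ((1/2)^k / 8) + ennreal ((1/2)^k / 8))"
            by (intro mult_left_mono add_mono n that) auto
          also have "\<dots> = ennreal ((1/2)^k)" by (subst four_mult_add) auto
          finally show ?thesis .
        qed
        then show ?thesis by blast
      qed
      have P: "D i j y \<le> ennreal ((1/2)^k)" if "i \<ge> nk k y" "j \<ge> nk k y" for i j k
        using LeastI_ex[OF ex[of k]] that unfolding nk_def by blast
      have close: "Lq q (\<lambda>x. F0 x - G k (y, x)) \<le> ennreal (8 * (1/2)^k)" for k
      proof -
        obtain n where n: "\<And>i. i \<ge> n \<Longrightarrow> Lq q (\<lambda>x. F0 x - g i (y, x)) \<le> ennreal ((1/2)^k)"
          using ev[of "(1/2)^k"] by auto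
        define j where "j = max n (nk k y)"
        have "Lq q (\<lambda>x. F0 x - g (nk k y) (y, x)) \<le> 4 * (Lq q (\<lambda>x. F0 x - g j (y, x)) + Lq q (\<lambda>x. g (nk k y) (y, x) - g j (y, x)))"
        proof (rule Lq_triangle[OF q])
          show "norm (F0 x - g (nk k y) (y, x)) \<le> norm (F0 x - g j (y, x)) + norm (g (nk k y) (y, x) - g j (y, x))" for x
            using norm_triangle_ineq4[of "F0 x - g j (y, x)" "g (nk k y) (y, x) - g j (y, x)"] by simp
        qed (intro borel_measurable_diff F0m gm)+
        also have "\<dots> \<le> 4 * (ennreal ((1/2)^k) + ennreal ((1/2)^k))"
          using P[of k "nk k y" j] by (intro mult_left_mono add_mono n) (auto simp: j_def D_def)
        also have "\<dots> = ennreal (8 * (1/2)^k)" by (rule four_mult_add) simp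
        finally show ?thesis by (simp add: G_def)
      qed
      have "ae x. (\<lambda>k. G k (y, x)) \<longlonglongrightarrow> F0 x"
        by (rule AE_tendsto_of_Lq_summable[OF q F0m _ close]) (rule borel_section[OF Gm])
      moreover have "ae x. x \<in> U \<longrightarrow> F y x = F0 x" using F0 by (simp add: represents1_def)
      ultimately have "ae x. x \<in> U \<longrightarrow> F y x = h (y, x)"
        by eventually_elim (auto simp: h_def limI)
      then show ?case using hs h0 by (simp add: represents1_def)
    qed
  qed
  then show ?thesis by (rule that)
qed

lemma strongly_measurable_represents:
  fixes F :: "'b::euclidean_space \<Rightarrow> 'a::euclidean_space \<Rightarrow> 'k::{real_normed_field, euclidean_space}"
  assumes U: "open U" and q: "1 < q" and F: "strongly_measurable lebesgue (LX q U) F"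
  obtains g where "represents U F g"
proof -
  have q0: "0 < q" using q by simp
  have vec: "F y \<in> vectors (LX q U)" for y using F by (simp add: strongly_measurable_def)
  obtain \<sigma> where \<sigma>: "\<And>i. simple_function lebesgue (\<sigma> i)" "\<And>i y. \<sigma> i y \<in> vectors (LX q U)"
    and lim: "AE y in lebesgue. (\<lambda>i. nrm (LX q U) (F y - \<sigma> i y)) \<longlonglongrightarrow> 0"
    using F by (auto simp: strongly_measurable_def)
  have "\<exists>g. represents U (\<sigma> i) g" for i using represents_simple[OF U \<sigma>(1) \<sigma>(2)] by blast
  then obtain g where g: "\<And>i. represents U (\<sigma> i) (g i)" by metis
  have "ae y. \<forall>i. represents1 U (\<sigma> i y) (\<lambda>x. g i (y, x))"
    unfolding AE_all_countable using representsD(3)[OF g] by blast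
  moreover have "ae y. (\<lambda>i. nrm (LX q U) (F y - \<sigma> i y)) \<longlonglongrightarrow> 0"
    using lim by (simp add: AE_completion_iff)
  ultimately have "ae y. \<exists>F0. represents1 U (F y) F0 \<and> (\<lambda>i. Lq q (\<lambda>x. F0 x - g i (y, x))) \<longlonglongrightarrow> 0"
  proof eventually_elim
    case (elim y)
    obtain F0 where F0: "represents1 U (F y) F0" by (rule represents1_vectors_ex[OF U vec])
    have d: "represents1 U (F y - \<sigma> i y) (\<lambda>x. F0 x - g i (y, x))" for i
      using represents1_diff[OF F0 elim(1)[rule_format, of i]] .
    have "ennreal (nrm (LX q U) (F y - \<sigma> i y)) = Lq q (\<lambda>x. F0 x - g i (y, x))" for i
    proof (rule nrm_LX[OF U d q0])
      have "Lq q (\<lambda>x. F0 x - g i (y, x)) \<le> 4 * (Lq q F0 + Lq q (\<lambda>x. g i (y, x)))"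
        using F0 elim(1) by (intro Lq_triangle[OF q] norm_triangle_ineq4) (auto simp: represents1_def)
      also have "\<dots> < \<top>"
        using vectors_LX_iff[OF U F0 q0] vectors_LX_iff[OF U elim(1)[rule_format, of i] q0] vec \<sigma>(2)
        by (simp add: ennreal_mult_less_top)
      finally show "F y - \<sigma> i y \<in> vectors (LX q U)" by (simp add: vectors_LX_iff[OF U d q0])
    qed
    moreover have "(\<lambda>i. ennreal (nrm (LX q U) (F y - \<sigma> i y))) \<longlonglongrightarrow> ennreal 0"
      using elim(2) by (rule tendsto_ennrealI)
    ultimately show ?case using F0 by (intro exI[of _ F0]) simp
  qed
  then show ?thesis
    using representsD(1)[OF g] representsD(2)[OF g]
    by (rule_tac represents_limit[OF q, of g U F]) (auto intro: that)
qed

section \<open>Separability\<close>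

lemma Lq_dominated_convergence:
  fixes f :: "'a::euclidean_space \<Rightarrow> 'k::{real_normed_vector, second_countable_topology}"
  assumes q: "1 < q" and [measurable]: "f \<in> borel_fun" "\<And>n::nat. g n \<in> borel_fun" "w \<in> borel_fun"
    and lim: "ae x. (\<lambda>n. g n x) \<longlonglongrightarrow> f x" and le: "\<And>n x. norm (f x - g n x) powr q \<le> w x"
    and w: "(NN x. ennreal (w x)) < \<top>" and e: "0 < e"
  obtains n where "Lq q (\<lambda>x. f x - g n x) \<le> ennreal e"
proof -
  have "(\<lambda>n. NN x. ennreal (norm (f x - g n x) powr q)) \<longlonglongrightarrow> (\<integral>\<^sup>+x. 0 \<partial>(lborel :: 'a measure))"
  proof (rule nn_integral_dominated_convergence)
    show "ae x. ennreal (norm (f x - g n x) powr q) \<le> ennreal (w x)" for n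
      using le by (intro AE_I2 ennreal_leI)
    show "ae x. (\<lambda>n. ennreal (norm (f x - g n x) powr q)) \<longlonglongrightarrow> 0"
      using lim
    proof eventually_elim
      case (elim x)
      have "(\<lambda>n. norm (f x - g n x)) \<longlonglongrightarrow> 0"
        using tendsto_norm[OF tendsto_diff[OF tendsto_const[of "f x"] elim]] by simp
      from tendsto_zero_powrI[OF this tendsto_const[of q]]
      have "(\<lambda>n. norm (f x - g n x) powr q) \<longlonglongrightarrow> 0" using q by simp
      from tendsto_ennrealI[OF this] show ?case by simp
    qed
  qed (use w in \<open>simp_all\<close>)
  then have "\<forall>\<^sub>F n in sequentially. (NN x. ennreal (norm (f x - g n x) powr q)) < ennreal (e powr q)"
    using e by (intro order_tendstoD(2)) auto
  then obtain n where n: "(NN x. ennreal (norm (f x - g n x) powr q)) < ennreal (e powr q)"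
    by (auto simp: eventually_sequentially)
  then have "epow (Lq q (\<lambda>x. f x - g n x)) q \<le> epow (ennreal e) q"
    using q e by (simp add: Lq_powr epow_ennreal)
  then have "Lq q (\<lambda>x. f x - g n x) \<le> ennreal e" using q by (subst (asm) epow_le_iff) auto
  then show ?thesis by (rule that)
qed

lemma norm_diff_triangle_ineq': "norm (a - c) \<le> norm (a - b) + norm (b - c)"
  for a b c :: "'a::real_normed_vector"
  using norm_triangle_ineq[of "a - b" "b - c"] by simp

lemma dist_gcell_le:
  fixes x y :: "'a::euclidean_space"
  assumes "y \<in> gcell {} (int k) x"
  shows "dist x y \<le> real DIM('a) * (1/2)^k"
proof -
  have p: "2 powr real k = 2 ^ k" by (simp add: powr_realpow)
  have "\<bar>(x - y) \<bullet> i\<bar> \<le> (1/2)^k" if i: "i \<in> Basis" for i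
  proof -
    have "\<lfloor>2 ^ k * (y \<bullet> i)\<rfloor> = \<lfloor>2 ^ k * (x \<bullet> i)\<rfloor>"
      using assms i by (simp add: gcell_def gidx_def shift_def p)
    then have "\<bar>2 ^ k * (x \<bullet> i) - 2 ^ k * (y \<bullet> i)\<bar> \<le> 1" by linarith
    then have "2 ^ k * \<bar>(x - y) \<bullet> i\<bar> \<le> 1" by (simp add: inner_diff_left abs_mult flip: right_diff_distrib)
    then show ?thesis by (simp add: field_simps power_one_over)
  qed
  then have "(\<Sum>i\<in>Basis. \<bar>(x - y) \<bullet> i\<bar>) \<le> (\<Sum>i\<in>(Basis :: 'a set). (1/2)^k)" by (intro sum_mono) auto
  then show ?thesis using norm_le_l1[of "x - y"] by (simp add: dist_norm)
qed

lemma finite_gcells: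
  "finite (gcell {} k ` cball (0 :: 'a::euclidean_space) b)"
proof -
  define c where "c = 2 powr real_of_int k"
  let ?I = "Basis \<rightarrow>\<^sub>E {\<lfloor>- (c * b)\<rfloor>..\<lfloor>c * b\<rfloor>}"
  have "gcell {} k ` cball (0 :: 'a) b \<subseteq> (\<lambda>m. {y. \<forall>i\<in>Basis. gidx {} k y i = m i}) ` ?I"
  proof safe
    fix x :: 'a assume x: "x \<in> cball 0 b"
    have "gidx {} k x i \<in> {\<lfloor>- (c * b)\<rfloor>..\<lfloor>c * b\<rfloor>}" if i: "i \<in> Basis" for i
    proof -
      have "\<bar>x \<bullet> i\<bar> \<le> b" using Basis_le_norm[OF i, of x] x by simp
      moreover have "0 \<le> c" by (simp add: c_def)
      ultimately have "\<bar>c * (x \<bullet> i)\<bar> \<le> c * b" by (simp add: abs_mult mult_left_mono)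
      then have "- (c * b) \<le> c * (x \<bullet> i)" "c * (x \<bullet> i) \<le> c * b" by linarith+
      then show ?thesis
        unfolding gidx_def shift_def c_def[symmetric] by (simp only: atLeastAtMost_iff floor_mono if_False empty_iff diff_0_right)
    qed
    then have "restrict (gidx {} k x) Basis \<in> ?I" by auto
    moreover have "gcell {} k x = {y. \<forall>i\<in>Basis. gidx {} k y i = restrict (gidx {} k x) Basis i}" by (auto simp: gcell_def)
    ultimately show "gcell {} k x \<in> (\<lambda>m. {y. \<forall>i\<in>Basis. gidx {} k y i = m i}) ` ?I" by blast
  qed
  then show ?thesis by (rule finite_subset) (intro finite_imageI finite_PiE; simp)
qed

text \<open>Step functions are coded by lists of pairs, so that the countability of the dense family
  is that of lists over a countable set.\<close>

definition step_fun :: "('a::euclidean_space set \<times> 'k::real_normed_vector) list \<Rightarrow> 'a \<Rightarrow> 'k" where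
  "step_fun l x = (\<Sum>(P, r)\<leftarrow>l. indicator P x *\<^sub>R r)"

lemma borel_measurable_step_fun:
  fixes l :: "('a::euclidean_space set \<times> 'k::{real_normed_vector, second_countable_topology}) list"
  assumes "\<forall>(P, r)\<in>set l. P \<in> sets borel"
  shows "step_fun l \<in> borel_fun"
  using assms
proof (induction l)
  case (Cons a l)
  obtain P r where a: "a = (P, r)" by (cases a)
  have [measurable]: "P \<in> sets borel" "step_fun l \<in> borel_fun" using Cons by (auto simp: a)
  have "(\<lambda>x. indicator P x *\<^sub>R r + step_fun l x) \<in> borel_fun" by measurable
  then show ?case by (simp add: a step_fun_def[abs_def])
qed (simp add: step_fun_def[abs_def])

lemma step_fun_bounded: "\<exists>b. \<forall>x. norm (step_fun l x) \<le> b"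
proof (induction l)
  case (Cons a l)
  obtain P r where a: "a = (P, r)" by (cases a)
  obtain b where b: "\<And>x. norm (step_fun l x) \<le> b" using Cons by blast
  have "norm (step_fun (a # l) x) \<le> norm r + b" for x
  proof -
    have "norm (step_fun (a # l) x) \<le> norm (indicator P x *\<^sub>R r) + norm (step_fun l x)"
    proof -
      have "step_fun (a # l) x = indicator P x *\<^sub>R r + step_fun l x" by (simp add: a step_fun_def)
      then show ?thesis by (simp only: norm_triangle_ineq)
    qed
    also have "\<dots> \<le> norm r + b" using b[of x] by (intro add_mono) (auto simp: indicator_def)
    finally show ?thesis .
  qed
  then show ?case by blast
qed (auto simp: step_fun_def)

lemma Lq_bounded_finite:
  fixes f :: "'a::euclidean_space \<Rightarrow> 'k::real_normed_vector"
  assumes q: "1 < q" and bd: "\<And>x. norm (f x) \<le> b" and supp: "\<And>x. x \<notin> cball 0 c \<Longrightarrow> f x = 0"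
  shows "Lq q f < \<top>"
proof -
  have "(NN x. epow (enorm (f x)) q) \<le> (NN x. ennreal (b powr q) * indicator (cball (0::'a) c) x)"
  proof (rule nn_integral_mono)
    fix x
    have "0 \<le> b" using bd[of x] norm_ge_zero[of "f x"] by linarith
    then show "epow (enorm (f x)) q \<le> ennreal (b powr q) * indicator (cball (0::'a) c) x"
      using bd[of x] supp[of x] q by (cases "x \<in> cball 0 c") (auto simp: epow_ennreal intro!: ennreal_leI powr_mono2)
  qed
  also have "\<dots> = ennreal (b powr q) * emeasure lborel (cball (0::'a) c)" by (rule nn_integral_cmult_indicator) simp
  also have "\<dots> < \<top>"
    using emeasure_lborel_cball_finite[of "0::'a" c] by (simp add: ennreal_mult_less_top)
  finally show ?thesis by (simp add: Lq_def top.not_eq_extremum[symmetric])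
qed

lemma indicator_scaleR_if: "x \<in> A \<longleftrightarrow> b \<Longrightarrow> indicator A x *\<^sub>R r = (if b then r else 0)"
  for r :: "'k::real_vector"
  by (simp add: indicator_def)

text \<open>Only finitely many cells of a fixed mesh meet the ball, and by uniform continuity one
  value from the dense set R is good on a whole cell.\<close>

lemma continuous_step_approx:
  fixes f :: "'a::euclidean_space \<Rightarrow> 'k::real_normed_vector"
  assumes cont: "continuous_on UNIV f" and d: "0 < d" and R: "\<And>y e. 0 < e \<Longrightarrow> \<exists>r\<in>R. dist y r < e"
  obtains l where "l \<in> lists (grid {} \<times> R)" "\<And>x. x \<in> cball 0 b \<Longrightarrow> norm (f x - step_fun l x) \<le> d"
proof -
  have "uniformly_continuous_on (cball 0 b) f"
    by (rule compact_uniformly_continuous) (auto intro: continuous_on_subset[OF cont])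
  then obtain \<eta> where \<eta>: "0 < \<eta>" "\<And>x y. x \<in> cball 0 b \<Longrightarrow> y \<in> cball 0 b \<Longrightarrow> dist y x < \<eta> \<Longrightarrow> dist (f y) (f x) < d / 2"
    using d unfolding uniformly_continuous_on_def by (metis half_gt_zero)
  have "(\<lambda>k. real DIM('a) * (1/2)^k) \<longlonglongrightarrow> real DIM('a) * 0"
    by (intro tendsto_mult tendsto_const LIMSEQ_power_zero) simp
  then have "\<forall>\<^sub>F k in sequentially. real DIM('a) * (1/2)^k < \<eta>" using \<eta>(1) by (intro order_tendstoD(2)) auto
  then obtain k where k: "real DIM('a) * (1/2)^k < \<eta>" by (auto simp: eventually_sequentially)
  define \<P> where "\<P> = gcell {} (int k) ` cball (0::'a) b"
  have fin: "finite \<P>" unfolding \<P>_def by (rule finite_gcells)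
  have "\<exists>r\<in>R. \<forall>x\<in>P \<inter> cball 0 b. norm (f x - r) \<le> d" if P: "P \<in> \<P>" for P
  proof -
    obtain z where z: "z \<in> cball 0 b" "P = gcell {} (int k) z" using P unfolding \<P>_def by blast
    obtain r where r: "r \<in> R" "dist (f z) r < d / 2" using R[of "d / 2" "f z"] d by auto
    have "norm (f x - r) \<le> d" if x: "x \<in> P" "x \<in> cball 0 b" for x
    proof -
      have "dist z x < \<eta>" using dist_gcell_le[of x k z] x z k by simp
      then have "dist (f z) (f x) < d / 2" using \<eta>(2)[of x z] x z by simp
      then show ?thesis using r(2) dist_triangle3[of "f x" r "f z"] by (simp add: dist_norm)
    qed
    then show ?thesis using r(1) by blast
  qed
  then obtain r where r: "\<And>P. P \<in> \<P> \<Longrightarrow> r P \<in> R" "\<And>P x. P \<in> \<P> \<Longrightarrow> x \<in> P \<Longrightarrow> x \<in> cball 0 b \<Longrightarrow> norm (f x - r P) \<le> d"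
    by (metis IntI)
  obtain ps where ps: "set ps = \<P>" "distinct ps" using finite_distinct_list[OF fin] by blast
  define l where "l = map (\<lambda>P. (P, r P)) ps"
  have "l \<in> lists (grid {} \<times> R)"
  proof -
    have "P \<in> grid {}" if "P \<in> \<P>" for P using that unfolding \<P>_def grid_def by blast
    then show ?thesis using r(1) ps(1) by (auto simp: l_def)
  qed
  moreover have "norm (f x - step_fun l x) \<le> d" if x: "x \<in> cball 0 b" for x
  proof -
    have "step_fun l x = (\<Sum>P\<in>\<P>. indicator P x *\<^sub>R r P)"
      unfolding step_fun_def l_def ps(1)[symmetric] by (simp add: o_def sum_list_distinct_conv_sum_set ps(2))
    also have "\<dots> = (\<Sum>P\<in>\<P>. if P = gcell {} (int k) x then r P else 0)"
    proof (rule sum.cong[OF refl])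
      fix P assume "P \<in> \<P>"
      then obtain z where "P = gcell {} (int k) z" by (auto simp: \<P>_def)
      then have "x \<in> P \<longleftrightarrow> P = gcell {} (int k) x"
        using gcell_eq[of x "{}" "int k" z] mem_gcell[of x "{}" "int k"] by metis
      then show "indicator P x *\<^sub>R r P = (if P = gcell {} (int k) x then r P else 0)"
        by (rule indicator_scaleR_if)
    qed
    also have "\<dots> = (if gcell {} (int k) x \<in> \<P> then r (gcell {} (int k) x) else 0)"
      by (rule sum.delta[OF fin])
    also have "\<dots> = r (gcell {} (int k) x)"
      using x unfolding \<P>_def by (simp only: imageI if_True)
    finally have eq: "step_fun l x = r (gcell {} (int k) x)" .
    have "gcell {} (int k) x \<in> \<P>" using x unfolding \<P>_def by blast
    from r(2)[OF this mem_gcell x] show ?thesis unfolding eq .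
  qed
  ultimately show ?thesis by (rule that)
qed

text \<open>The dense family consists of step functions on dyadic cells with values in a countable
  dense set, cut off to balls of integer radius. A given function is truncated, then replaced by a
  clipped continuous function (a measurable function is an almost everywhere limit of continuous
  ones), then by a step function. Index 0 is reserved for the zero function, so that a best
  approximation among the first members is never worse than 0.\<close>

lemma Lq_separable:
  assumes q: "1 < q"
  obtains D :: "nat \<Rightarrow> 'a::euclidean_space \<Rightarrow> 'k::euclidean_space"
  where "\<And>m. D m \<in> borel_fun" "\<And>m. Lq q (D m) < \<top>" "D 0 = (\<lambda>_. 0)"
    "\<And>\<phi> e. \<phi> \<in> borel_fun \<Longrightarrow> Lq q \<phi> < \<top> \<Longrightarrow> 0 < e \<Longrightarrow> \<exists>m. Lq q (\<lambda>x. \<phi> x - D m x) \<le> ennreal e"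
proof -
  obtain R :: "'k set" where R: "countable R" "\<And>X. open X \<Longrightarrow> X \<noteq> {} \<Longrightarrow> \<exists>d\<in>R. d \<in> X"
    using countable_dense_exists[where 'a = 'k] by blast
  have Rd: "\<exists>r\<in>R. dist y r < e" if "0 < e" for y :: 'k and e
    using R(2)[of "ball y e"] that by auto
  define L where "L = (UNIV :: nat set) \<times> lists (grid {} \<times> R :: ('a set \<times> 'k) set)"
  have cL: "countable L" unfolding L_def
    by (intro countable_SIGMA countable_lists countable_grid R(1)) auto
  have L0: "(0, []) \<in> L" by (simp add: L_def)
  define d where "d = (\<lambda>(b::nat, l) x. indicator (cball (0::'a) (real b)) x *\<^sub>R (step_fun l x :: 'k))"
  have dm: "d p \<in> borel_fun" and df: "Lq q (d p) < \<top>" if "p \<in> L" for p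
  proof -
    obtain b l where p: "p = (b, l)" "l \<in> lists (grid {} \<times> R)" using \<open>p \<in> L\<close> by (auto simp: L_def)
    have "\<forall>(P, r)\<in>set l. P \<in> sets borel" using p(2) grid_cell(1) by fastforce
    then have [measurable]: "step_fun l \<in> borel_fun" by (rule borel_measurable_step_fun)
    have [measurable]: "cball (0::'a) (real b) \<in> sets borel" by simp
    show "d p \<in> borel_fun" unfolding d_def p(1) prod.case by measurable
    obtain c where c: "\<And>x. norm (step_fun l x) \<le> c" using step_fun_bounded by blast
    show "Lq q (d p) < \<top>"
      unfolding d_def p(1) prod.case
    proof (rule Lq_bounded_finite[OF q])
      show "norm (indicator (cball 0 (real b)) x *\<^sub>R step_fun l x) \<le> c" for x
        using c[of x] norm_ge_zero[of "step_fun l x"] by (cases "x \<in> cball 0 (real b)") (auto simp: indicator_def simp del: norm_ge_zero)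
      show "indicator (cball 0 (real b)) x *\<^sub>R step_fun l x = 0" if "x \<notin> cball 0 (real b)" for x using that by simp
    qed
  qed
  define D where "D m = (case m of 0 \<Rightarrow> (\<lambda>_. 0) | Suc m \<Rightarrow> d (from_nat_into L m))" for m
  have inL: "from_nat_into L m \<in> L" for m using L0 by (intro from_nat_into) auto
  show ?thesis
  proof (rule that)
    show "D m \<in> borel_fun" for m using dm[OF inL] by (cases m) (auto simp: D_def)
    show "Lq q (D m) < \<top>" for m
      using df[OF inL] by (cases m) (auto simp: D_def Lq_def)
    show "D 0 = (\<lambda>_. 0)" by (simp add: D_def)
    fix \<phi> :: "'a \<Rightarrow> 'k" and e :: real
    assume \<phi> [measurable]: "\<phi> \<in> borel_fun" and \<phi>f: "Lq q \<phi> < \<top>" and e: "0 < e"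
    define \<phi>m where "\<phi>m n x = (if norm x \<le> real n \<and> norm (\<phi> x) \<le> real n then \<phi> x else 0)" for n x
    have [measurable]: "\<phi>m n \<in> borel_fun" for n unfolding \<phi>m_def by measurable
    \<comment> \<open>40 covers the loss 4 (1 + 4 (1 + 1)) = 36 of two nested uses of
      \<open>Lq_triangle\<close>.\<close>
    define e' where "e' = e / 40"
    have e': "0 < e'" "40 * e' = e" using e by (auto simp: e'_def)
    obtain n0 where n0: "Lq q (\<lambda>x. \<phi> x - \<phi>m n0 x) \<le> ennreal e'"
    proof (rule Lq_dominated_convergence[OF q, of \<phi> \<phi>m "\<lambda>x. norm (\<phi> x) powr q" e'])
      show "ae x. (\<lambda>n. \<phi>m n x) \<longlonglongrightarrow> \<phi> x"
      proof (rule AE_I2, rule tendsto_eventually)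
        fix x
        obtain N where "max (norm x) (norm (\<phi> x)) \<le> real N" using real_arch_simple by blast
        then show "\<forall>\<^sub>F n in sequentially. \<phi>m n x = \<phi> x"
          unfolding eventually_sequentially \<phi>m_def by (intro exI[of _ N]) auto
      qed
      show "norm (\<phi> x - \<phi>m n x) powr q \<le> norm (\<phi> x) powr q" for n x using q by (auto simp: \<phi>m_def)
      have "(NN x. ennreal (norm (\<phi> x) powr q)) = epow (Lq q \<phi>) q"
        using q by (simp add: Lq_powr epow_ennreal)
      then show "(NN x. ennreal (norm (\<phi> x) powr q)) < \<top>" using \<phi>f by (simp add: top.not_eq_extremum[symmetric])
    qed (use e' in auto)
    define b where "b = real n0 + 1"
    let ?B = "cball (0::'a) (real n0)"
    have "\<phi>m n0 \<in> borel_measurable lebesgue" by (intro measurable_completion) simp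
    then have "\<phi>m n0 measurable_on UNIV" using measurable_on_iff_borel_measurable[of UNIV "\<phi>m n0"] by simp
    then obtain N g where N: "negligible N" and g: "\<And>n. continuous_on UNIV (g n)" "\<And>x. x \<notin> N \<Longrightarrow> (\<lambda>n. g n x) \<longlonglongrightarrow> \<phi>m n0 x"
      unfolding measurable_on_def by auto
    \<comment> \<open>Radial projection onto the ball of radius b. It is continuous and leaves the
      values of the truncated function fixed, and it makes the approximants uniformly bounded, as
      dominated convergence requires.\<close>
    define cl where "cl y = (b / max b (norm y)) *\<^sub>R y" for y :: 'k
    have bpos: "0 < b" by (simp add: b_def)
    have cl_cont: "continuous_on UNIV cl"
      unfolding cl_def using bpos by (intro continuous_intros) auto
    have cl_id: "cl y = y" if "norm y \<le> b" for y using that bpos by (simp add: cl_def max_def)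
    have cl_le: "norm (cl y) \<le> b" for y
      using bpos by (auto simp: cl_def max_def field_simps)
    define G where "G n x = indicator ?B x *\<^sub>R cl (g n x)" for n x
    have clg: "continuous_on UNIV (\<lambda>x. cl (g n x))" for n
      by (rule continuous_on_compose2[OF cl_cont g(1)]) simp
    have [measurable]: "(\<lambda>x. cl (g n x)) \<in> borel_fun" for n
      by (rule borel_measurable_continuous_onI[OF clg])
    have [measurable]: "?B \<in> sets borel" by simp
    have [measurable]: "G n \<in> borel_fun" for n unfolding G_def[abs_def] by measurable
    obtain n1 where n1: "Lq q (\<lambda>x. \<phi>m n0 x - G n1 x) \<le> ennreal e'"
    proof (rule Lq_dominated_convergence[OF q, of "\<phi>m n0" G "\<lambda>x. (2 * b) powr q * indicator ?B x" e'])
      have "AE x in lebesgue. x \<notin> N" using N by (simp add: negligible_iff_null_sets AE_not_in)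
      then have "ae x. x \<notin> N" by (simp add: AE_completion_iff)
      then show "ae x. (\<lambda>n. G n x) \<longlonglongrightarrow> \<phi>m n0 x"
      proof eventually_elim
        case (elim x)
        have "isCont cl (\<phi>m n0 x)" using cl_cont by (simp add: continuous_on_eq_continuous_at)
        then have "(\<lambda>n. cl (g n x)) \<longlonglongrightarrow> cl (\<phi>m n0 x)" using g(2)[OF elim] by (rule isCont_tendsto_compose)
        then have "(\<lambda>n. G n x) \<longlonglongrightarrow> indicator ?B x *\<^sub>R cl (\<phi>m n0 x)" unfolding G_def by (intro tendsto_intros)
        moreover have "indicator ?B x *\<^sub>R cl (\<phi>m n0 x) = \<phi>m n0 x"
          using cl_id[of "\<phi>m n0 x"] by (auto simp: \<phi>m_def b_def indicator_def)
        ultimately show ?case by simp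
      qed
      show "norm (\<phi>m n0 x - G n x) powr q \<le> (2 * b) powr q * indicator ?B x" for n x
      proof (cases "x \<in> ?B")
        case True
        have "norm (\<phi>m n0 x - G n x) \<le> norm (\<phi>m n0 x) + norm (G n x)" by (rule norm_triangle_ineq4)
        also have "\<dots> \<le> b + b" using True cl_le by (intro add_mono) (auto simp: \<phi>m_def b_def G_def)
        finally show ?thesis using True q by (simp add: powr_mono2)
      next
        case False
        then have "\<phi>m n0 x - G n x = 0" by (simp add: \<phi>m_def G_def)
        then show ?thesis using False by simp
      qed
      have "(NN x. ennreal ((2 * b) powr q * indicator ?B x)) = ennreal ((2 * b) powr q) * emeasure lborel ?B"
        by (subst nn_integral_cmult_indicator[symmetric]) (auto intro!: nn_integral_cong simp: indicator_def)
      also have "\<dots> < \<top>" using emeasure_lborel_cball_finite[of "0::'a" "real n0"] by (simp add: ennreal_mult_less_top)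
      finally show "(NN x. ennreal ((2 * b) powr q * indicator ?B x)) < \<top>" .
    qed (use e' in auto)
    obtain v where v: "emeasure lborel ?B = ennreal v" "0 \<le> v"
      using emeasure_lborel_cball_finite[of "0::'a" "real n0"] by (cases "emeasure lborel ?B") auto
    \<comment> \<open>A uniform error \<delta> on a ball of measure v is an error of at most e' in
      the q-norm; the added 1 avoids division by 0 for the ball of radius 0.\<close>
    define \<delta> where "\<delta> = e' / (v + 1) powr (1 / q)"
    have \<delta>: "0 < \<delta>" using e' v by (simp add: \<delta>_def)
    obtain l where l: "l \<in> lists (grid {} \<times> R)" "\<And>x. x \<in> ?B \<Longrightarrow> norm (cl (g n1 x) - step_fun l x) \<le> \<delta>"
      by (rule continuous_step_approx[of "\<lambda>x. cl (g n1 x)" \<delta> R "real n0"]) (use clg[of n1] \<delta> Rd in \<open>auto\<close>)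
    have lL: "(n0, l) \<in> L" using l(1) by (simp add: L_def)
    have last: "Lq q (\<lambda>x. G n1 x - d (n0, l) x) \<le> ennreal e'"
    proof -
      have "epow (Lq q (\<lambda>x. G n1 x - d (n0, l) x)) q \<le> (NN x. ennreal (\<delta> powr q) * indicator ?B x)"
        unfolding Lq_powr[OF order.strict_trans[OF zero_less_one q]]
      proof (rule nn_integral_mono)
        fix x
        show "epow (enorm (G n1 x - d (n0, l) x)) q \<le> ennreal (\<delta> powr q) * indicator ?B x"
          using l(2)[of x] q by (cases "x \<in> ?B")
            (auto simp: G_def d_def epow_ennreal indicator_def intro!: ennreal_leI powr_mono2)
      qed
      also have "\<dots> = ennreal (\<delta> powr q * v)"
        using v by (subst nn_integral_cmult_indicator) (auto simp: ennreal_mult)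
      also have "\<dots> \<le> epow (ennreal e') q"
      proof -
        have "\<delta> powr q * (v + 1) = e' powr q" using v q e' by (simp add: \<delta>_def powr_divide powr_powr)
        then have "\<delta> powr q * v \<le> e' powr q"
          using powr_ge_zero[of \<delta> q] unfolding distrib_left by linarith
        then show ?thesis using e' by (simp add: epow_ennreal ennreal_leI)
      qed
      finally show ?thesis using q by (subst (asm) epow_le_iff) auto
    qed
    have [measurable]: "d (n0, l) \<in> borel_fun" by (rule dm[OF lL])
    have mid: "Lq q (\<lambda>x. \<phi>m n0 x - d (n0, l) x) \<le> ennreal (8 * e')"
    proof -
      have "Lq q (\<lambda>x. \<phi>m n0 x - d (n0, l) x) \<le> 4 * (Lq q (\<lambda>x. \<phi>m n0 x - G n1 x) + Lq q (\<lambda>x. G n1 x - d (n0, l) x))"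
        by (rule Lq_triangle[OF q]) (simp_all add: norm_diff_triangle_ineq')
      also have "\<dots> \<le> 4 * (ennreal e' + ennreal e')" by (intro mult_left_mono add_mono n1 last) auto
      also have "\<dots> = ennreal (8 * e')" using e' by (intro four_mult_add) simp
      finally show ?thesis .
    qed
    have "Lq q (\<lambda>x. \<phi> x - d (n0, l) x) \<le> 4 * (Lq q (\<lambda>x. \<phi> x - \<phi>m n0 x) + Lq q (\<lambda>x. \<phi>m n0 x - d (n0, l) x))"
      by (rule Lq_triangle[OF q]) (simp_all add: norm_diff_triangle_ineq')
    also have "\<dots> \<le> 4 * (ennreal (5 * e') + ennreal (5 * e'))"
    proof -
      have "Lq q (\<lambda>x. \<phi> x - \<phi>m n0 x) + Lq q (\<lambda>x. \<phi>m n0 x - d (n0, l) x) \<le> ennreal e' + ennreal (8 * e')"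
        by (intro add_mono n0 mid)
      also have "\<dots> = ennreal (9 * e')" using e' by (simp flip: ennreal_plus)
      also have "\<dots> \<le> ennreal (5 * e' + 5 * e')" using e' by (intro ennreal_leI) simp
      also have "\<dots> = ennreal (5 * e') + ennreal (5 * e')" using e' by (intro ennreal_plus) auto
      finally show ?thesis by (rule mult_left_mono) simp
    qed
    also have "\<dots> = ennreal (8 * (5 * e'))" using e' by (intro four_mult_add) simp
    also have "\<dots> = ennreal e" using e'(2) by simp
    finally have "Lq q (\<lambda>x. \<phi> x - d (n0, l) x) \<le> ennreal e" .
    moreover have "d (n0, l) = D (Suc (to_nat_on L (n0, l)))"
      using from_nat_into_to_nat_on[OF cL lL] by (simp add: D_def)
    ultimately show "\<exists>m. Lq q (\<lambda>x. \<phi> x - D m x) \<le> ennreal e" by metis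
  qed
qed

section \<open>Bochner integrals through representatives\<close>

lemma LX_diff:
  assumes U: "open U" and q: "1 < q" and f: "represents1 U f f'" "f \<in> vectors (LX q U)"
    and g: "represents1 U g g'" "g \<in> vectors (LX q U)"
  shows "f - g \<in> vectors (LX q U)" "ennreal (nrm (LX q U) (f - g)) = Lq q (\<lambda>x. f' x - g' x)"
proof -
  have q0: "0 < q" using q by simp
  have d: "represents1 U (f - g) (\<lambda>x. f' x - g' x)" by (rule represents1_diff[OF f(1) g(1)])
  have "Lq q (\<lambda>x. f' x - g' x) \<le> 4 * (Lq q f' + Lq q g')"
    using f g by (intro Lq_triangle[OF q] norm_triangle_ineq4) (auto simp: represents1_def)
  also have "\<dots> < \<top>"
    using vectors_LX_iff[OF U f(1) q0] vectors_LX_iff[OF U g(1) q0] f(2) g(2)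
    by (simp add: ennreal_mult_less_top)
  finally show v: "f - g \<in> vectors (LX q U)" by (simp add: vectors_LX_iff[OF U d q0])
  show "ennreal (nrm (LX q U) (f - g)) = Lq q (\<lambda>x. f' x - g' x)" by (rule nrm_LX[OF U d q0 v])
qed

lemma represents1_0: "represents1 U 0 (\<lambda>_. 0)"
  by (simp add: represents1_def)


text \<open>At stage i the value is the nearest to F y among the first i + 1 members of a dense
  sequence, and 0 off the ball of radius i. Since member 0 is the zero function, the error is at
  most the norm of F y, so dominated convergence applies; the bounded support makes the approximants
  admissible for the Bochner integral.\<close>

lemma simple_approximation:
  fixes F :: "'b::euclidean_space \<Rightarrow> 'a::euclidean_space \<Rightarrow> 'k::{real_normed_field, euclidean_space}"
  assumes U: "open U" and q: "1 < q" and rep: "represents U F h" and vec: "\<And>y. F y \<in> vectors (LX q U)"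
  obtains \<sigma> where "\<And>i. simple_function lebesgue (\<sigma> i)" "\<And>i y. \<sigma> i y \<in> vectors (LX q U)"
    "\<And>i y. y \<notin> cball 0 (real i) \<Longrightarrow> \<sigma> i y = 0"
    "ae y. (\<lambda>i. nrm (LX q U) (F y - \<sigma> i y)) \<longlonglongrightarrow> 0"
    "ae y. \<forall>i. nrm (LX q U) (F y - \<sigma> i y) \<le> nrm (LX q U) (F y)"
proof -
  have q0: "0 < q" using q by simp
  have Ub [measurable]: "U \<in> sets borel" using U by simp
  have hm [measurable]: "h \<in> borel_fun" using rep by (rule representsD)
  obtain D :: "nat \<Rightarrow> 'a \<Rightarrow> 'k" where D [measurable]: "\<And>m. D m \<in> borel_fun"
    and Df: "\<And>m. Lq q (D m) < \<top>" and D0: "D 0 = (\<lambda>_. 0)"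
    and dense: "\<And>\<phi> e. \<phi> \<in> borel_fun \<Longrightarrow> Lq q \<phi> < \<top> \<Longrightarrow> 0 < e \<Longrightarrow> \<exists>m. Lq q (\<lambda>x. \<phi> x - D m x) \<le> ennreal e"
    by (rule Lq_separable[OF q]) blast
  define d where "d m x = indicator U x *\<^sub>R D m x" for m x
  have dm [measurable]: "d m \<in> borel_fun" for m unfolding d_def[abs_def] by measurable
  have d_rep: "represents1 U (d m) (d m)" for m by (simp add: represents1_def d_def)
  have "Lq q (d m) \<le> Lq q (D m)" for m by (rule Lq_mono[OF q0]) (auto simp: d_def indicator_def)
  then have d_vec: "d m \<in> vectors (LX q U)" for m
    using Df[of m] by (subst vectors_LX_iff[OF U d_rep q0]) (rule le_less_trans)
  have d0: "d 0 = 0" by (rule ext) (simp add: d_def D0)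
  define \<delta> where "\<delta> m y = Lq q (\<lambda>x. h (y, x) - d m x)" for m y
  have [measurable]: "\<delta> m \<in> borel_fun" for m
  proof -
    have "(\<lambda>z. h z - d m (snd z)) \<in> borel_fun"
      by (intro borel_measurable_diff hm measurable_compose[OF _ dm]) (simp add: borel_prod[symmetric])
    from borel_measurable_Lq[OF this, of q] show ?thesis by (simp add: \<delta>_def[abs_def])
  qed
  \<comment> \<open>Taking the least index among the minimizers settles ties and keeps the choice
    Borel in y.\<close>
  define best where "best i y = (LEAST m. m \<in> {..i} \<and> (\<forall>j\<in>{..i}. \<delta> m y \<le> \<delta> j y))" for i y
  have best: "best i y \<le> i" "j \<le> i \<Longrightarrow> \<delta> (best i y) y \<le> \<delta> j y" for i j y
  proof -
    have "\<exists>m. m \<in> {..i} \<and> (\<forall>j\<in>{..i}. \<delta> m y \<le> \<delta> j y)"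
    proof -
      have "Min ((\<lambda>m. \<delta> m y) ` {..i}) \<in> (\<lambda>m. \<delta> m y) ` {..i}" by (rule Min_in) auto
      then obtain m where m: "m \<in> {..i}" "Min ((\<lambda>m. \<delta> m y) ` {..i}) = \<delta> m y" by blast
      have "\<delta> m y \<le> \<delta> j y" if "j \<in> {..i}" for j
        unfolding m(2)[symmetric] using that by (intro Min_le) auto
      then show ?thesis using m(1) by blast
    qed
    from LeastI_ex[OF this] show "best i y \<le> i" "j \<le> i \<Longrightarrow> \<delta> (best i y) y \<le> \<delta> j y"
      unfolding best_def[symmetric] by auto
  qed
  have bm: "best i \<in> measurable borel (count_space UNIV)" for i
    unfolding best_def[abs_def] by (intro measurable_Least) measurable
  define idx where "idx i y = (if y \<in> cball 0 (real i) then best i y else 0)" for i and y :: 'b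
  have idx0: "\<delta> (idx i y) y \<le> \<delta> 0 y" for i y using best(2)[of 0 i y] by (auto simp: idx_def)
  have "simple_function lborel (idx i)" for i
    unfolding simple_function_def
  proof (intro conjI ballI)
    have "idx i ` space lborel \<subseteq> {..i}" using best(1)[of i] by (auto simp: idx_def)
    then show "finite (idx i ` space lborel)" by (rule finite_subset) simp
    have [measurable]: "best i \<in> measurable borel (count_space UNIV)" by (rule bm)
    have [measurable]: "cball (0::'b) (real i) \<in> sets borel" by simp
    have "idx i \<in> measurable borel (count_space UNIV)" unfolding idx_def[abs_def] by measurable
    then show "idx i -` {m} \<inter> space lborel \<in> sets lborel" for m
      using measurable_sets[of "idx i" borel "count_space UNIV" "{m}"] by simp
  qed
  then have sf: "simple_function lebesgue (\<lambda>y. d (idx i y))" for i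
    by (rule simple_function_completion[OF simple_function_compose1])
  have key: "ae y. \<forall>m. ennreal (nrm (LX q U) (F y - d m)) = \<delta> m y"
    using representsD(3)[OF rep]
  proof eventually_elim
    case (elim y)
    show ?case unfolding \<delta>_def using LX_diff(2)[OF U q elim vec d_rep d_vec] by blast
  qed
  show ?thesis
  proof (rule that)
    show "simple_function lebesgue (\<lambda>y. d (idx i y))" for i by (rule sf)
    show "d (idx i y) \<in> vectors (LX q U)" for i y by (rule d_vec)
    show "d (idx i y) = 0" if "y \<notin> cball 0 (real i)" for i y using that by (simp add: idx_def d0)
    show "ae y. \<forall>i. nrm (LX q U) (F y - d (idx i y)) \<le> nrm (LX q U) (F y)"
      using key
    proof eventually_elim
      case (elim y)
      have "ennreal (nrm (LX q U) (F y - d (idx i y))) \<le> ennreal (nrm (LX q U) (F y))" for i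
      proof -
        have "ennreal (nrm (LX q U) (F y)) = \<delta> 0 y" using elim[rule_format, of 0] unfolding d0 diff_0_right .
        then show ?thesis using idx0[of i y] unfolding elim[rule_format] by simp
      qed
      then show ?case by (simp add: nrm_Leb_space_nonneg)
    qed
    show "ae y. (\<lambda>i. nrm (LX q U) (F y - d (idx i y))) \<longlonglongrightarrow> 0"
      using key representsD(3)[OF rep]
    proof eventually_elim
      case (elim y)
      have hy: "(\<lambda>x. h (y, x)) \<in> borel_fun" by (rule borel_section[OF hm])
      have hf: "Lq q (\<lambda>x. h (y, x)) < \<top>" using vectors_LX_iff[OF U elim(2) q0] vec by blast
      show ?case
      proof (rule LIMSEQ_I)
        fix e :: real assume e: "0 < e"
        obtain m where m: "Lq q (\<lambda>x. h (y, x) - D m x) \<le> ennreal (e / 2)" using dense[OF hy hf, of "e / 2"] e by auto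
        have "\<delta> m y \<le> Lq q (\<lambda>x. h (y, x) - D m x)"
          unfolding \<delta>_def using representsD(2)[OF rep] by (intro Lq_mono[OF q0]) (auto simp: d_def indicator_def)
        with m have dm: "\<delta> m y \<le> ennreal (e / 2)" by (rule order_trans[rotated])
        obtain N where N: "norm y \<le> real N" using real_arch_simple by blast
        have "norm (nrm (LX q U) (F y - d (idx i y)) - 0) < e" if i: "i \<ge> max m N" for i
        proof -
          have "y \<in> cball 0 (real i)" using N i by simp
          then have "\<delta> (idx i y) y \<le> \<delta> m y" using best(2)[of m i y] i by (simp add: idx_def)
          then have "ennreal (nrm (LX q U) (F y - d (idx i y))) \<le> ennreal (e / 2)"
            unfolding elim(1)[rule_format] using dm by (rule order_trans)
          then show ?thesis using e by (simp add: nrm_Leb_space_nonneg)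
        qed
        then show "\<exists>n0. \<forall>i\<ge>n0. norm (nrm (LX q U) (F y - d (idx i y)) - 0) < e" by blast
      qed
    qed
  qed
qed

lemma represents_strongly_measurable:
  fixes F :: "'b::euclidean_space \<Rightarrow> 'a::euclidean_space \<Rightarrow> 'k::{real_normed_field, euclidean_space}"
  assumes "open U" "1 < q" "represents U F h" and vec: "\<And>y. F y \<in> vectors (LX q U)"
  shows "strongly_measurable lebesgue (LX q U) F"
proof (rule simple_approximation[OF assms])
  fix \<sigma> :: "nat \<Rightarrow> 'b \<Rightarrow> 'a \<Rightarrow> 'k"
  assume "\<And>i. simple_function lebesgue (\<sigma> i)" "\<And>i y. \<sigma> i y \<in> vectors (LX q U)"
    and "ae y. (\<lambda>i. nrm (LX q U) (F y - \<sigma> i y)) \<longlonglongrightarrow> 0"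
  then show ?thesis unfolding strongly_measurable_def using vec
    by (intro conjI exI[of _ \<sigma>]) (auto simp: AE_completion_iff)
qed

lemma norm_integral_le_nn_integral:
  fixes f :: "'a \<Rightarrow> 'b::{banach, second_countable_topology}"
  shows "enorm (\<integral>x. f x \<partial>M) \<le> (\<integral>\<^sup>+x. enorm (f x) \<partial>M)"
proof (cases "integrable M f")
  case True then show ?thesis by (rule integral_norm_bound_ennreal)
next
  case False then show ?thesis by (simp add: not_integrable_integral_eq)
qed

text \<open>Minkowski's inequality bounds the space norm of the integral of the absolute values. If
  that bound is finite, the sections are integrable for almost every x, and integrating pointwise
  becomes a candidate for the Bochner integral.\<close>

lemma
  fixes g :: "'b::euclidean_space \<times> 'a::euclidean_space \<Rightarrow> 'k::{banach, second_countable_topology}"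
  assumes q: "1 < q" and g: "g \<in> borel_fun"
  shows Lq_nn_integral_le: "epow (NN x. epow (NN s. enorm (g (s, x))) q) (1 / q)
      \<le> 2 * (NN s. Lq q (\<lambda>x. g (s, x)))" (is "?A \<le> ?B")
    and Lq_integral_le: "Lq q (\<lambda>x. \<integral>s. g (s, x) \<partial>lborel) \<le> 2 * (NN s. Lq q (\<lambda>x. g (s, x)))"
    and AE_integrable_Lq: "(NN s. Lq q (\<lambda>x. g (s, x))) < \<top> \<Longrightarrow> ae x. integrable lborel (\<lambda>s. g (s, x))"
    and borel_measurable_integral_section: "(\<lambda>x. \<integral>s. g (s, x) \<partial>lborel) \<in> borel_fun"
proof -
  have gm [measurable]: "g \<in> borel_measurable (borel \<Otimes>\<^sub>M borel)" using g by (simp add: borel_prod)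
  have "(\<lambda>z. enorm (g z)) \<in> borel_measurable (lborel \<Otimes>\<^sub>M lborel)" by measurable
  from minkowski_integral[OF sigma_finite_lborel sigma_finite_lborel this q]
  show *: "?A \<le> ?B" by (simp add: Lq_def)
  have "Lq q (\<lambda>x. \<integral>s. g (s, x) \<partial>lborel) \<le> ?A"
    unfolding Lq_def using q by (intro epow_mono nn_integral_mono norm_integral_le_nn_integral) auto
  with * show "Lq q (\<lambda>x. \<integral>s. g (s, x) \<partial>lborel) \<le> 2 * (NN s. Lq q (\<lambda>x. g (s, x)))" by (rule order_trans[rotated])
  show "ae x. integrable lborel (\<lambda>s. g (s, x))" if fin: "(NN s. Lq q (\<lambda>x. g (s, x))) < \<top>"
  proof -
    have "?B < \<top>" using fin by (simp add: ennreal_mult_less_top)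
    with * have "?A < \<top>" by (rule le_less_trans)
    then have "(NN x. epow (NN s. enorm (g (s, x))) q) \<noteq> \<infinity>"
      by (auto simp: ennreal_powr_def)
    then have "ae x. epow (NN s. enorm (g (s, x))) q \<noteq> \<infinity>"
      by (intro nn_integral_PInf_AE) measurable
    then show ?thesis
    proof eventually_elim
      case (elim x)
      then have "(NN s. enorm (g (s, x))) \<noteq> \<infinity>" by (auto simp: ennreal_powr_def)
      moreover have "(\<lambda>s. g (s, x)) \<in> borel_measurable lborel" by measurable
      ultimately show ?case by (intro integrableI_bounded) (auto simp: top.not_eq_extremum)
    qed
  qed
  have "(\<lambda>x. \<integral>s. (\<lambda>(x, s). g (s, x)) (x, s) \<partial>lborel) \<in> borel_fun" by measurable
  then show "(\<lambda>x. \<integral>s. g (s, x) \<partial>lborel) \<in> borel_fun" by simp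
qed


lemma has_bochner_integral_sum_indicator:
  fixes r :: "'c \<Rightarrow> 'a \<Rightarrow> 'k::{real_normed_field, euclidean_space}"
  assumes "finite V" and A: "\<And>v. v \<in> V \<Longrightarrow> A v \<in> sets lborel"
    and fin: "\<And>v. v \<in> V \<Longrightarrow> emeasure lborel (A v) = \<infinity> \<Longrightarrow> r v = (\<lambda>_. 0)"
  shows "has_bochner_integral lborel (\<lambda>s. \<Sum>v\<in>V. indicator (A v) s *\<^sub>R r v x) (\<Sum>v\<in>V. measure lborel (A v) *\<^sub>R r v x)"
proof (rule has_bochner_integral_sum)
  fix v assume v: "v \<in> V"
  show "has_bochner_integral lborel (\<lambda>s. indicator (A v) s *\<^sub>R r v x) (measure lborel (A v) *\<^sub>R r v x)"
  proof (cases "emeasure lborel (A v) = \<infinity>")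
    case True
    then show ?thesis using fin[OF v] by (simp add: has_bochner_integral_zero measure_def)
  next
    case False
    then show ?thesis using A[OF v] by (intro has_bochner_integral_scaleR_left has_bochner_integral_real_indicator) (auto simp: top.not_eq_extremum)
  qed
qed


lemma represents1_sum:
  assumes "\<And>v. v \<in> V \<Longrightarrow> represents1 U (f v) (r v)"
  shows "represents1 U (\<Sum>v\<in>V. f v) (\<lambda>x. \<Sum>v\<in>V. r v x)"
  using assms
proof (induction V rule: infinite_finite_induct)
  case (insert v V)
  then have "represents1 U (f v + (\<Sum>v\<in>V. f v)) (\<lambda>x. r v x + (\<Sum>v\<in>V. r v x))"
    by (intro represents1_add) auto
  then show ?case unfolding sum.insert[OF insert(1,2)] .
qed (auto simp: represents1_0)

lemma simple_integral_represents:
  fixes \<sigma> :: "'b::euclidean_space \<Rightarrow> 'a::euclidean_space \<Rightarrow> 'k::{real_normed_field, euclidean_space}"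
  assumes U: "open U" and sf: "simple_function lebesgue \<sigma>" and vec: "\<And>y. \<sigma> y \<in> vectors (LX q U)"
    and fin: "emeasure lebesgue {y. \<sigma> y \<noteq> 0} \<noteq> \<infinity>"
  obtains g where "represents U \<sigma> g" "\<And>x. integrable lborel (\<lambda>s. g (s, x))"
    "represents1 U (simple_integral_in lebesgue (LX q U) \<sigma>) (\<lambda>x. \<integral>s. g (s, x) \<partial>lborel)"
proof -
  obtain \<sigma>' where \<sigma>': "simple_function lborel \<sigma>'" "ae y. \<sigma> y = \<sigma>' y"
    using completion_ex_simple_function[OF sf] by blast
  define V where "V = range \<sigma>"
  have V: "finite V" using sf by (simp add: V_def simple_function_def)
  \<comment> \<open>The value 0 may be taken on a set of infinite measure, so its representative has
    to vanish at every point for the sections in s to be integrable for all x.\<close>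
  have "\<exists>g. represents1 U v g \<and> (v = 0 \<longrightarrow> g = (\<lambda>_. 0))" if v: "v \<in> V" for v
  proof (cases "v = 0")
    case True
    then show ?thesis using represents1_0 by blast
  next
    case False
    then show ?thesis using v vec represents1_vectors_ex[OF U] unfolding V_def by blast
  qed
  then obtain r where r: "\<And>v. v \<in> V \<Longrightarrow> represents1 U v (r v)" "\<And>v. v \<in> V \<Longrightarrow> v = 0 \<Longrightarrow> r v = (\<lambda>_. 0)" by metis
  define g where "g z = (\<Sum>v\<in>V. indicator (\<sigma>' -` {v}) (fst z) *\<^sub>R r v (snd z))" for z
  have A: "\<sigma>' -` {v} \<in> sets borel" for v using simple_functionD(2)[OF \<sigma>'(1), of "{v}"] by simp
  have B: "{y. \<sigma> y = v} \<in> sets lebesgue" for v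
    using simple_functionD(2)[OF sf, of "{v}"] by (simp add: vimage_def)
  have em: "emeasure lborel (\<sigma>' -` {v}) = emeasure lebesgue {y. \<sigma> y = v}" for v
  proof -
    have "emeasure lborel (\<sigma>' -` {v}) = emeasure lebesgue (\<sigma>' -` {v})" using A[of v] by simp
    also have "\<dots> = emeasure lebesgue {y. \<sigma> y = v}"
    proof (rule emeasure_eq_AE)
      have "AE y in lebesgue. \<sigma> y = \<sigma>' y" using \<sigma>'(2) by (simp add: AE_completion_iff)
      then show "AE y in lebesgue. y \<in> \<sigma>' -` {v} \<longleftrightarrow> y \<in> {y. \<sigma> y = v}" by eventually_elim auto
    qed (use A[of v] B[of v] in auto)
    finally show ?thesis .
  qed
  have zero: "r v = (\<lambda>_. 0)" if v: "v \<in> V" "emeasure lborel (\<sigma>' -` {v}) = \<infinity>" for v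
  proof (rule r(2)[OF v(1)], rule ccontr)
    assume "v \<noteq> 0"
    have N: "{y. \<sigma> y \<noteq> 0} \<in> sets lebesgue" using B[of 0] sets.compl_sets[OF B[of 0]] by (simp add: Collect_neg_eq Compl_eq_Diff_UNIV)
    have "emeasure lebesgue {y. \<sigma> y = v} \<le> emeasure lebesgue {y. \<sigma> y \<noteq> 0}"
      using \<open>v \<noteq> 0\<close> N by (intro emeasure_mono) auto
    then show False using v(2) fin unfolding em by (simp add: top_unique)
  qed
  have int: "has_bochner_integral lborel (\<lambda>s. g (s, x)) (\<Sum>v\<in>V. measure lborel (\<sigma>' -` {v}) *\<^sub>R r v x)" for x
    unfolding g_def fst_conv snd_conv using A zero by (intro has_bochner_integral_sum_indicator V) auto
  show ?thesis
  proof (rule that)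
    show "represents U \<sigma> g"
    proof (rule representsI)
      have rm: "v \<in> V \<Longrightarrow> r v \<in> borel_fun" for v using r(1)[of v] by (simp add: represents1_def)
      show "g \<in> borel_fun"
        unfolding g_def[abs_def] using A
        by (intro borel_measurable_sum borel_measurable_scaleR measurable_compose[OF _ rm] measurable_compose[OF _ borel_measurable_indicator])
          (auto simp: borel_prod[symmetric])
      show "g (y, x) = 0" if "x \<notin> U" for x y
        using r(1) that by (auto simp: g_def represents1_def)
      show "ae y. represents1 U (\<sigma> y) (\<lambda>x. g (y, x))"
        using \<sigma>'(2)
      proof eventually_elim
        case (elim y)
        have vy: "\<sigma> y \<in> V" by (simp add: V_def)
        have "g (y, x) = r (\<sigma> y) x" for x
        proof -
          have "g (y, x) = (\<Sum>v\<in>V. if v = \<sigma> y then r v x else 0)"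
            unfolding g_def fst_conv snd_conv by (intro sum.cong refl indicator_scaleR_if) (auto simp: elim)
          also have "\<dots> = (if \<sigma> y \<in> V then r (\<sigma> y) x else 0)" by (rule sum.delta[OF V])
          finally show ?thesis using vy by simp
        qed
        then show ?case using r(1)[OF vy] by simp
      qed
    qed
    show "integrable lborel (\<lambda>s. g (s, x))" for x using int by (rule integrable.intros)
    have "simple_integral_in lebesgue (LX q U) \<sigma> = (\<Sum>v\<in>V. (\<lambda>x. of_real (measure lborel (\<sigma>' -` {v})) * v x))"
      using em by (simp add: simple_integral_in_def Leb_space_def V_def measure_def)
    moreover have "represents1 U \<dots> (\<lambda>x. \<Sum>v\<in>V. of_real (measure lborel (\<sigma>' -` {v})) * r v x)"
      using r(1) by (intro represents1_sum represents1_cmult)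
    moreover have "(\<Sum>v\<in>V. of_real (measure lborel (\<sigma>' -` {v})) * r v x) = (\<integral>s. g (s, x) \<partial>lborel)" for x
      using has_bochner_integral_integral_eq[OF int[of x]] by (simp add: scaleR_conv_of_real)
    ultimately show "represents1 U (simple_integral_in lebesgue (LX q U) \<sigma>) (\<lambda>x. \<integral>s. g (s, x) \<partial>lborel)" by simp
  qed
qed


lemma Lq_cong_AE:
  assumes "ae x. norm (f x) = norm (g x)"
  shows "Lq q f = Lq q g"
  unfolding Lq_def
  by (intro arg_cong[where f = "\<lambda>a. epow a (1 / q)"] nn_integral_cong_AE eventually_mono[OF assms]) simp

lemma AE_eq_0_if_Lq_eq_0:
  fixes f :: "'a::euclidean_space \<Rightarrow> 'k::{real_normed_vector, second_countable_topology}"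
  assumes [measurable]: "f \<in> borel_fun" and "Lq q f = 0" and q: "0 < q"
  shows "ae x. f x = 0"
proof -
  have "(NN x. epow (enorm (f x)) q) = 0"
    using Lq_powr[OF q, of f] assms(2) by (simp add: ennreal_powr_def)
  then have "ae x. epow (enorm (f x)) q = 0"
    by (subst (asm) nn_integral_0_iff_AE) auto
  then show ?thesis
    by eventually_elim (use q in \<open>auto simp: epow_ennreal\<close>)
qed

text \<open>Common to identification and existence of Bochner integrals: a simple integral is the
  pointwise integral of a representative, and Minkowski's inequality compares it with the pointwise
  integral of h.\<close>

lemma simple_integral_close:
  fixes F :: "'b::euclidean_space \<Rightarrow> 'a::euclidean_space \<Rightarrow> 'k::{real_normed_field, euclidean_space}"
  assumes U: "open U" and q: "1 < q" and rep: "represents U F h" and vec: "\<And>y. F y \<in> vectors (LX q U)"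
    and hf: "(NN s. Lq q (\<lambda>x. h (s, x))) < \<top>"
    and sf: "simple_function lebesgue \<sigma>" and svec: "\<And>y. \<sigma> y \<in> vectors (LX q U)"
    and fin: "emeasure lebesgue {y. \<sigma> y \<noteq> 0} \<noteq> \<infinity>"
  obtains u where "represents1 U (simple_integral_in lebesgue (LX q U) \<sigma>) u"
    "Lq q (\<lambda>x. u x - (\<integral>s. h (s, x) \<partial>lborel)) \<le> 2 * (\<integral>\<^sup>+s. ennreal (nrm (LX q U) (F s - \<sigma> s)) \<partial>lebesgue)"
proof -
  obtain g where g: "represents U \<sigma> g" "\<And>x. integrable lborel (\<lambda>s. g (s, x))"
    "represents1 U (simple_integral_in lebesgue (LX q U) \<sigma>) (\<lambda>x. \<integral>s. g (s, x) \<partial>lborel)"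
    by (rule simple_integral_represents[OF U sf svec fin]) blast
  have hm: "h \<in> borel_fun" using rep by (rule representsD)
  have gm: "g \<in> borel_fun" using g(1) by (rule representsD)
  have dm: "(\<lambda>z. g z - h z) \<in> borel_fun" by (intro borel_measurable_diff gm hm)
  have "Lq q (\<lambda>x. (\<integral>s. g (s, x) \<partial>lborel) - (\<integral>s. h (s, x) \<partial>lborel)) = Lq q (\<lambda>x. \<integral>s. g (s, x) - h (s, x) \<partial>lborel)"
  proof (rule Lq_cong_AE)
    show "ae x. norm ((\<integral>s. g (s, x) \<partial>lborel) - (\<integral>s. h (s, x) \<partial>lborel)) = norm (\<integral>s. g (s, x) - h (s, x) \<partial>lborel)"
      using AE_integrable_Lq[OF q hm hf]
    proof eventually_elim
      case (elim x)
      show ?case by (subst Bochner_Integration.integral_diff[OF g(2) elim]) simp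
    qed
  qed
  also have "\<dots> \<le> 2 * (NN s. Lq q (\<lambda>x. g (s, x) - h (s, x)))" by (rule Lq_integral_le[OF q dm])
  also have "(NN s. Lq q (\<lambda>x. g (s, x) - h (s, x))) = (NN s. ennreal (nrm (LX q U) (F s - \<sigma> s)))"
  proof (rule nn_integral_cong_AE)
    show "ae s. Lq q (\<lambda>x. g (s, x) - h (s, x)) = ennreal (nrm (LX q U) (F s - \<sigma> s))"
      using representsD(3)[OF rep] representsD(3)[OF g(1)]
    proof eventually_elim
      case (elim s)
      show ?case
        unfolding LX_diff(2)[OF U q elim(1) vec elim(2) svec] by (rule Lq_cong_AE) (simp add: norm_minus_commute)
    qed
  qed
  also have "\<dots> = (\<integral>\<^sup>+s. ennreal (nrm (LX q U) (F s - \<sigma> s)) \<partial>lebesgue)" by (simp add: nn_integral_completion)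
  finally show ?thesis using g(3) that by blast
qed

lemma represents1_integral:
  fixes h :: "'b::euclidean_space \<times> 'a::euclidean_space \<Rightarrow> 'k::{real_normed_field, euclidean_space}" and q :: real
  assumes U: "open U" and q: "1 < q" and rep: "represents U F h"
    and v: "represents1 U v v'" "ae x. v' x = (\<integral>s. h (s, x) \<partial>lborel)"
  shows "represents1 U v (\<lambda>x. \<integral>s. h (s, x) \<partial>lborel)"
  unfolding represents1_def
proof (intro conjI allI impI)
  show "(\<lambda>x. \<integral>s. h (s, x) \<partial>lborel) \<in> borel_fun"
    by (rule borel_measurable_integral_section[OF q representsD(1)[OF rep]])
  show "(\<integral>s. h (s, x) \<partial>lborel) = 0" if "x \<notin> U" for x using representsD(2)[OF rep that] by simp
  have "ae x. x \<in> U \<longrightarrow> v x = v' x" using v(1) by (simp add: represents1_def)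
  with v(2) show "ae x. x \<in> U \<longrightarrow> v x = (\<integral>s. h (s, x) \<partial>lborel)" by eventually_elim simp
qed

text \<open>\<open>bochner_integral_in\<close> selects an arbitrary admissible value, so every such
  value has to be identified. Its defining sequence has simple integrals close both to v and to the
  pointwise integral of h.\<close>

lemma bochner_integral_represents:
  fixes F :: "'b::euclidean_space \<Rightarrow> 'a::euclidean_space \<Rightarrow> 'k::{real_normed_field, euclidean_space}"
  assumes U: "open U" and q: "1 < q" and rep: "represents U F h" and vec: "\<And>y. F y \<in> vectors (LX q U)"
    and hf: "(NN s. Lq q (\<lambda>x. h (s, x))) < \<top>"
    and v: "has_bochner_integral_in lebesgue (LX q U) F v"
  shows "represents1 U v (\<lambda>x. \<integral>s. h (s, x) \<partial>lborel)"
proof -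
  have q0: "0 < q" using q by simp
  let ?v0 = "\<lambda>x. \<integral>s. h (s, x) \<partial>lborel"
  have v0m: "?v0 \<in> borel_fun" by (rule borel_measurable_integral_section[OF q representsD(1)[OF rep]])
  obtain \<sigma> where sf: "\<And>i. simple_function lebesgue (\<sigma> i)" and svec: "\<And>i y. \<sigma> i y \<in> vectors (LX q U)"
    and fin: "\<And>i. emeasure lebesgue {y. \<sigma> i y \<noteq> 0} \<noteq> \<infinity>"
    and lim1: "(\<lambda>i. \<integral>\<^sup>+s. ennreal (nrm (LX q U) (F s - \<sigma> i s)) \<partial>lebesgue) \<longlonglongrightarrow> 0"
    and lim2: "(\<lambda>i. nrm (LX q U) (simple_integral_in lebesgue (LX q U) (\<sigma> i) - v)) \<longlonglongrightarrow> 0"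
    and vv: "v \<in> vectors (LX q U)"
    using v by (auto simp: has_bochner_integral_in_def)
  obtain v' where v': "represents1 U v v'" by (rule represents1_vectors_ex[OF U vv])
  have v'm: "v' \<in> borel_fun" using v' by (simp add: represents1_def)
  have v'f: "Lq q v' < \<top>" using vv vectors_LX_iff[OF U v' q0] by simp
  have "2 * (NN s. Lq q (\<lambda>x. h (s, x))) < \<top>" using hf by (simp add: ennreal_mult_less_top)
  with Lq_integral_le[OF q representsD(1)[OF rep]] have v0f: "Lq q ?v0 < \<top>" by (rule le_less_trans)
  have "Lq q (\<lambda>x. v' x - ?v0 x) \<le> 0"
  proof (rule ennreal_le_epsilon)
    fix e :: real assume e: "0 < e"
    \<comment> \<open>e/16 is doubled by \<open>simple_integral_close\<close>, and e/8 is the share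
      that the factor 4 of \<open>Lq_triangle\<close> leaves to each of two terms.\<close>
    have "\<forall>\<^sub>F i in sequentially. (\<integral>\<^sup>+s. ennreal (nrm (LX q U) (F s - \<sigma> i s)) \<partial>lebesgue) < ennreal (e / 16)"
      using lim1 e by (intro order_tendstoD(2)) auto
    moreover have "\<forall>\<^sub>F i in sequentially. nrm (LX q U) (simple_integral_in lebesgue (LX q U) (\<sigma> i) - v) < e / 8"
      using lim2 e by (intro order_tendstoD(2)) auto
    ultimately have "\<forall>\<^sub>F i in sequentially. (\<integral>\<^sup>+s. ennreal (nrm (LX q U) (F s - \<sigma> i s)) \<partial>lebesgue) < ennreal (e / 16)
      \<and> nrm (LX q U) (simple_integral_in lebesgue (LX q U) (\<sigma> i) - v) < e / 8"
      by (rule eventually_conj)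
    then obtain i where i1: "(\<integral>\<^sup>+s. ennreal (nrm (LX q U) (F s - \<sigma> i s)) \<partial>lebesgue) < ennreal (e / 16)"
      and i2: "nrm (LX q U) (simple_integral_in lebesgue (LX q U) (\<sigma> i) - v) < e / 8"
      unfolding eventually_sequentially by blast
    obtain u where u: "represents1 U (simple_integral_in lebesgue (LX q U) (\<sigma> i)) u"
      and uc: "Lq q (\<lambda>x. u x - ?v0 x) \<le> 2 * (\<integral>\<^sup>+s. ennreal (nrm (LX q U) (F s - \<sigma> i s)) \<partial>lebesgue)"
      by (rule simple_integral_close[OF U q rep vec hf sf svec fin])
    have um: "u \<in> borel_fun" using u by (simp add: represents1_def)
    have "Lq q (\<lambda>x. u x - ?v0 x) \<le> 2 * ennreal (e / 16)"
      by (rule order_trans[OF uc]) (intro mult_left_mono less_imp_le[OF i1] zero_le)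
    also have "2 * ennreal (e / 16) = ennreal (e / 8)"
      using e ennreal_mult[of 2 "e / 16"] by simp
    finally have c1: "Lq q (\<lambda>x. u x - ?v0 x) \<le> ennreal (e / 8)" .
    have "Lq q u \<le> 4 * (Lq q (\<lambda>x. u x - ?v0 x) + Lq q ?v0)"
      using norm_diff_triangle_ineq'[of "u _" 0 "?v0 _"] um v0m by (intro Lq_triangle[OF q] borel_measurable_diff) auto
    also have "\<dots> < \<top>" using c1 v0f by (simp add: ennreal_mult_less_top le_less_trans[OF c1])
    finally have uv: "simple_integral_in lebesgue (LX q U) (\<sigma> i) \<in> vectors (LX q U)"
      by (simp add: vectors_LX_iff[OF U u q0])
    have c2: "Lq q (\<lambda>x. u x - v' x) \<le> ennreal (e / 8)"
      unfolding LX_diff(2)[OF U q u uv v' vv, symmetric] using i2 by (intro ennreal_leI) simp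
    have "Lq q (\<lambda>x. v' x - ?v0 x) \<le> 4 * (Lq q (\<lambda>x. u x - v' x) + Lq q (\<lambda>x. u x - ?v0 x))"
    proof (rule Lq_triangle[OF q])
      show "norm (v' x - ?v0 x) \<le> norm (u x - v' x) + norm (u x - ?v0 x)" for x
        using norm_diff_triangle_ineq'[of "v' x" "?v0 x" "u x"] by (simp add: norm_minus_commute)
    qed (intro borel_measurable_diff um v'm v0m)+
    also have "\<dots> \<le> 4 * (ennreal (e / 8) + ennreal (e / 8))" by (intro mult_left_mono add_mono c1 c2 zero_le)
    also have "\<dots> = ennreal (8 * (e / 8))" using e by (intro four_mult_add) simp
    finally show "Lq q (\<lambda>x. v' x - ?v0 x) \<le> 0 + ennreal e" using e by simp
  qed
  then have "ae x. v' x - ?v0 x = 0"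
    by (intro AE_eq_0_if_Lq_eq_0[where q = q] borel_measurable_diff v'm v0m q0) simp
  then have "ae x. v' x = ?v0 x" by simp
  then show ?thesis by (rule represents1_integral[OF U q rep v'])
qed

text \<open>The errors of the simple approximants are dominated by the integrable norm of F, so
  their integrals tend to 0; the simple integrals then converge to the pointwise integral by the
  comparison above.\<close>

lemma has_bochner_integral_inI:
  fixes F :: "'b::euclidean_space \<Rightarrow> 'a::euclidean_space \<Rightarrow> 'k::{real_normed_field, euclidean_space}"
  assumes U: "open U" and q: "1 < q" and rep: "represents U F h" and vec: "\<And>y. F y \<in> vectors (LX q U)"
    and hf: "(NN s. Lq q (\<lambda>x. h (s, x))) < \<top>"
  shows "has_bochner_integral_in lebesgue (LX q U) F (\<lambda>x. \<integral>s. h (s, x) \<partial>lborel)"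
proof (rule simple_approximation[OF U q rep vec])
  fix \<sigma> :: "nat \<Rightarrow> 'b \<Rightarrow> 'a \<Rightarrow> 'k"
  assume sf: "\<And>i. simple_function lebesgue (\<sigma> i)" and svec: "\<And>i y. \<sigma> i y \<in> vectors (LX q U)"
    and supp: "\<And>i y. y \<notin> cball 0 (real i) \<Longrightarrow> \<sigma> i y = 0"
    and lim: "ae y. (\<lambda>i. nrm (LX q U) (F y - \<sigma> i y)) \<longlonglongrightarrow> 0"
    and dom: "ae y. \<forall>i. nrm (LX q U) (F y - \<sigma> i y) \<le> nrm (LX q U) (F y)"
  have q0: "0 < q" using q by simp
  let ?v0 = "\<lambda>x. \<integral>s. h (s, x) \<partial>lborel"
  have hm: "h \<in> borel_fun" by (rule representsD[OF rep])
  have v0m: "?v0 \<in> borel_fun" by (rule borel_measurable_integral_section[OF q hm])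
  have v0r: "represents1 U ?v0 ?v0" using v0m representsD(2)[OF rep] by (simp add: represents1_def)
  have "2 * (NN s. Lq q (\<lambda>x. h (s, x))) < \<top>" using hf by (simp add: ennreal_mult_less_top)
  with Lq_integral_le[OF q hm] have v0f: "Lq q ?v0 < \<top>" by (rule le_less_trans)
  have v0v: "?v0 \<in> vectors (LX q U)" using v0f vectors_LX_iff[OF U v0r q0] by simp
  have fin: "emeasure lebesgue {y. \<sigma> i y \<noteq> 0} \<noteq> \<infinity>" for i
  proof -
    have "emeasure lebesgue {y. \<sigma> i y \<noteq> 0} \<le> emeasure lebesgue (cball (0::'b) (real i))"
      using supp by (intro emeasure_mono) auto
    also have "\<dots> < \<infinity>" using emeasure_lborel_cball_finite[of "0::'b" "real i"] by simp
    finally show ?thesis by simp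
  qed
  have lim1: "(\<lambda>i. \<integral>\<^sup>+s. ennreal (nrm (LX q U) (F s - \<sigma> i s)) \<partial>lebesgue) \<longlonglongrightarrow> 0"
  proof -
    have "\<exists>g. represents U (\<sigma> i) g" for i using represents_simple[OF U sf svec] by blast
    then obtain g where g: "\<And>i. represents U (\<sigma> i) (g i)" by metis
    have gm: "g i \<in> borel_fun" for i by (rule representsD[OF g])
    have "ae y. \<forall>i. represents1 U (\<sigma> i y) (\<lambda>x. g i (y, x))"
      unfolding AE_all_countable using representsD(3)[OF g] by blast
    then have eq: "ae s. (\<forall>i. ennreal (nrm (LX q U) (F s - \<sigma> i s)) = Lq q (\<lambda>x. h (s, x) - g i (s, x)))
      \<and> ennreal (nrm (LX q U) (F s)) = Lq q (\<lambda>x. h (s, x))"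
      using representsD(3)[OF rep]
    proof eventually_elim
      case (elim s)
      show ?case using LX_diff(2)[OF U q elim(2) vec elim(1)[rule_format] svec] nrm_LX[OF U elim(2) q0 vec] by blast
    qed
    have "(\<lambda>i. NN s. Lq q (\<lambda>x. h (s, x) - g i (s, x))) \<longlonglongrightarrow> (\<integral>\<^sup>+s. 0 \<partial>(lborel :: 'b measure))"
    proof (rule nn_integral_dominated_convergence)
      show "(\<lambda>s. Lq q (\<lambda>x. h (s, x) - g i (s, x))) \<in> borel_measurable lborel" for i
        using borel_measurable_Lq[of "\<lambda>z. h z - g i z" q] hm gm by (auto intro: borel_measurable_diff)
      show "(\<lambda>s. Lq q (\<lambda>x. h (s, x))) \<in> borel_measurable lborel"
        using borel_measurable_Lq[OF hm, of q] by simp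
      show "(NN s. Lq q (\<lambda>x. h (s, x))) < \<infinity>" using hf by simp
      show "ae s. Lq q (\<lambda>x. h (s, x) - g i (s, x)) \<le> Lq q (\<lambda>x. h (s, x))" for i
        using eq dom
      proof eventually_elim
        case (elim s)
        show ?case using elim(2)[rule_format, of i] elim(1) by (metis ennreal_leI)
      qed
      show "ae s. (\<lambda>i. Lq q (\<lambda>x. h (s, x) - g i (s, x))) \<longlonglongrightarrow> 0"
        using eq lim
      proof eventually_elim
        case (elim s)
        show ?case using tendsto_ennrealI[OF elim(2)] elim(1) by simp
      qed
    qed simp
    moreover have "(\<integral>\<^sup>+s. ennreal (nrm (LX q U) (F s - \<sigma> i s)) \<partial>lebesgue) = (NN s. Lq q (\<lambda>x. h (s, x) - g i (s, x)))" for i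
      unfolding nn_integral_completion by (rule nn_integral_cong_AE) (rule eventually_mono[OF eq], blast)
    ultimately show ?thesis by simp
  qed
  have lim2: "(\<lambda>i. nrm (LX q U) (simple_integral_in lebesgue (LX q U) (\<sigma> i) - ?v0)) \<longlonglongrightarrow> 0"
  proof (rule LIMSEQ_I)
    fix e :: real assume e: "0 < e"
    have "\<forall>\<^sub>F i in sequentially. (\<integral>\<^sup>+s. ennreal (nrm (LX q U) (F s - \<sigma> i s)) \<partial>lebesgue) < ennreal (e / 4)"
      using lim1 e by (intro order_tendstoD(2)) auto
    then obtain N where N: "\<And>i. i \<ge> N \<Longrightarrow> (\<integral>\<^sup>+s. ennreal (nrm (LX q U) (F s - \<sigma> i s)) \<partial>lebesgue) < ennreal (e / 4)"
      unfolding eventually_sequentially by blast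
    have "norm (nrm (LX q U) (simple_integral_in lebesgue (LX q U) (\<sigma> i) - ?v0) - 0) < e" if i: "i \<ge> N" for i
    proof -
      obtain u where u: "represents1 U (simple_integral_in lebesgue (LX q U) (\<sigma> i)) u"
        and uc: "Lq q (\<lambda>x. u x - ?v0 x) \<le> 2 * (\<integral>\<^sup>+s. ennreal (nrm (LX q U) (F s - \<sigma> i s)) \<partial>lebesgue)"
        by (rule simple_integral_close[OF U q rep vec hf sf svec fin])
      have um: "u \<in> borel_fun" using u by (simp add: represents1_def)
      have "Lq q (\<lambda>x. u x - ?v0 x) \<le> 2 * ennreal (e / 4)"
        by (rule order_trans[OF uc]) (intro mult_left_mono less_imp_le[OF N[OF i]] zero_le)
      also have "2 * ennreal (e / 4) = ennreal (e / 2)"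
        using e ennreal_mult[of 2 "e / 4"] by simp
      finally have c1: "Lq q (\<lambda>x. u x - ?v0 x) \<le> ennreal (e / 2)" .
      have "Lq q u \<le> 4 * (Lq q (\<lambda>x. u x - ?v0 x) + Lq q ?v0)"
        using norm_diff_triangle_ineq'[of "u _" 0 "?v0 _"] um v0m by (intro Lq_triangle[OF q] borel_measurable_diff) auto
      also have "\<dots> < \<top>" using v0f by (simp add: ennreal_mult_less_top le_less_trans[OF c1])
      finally have uv: "simple_integral_in lebesgue (LX q U) (\<sigma> i) \<in> vectors (LX q U)"
        by (simp add: vectors_LX_iff[OF U u q0])
      have "ennreal (nrm (LX q U) (simple_integral_in lebesgue (LX q U) (\<sigma> i) - ?v0)) \<le> ennreal (e / 2)"
        unfolding LX_diff(2)[OF U q u uv v0r v0v] by (rule c1)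
      then show ?thesis using e by (simp add: nrm_Leb_space_nonneg)
    qed
    then show "\<exists>N. \<forall>i\<ge>N. norm (nrm (LX q U) (simple_integral_in lebesgue (LX q U) (\<sigma> i) - ?v0) - 0) < e" by blast
  qed
  show ?thesis
    unfolding has_bochner_integral_in_def
  proof (intro conjI exI[of _ \<sigma>] allI)
    show "strongly_measurable lebesgue (LX q U) F" by (rule represents_strongly_measurable[OF U q rep vec])
  qed (use sf svec fin lim1 lim2 v0v in auto)
qed

section \<open>Khintchine's inequality\<close>

text \<open>d^r and d come from splitting into d coordinates, r^r from the inequality y \<le> r exp
  (y / r), and 2 exp (1/2) from the exponential moments of a normalized sum and of its
  negative.\<close>

definition khintchine_const :: "real \<Rightarrow> real \<Rightarrow> real" where
  "khintchine_const d r = d powr r * (d * (r powr r * (2 * exp (1 / 2))))"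

text \<open>The p-th power of the norm of L^p in time with values in L^q, allowed to be
  infinite.\<close>

definition mixed :: "real \<Rightarrow> real \<Rightarrow> (real \<times> 'a::euclidean_space \<Rightarrow> ennreal) \<Rightarrow> ennreal" where
  "mixed p q w = (NN t. epow (NN x. epow (w (t, x)) q) (p / q))"

locale rademacher = prob_space P for P :: "'p measure" +
  fixes \<epsilon> :: "nat \<Rightarrow> 'p \<Rightarrow> real"
  assumes indep: "indep_vars (\<lambda>_. borel) \<epsilon> {1..}"
    and half: "1 \<le> n \<Longrightarrow> prob {w\<in>space P. \<epsilon> n w = 1} = 1 / 2" "1 \<le> n \<Longrightarrow> prob {w\<in>space P. \<epsilon> n w = - 1} = 1 / 2"
begin

abbreviation nn_expectation :: "('p \<Rightarrow> ennreal) \<Rightarrow> ennreal" (binder "EE " 10)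
  where "nn_expectation f \<equiv> \<integral>\<^sup>+w. f w \<partial>P"

lemma rv: "1 \<le> n \<Longrightarrow> \<epsilon> n \<in> borel_measurable P"
  using indep by (auto simp: indep_vars_def)

lemma sign_sets: "1 \<le> n \<Longrightarrow> {w\<in>space P. \<epsilon> n w = c} \<in> sets P"
  using rv[of n] by measurable

lemma AE_sign: "1 \<le> n \<Longrightarrow> AE w in P. \<epsilon> n w = 1 \<or> \<epsilon> n w = - 1"
proof -
  assume n: "1 \<le> n"
  have "prob ({w\<in>space P. \<epsilon> n w = 1} \<union> {w\<in>space P. \<epsilon> n w = - 1})
    = prob {w\<in>space P. \<epsilon> n w = 1} + prob {w\<in>space P. \<epsilon> n w = - 1}"
    by (rule finite_measure_Union[OF sign_sets[OF n] sign_sets[OF n]]) auto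
  then have "prob ({w\<in>space P. \<epsilon> n w = 1} \<union> {w\<in>space P. \<epsilon> n w = - 1}) = 1" by (simp add: half[OF n])
  from AE_prob_1[OF this] show ?thesis by eventually_elim auto
qed

lemma nn_integral_sign:
  assumes n: "1 \<le> n"
  shows "(EE w. f (\<epsilon> n w)) = f 1 * ennreal (1 / 2) + f (- 1) * ennreal (1 / 2)"
proof -
  let ?A = "\<lambda>c. {w\<in>space P. \<epsilon> n w = c}"
  have "(EE w. f (\<epsilon> n w)) = (EE w. f 1 * indicator (?A 1) w + f (- 1) * indicator (?A (- 1)) w)"
  proof (rule nn_integral_cong_AE)
    show "AE w in P. f (\<epsilon> n w) = f 1 * indicator (?A 1) w + f (- 1) * indicator (?A (- 1)) w"
      using AE_sign[OF n] AE_space by eventually_elim (auto simp: indicator_def)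
  qed
  also have "\<dots> = f 1 * emeasure P (?A 1) + f (- 1) * emeasure P (?A (- 1))"
    using sign_sets[OF n] by (subst nn_integral_add) (auto simp: nn_integral_cmult_indicator)
  finally show ?thesis by (simp only: emeasure_eq_measure half[OF n])
qed

lemma expectation_sign:
  assumes n: "1 \<le> n"
  shows "integrable P (\<epsilon> n)" "expectation (\<epsilon> n) = 0" "AE w in P. \<epsilon> n w * \<epsilon> n w = 1"
proof -
  let ?A = "\<lambda>c. {w\<in>space P. \<epsilon> n w = c}"
  have [measurable]: "\<epsilon> n \<in> borel_measurable P" by (rule rv[OF n])
  show "integrable P (\<epsilon> n)"
    by (rule integrable_const_bound[of _ 1]) (use AE_sign[OF n] in \<open>auto elim!: eventually_mono\<close>)
  have "expectation (\<epsilon> n) = (\<integral>w. indicator (?A 1) w - indicator (?A (- 1)) w \<partial>P)"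
  proof (rule integral_cong_AE)
    show "AE w in P. \<epsilon> n w = indicator (?A 1) w - indicator (?A (- 1)) w"
      using AE_sign[OF n] AE_space by eventually_elim (auto simp: indicator_def)
  qed measurable
  also have "\<dots> = prob (?A 1) - prob (?A (- 1))"
    using sign_sets[OF n] by (subst Bochner_Integration.integral_diff) (auto simp: emeasure_eq_measure)
  finally show "expectation (\<epsilon> n) = 0" by (simp add: half[OF n])
  show "AE w in P. \<epsilon> n w * \<epsilon> n w = 1" using AE_sign[OF n] by eventually_elim auto
qed

lemma expectation_sign_mult:
  assumes m: "1 \<le> m" and n: "1 \<le> n"
  shows "integrable P (\<lambda>w. \<epsilon> m w * \<epsilon> n w)" "expectation (\<lambda>w. \<epsilon> m w * \<epsilon> n w) = (if m = n then 1 else 0)"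
proof -
  have [measurable]: "\<epsilon> n \<in> borel_measurable P" "\<epsilon> m \<in> borel_measurable P" by (intro rv m n)+
  show "integrable P (\<lambda>w. \<epsilon> m w * \<epsilon> n w)"
  proof (rule integrable_const_bound[of _ 1])
    show "AE w in P. norm (\<epsilon> m w * \<epsilon> n w) \<le> 1" using AE_sign[OF m] AE_sign[OF n] by eventually_elim auto
  qed measurable
  show "expectation (\<lambda>w. \<epsilon> m w * \<epsilon> n w) = (if m = n then 1 else 0)"
  proof (cases "m = n")
    case True
    have "expectation (\<lambda>w. \<epsilon> m w * \<epsilon> n w) = expectation (\<lambda>_. 1)"
      by (rule integral_cong_AE) (use expectation_sign(3)[OF n] True in \<open>auto\<close>)
    then show ?thesis using True by (simp add: prob_space)
  next
    case False
    have "expectation (\<lambda>w. \<Prod>i\<in>{m, n}. \<epsilon> i w) = (\<Prod>i\<in>{m, n}. expectation (\<epsilon> i))"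
      using m n expectation_sign(1) by (intro indep_vars_lebesgue_integral indep_vars_subset[OF indep]) auto
    then show ?thesis using False expectation_sign(2)[OF m] by simp
  qed
qed

lemma second_moment:
  fixes a :: "nat \<Rightarrow> real"
  shows "(EE w. ennreal ((\<Sum>n=1..N. \<epsilon> n w * a n)\<^sup>2)) = ennreal (\<Sum>n=1..N. (a n)\<^sup>2)"
proof -
  have sq: "(\<Sum>n=1..N. \<epsilon> n w * a n)\<^sup>2 = (\<Sum>m=1..N. \<Sum>n=1..N. (\<epsilon> m w * \<epsilon> n w) * (a m * a n))" for w
    unfolding power2_eq_square sum_product by (intro sum.cong refl) (simp add: mult_ac)
  have int: "has_bochner_integral P (\<lambda>w. (\<epsilon> m w * \<epsilon> n w) * (a m * a n)) ((if m = n then 1 else 0) * (a m * a n))"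
    if "m \<in> {1..N}" "n \<in> {1..N}" for m n
    using expectation_sign_mult[of m n] that
    by (intro has_bochner_integral_mult_left) (auto simp: has_bochner_integral_iff)
  have "has_bochner_integral P (\<lambda>w. (\<Sum>n=1..N. \<epsilon> n w * a n)\<^sup>2) (\<Sum>m=1..N. \<Sum>n=1..N. (if m = n then 1 else 0) * (a m * a n))"
    unfolding sq by (intro has_bochner_integral_sum int)
  moreover have "(\<Sum>m=1..N. \<Sum>n=1..N. (if m = n then 1 else 0) * (a m * a n)) = (\<Sum>n=1..N. (a n)\<^sup>2)"
    by (intro sum.cong refl) (simp add: power2_eq_square if_distrib if_distribR sum.delta cong: if_cong)
  ultimately have hb: "has_bochner_integral P (\<lambda>w. (\<Sum>n=1..N. \<epsilon> n w * a n)\<^sup>2) (\<Sum>n=1..N. (a n)\<^sup>2)" by simp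
  then show ?thesis
    using nn_integral_eq_integral[of P "\<lambda>w. (\<Sum>n=1..N. \<epsilon> n w * a n)\<^sup>2"] by (simp add: has_bochner_integral_iff)
qed

text \<open>This is Hoeffding's lemma for a fair sign: its auxiliary estimate at 2 x and probability
  1/2, multiplied by exp (- x). Negative x follows by symmetry.\<close>

lemma cosh_le_exp: "(exp x + exp (- x)) / 2 \<le> exp (x\<^sup>2 / 2)" for x :: real
proof -
  have *: "(exp x + exp (- x)) / 2 \<le> exp (x\<^sup>2 / 2)" if x: "0 \<le> x" for x :: real
  proof -
    have "- (2 * x) * (1 / 2) + ln (1 + 1 / 2 * (exp (2 * x) - 1)) \<le> (2 * x)\<^sup>2 / 8"
      using Hoeffdings_lemma_aux[of "2 * x" "1 / 2"] x by simp
    then have "ln (1 + 1 / 2 * (exp (2 * x) - 1)) \<le> x + x\<^sup>2 / 2" by (simp add: power2_eq_square)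
    moreover have pos: "0 < 1 + 1 / 2 * (exp (2 * x) - 1)" using x by (simp add: add_pos_nonneg)
    ultimately have "exp (ln (1 + 1 / 2 * (exp (2 * x) - 1))) \<le> exp (x + x\<^sup>2 / 2)" by (simp only: exp_le_cancel_iff)
    then have "1 + 1 / 2 * (exp (2 * x) - 1) \<le> exp (x + x\<^sup>2 / 2)" using pos by (simp only: exp_ln)
    then have "exp (- x) * (1 + 1 / 2 * (exp (2 * x) - 1)) \<le> exp (- x) * exp (x + x\<^sup>2 / 2)"
      by (rule mult_left_mono) simp
    moreover have "exp (- x) * exp (2 * x) = exp x" "exp (- x) * exp (x + x\<^sup>2 / 2) = exp (x\<^sup>2 / 2)"
      by (simp_all flip: exp_add)
    ultimately show ?thesis by (simp add: algebra_simps add_divide_distrib)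
  qed
  show ?thesis using *[of x] *[of "- x"] by (cases "0 \<le> x") (auto simp: add.commute)
qed

lemma exp_moment:
  fixes a :: "nat \<Rightarrow> real"
  shows "(EE w. ennreal (exp (\<Sum>n=1..N. \<epsilon> n w * a n))) \<le> ennreal (exp ((\<Sum>n=1..N. (a n)\<^sup>2) / 2))"
proof -
  have "(EE w. ennreal (exp (\<Sum>n=1..N. \<epsilon> n w * a n))) = (EE w. (\<Prod>n\<in>{1..N}. ennreal (exp (\<epsilon> n w * a n))))"
    by (simp add: exp_sum prod_ennreal)
  also have "\<dots> = (\<Prod>n\<in>{1..N}. EE w. ennreal (exp (\<epsilon> n w * a n)))"
  proof (rule indep_vars_nn_integral)
    have "indep_vars (\<lambda>_. borel) \<epsilon> {1..N}" by (rule indep_vars_subset[OF indep]) auto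
    then show "indep_vars (\<lambda>_. borel) (\<lambda>n w. ennreal (exp (\<epsilon> n w * a n))) {1..N}"
      by (rule indep_vars_compose2[where Y = "\<lambda>n y. ennreal (exp (y * a n))"]) measurable
  qed auto
  also have "\<dots> \<le> (\<Prod>n\<in>{1..N}. ennreal (exp ((a n)\<^sup>2 / 2)))"
  proof (rule prod_mono_ennreal)
    fix n assume n: "n \<in> {1..N}"
    then have "(EE w. ennreal (exp (\<epsilon> n w * a n))) = ennreal (exp (a n)) * ennreal (1 / 2) + ennreal (exp (- a n)) * ennreal (1 / 2)"
      using nn_integral_sign[of n "\<lambda>y. ennreal (exp (y * a n))"] by simp
    also have "\<dots> = ennreal ((exp (a n) + exp (- a n)) / 2)"
      by (subst (1 2) ennreal_mult[symmetric], simp_all only: exp_ge_zero divide_nonneg_nonneg zero_le_one zero_le_numeral,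
        subst ennreal_plus[symmetric]) (simp_all add: add_divide_distrib)
    also have "\<dots> \<le> ennreal (exp ((a n)\<^sup>2 / 2))" by (intro ennreal_leI cosh_le_exp)
    finally show "(EE w. ennreal (exp (\<epsilon> n w * a n))) \<le> ennreal (exp ((a n)\<^sup>2 / 2))" .
  qed
  also have "\<dots> = ennreal (exp ((\<Sum>n=1..N. (a n)\<^sup>2) / 2))"
    by (simp add: prod_ennreal sum_divide_distrib flip: exp_sum)
  finally show ?thesis .
qed

text \<open>The bound y^r \<le> r^r exp y reduces moments to exponential moments, and exp of an
  absolute value is at most the sum of the two exponentials.\<close>

lemma real_moment:
  fixes a :: "nat \<Rightarrow> real"
  assumes r: "0 < r" and a: "(\<Sum>n=1..N. (a n)\<^sup>2) \<le> 1"
  shows "(EE w. ennreal (\<bar>\<Sum>n=1..N. \<epsilon> n w * a n\<bar> powr r)) \<le> ennreal (r powr r * (2 * exp (1 / 2)))"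
proof -
  define S where "S w = (\<Sum>n=1..N. \<epsilon> n w * a n)" for w
  have [measurable]: "S \<in> borel_measurable P"
    unfolding S_def[abs_def] by (intro borel_measurable_sum borel_measurable_times rv) auto
  have e: "(EE w. ennreal (exp (S w))) \<le> ennreal (exp (1 / 2))" "(EE w. ennreal (exp (- S w))) \<le> ennreal (exp (1 / 2))"
  proof -
    have le: "ennreal (exp ((\<Sum>n=1..N. (a n)\<^sup>2) / 2)) \<le> ennreal (exp (1 / 2))"
      using a by (intro ennreal_leI) simp
    show "(EE w. ennreal (exp (S w))) \<le> ennreal (exp (1 / 2))"
      using exp_moment[where N = N and a = a] le unfolding S_def by (rule order_trans)
    have "(EE w. ennreal (exp (- S w))) \<le> ennreal (exp ((\<Sum>n=1..N. (a n)\<^sup>2) / 2))"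
      using exp_moment[where N = N and a = "\<lambda>n. - a n"] unfolding S_def by (simp add: sum_negf)
    then show "(EE w. ennreal (exp (- S w))) \<le> ennreal (exp (1 / 2))" using le by (rule order_trans)
  qed
  have "(EE w. ennreal (\<bar>S w\<bar> powr r)) \<le> (EE w. ennreal (r powr r) * (ennreal (exp (S w)) + ennreal (exp (- S w))))"
  proof (rule nn_integral_mono)
    fix w
    define y where "y = \<bar>S w\<bar>"
    have "y / r \<le> exp (y / r)" using exp_ge_add_one_self[of "y / r"] by linarith
    then have "y \<le> r * exp (y / r)" using r by (simp add: field_simps)
    then have "y powr r \<le> (r * exp (y / r)) powr r" using r by (intro powr_mono2) (auto simp: y_def)
    also have "\<dots> = r powr r * exp y" 
    proof -
      have "exp (y / r) powr r = exp y" using r by (simp add: powr_def)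
      then show ?thesis using r by (simp add: powr_mult)
    qed
    also have "\<dots> \<le> r powr r * (exp (S w) + exp (- S w))"
      by (intro mult_left_mono) (auto simp: y_def abs_if add_increasing add_increasing2)
    finally show "ennreal (\<bar>S w\<bar> powr r) \<le> ennreal (r powr r) * (ennreal (exp (S w)) + ennreal (exp (- S w)))"
      by (simp add: y_def ennreal_leI flip: ennreal_plus ennreal_mult)
  qed
  also have "\<dots> = ennreal (r powr r) * ((EE w. ennreal (exp (S w))) + (EE w. ennreal (exp (- S w))))"
    by (simp add: nn_integral_cmult nn_integral_add)
  also have "\<dots> \<le> ennreal (r powr r) * (ennreal (exp (1 / 2)) + ennreal (exp (1 / 2)))"
    by (intro mult_left_mono add_mono e) auto
  also have "\<dots> = ennreal (r powr r * (2 * exp (1 / 2)))"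
    by (simp flip: ennreal_plus ennreal_mult)
  finally show ?thesis by (simp add: S_def)
qed

text \<open>After division by the square function s, each coordinate is a real random sum with
  coefficients of square sum at most 1, to which \<open>real_moment\<close> applies.\<close>

lemma khintchine_upper:
  fixes a :: "nat \<Rightarrow> 'k::{real_normed_field, euclidean_space}"
  assumes r: "0 < r"
  shows "(EE w. ennreal (norm (\<Sum>n=1..N. of_real (\<epsilon> n w) * a n) powr r))
    \<le> ennreal (khintchine_const (real DIM('k)) r * sqrt (\<Sum>n=1..N. (norm (a n))\<^sup>2) powr r)"
proof -
  define s where "s = sqrt (\<Sum>n=1..N. (norm (a n))\<^sup>2)"
  define Z where "Z w = (\<Sum>n=1..N. of_real (\<epsilon> n w) * a n)" for w
  let ?d = "real DIM('k)"
  show ?thesis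
  proof (cases "s = 0")
    case True
    then have "(\<Sum>n=1..N. (norm (a n))\<^sup>2) = 0" by (simp add: s_def)
    then have "\<forall>n\<in>{1..N}. a n = 0" by (subst (asm) sum_nonneg_eq_0_iff) auto
    then have "norm (Z w) powr r = 0" for w using r by (simp add: Z_def)
    then show ?thesis by (simp add: Z_def)
  next
    case False
    have s: "0 < s" using False by (simp add: s_def sum_nonneg order_less_le)
    have s2: "s\<^sup>2 = (\<Sum>n=1..N. (norm (a n))\<^sup>2)" by (simp add: s_def sum_nonneg)
    define S where "S c w = (\<Sum>n=1..N. \<epsilon> n w * c n)" for c :: "nat \<Rightarrow> real" and w
    have [measurable]: "S c \<in> borel_measurable P" for c
      unfolding S_def[abs_def] by (intro borel_measurable_sum borel_measurable_times rv) auto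
    have comp: "Z w \<bullet> b = s * S (\<lambda>n. a n \<bullet> b / s) w" for w b
      using s by (simp add: Z_def S_def inner_sum_left sum_distrib_left scaleR_conv_of_real[symmetric])
    have "(EE w. ennreal (norm (Z w) powr r))
      \<le> (EE w. ennreal ((?d * s) powr r) * (\<Sum>b\<in>(Basis :: 'k set). ennreal (\<bar>S (\<lambda>n. a n \<bullet> b / s) w\<bar> powr r)))"
    proof (rule nn_integral_mono)
      fix w
      define c where "c b = \<bar>S (\<lambda>n. a n \<bullet> b / s) w\<bar>" for b :: 'k
      define m where "m = Max (c ` Basis)"
      have "m \<in> c ` Basis" unfolding m_def by (intro Max_in) auto
      then obtain b0 where b0: "b0 \<in> Basis" "m = c b0" by blast
      have le: "c b \<le> m" if "b \<in> Basis" for b using that by (simp add: m_def)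
      have "norm (Z w) \<le> (\<Sum>b\<in>Basis. \<bar>Z w \<bullet> b\<bar>)" by (rule norm_le_l1)
      also have "\<dots> = (\<Sum>b\<in>(Basis :: 'k set). s * c b)" using s by (simp add: comp c_def abs_mult)
      also have "\<dots> \<le> (\<Sum>b\<in>(Basis :: 'k set). s * m)" using s le by (intro sum_mono mult_left_mono) auto
      finally have "norm (Z w) powr r \<le> (?d * (s * m)) powr r" using r by (intro powr_mono2) auto
      also have "\<dots> = (?d * s) powr r * c b0 powr r"
        using s b0 by (simp add: powr_mult c_def)
      also have "\<dots> \<le> (?d * s) powr r * (\<Sum>b\<in>Basis. c b powr r)"
        using b0 by (intro mult_left_mono member_le_sum) auto
      finally show "ennreal (norm (Z w) powr r) \<le> ennreal ((?d * s) powr r) * (\<Sum>b\<in>(Basis :: 'k set). ennreal (\<bar>S (\<lambda>n. a n \<bullet> b / s) w\<bar> powr r))"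
        unfolding c_def by (simp add: ennreal_leI sum_nonneg flip: ennreal_mult)
    qed
    also have "\<dots> = ennreal ((?d * s) powr r) * (EE w. (\<Sum>b\<in>(Basis :: 'k set). ennreal (\<bar>S (\<lambda>n. a n \<bullet> b / s) w\<bar> powr r)))"
      by (rule nn_integral_cmult) measurable
    also have "(EE w. (\<Sum>b\<in>(Basis :: 'k set). ennreal (\<bar>S (\<lambda>n. a n \<bullet> b / s) w\<bar> powr r)))
      = (\<Sum>b\<in>(Basis :: 'k set). EE w. ennreal (\<bar>S (\<lambda>n. a n \<bullet> b / s) w\<bar> powr r))"
      by (rule nn_integral_sum) measurable
    also have "ennreal ((?d * s) powr r) * (\<Sum>b\<in>(Basis :: 'k set). EE w. ennreal (\<bar>S (\<lambda>n. a n \<bullet> b / s) w\<bar> powr r))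
      \<le> ennreal ((?d * s) powr r) * (\<Sum>b\<in>(Basis :: 'k set). ennreal (r powr r * (2 * exp (1 / 2))))"
    proof (intro mult_left_mono sum_mono real_moment[OF r, where N = N, folded S_def])
      fix b :: 'k assume b: "b \<in> Basis"
      have "(\<Sum>n=1..N. (a n \<bullet> b / s)\<^sup>2) \<le> (\<Sum>n=1..N. (norm (a n))\<^sup>2 / s\<^sup>2)"
        unfolding power_divide using Basis_le_norm[OF b]
        by (intro sum_mono divide_right_mono) (auto simp: abs_le_square_iff[symmetric])
      also have "\<dots> = 1" using s unfolding sum_divide_distrib[symmetric] s2[symmetric] by simp
      finally show "(\<Sum>n=1..N. (a n \<bullet> b / s)\<^sup>2) \<le> 1" .
    qed simp
    also have "\<dots> = ennreal (khintchine_const ?d r * s powr r)"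
    proof -
      have "(\<Sum>b\<in>(Basis :: 'k set). ennreal (r powr r * (2 * exp (1 / 2)))) = ennreal (?d * (r powr r * (2 * exp (1 / 2))))"
        by (simp add: ennreal_mult ennreal_of_nat_eq_real_of_nat)
      then show ?thesis using s by (simp add: khintchine_const_def powr_mult mult_ac flip: ennreal_mult)
    qed
    finally show ?thesis by (simp add: Z_def s_def)
  qed
qed

lemma second_moment_norm:
  fixes a :: "nat \<Rightarrow> 'k::{real_normed_field, euclidean_space}"
  shows "(EE w. ennreal ((norm (\<Sum>n=1..N. of_real (\<epsilon> n w) * a n))\<^sup>2)) = ennreal (\<Sum>n=1..N. (norm (a n))\<^sup>2)"
proof -
  have nb: "(norm x)\<^sup>2 = (\<Sum>b\<in>Basis. (x \<bullet> b)\<^sup>2)" for x :: 'k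
    unfolding power2_norm_eq_inner by (subst euclidean_inner) (simp add: power2_eq_square)
  define S where "S c w = (\<Sum>n=1..N. \<epsilon> n w * c n)" for c :: "nat \<Rightarrow> real" and w
  have [measurable]: "S c \<in> borel_measurable P" for c
    unfolding S_def[abs_def] by (intro borel_measurable_sum borel_measurable_times rv) auto
  have "(EE w. ennreal ((norm (\<Sum>n=1..N. of_real (\<epsilon> n w) * a n))\<^sup>2))
    = (EE w. (\<Sum>b\<in>(Basis :: 'k set). ennreal ((S (\<lambda>n. a n \<bullet> b) w)\<^sup>2)))"
    by (simp add: nb S_def inner_sum_left scaleR_conv_of_real[symmetric])
  also have "\<dots> = (\<Sum>b\<in>(Basis :: 'k set). ennreal (\<Sum>n=1..N. (a n \<bullet> b)\<^sup>2))"
    unfolding second_moment[symmetric] S_def[symmetric] by (rule nn_integral_sum) measurable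
  also have "\<dots> = ennreal (\<Sum>n=1..N. (norm (a n))\<^sup>2)"
    unfolding nb by (subst sum.swap) (simp add: sum_nonneg)
  finally show ?thesis .
qed

text \<open>The second moment is controlled by the first and the fourth through y^2 \<le> k y + y^4
  / k^2 with k = K s. Since K^2 is twice the fourth moment constant, the last term contributes at
  most s^2 / 2 and is absorbed.\<close>

lemma khintchine_lower:
  fixes a :: "nat \<Rightarrow> 'k::{real_normed_field, euclidean_space}"
  assumes K: "K = sqrt (2 * khintchine_const (real DIM('k)) 4)"
  shows "ennreal (sqrt (\<Sum>n=1..N. (norm (a n))\<^sup>2)) \<le> ennreal (2 * K) * (EE w. enorm (\<Sum>n=1..N. of_real (\<epsilon> n w) * a n))"
proof -
  define s where "s = sqrt (\<Sum>n=1..N. (norm (a n))\<^sup>2)"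
  define Z where "Z w = (\<Sum>n=1..N. of_real (\<epsilon> n w) * a n)" for w
  let ?C = "khintchine_const (real DIM('k)) 4"
  have C: "0 < ?C" by (simp add: khintchine_const_def)
  then have K0: "0 < K" "K\<^sup>2 = 2 * ?C" by (simp_all add: K)
  have Zm: "Z \<in> borel_measurable P"
    unfolding Z_def[abs_def] by (intro borel_measurable_sum borel_measurable_times measurable_compose[OF rv borel_measurable_of_real]) auto
  note [measurable] = Zm
  have s2: "s\<^sup>2 = (\<Sum>n=1..N. (norm (a n))\<^sup>2)" "0 \<le> s" by (simp_all add: s_def sum_nonneg)
  have "ennreal s \<le> ennreal (2 * K) * (EE w. enorm (Z w))"
  proof (cases "s = 0")
    case False
    then have s: "0 < s" using s2 by simp
    define k where "k = K * s"
    have k: "0 < k" using s K0 by (simp add: k_def)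
    have "ennreal (s\<^sup>2) = (EE w. ennreal ((norm (Z w))\<^sup>2))"
      unfolding s2 Z_def second_moment_norm ..
    also have "\<dots> \<le> (EE w. ennreal k * enorm (Z w) + ennreal (1 / k\<^sup>2) * ennreal (norm (Z w) powr 4))"
    proof (rule nn_integral_mono)
      fix w
      define y where "y = norm (Z w)"
      have y: "0 \<le> y" by (simp add: y_def)
      have p4: "y powr 4 = y ^ 4" using y by (cases "y = 0") (simp_all add: powr_numeral)
      have "y\<^sup>2 \<le> k * y + 1 / k\<^sup>2 * y ^ 4"
      proof (cases "y \<le> k")
        case True
        then have "y\<^sup>2 \<le> k * y" using y by (simp add: power2_eq_square mult_right_mono)
        then show ?thesis using k y by (simp add: add_increasing2)
      next
        case False
        then have "k\<^sup>2 \<le> y\<^sup>2" using k by (intro power_mono) auto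
        then have "y\<^sup>2 * k\<^sup>2 \<le> y\<^sup>2 * y\<^sup>2" by (intro mult_left_mono) auto
        also have "\<dots> = y ^ 4" by (simp flip: power_add)
        finally have "y\<^sup>2 \<le> 1 / k\<^sup>2 * y ^ 4" using k by (simp add: field_simps)
        then show ?thesis using k y by (simp add: add_increasing)
      qed
      then show "ennreal ((norm (Z w))\<^sup>2) \<le> ennreal k * enorm (Z w) + ennreal (1 / k\<^sup>2) * ennreal (norm (Z w) powr 4)"
        unfolding y_def[symmetric] p4 using k y by (simp add: ennreal_leI flip: ennreal_mult ennreal_plus)
    qed
    also have "\<dots> = ennreal k * (EE w. enorm (Z w)) + ennreal (1 / k\<^sup>2) * (EE w. ennreal (norm (Z w) powr 4))"
      by (subst nn_integral_add) (simp_all add: nn_integral_cmult)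
    also have "\<dots> \<le> ennreal k * (EE w. enorm (Z w)) + ennreal (1 / k\<^sup>2) * ennreal (?C * s powr 4)"
      using khintchine_upper[where r = 4 and N = N and a = a] unfolding Z_def s_def by (intro add_left_mono mult_left_mono) auto
    also have "ennreal (1 / k\<^sup>2) * ennreal (?C * s powr 4) = ennreal (s\<^sup>2 / 2)"
    proof -
      have "1 / k\<^sup>2 * (?C * s powr 4) = s\<^sup>2 / 2"
        using C s by (simp add: k_def power_mult_distrib K0(2) powr_numeral field_simps flip: power_add)
      then show ?thesis using C by (simp flip: ennreal_mult)
    qed
    finally have main: "ennreal (s\<^sup>2) \<le> ennreal k * (EE w. enorm (Z w)) + ennreal (s\<^sup>2 / 2)" .
    show ?thesis
    proof (cases "EE w. enorm (Z w)")
      case (real z)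
      have "s\<^sup>2 \<le> k * z + s\<^sup>2 / 2"
        using main k real by (simp flip: ennreal_mult ennreal_plus)
      then have "s * s \<le> (2 * K * z) * s" by (simp add: k_def power2_eq_square algebra_simps)
      then have "s \<le> 2 * K * z" using s by (simp only: mult_le_cancel_right_pos)
      then show ?thesis using real K0 by (simp add: ennreal_leI flip: ennreal_mult)
    next
      case top
      then show ?thesis using K0 by (simp add: ennreal_mult_top)
    qed
  qed simp
  then show ?thesis by (simp add: s_def Z_def)
qed


section \<open>Random sums in mixed norms\<close>

lemma prob_jensen:
  assumes [measurable]: "v \<in> borel_measurable P" and r: "1 < r"
  shows "epow (EE w. v w) r \<le> ennreal (2 powr r) * (EE w. epow (v w) r)"
  using weighted_jensen[of "\<lambda>_. 1" P v "\<lambda>_. 1" 1 r] r by (simp add: emeasure_space_1)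

text \<open>Khintchine's inequality is known at each point (t,x) for the exponent r. As r exceeds q,
  p and 2, Minkowski's inequality with exponents r/q and r/p moves the expectation inside both
  integrals, and Jensen's inequality lowers the exponent from r to 2 on the left.\<close>

lemma mixed_moment_upper:
  fixes W :: "real \<times> 'a::euclidean_space \<times> 'p \<Rightarrow> ennreal"
  assumes p: "1 < p" and q: "1 < q" and r: "2 < r" "p < r" "q < r"
    and [measurable]: "W \<in> borel_measurable (lborel \<Otimes>\<^sub>M lborel \<Otimes>\<^sub>M P)" "\<sigma> \<in> borel_measurable (lborel \<Otimes>\<^sub>M lborel)"
    and le: "\<And>t x. (EE w. epow (W (t, x, w)) r) \<le> C * epow (\<sigma> (t, x)) r"
  shows "(EE w. epow (mixed p q (\<lambda>(t, x). W (t, x, w))) (2 / p))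
    \<le> 2 * epow (2 * epow (2 * epow C (q / r)) (p / q)) (2 / p) * epow (mixed p q \<sigma>) (2 / p)"
proof -
  note [arith] = p q r
  have sf: "sigma_finite_measure P" by unfold_locales
  define A where "A t w = (NN x. epow (W (t, x, w)) q)" for t w
  have [measurable]: "(\<lambda>(t, w). A t w) \<in> borel_measurable (lborel \<Otimes>\<^sub>M P)" unfolding A_def by measurable
  define K1 where "K1 = 2 * epow C (q / r)"
  define s where "s t = (NN x. epow (\<sigma> (t, x)) q)" for t
  have [measurable]: "s \<in> borel_measurable lborel" unfolding s_def by measurable
  have inner: "(EE w. epow (A t w) (r / q)) \<le> epow (K1 * s t) (r / q)" for t
  proof -
    have "epow (EE w. epow (A t w) (r / q)) (1 / (r / q))
      \<le> 2 * (NN x. epow (EE w. epow (epow (W (t, x, w)) q) (r / q)) (1 / (r / q)))"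
      using minkowski_integral[OF sigma_finite_lborel sf, of "\<lambda>(x, w). epow (W (t, x, w)) q" "r / q"]
      by (simp add: A_def)
    also have "\<dots> \<le> 2 * (NN x. epow C (q / r) * epow (\<sigma> (t, x)) q)"
    proof (intro mult_left_mono nn_integral_mono)
      fix x
      have "epow (EE w. epow (epow (W (t, x, w)) q) (r / q)) (1 / (r / q))
        \<le> epow (C * epow (\<sigma> (t, x)) r) (q / r)"
        using le[of t x] by (simp add: epow_powr epow_mono)
      also have "\<dots> = epow C (q / r) * epow (\<sigma> (t, x)) q"
        by (simp add: epow_powr epow_mult)
      finally show "epow (EE w. epow (epow (W (t, x, w)) q) (r / q)) (1 / (r / q))
        \<le> epow C (q / r) * epow (\<sigma> (t, x)) q" .
    qed simp
    also have "\<dots> = K1 * s t" by (simp add: K1_def s_def nn_integral_cmult mult.assoc)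
    finally have "epow (epow (EE w. epow (A t w) (r / q)) (1 / (r / q))) (r / q) \<le> epow (K1 * s t) (r / q)"
      by (intro epow_mono) auto
    then show ?thesis by (simp add: epow_powr)
  qed
  define J where "J w = mixed p q (\<lambda>(t, x). W (t, x, w))" for w
  have J: "J w = (NN t. epow (A t w) (p / q))" for w by (simp add: J_def mixed_def A_def)
  have [measurable]: "J \<in> borel_measurable P" unfolding J[abs_def] by measurable
  define K2 where "K2 = 2 * epow K1 (p / q)"
  have outer: "(EE w. epow (J w) (r / p)) \<le> epow (K2 * mixed p q \<sigma>) (r / p)"
  proof -
    have "epow (EE w. epow (J w) (r / p)) (1 / (r / p))
      \<le> 2 * (NN t. epow (EE w. epow (epow (A t w) (p / q)) (r / p)) (1 / (r / p)))"
      using minkowski_integral[OF sigma_finite_lborel sf, of "\<lambda>(t, w). epow (A t w) (p / q)" "r / p"]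
      by (simp add: J)
    also have "\<dots> \<le> 2 * (NN t. epow K1 (p / q) * epow (s t) (p / q))"
    proof (intro mult_left_mono nn_integral_mono)
      fix t
      have "epow (EE w. epow (epow (A t w) (p / q)) (r / p)) (1 / (r / p))
        \<le> epow (epow (K1 * s t) (r / q)) (p / r)"
        using epow_mono[OF _ inner[of t], of "p / r"] by (simp add: epow_powr)
      also have "\<dots> = epow K1 (p / q) * epow (s t) (p / q)"
        by (simp add: epow_powr epow_mult)
      finally show "epow (EE w. epow (epow (A t w) (p / q)) (r / p)) (1 / (r / p))
        \<le> epow K1 (p / q) * epow (s t) (p / q)" .
    qed simp
    also have "\<dots> = K2 * mixed p q \<sigma>" by (simp add: K2_def s_def[symmetric] mixed_def nn_integral_cmult mult.assoc)
    finally have "epow (epow (EE w. epow (J w) (r / p)) (1 / (r / p))) (r / p) \<le> epow (K2 * mixed p q \<sigma>) (r / p)"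
      by (intro epow_mono) auto
    then show ?thesis by (simp add: epow_powr)
  qed
  have "epow (EE w. epow (J w) (2 / p)) (r / 2) \<le> ennreal (2 powr (r / 2)) * (EE w. epow (J w) (r / p))"
    using prob_jensen[of "\<lambda>w. epow (J w) (2 / p)" "r / 2"] by (simp add: epow_powr)
  also have "\<dots> \<le> ennreal (2 powr (r / 2)) * epow (K2 * mixed p q \<sigma>) (r / p)"
    by (intro mult_left_mono outer) simp
  finally have "epow (epow (EE w. epow (J w) (2 / p)) (r / 2)) (2 / r)
    \<le> epow (ennreal (2 powr (r / 2)) * epow (K2 * mixed p q \<sigma>) (r / p)) (2 / r)"
    by (intro epow_mono) auto
  then have "(EE w. epow (J w) (2 / p)) \<le> epow (ennreal (2 powr (r / 2))) (2 / r) * (epow K2 (2 / p) * epow (mixed p q \<sigma>) (2 / p))"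
    by (simp add: epow_powr epow_mult)
  also have "epow (ennreal (2 powr (r / 2))) (2 / r) = 2" by (simp add: epow_ennreal powr_powr)
  finally show ?thesis by (simp add: J_def K2_def K1_def mult.assoc)
qed

text \<open>Here the expectation starts innermost, and Minkowski's inequality with exponents q and p
  pulls it out of both norms. Each use costs 2, which gives 4 C; the outer 4 is the cost of Jensen's
  inequality for the square.\<close>

lemma mixed_moment_lower:
  fixes W :: "real \<times> 'a::euclidean_space \<times> 'p \<Rightarrow> ennreal"
  assumes p: "1 < p" and q: "1 < q"
    and [measurable]: "W \<in> borel_measurable (lborel \<Otimes>\<^sub>M lborel \<Otimes>\<^sub>M P)" "\<sigma> \<in> borel_measurable (lborel \<Otimes>\<^sub>M lborel)"
    and le: "\<And>t x. \<sigma> (t, x) \<le> C * (EE w. W (t, x, w))"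
  shows "epow (mixed p q \<sigma>) (2 / p)
    \<le> 4 * epow (4 * C) 2 * (EE w. epow (mixed p q (\<lambda>(t, x). W (t, x, w))) (2 / p))"
proof -
  note [arith] = p q
  have sf: "sigma_finite_measure P" by unfold_locales
  define B where "B t w = epow (NN x. epow (W (t, x, w)) q) (1 / q)" for t w
  have [measurable]: "(\<lambda>(t, w). B t w) \<in> borel_measurable (lborel \<Otimes>\<^sub>M P)" unfolding B_def by measurable
  define J where "J w = mixed p q (\<lambda>(t, x). W (t, x, w))" for w
  have J: "J w = (NN t. epow (B t w) p)" for w
    by (simp add: J_def mixed_def B_def epow_powr)
  have [measurable]: "J \<in> borel_measurable P" unfolding J[abs_def] by measurable
  have inner: "epow (NN x. epow (\<sigma> (t, x)) q) (1 / q) \<le> 2 * C * (EE w. B t w)" for t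
  proof -
    have "(NN x. epow (\<sigma> (t, x)) q) \<le> (NN x. epow C q * epow (EE w. W (t, x, w)) q)"
      using le unfolding epow_mult[symmetric] by (intro nn_integral_mono epow_mono) auto
    also have "\<dots> = epow C q * (NN x. epow (EE w. W (t, x, w)) q)"
      by (rule nn_integral_cmult) measurable
    finally have "epow (NN x. epow (\<sigma> (t, x)) q) (1 / q)
      \<le> epow (epow C q * (NN x. epow (EE w. W (t, x, w)) q)) (1 / q)"
      by (intro epow_mono) auto
    also have "\<dots> = C * epow (NN x. epow (EE w. W (t, x, w)) q) (1 / q)"
      by (simp add: epow_mult epow_powr)
    also have "\<dots> \<le> C * (2 * (EE w. B t w))"
      using minkowski_integral[OF sf sigma_finite_lborel, of "\<lambda>(w, x). W (t, x, w)" q]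
      by (intro mult_left_mono) (simp_all add: B_def)
    finally show ?thesis by (simp add: mult_ac)
  qed
  have "mixed p q \<sigma> = (NN t. epow (epow (NN x. epow (\<sigma> (t, x)) q) (1 / q)) p)"
    by (simp add: mixed_def epow_powr)
  also have "\<dots> \<le> (NN t. epow (2 * C) p * epow (EE w. B t w) p)"
    using inner unfolding epow_mult[symmetric] by (intro nn_integral_mono epow_mono) auto
  also have "\<dots> = epow (2 * C) p * (NN t. epow (EE w. B t w) p)"
    by (rule nn_integral_cmult) measurable
  finally have "epow (mixed p q \<sigma>) (1 / p) \<le> epow (epow (2 * C) p * (NN t. epow (EE w. B t w) p)) (1 / p)"
    by (intro epow_mono) auto
  also have "\<dots> = 2 * C * epow (NN t. epow (EE w. B t w) p) (1 / p)"
    by (simp add: epow_mult[of "_ * _" "nn_integral _ _"] epow_mult[of "epow _ _"] epow_powr)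
  also have "\<dots> \<le> 2 * C * (2 * (EE w. epow (J w) (1 / p)))"
    using minkowski_integral[OF sf sigma_finite_lborel, of "\<lambda>(w, t). B t w" p]
    by (intro mult_left_mono) (simp_all add: J)
  finally have "epow (epow (mixed p q \<sigma>) (1 / p)) 2 \<le> epow (2 * C * (2 * (EE w. epow (J w) (1 / p)))) 2"
    by (intro epow_mono) auto
  then have "epow (mixed p q \<sigma>) (2 / p) \<le> epow (2 * C * (2 * (EE w. epow (J w) (1 / p)))) 2"
    by (simp add: epow_powr)
  also have "2 * C * (2 * (EE w. epow (J w) (1 / p))) = (4 * C) * (EE w. epow (J w) (1 / p))"
  proof -
    have "(4::ennreal) = 2 * 2" by simp
    then show ?thesis by (simp only: mult_ac)
  qed
  also have "epow \<dots> 2 = epow (4 * C) 2 * epow (EE w. epow (J w) (1 / p)) 2"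
    by (rule epow_mult)
  also have "\<dots> \<le> epow (4 * C) 2 * (4 * (EE w. epow (J w) (2 / p)))"
    using prob_jensen[of "\<lambda>w. epow (J w) (1 / p)" 2]
    by (intro mult_left_mono) (simp_all add: epow_powr powr_numeral)
  finally show ?thesis by (simp add: J_def mult_ac)
qed

end

section \<open>The integral operators\<close>

lemma AE_lborel_snd:
  fixes P :: "'b::euclidean_space \<Rightarrow> bool"
  assumes "ae s. P s"
  shows "AE z in (lborel :: ('a::euclidean_space \<times> 'b) measure). P (snd z)"
proof -
  obtain N where N: "{s\<in>space lborel. \<not> P s} \<subseteq> N" "emeasure lborel N = 0" "N \<in> sets lborel"
    by (rule AE_E[OF assms])
  have Nb [measurable]: "N \<in> sets borel" using N(3) by simp
  have [measurable]: "snd \<in> borel_measurable (borel :: ('a \<times> 'b) measure)" by (simp add: borel_prod[symmetric])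
  have sN: "ae s. s \<notin> N" using N(2,3) by (intro AE_not_in) (simp add: null_sets_def)
  have "AE z in (lborel :: ('a \<times> 'b) measure). snd z \<notin> N"
  proof (rule AE_prod_borelI)
    have "{z :: 'a \<times> 'b. snd z \<notin> N} = snd -` (- N)" by auto
    then show "{z :: 'a \<times> 'b. snd z \<notin> N} \<in> sets borel"
      using measurable_sets[of snd "borel :: ('a \<times> 'b) measure" borel "- N"] Nb by (simp add: sets.compl_sets Compl_eq_Diff_UNIV)
    show "ae y. AE x in (lborel :: 'a measure). snd (x, y) \<notin> N" using sN by (rule eventually_mono) simp
  qed
  then show ?thesis by eventually_elim (use N(1) in auto)
qed

text \<open>Bounded operators are additive and homogeneous only up to seminorm 0. In terms of
  representatives such an identity says that both sides are represented by the same function, which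
  is how linearity is used below.\<close>

lemma LX_diff_eq_0:
  assumes U: "open U" and q: "1 < q" and f: "represents1 U f f'" "f \<in> vectors (LX q U)"
    and g: "represents1 U g g'" "g \<in> vectors (LX q U)" and 0: "nrm (LX q U) (f - g) = 0"
  shows "represents1 U f g'"
proof -
  have fm: "f' \<in> borel_fun" "g' \<in> borel_fun" using f(1) g(1) by (auto simp: represents1_def)
  have "Lq q (\<lambda>x. f' x - g' x) = 0"
    unfolding LX_diff(2)[OF U q f g, symmetric] 0 by simp
  then have "ae x. f' x - g' x = 0"
    using q by (intro AE_eq_0_if_Lq_eq_0[of _ q] borel_measurable_diff fm) auto
  moreover have "ae x. x \<in> U \<longrightarrow> f x = f' x" using f(1) by (simp add: represents1_def)
  ultimately have "ae x. x \<in> U \<longrightarrow> f x = g' x" by eventually_elim auto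
  then show ?thesis using g(1) by (simp add: represents1_def)
qed

lemma LX_add:
  assumes U: "open U" and q: "1 < q" and f: "f \<in> vectors (LX q U)" and g: "g \<in> vectors (LX q U)"
  shows "f + g \<in> vectors (LX q U)"
proof -
  have q0: "0 < q" using q by simp
  obtain f' g' where r: "represents1 U f f'" "represents1 U g g'"
    using represents1_vectors_ex[OF U f] represents1_vectors_ex[OF U g] by metis
  have "Lq q (\<lambda>x. f' x + g' x) \<le> 4 * (Lq q f' + Lq q g')"
    using r by (intro Lq_triangle[OF q] norm_triangle_ineq) (auto simp: represents1_def)
  also have "\<dots> < \<top>"
    using vectors_LX_iff[OF U r(1) q0] vectors_LX_iff[OF U r(2) q0] f g by (simp add: ennreal_mult_less_top)
  finally show ?thesis by (simp add: vectors_LX_iff[OF U represents1_add[OF r] q0])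
qed

lemma LX_cmult:
  fixes c :: "'k::{real_normed_field, euclidean_space}"
  assumes U: "open U" and q: "0 < q" and f: "f \<in> vectors (LX q U)"
  shows "(\<lambda>x. c * f x) \<in> vectors (LX q U)"
proof -
  obtain f' where r: "represents1 U f f'" by (rule represents1_vectors_ex[OF U f])
  have "f' \<in> borel_fun" using r by (simp add: represents1_def)
  then show ?thesis
    using f vectors_LX_iff[OF U r q] Lq_cmult[OF q, of f' c]
    by (simp add: vectors_LX_iff[OF U represents1_cmult[OF r] q] ennreal_mult_less_top)
qed

lemma scl_LX: "scl (LX q U) c f = (\<lambda>x. c * f x)"
  by (simp add: Leb_space_def)

lemma bounded_ops_add_represents:
  assumes U: "open U" and q: "1 < q" and S: "S \<in> bounded_ops (LX q U)"
    and x: "x \<in> vectors (LX q U)" "represents1 U (S x) u" and y: "y \<in> vectors (LX q U)" "represents1 U (S y) v"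
  shows "represents1 U (S (x + y)) (\<lambda>z. u z + v z)"
proof -
  have vec: "S x \<in> vectors (LX q U)" "S y \<in> vectors (LX q U)" "S (x + y) \<in> vectors (LX q U)"
    using S x y LX_add[OF U q] by (auto simp: bounded_ops_def)
  obtain w where "represents1 U (S (x + y)) w" by (rule represents1_vectors_ex[OF U vec(3)])
  moreover have "nrm (LX q U) (S (x + y) - (S x + S y)) = 0" using S x y unfolding bounded_ops_def by blast
  ultimately show ?thesis
    using LX_diff_eq_0[OF U q _ vec(3) represents1_add[OF x(2) y(2)] LX_add[OF U q vec(1,2)]] by blast
qed

lemma bounded_ops_cmult_represents:
  assumes U: "open U" and q: "1 < q" and S: "S \<in> bounded_ops (LX q U)"
    and x: "x \<in> vectors (LX q U)" "represents1 U (S x) u"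
  shows "represents1 U (S (\<lambda>z. c * x z)) (\<lambda>z. c * u z)"
proof -
  have q0: "0 < q" using q by simp
  have vec: "S x \<in> vectors (LX q U)" "S (\<lambda>z. c * x z) \<in> vectors (LX q U)"
    using S x LX_cmult[OF U q0] by (auto simp: bounded_ops_def)
  obtain w where "represents1 U (S (\<lambda>z. c * x z)) w" by (rule represents1_vectors_ex[OF U vec(2)])
  moreover have "nrm (LX q U) (S (\<lambda>z. c * x z) - (\<lambda>z. c * S x z)) = 0"
    using S x unfolding bounded_ops_def scl_LX by blast
  ultimately show ?thesis
    using LX_diff_eq_0[OF U q _ vec(2) represents1_cmult[OF x(2)] LX_cmult[OF U q0 vec(1)]] by blast
qed

abbreviation LY :: "real \<Rightarrow> real \<Rightarrow> 'a::euclidean_space set \<Rightarrow> ('k::{real_normed_field, euclidean_space}, real \<Rightarrow> 'a \<Rightarrow> 'k) seminormed_space" where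
  "LY p q U \<equiv> Bochner_space lebesgue p (LX q U)"

lemma vectors_LYD:
  assumes "F \<in> vectors (LY p q U)"
  shows "F t \<in> vectors (LX q U)" "strongly_measurable lebesgue (LX q U) F" "integrable lebesgue (\<lambda>t. nrm (LX q U) (F t) powr p)"
  using assms by (auto simp: Bochner_space_def strongly_measurable_def)

lemma represents_nn_integral:
  fixes F :: "real \<Rightarrow> 'a::euclidean_space \<Rightarrow> 'k::{real_normed_field, euclidean_space}"
  assumes U: "open U" and p: "0 < p" and q: "0 < q" and rep: "represents U F h" and vec: "\<And>t. F t \<in> vectors (LX q U)"
  shows "(\<integral>\<^sup>+t. ennreal (nrm (LX q U) (F t) powr p) \<partial>lebesgue) = mixed p q (\<lambda>z. enorm (h z))"
proof -
  have "(NN t. ennreal (nrm (LX q U) (F t) powr p)) = (NN t. epow (Lq q (\<lambda>x. h (t, x))) p)"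
  proof (rule nn_integral_cong_AE)
    show "ae t. ennreal (nrm (LX q U) (F t) powr p) = epow (Lq q (\<lambda>x. h (t, x))) p"
      using representsD(3)[OF rep]
    proof eventually_elim
      case (elim t)
      show ?case unfolding nrm_LX[OF U elim q vec, symmetric] by (simp add: epow_ennreal nrm_Leb_space_nonneg)
    qed
  qed
  then show ?thesis by (simp add: nn_integral_completion mixed_def Lq_def epow_powr)
qed

lemma nrm_LY:
  fixes F :: "real \<Rightarrow> 'a::euclidean_space \<Rightarrow> 'k::{real_normed_field, euclidean_space}"
  assumes U: "open U" and p: "0 < p" and q: "0 < q" and rep: "represents U F h" and F: "F \<in> vectors (LY p q U)"
  shows "ennreal (nrm (LY p q U) F) = epow (mixed p q (\<lambda>z. enorm (h z))) (1 / p)" "mixed p q (\<lambda>z. enorm (h z)) < \<top>"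
proof -
  have I: "0 \<le> (\<integral>t. nrm (LX q U) (F t) powr p \<partial>lebesgue)" by (intro integral_nonneg_AE) auto
  have eq: "mixed p q (\<lambda>z. enorm (h z)) = ennreal (\<integral>t. nrm (LX q U) (F t) powr p \<partial>lebesgue)"
    unfolding represents_nn_integral[OF U p q rep vectors_LYD(1)[OF F], symmetric]
    by (rule nn_integral_eq_integral[OF vectors_LYD(3)[OF F]]) simp
  show "mixed p q (\<lambda>z. enorm (h z)) < \<top>" unfolding eq by simp
  show "ennreal (nrm (LY p q U) F) = epow (mixed p q (\<lambda>z. enorm (h z))) (1 / p)"
    unfolding eq using I by (simp add: Bochner_space_def epow_ennreal)
qed

lemma nrm_LX_measurable:
  fixes F :: "'b::euclidean_space \<Rightarrow> 'a::euclidean_space \<Rightarrow> 'k::{real_normed_field, euclidean_space}"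
  assumes U: "open U" and q: "0 < q" and rep: "represents U F h" and vec: "\<And>t. F t \<in> vectors (LX q U)"
  shows "(\<lambda>t. nrm (LX q U) (F t)) \<in> borel_measurable lebesgue"
proof (rule borel_measurable_AE)
  have [measurable]: "(\<lambda>t. Lq q (\<lambda>x. h (t, x))) \<in> borel_fun" by (rule borel_measurable_Lq[OF representsD(1)[OF rep]])
  show "(\<lambda>t. enn2real (Lq q (\<lambda>x. h (t, x)))) \<in> borel_measurable lebesgue" by (intro measurable_completion) measurable
  have "ae t. enn2real (Lq q (\<lambda>x. h (t, x))) = nrm (LX q U) (F t)"
    using representsD(3)[OF rep]
  proof eventually_elim
    case (elim t)
    show ?case unfolding nrm_LX[OF U elim q vec, symmetric] by (simp add: nrm_Leb_space_nonneg)
  qed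
  then show "AE t in lebesgue. enn2real (Lq q (\<lambda>x. h (t, x))) = nrm (LX q U) (F t)" by (simp add: AE_completion_iff)
qed

lemma vectors_LYI:
  fixes F :: "real \<Rightarrow> 'a::euclidean_space \<Rightarrow> 'k::{real_normed_field, euclidean_space}"
  assumes U: "open U" and p: "0 < p" and q: "1 < q" and rep: "represents U F h" and vec: "\<And>t. F t \<in> vectors (LX q U)"
    and fin: "mixed p q (\<lambda>z. enorm (h z)) < \<top>"
  shows "F \<in> vectors (LY p q U)"
proof -
  have q0: "0 < q" using q by simp
  have [measurable]: "(\<lambda>t. nrm (LX q U) (F t)) \<in> borel_measurable lebesgue" by (rule nrm_LX_measurable[OF U q0 rep vec])
  have "integrable lebesgue (\<lambda>t. nrm (LX q U) (F t) powr p)"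
    using fin unfolding represents_nn_integral[OF U p q0 rep vec, symmetric]
    by (intro integrableI_bounded) (simp_all add: abs_of_nonneg)
  then show ?thesis using represents_strongly_measurable[OF U q rep vec] by (simp add: Bochner_space_def)
qed

lemma has_bochner_integral_in_integral:
  assumes "bochner_integrable_in M X F"
  shows "has_bochner_integral_in M X F (bochner_integral_in M X F)"
  unfolding bochner_integral_in_def if_P[OF assms]
  by (rule someI_ex) (use assms in \<open>simp add: bochner_integrable_in_def\<close>)

section \<open>Representatives for the operator family and its kernel integrals\<close>

locale operator_family =
  fixes U :: "'a::euclidean_space set" and p q :: real
    and T :: "real \<Rightarrow> real \<Rightarrow> ('a \<Rightarrow> 'k::{real_normed_field, euclidean_space}) \<Rightarrow> ('a \<Rightarrow> 'k)"
    and C :: "real \<Rightarrow> real"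
  assumes U: "open U" and p: "1 < p" and q: "1 < q"
    and bdd: "\<And>t s. T t s \<in> bounded_ops (LX q U)"
    and meas: "\<And>\<phi>. \<phi> \<in> vectors (LX q U) \<Longrightarrow> strongly_measurable (lebesgue :: (real \<times> real) measure) (LX q U) (\<lambda>(t, s). T t s \<phi>)"
    and consistent: "A_consistently_bounded q U T C"
begin

abbreviation "X \<equiv> LX q U :: ('k, 'a \<Rightarrow> 'k) seminormed_space"
abbreviation "Y \<equiv> LY p q U :: ('k, real \<Rightarrow> 'a \<Rightarrow> 'k) seminormed_space"

lemma q0: "0 < q" and p0: "0 < p" using p q by auto

lemma T_vec: "\<phi> \<in> vectors X \<Longrightarrow> T t s \<phi> \<in> vectors X"
  using bdd by (auto simp: bounded_ops_def)

lemma weighted_bound: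
  obtains c where "0 \<le> c"
    "\<And>(w :: 'a \<Rightarrow> real) t s \<phi> u v. w \<in> borel_fun \<Longrightarrow> (\<And>x. 0 < w x) \<Longrightarrow> A_weight q w \<Longrightarrow> A_const q w \<le> ennreal N \<Longrightarrow>
      \<phi> \<in> vectors X \<Longrightarrow> represents1 U \<phi> v \<Longrightarrow> represents1 U (T t s \<phi>) u \<Longrightarrow>
      (NN x. epow (enorm (u x)) q * ennreal (w x))
       \<le> ennreal c * (NN x. epow (enorm (v x)) q * ennreal (w x))"
proof -
  obtain c where c: "0 \<le> c" and le: "\<And>(w :: 'a \<Rightarrow> real) t s \<phi>. w \<in> borel_fun \<Longrightarrow> (\<And>x. 0 < w x) \<Longrightarrow> A_weight q w \<Longrightarrow> A_const q w \<le> ennreal N \<Longrightarrow>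
      \<phi> \<in> vectors X \<Longrightarrow> (\<integral>\<^sup>+x. ennreal (norm (T t s \<phi> x) powr q) * ennreal (w x) \<partial>lebesgue_on U)
       \<le> ennreal c * (\<integral>\<^sup>+x. ennreal (norm (\<phi> x) powr q) * ennreal (w x) \<partial>lebesgue_on U)"
    by (rule A_consistently_bounded_nn[OF U q consistent T_vec]) blast+
  have eq: "(\<integral>\<^sup>+x. ennreal (norm (f x) powr q) * ennreal (w x) \<partial>lebesgue_on U) = (NN x. epow (enorm (g x)) q * ennreal (w x))"
    if g: "represents1 U f g" for f g :: "'a \<Rightarrow> 'k" and w
    unfolding nn_integral_lebesgue_on[OF U]
  proof (rule nn_integral_cong_AE)
    have g0: "x \<notin> U \<Longrightarrow> g x = 0" for x using g by (simp add: represents1_def)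
    have "ae x. x \<in> U \<longrightarrow> f x = g x" using g by (simp add: represents1_def)
    then show "ae x. ennreal (norm (f x) powr q) * ennreal (w x) * indicator U x = epow (enorm (g x)) q * ennreal (w x)"
      by eventually_elim (auto simp: g0 epow_ennreal split: split_indicator)
  qed
  show ?thesis
  proof (rule that[OF c])
    fix w :: "'a \<Rightarrow> real" and t s \<phi> u v
    assume w: "w \<in> borel_fun" "\<And>x. 0 < w x" "A_weight q w" "A_const q w \<le> ennreal N"
      and r: "\<phi> \<in> vectors X" "represents1 U \<phi> v" "represents1 U (T t s \<phi>) u"
    show "(NN x. epow (enorm (u x)) q * ennreal (w x))
       \<le> ennreal c * (NN x. epow (enorm (v x)) q * ennreal (w x))"
      using le[OF w r(1), of t s] unfolding eq[OF r(2)] eq[OF r(3)] .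
  qed
qed

text \<open>The constant weight 1 has \<open>A\<^sub>1\<close> factors equal to 1, so the weighted
  hypothesis contains an unweighted bound that is uniform in t and s; \<open>bounded_ops\<close>
  alone gives a bound for each pair separately.\<close>

lemma uniform_bound:
  obtains c where "0 \<le> c"
    "\<And>t s \<phi> u v. \<phi> \<in> vectors X \<Longrightarrow> represents1 U \<phi> v \<Longrightarrow> represents1 U (T t s \<phi>) u \<Longrightarrow> Lq q u \<le> ennreal c * Lq q v"
proof -
  let ?B = "2 ^ DIM('a) :: real"
  have gm: "ae x. grid_max (\<lambda>y::'a. ennreal 1) x \<le> ennreal (?B * 1)"
  proof (rule AE_I2)
    have "ennreal (?B * 1) = ennreal ?B * ennreal 1" by simp
    then show "grid_max (\<lambda>y::'a. ennreal 1) x \<le> ennreal (?B * 1)" for x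
      using grid_max_const_le[where 'a = 'a and c = "ennreal 1" and x = x] by (simp only:)
  qed
  have w1: "wt q (\<lambda>_. 1) (\<lambda>_. 1) = (\<lambda>_::'a. 1)" by (simp add: wt_def fun_eq_iff)
  have A: "A_weight q (\<lambda>_::'a. 1)" "A_const q (\<lambda>_::'a. 1) \<le> ennreal ((6 ^ DIM('a) * ?B) powr q)"
    using A_weight_wt[of "\<lambda>_::'a. 1" "\<lambda>_. 1" ?B q] gm q unfolding w1 by simp_all
  obtain c where c: "0 \<le> c" and le: "\<And>(w :: 'a \<Rightarrow> real) t s \<phi> u v. w \<in> borel_fun \<Longrightarrow> (\<And>x. 0 < w x) \<Longrightarrow> A_weight q w \<Longrightarrow> A_const q w \<le> ennreal ((6 ^ DIM('a) * ?B) powr q) \<Longrightarrow>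
      \<phi> \<in> vectors X \<Longrightarrow> represents1 U \<phi> v \<Longrightarrow> represents1 U (T t s \<phi>) u \<Longrightarrow>
      (NN x. epow (enorm (u x)) q * ennreal (w x))
       \<le> ennreal c * (NN x. epow (enorm (v x)) q * ennreal (w x))"
    by (rule weighted_bound) blast
  show ?thesis
  proof (rule that[of "c powr (1 / q)"])
    fix t s u v and \<phi> :: "'a \<Rightarrow> 'k"
    assume *: "\<phi> \<in> vectors X" "represents1 U \<phi> v" "represents1 U (T t s \<phi>) u"
    have "(NN x. epow (enorm (u x)) q) \<le> ennreal c * (NN x. epow (enorm (v x)) q)"
      using le[OF _ _ A *] by simp
    then have "Lq q u \<le> epow (ennreal c * (NN x. epow (enorm (v x)) q)) (1 / q)"
      unfolding Lq_def using q0 by (intro epow_mono) auto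
    also have "\<dots> = ennreal (c powr (1 / q)) * Lq q v"
      using c by (simp add: epow_mult epow_ennreal Lq_def)
    finally show "Lq q u \<le> ennreal (c powr (1 / q)) * Lq q v" .
  qed simp
qed

text \<open>The inequality holds for all admissible weights at each (t,s) where the sections of G
  and h are representatives; so the exceptional null set is independent of the weights, as
  \<open>weight_dominated\<close> demands.\<close>

lemma weight_dominated_T:
  obtains c :: "real \<Rightarrow> real" where "\<And>B. 0 \<le> c B"
    "\<And>f h G. (\<And>s. f s \<in> vectors X) \<Longrightarrow> represents U f h \<Longrightarrow> represents U (\<lambda>(t, s). T t s (f s)) G \<Longrightarrow>
      weight_dominated q c (\<lambda>(t, s, x). enorm (G ((t, s), x))) (\<lambda>z. enorm (h z))"
proof -
  define Q where "Q B c \<longleftrightarrow> 0 \<le> c \<and> (\<forall>(w :: 'a \<Rightarrow> real) t s \<phi> u v. w \<in> borel_fun \<longrightarrow> (\<forall>x. 0 < w x) \<longrightarrow> A_weight q w \<longrightarrow> A_const q w \<le> ennreal ((6 ^ DIM('a) * B) powr q) \<longrightarrow>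
      \<phi> \<in> vectors X \<longrightarrow> represents1 U \<phi> v \<longrightarrow> represents1 U (T t s \<phi>) u \<longrightarrow>
      (NN x. epow (enorm (u x)) q * ennreal (w x))
       \<le> ennreal c * (NN x. epow (enorm (v x)) q * ennreal (w x)))" for B c
  have "\<exists>c. Q B c" for B
    unfolding Q_def by (rule weighted_bound[of "(6 ^ DIM('a) * B) powr q"]) blast
  then have "\<exists>c. \<forall>B. Q B (c B)" by (intro choice allI)
  then obtain c where Qc: "\<And>B. Q B (c B)" by blast
  have c: "0 \<le> c B" for B using Qc[of B] unfolding Q_def by (rule conjunct1)
  show ?thesis
  proof (rule that[OF c])
    fix f h G assume vec: "\<And>s. f s \<in> vectors X" and h: "represents U f h" and G: "represents U (\<lambda>(t, s). T t s (f s)) G"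
    have "ae t. ae s. represents1 U (T t s (f s)) (\<lambda>x. G ((t, s), x))"
      using AE_prod_borel(1)[OF representsD(3)[OF G]] by simp
    moreover have "AE t in (lborel :: real measure). ae s. represents1 U (f s) (\<lambda>x. h (s, x))"
      using representsD(3)[OF h] by simp
    ultimately have ae: "ae t. ae s. represents1 U (T t s (f s)) (\<lambda>x. G ((t, s), x)) \<and> represents1 U (f s) (\<lambda>x. h (s, x))"
      by eventually_elim (rule AE_conjI)
    have key: "\<forall>h1\<in>A1_class lborel grid_max B. \<forall>h2\<in>A1_class lborel grid_max B.
        (NN x. epow (enorm (G ((t, s), x))) q * ennreal (wt q h1 h2 x))
          \<le> ennreal (c B) * (NN x. epow (enorm (h (s, x))) q * ennreal (wt q h1 h2 x))"
      if B: "0 < B" and reps: "represents1 U (T t s (f s)) (\<lambda>x. G ((t, s), x)) \<and> represents1 U (f s) (\<lambda>x. h (s, x))" for B t s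
    proof (intro ballI)
      fix h1 h2 :: "'a \<Rightarrow> real"
      assume H: "h1 \<in> A1_class lborel grid_max B" "h2 \<in> A1_class lborel grid_max B"
      have hm [measurable]: "h1 \<in> borel_fun" "h2 \<in> borel_fun" using A1_classD(1)[OF H(1)] A1_classD(1)[OF H(2)] by simp_all
      have pos: "0 < h1 x" "0 < h2 x" for x using A1_classD(2)[OF H(1)] A1_classD(2)[OF H(2)] by simp_all
      have w: "0 < wt q h1 h2 x" for x using pos[of x] by (simp add: wt_def)
      have wm: "wt q h1 h2 \<in> borel_fun" by measurable
      note A = A_weight_wt[OF hm pos A1_classD(3)[OF H(1)] A1_classD(3)[OF H(2)] B q]
      show "(NN x. epow (enorm (G ((t, s), x))) q * ennreal (wt q h1 h2 x))
          \<le> ennreal (c B) * (NN x. epow (enorm (h (s, x))) q * ennreal (wt q h1 h2 x))"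
        by (rule conjunct2[OF Qc[of B, unfolded Q_def], rule_format, OF wm w A vec[of s] conjunct2[OF reps] conjunct1[OF reps]])
    qed
    show "weight_dominated q c (\<lambda>(t, s, x). enorm (G ((t, s), x))) (\<lambda>z. enorm (h z))"
      unfolding weight_dominated_def prod.case
    proof (intro allI impI)
      fix B :: real assume B: "0 < B"
      show "ae t. ae s. \<forall>h1\<in>A1_class lborel grid_max B. \<forall>h2\<in>A1_class lborel grid_max B.
        (NN x. epow (enorm (G ((t, s), x))) q * ennreal (wt q h1 h2 x))
          \<le> ennreal (c B) * (NN x. epow (enorm (h (s, x))) q * ennreal (wt q h1 h2 x))"
        using ae by (rule eventually_mono) (erule eventually_mono, rule key[OF B])
    qed
  qed
qed

lemma represents1_unique:
  assumes "represents1 U f g" "represents1 U f g'"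
  shows "ae x. g x = g' x"
proof -
  have out: "\<And>x. x \<notin> U \<Longrightarrow> g x = g' x" using assms by (auto simp: represents1_def)
  have "ae x. x \<in> U \<longrightarrow> f x = g x" "ae x. x \<in> U \<longrightarrow> f x = g' x"
    using assms by (auto simp: represents1_def)
  then show ?thesis by eventually_elim (metis out)
qed

lemma represents_operator_simple:
  assumes sf: "simple_function lebesgue \<sigma>" and svec: "\<And>s. \<sigma> s \<in> vectors X"
  obtains g where "represents U (\<lambda>(t, s). T t s (\<sigma> s)) g"
proof -
  obtain \<sigma>' where \<sigma>': "simple_function lborel \<sigma>'" "ae s. \<sigma> s = \<sigma>' s"
    using completion_ex_simple_function[OF sf] by blast
  define V where "V = range \<sigma>"
  have V: "finite V" using sf by (simp add: V_def simple_function_def)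
  have "\<exists>g. represents U (\<lambda>(t, s). T t s v) g" if v: "v \<in> V" for v
  proof -
    have "v \<in> vectors X" using v svec by (auto simp: V_def)
    then show ?thesis by (rule strongly_measurable_represents[OF U q meas]) blast
  qed
  then obtain r where r: "\<And>v. v \<in> V \<Longrightarrow> represents U (\<lambda>(t, s). T t s v) (r v)" by metis
  define g where "g z = (\<Sum>v\<in>V. indicator (\<sigma>' -` {v}) (snd (fst z)) *\<^sub>R r v z)" for z
  have A: "\<sigma>' -` {v} \<in> sets borel" for v using simple_functionD(2)[OF \<sigma>'(1), of "{v}"] by simp
  have "represents U (\<lambda>(t, s). T t s (\<sigma> s)) g"
  proof (rule representsI)
    have "(\<lambda>z :: (real \<times> real) \<times> 'a. indicator (\<sigma>' -` {v}) (snd (fst z)) :: real) \<in> borel_fun" for v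
      by (rule measurable_compose[OF _ borel_measurable_indicator[OF A]]) (simp add: borel_prod[symmetric])
    then show "g \<in> borel_fun"
      unfolding g_def[abs_def] using representsD(1)[OF r]
      by (intro borel_measurable_sum borel_measurable_scaleR) auto
    show "g (y, x) = 0" if "x \<notin> U" for x y
      using representsD(2)[OF r that] by (simp add: g_def)
    have "ae y. \<forall>v\<in>V. represents1 U (case y of (t, s) \<Rightarrow> T t s v) (\<lambda>x. r v (y, x))"
      using representsD(3)[OF r] by (intro AE_finite_allI V) auto
    then show "ae y. represents1 U (case y of (t, s) \<Rightarrow> T t s (\<sigma> s)) (\<lambda>x. g (y, x))"
      using AE_lborel_snd[OF \<sigma>'(2)]
    proof eventually_elim
      case (elim y)
      have vy: "\<sigma> (snd y) \<in> V" by (simp add: V_def)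
      have "g (y, x) = r (\<sigma> (snd y)) (y, x)" for x
      proof -
        have "g (y, x) = (\<Sum>v\<in>V. if v = \<sigma> (snd y) then r v (y, x) else 0)"
          unfolding g_def fst_conv by (intro sum.cong refl indicator_scaleR_if) (auto simp: elim(2))
        also have "\<dots> = (if \<sigma> (snd y) \<in> V then r (\<sigma> (snd y)) (y, x) else 0)" by (rule sum.delta[OF V])
        finally show ?thesis using vy by simp
      qed
      then show ?case using elim(1)[rule_format, OF vy] by (simp add: case_prod_beta)
    qed
  qed
  then show ?thesis by (rule that)
qed

text \<open>Measurability in (t,s) is assumed for fixed vectors. It extends to simple f by splitting
  over the values, and to general f because \<open>uniform_bound\<close> carries convergence of the
  approximants over to T(t,s) f(s) for almost every (t,s).\<close>

lemma ex_represents_operator: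
  assumes f: "strongly_measurable lebesgue X f"
  obtains G where "represents U (\<lambda>(t, s). T t s (f s)) G"
proof -
  have fv: "f s \<in> vectors X" for s using f by (simp add: strongly_measurable_def)
  obtain \<sigma> where sf: "\<And>i. simple_function lebesgue (\<sigma> i)" and sv: "\<And>i s. \<sigma> i s \<in> vectors X"
    and lim: "AE s in lebesgue. (\<lambda>i. nrm X (f s - \<sigma> i s)) \<longlonglongrightarrow> 0"
    using f by (auto simp: strongly_measurable_def)
  have "\<exists>g. represents U (\<lambda>(t, s). T t s (\<sigma> i s)) g" for i
    by (rule represents_operator_simple[OF sf[of i] sv]) blast
  then obtain g where g: "\<And>i. represents U (\<lambda>(t, s). T t s (\<sigma> i s)) (g i)" by metis
  obtain c where c: "0 \<le> c" and bound: "\<And>t s \<phi> u v. \<phi> \<in> vectors X \<Longrightarrow> represents1 U \<phi> v \<Longrightarrow> represents1 U (T t s \<phi>) u \<Longrightarrow> Lq q u \<le> ennreal c * Lq q v"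
    by (rule uniform_bound) blast
  have "ae y. \<forall>i. represents1 U (case y of (t, s) \<Rightarrow> T t s (\<sigma> i s)) (\<lambda>x. g i (y, x))"
    unfolding AE_all_countable using representsD(3)[OF g] by blast
  moreover have "AE y in (lborel :: (real \<times> real) measure). (\<lambda>i. nrm X (f (snd y) - \<sigma> i (snd y))) \<longlonglongrightarrow> 0"
    by (rule AE_lborel_snd) (use lim in \<open>simp only: AE_completion_iff\<close>)
  ultimately have "ae y. \<exists>F0. represents1 U (case y of (t, s) \<Rightarrow> T t s (f s)) F0 \<and> (\<lambda>i. Lq q (\<lambda>x. F0 x - g i (y, x))) \<longlonglongrightarrow> 0"
  proof eventually_elim
    case (elim y)
    obtain t s where y: "y = (t, s)" by (cases y)
    obtain F0 where F0: "represents1 U (T t s (f s)) F0" by (rule represents1_vectors_ex[OF U T_vec[OF fv]])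
    have le: "Lq q (\<lambda>x. F0 x - g i (y, x)) \<le> ennreal (c * nrm X (f s - \<sigma> i s))" for i
    proof -
      obtain f' where f': "represents1 U (f s) f'" by (rule represents1_vectors_ex[OF U fv])
      obtain s' where s': "represents1 U (\<sigma> i s) s'" by (rule represents1_vectors_ex[OF U sv])
      note d = LX_diff[OF U q f' fv s' sv]
      obtain u where u: "represents1 U (T t s (f s - \<sigma> i s)) u" by (rule represents1_vectors_ex[OF U T_vec[OF d(1)]])
      have gi: "represents1 U (T t s (\<sigma> i s)) (\<lambda>x. g i (y, x))" using elim(1)[rule_format, of i] by (simp add: y)
      have "represents1 U (T t s (\<sigma> i s + (f s - \<sigma> i s))) (\<lambda>x. g i (y, x) + u x)"
        by (rule bounded_ops_add_represents[OF U q bdd sv gi d(1) u])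
      then have "represents1 U (T t s (f s)) (\<lambda>x. g i (y, x) + u x)" by simp
      from represents1_unique[OF F0 this] have "Lq q (\<lambda>x. F0 x - g i (y, x)) = Lq q u"
        by (intro Lq_cong_AE, elim eventually_mono) simp
      also have "\<dots> \<le> ennreal c * Lq q (\<lambda>x. f' x - s' x)" by (rule bound[OF d(1) represents1_diff[OF f' s'] u])
      also have "\<dots> = ennreal (c * nrm X (f s - \<sigma> i s))" unfolding d(2)[symmetric] using c by (simp add: ennreal_mult nrm_Leb_space_nonneg)
      finally show ?thesis .
    qed
    have "(\<lambda>i. c * nrm X (f s - \<sigma> i s)) \<longlonglongrightarrow> c * 0" using elim(2) by (intro tendsto_mult tendsto_const) (simp add: y)
    then have "(\<lambda>i. ennreal (c * nrm X (f s - \<sigma> i s))) \<longlonglongrightarrow> ennreal 0" by (intro tendsto_ennrealI) simp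
    then have up: "(\<lambda>i. ennreal (c * nrm X (f s - \<sigma> i s))) \<longlonglongrightarrow> 0" by simp
    have "(\<lambda>i. Lq q (\<lambda>x. F0 x - g i (y, x))) \<longlonglongrightarrow> 0"
    proof (rule tendsto_sandwich[OF _ _ tendsto_const up])
      show "\<forall>\<^sub>F i in sequentially. Lq q (\<lambda>x. F0 x - g i (y, x)) \<le> ennreal (c * nrm X (f s - \<sigma> i s))"
        using le by (intro always_eventually allI)
    qed simp
    then show ?case using F0 unfolding y prod.case by blast
  qed
  then show ?thesis
    using representsD(1)[OF g] representsD(2)[OF g]
    by (rule_tac represents_limit[OF q, of g U "\<lambda>(t, s). T t s (f s)"]) (auto intro: that)
qed

text \<open>Young's convolution inequality for a kernel of mass at most 1, by Jensen's inequality
  and Fubini's theorem. It makes the integral defining the operator absolutely convergent at almost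
  every time.\<close>

lemma AE_kernel_Lq_finite:
  assumes k: "dominated_kernel (\<lambda>x. norm (k0 x))" and hm: "h \<in> borel_fun"
    and fin: "mixed p q (\<lambda>z. enorm (h z :: 'k)) < \<top>"
  shows "ae t. (NN s. enorm (k0 (t - s)) * Lq q (\<lambda>x. h (s, x :: 'a))) < \<top>"
proof -
  have [measurable]: "(\<lambda>x. norm (k0 x)) \<in> borel_fun" by (rule dominated_kernelD[OF k])
  define a where "a s = Lq q (\<lambda>x. h (s, x))" for s
  have [measurable]: "a \<in> borel_fun" unfolding a_def[abs_def] by (rule borel_measurable_Lq[OF hm])
  define I where "I t = (NN s. enorm (k0 (t - s)) * a s)" for t
  have [measurable]: "I \<in> borel_fun" unfolding I_def[abs_def] by measurable
  have k1: "(NN x. enorm (k0 x)) \<le> 1" by (rule dominated_kernelD(3)[OF k])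
  have "(NN t. epow (I t) p) \<le> (NN t. ennreal (2 powr p) * (NN s. enorm (k0 (t - s)) * epow (a s) p))"
  proof (rule nn_integral_mono)
    fix t
    have "(NN s. enorm (k0 (t - s))) \<le> 1"
      using k1 nn_integral_reflect_shift[of "\<lambda>x. enorm (k0 x)" t] by simp
    then show "epow (I t) p \<le> ennreal (2 powr p) * (NN s. enorm (k0 (t - s)) * epow (a s) p)"
      using weighted_jensen[of "\<lambda>s. enorm (k0 (t - s))" lborel a "\<lambda>_. 1" 1 p] p by (simp add: I_def)
  qed
  also have "\<dots> = ennreal (2 powr p) * (NN t. NN s. enorm (k0 (t - s)) * epow (a s) p)"
    by (rule nn_integral_cmult) measurable
  also have "(NN t. NN s. enorm (k0 (t - s)) * epow (a s) p)
    = (NN s. NN t. enorm (k0 (t - s)) * epow (a s) p)"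
    by (rule lborel_pair.Fubini') measurable
  also have "\<dots> = (NN s. (NN t. enorm (k0 (t - s))) * epow (a s) p)"
    by (intro nn_integral_cong nn_integral_multc) measurable
  also have "\<dots> \<le> (NN s. 1 * epow (a s) p)"
  proof (intro nn_integral_mono mult_right_mono)
    fix s
    show "(NN t. enorm (k0 (t - s))) \<le> 1"
      using k1 nn_integral_real_affine[of "\<lambda>x. enorm (k0 x)" 1 "- s"] by simp
  qed simp
  also have "(NN s. 1 * epow (a s) p) = mixed p q (\<lambda>z. enorm (h z))"
    by (simp add: mixed_def a_def Lq_def epow_powr)
  finally have "(NN t. epow (I t) p) \<le> ennreal (2 powr p) * mixed p q (\<lambda>z. enorm (h z))"
    by (simp add: mult_left_mono)
  also have "\<dots> < \<top>" using fin by (simp add: ennreal_mult_less_top)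
  finally have "ae t. epow (I t) p \<noteq> \<infinity>"
    by (intro nn_integral_PInf_AE) auto
  then show ?thesis
    unfolding I_def[symmetric] a_def[symmetric]
    by eventually_elim (auto simp: ennreal_powr_def top.not_eq_extremum split: if_splits)
qed

lemma LX_0: "0 \<in> vectors X"
proof -
  have "Lq q (\<lambda>_::'a. 0::'k) = 0" by (simp add: Lq_def ennreal_powr_def)
  then show ?thesis by (simp add: vectors_LX_iff[OF U represents1_0 q0])
qed

lemma integral_op_vec: "integral_op X T k f t \<in> vectors X"
proof (cases "bochner_integrable_in lebesgue X (\<lambda>s. scl X (k (t - s)) (T t s (f s)))")
  case True
  then have "has_bochner_integral_in lebesgue X (\<lambda>s. scl X (k (t - s)) (T t s (f s))) (integral_op X T k f t)"
    unfolding integral_op_def by (rule has_bochner_integral_in_integral)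
  then show ?thesis by (simp add: has_bochner_integral_in_def)
next
  case False
  then show ?thesis using LX_0 by (simp add: integral_op_def bochner_integral_in_def)
qed

text \<open>At almost every t the integrand has a Borel version in (s,x) whose space norm is
  integrable in s. Existence and value of the Bochner integral then follow from
  \<open>has_bochner_integral_inI\<close> and \<open>bochner_integral_represents\<close>.\<close>

lemma AE_integral_op:
  assumes k0: "k0 \<in> borel_fun" "ae x. k x = k0 x" "dominated_kernel (\<lambda>x. norm (k0 x))"
    and f: "f \<in> vectors Y" and h: "represents U f h" and G: "represents U (\<lambda>(t, s). T t s (f s)) G"
  shows "ae t. bochner_integrable_in lebesgue X (\<lambda>s. scl X (k (t - s)) (T t s (f s)))
    \<and> represents1 U (integral_op X T k f t) (\<lambda>x. \<integral>s. k0 (t - s) * G ((t, s), x) \<partial>lborel)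
    \<and> (ae x. integrable lborel (\<lambda>s. k0 (t - s) * G ((t, s), x)))"
proof -
  note fv = vectors_LYD(1)[OF f]
  have hm: "h \<in> borel_fun" by (rule representsD[OF h])
  have Gm: "G \<in> borel_fun" by (rule representsD[OF G])
  obtain c where c: "0 \<le> c" and bound: "\<And>t s \<phi> u v. \<phi> \<in> vectors X \<Longrightarrow> represents1 U \<phi> v \<Longrightarrow> represents1 U (T t s \<phi>) u \<Longrightarrow> Lq q u \<le> ennreal c * Lq q v"
    by (rule uniform_bound) blast
  have "ae t. ae s. represents1 U (T t s (f s)) (\<lambda>x. G ((t, s), x))"
    using AE_prod_borel(1)[OF representsD(3)[OF G]] by simp
  then show ?thesis
    using AE_kernel_Lq_finite[OF k0(3) hm nrm_LY(2)[OF U p0 q0 h f]]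
  proof eventually_elim
    case (elim t)
    let ?F = "\<lambda>s. scl X (k (t - s)) (T t s (f s))"
    define H where "H = (\<lambda>(s, x). k0 (t - s) * G ((t, s), x))"
    have Gs [measurable]: "(\<lambda>z. G ((t, fst z), snd z)) \<in> borel_fun"
      by (rule measurable_compose[OF _ Gm]) (simp add: borel_prod[symmetric])
    have [measurable]: "(\<lambda>z. k0 (t - fst z)) \<in> borel_measurable (borel :: (real \<times> 'a) measure)"
      by (rule measurable_compose[OF _ k0(1)]) (simp add: borel_prod[symmetric])
    have Hm: "H \<in> borel_fun"
      unfolding H_def case_prod_beta by measurable
    have ks: "ae s. k (t - s) = k0 (t - s)"
      using AE_lborel_affine[of "- 1" _ t, OF _ k0(2)] by simp
    have Frep: "represents U ?F H"
    proof (rule representsI[OF Hm])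
      show "H (s, x) = 0" if "x \<notin> U" for s x using representsD(2)[OF G that] by (simp add: H_def)
      show "ae s. represents1 U (?F s) (\<lambda>x. H (s, x))"
        using ks elim(1)
      proof eventually_elim
        case (elim s)
        then show ?case using represents1_cmult[OF elim(2), of "k0 (t - s)"] by (simp add: scl_LX H_def)
      qed
    qed
    have Fv: "?F s \<in> vectors X" for s unfolding scl_LX by (rule LX_cmult[OF U q0 T_vec[OF fv]])
    have "(NN s. Lq q (\<lambda>x. H (s, x))) \<le> (NN s. ennreal c * (enorm (k0 (t - s)) * Lq q (\<lambda>x. h (s, x))))"
    proof (rule nn_integral_mono_AE)
      show "ae s. Lq q (\<lambda>x. H (s, x)) \<le> ennreal c * (enorm (k0 (t - s)) * Lq q (\<lambda>x. h (s, x)))"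
        using elim(1) representsD(3)[OF h]
      proof eventually_elim
        case (elim s)
        have "Lq q (\<lambda>x. H (s, x)) = enorm (k0 (t - s)) * Lq q (\<lambda>x. G ((t, s), x))"
          unfolding H_def prod.case by (rule Lq_cmult[OF q0 borel_section(1)[OF Gm]])
        also have "\<dots> \<le> enorm (k0 (t - s)) * (ennreal c * Lq q (\<lambda>x. h (s, x)))"
          by (rule mult_left_mono[OF bound[OF fv elim(2,1)]]) simp
        finally show ?case by (simp add: mult_ac)
      qed
    qed
    also have "\<dots> = ennreal c * (NN s. enorm (k0 (t - s)) * Lq q (\<lambda>x. h (s, x)))"
    proof (rule nn_integral_cmult)
      have [measurable]: "(\<lambda>s. Lq q (\<lambda>x. h (s, x))) \<in> borel_fun" by (rule borel_measurable_Lq[OF hm])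
      have [measurable]: "k0 \<in> borel_fun" by (rule k0)
      show "(\<lambda>s. enorm (k0 (t - s)) * Lq q (\<lambda>x. h (s, x))) \<in> borel_measurable lborel" by measurable
    qed
    also have "\<dots> < \<top>" using elim(2) by (simp add: ennreal_mult_less_top)
    finally have fin: "(NN s. Lq q (\<lambda>x. H (s, x))) < \<top>" .
    have bi: "bochner_integrable_in lebesgue X ?F"
      unfolding bochner_integrable_in_def using has_bochner_integral_inI[OF U q Frep Fv fin] by blast
    then have "has_bochner_integral_in lebesgue X ?F (integral_op X T k f t)"
      unfolding integral_op_def by (rule has_bochner_integral_in_integral)
    from bochner_integral_represents[OF U q Frep Fv fin this]
    have "represents1 U (integral_op X T k f t) (\<lambda>x. \<integral>s. H (s, x) \<partial>lborel)" .
    moreover have "ae x. integrable lborel (\<lambda>s. H (s, x))" by (rule AE_integrable_Lq[OF q Hm fin])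
    ultimately show ?case using bi by (simp add: H_def)
  qed
qed

end

section \<open>Mixed norms, square sums and vector operations in the Bochner space\<close>

lemma mixed_add_le:
  assumes p: "0 < p" and q: "0 < q"
    and [measurable]: "v \<in> borel_fun" "w \<in> borel_measurable (borel :: (real \<times> 'a::euclidean_space) measure)"
  shows "mixed p q (\<lambda>z. v z + w z) \<le> ennreal ((2 powr q) powr (p / q) * 2 powr (p / q)) * (mixed p q v + mixed p q w)"
proof -
  have [measurable]: "v \<in> borel_measurable (borel \<Otimes>\<^sub>M borel)" "w \<in> borel_measurable (borel \<Otimes>\<^sub>M borel)"
    using assms(3,4) by (simp_all add: borel_prod)
  define V where "V t = (NN x. epow (v (t, x)) q)" for t
  define W where "W t = (NN x. epow (w (t, x)) q)" for t
  have [measurable]: "V \<in> borel_fun" "W \<in> borel_fun" unfolding V_def[abs_def] W_def[abs_def] by measurable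
  have "mixed p q (\<lambda>z. v z + w z) \<le> (NN t. ennreal ((2 powr q) powr (p / q) * 2 powr (p / q)) * (epow (V t) (p / q) + epow (W t) (p / q)))"
    unfolding mixed_def
  proof (rule nn_integral_mono)
    fix t
    have "(NN x. epow (v (t, x) + w (t, x)) q) \<le> (NN x. ennreal (2 powr q) * (epow (v (t, x)) q + epow (w (t, x)) q))"
      using q by (intro nn_integral_mono epow_add_le) auto
    also have "\<dots> = ennreal (2 powr q) * (V t + W t)"
      by (simp add: nn_integral_cmult nn_integral_add V_def W_def)
    finally have "epow (NN x. epow (v (t, x) + w (t, x)) q) (p / q) \<le> epow (ennreal (2 powr q) * (V t + W t)) (p / q)"
      using p q by (intro epow_mono) auto
    also have "\<dots> = ennreal ((2 powr q) powr (p / q)) * epow (V t + W t) (p / q)"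
      by (simp add: epow_mult epow_ennreal)
    also have "\<dots> \<le> ennreal ((2 powr q) powr (p / q)) * (ennreal (2 powr (p / q)) * (epow (V t) (p / q) + epow (W t) (p / q)))"
      using p q by (intro mult_left_mono epow_add_le) auto
    also have "\<dots> = ennreal ((2 powr q) powr (p / q) * 2 powr (p / q)) * (epow (V t) (p / q) + epow (W t) (p / q))"
      by (simp add: ennreal_mult mult.assoc)
    finally show "epow (NN x. epow (v (t, x) + w (t, x)) q) (p / q)
      \<le> ennreal ((2 powr q) powr (p / q) * 2 powr (p / q)) * (epow (V t) (p / q) + epow (W t) (p / q))" .
  qed
  also have "\<dots> = ennreal ((2 powr q) powr (p / q) * 2 powr (p / q)) * (mixed p q v + mixed p q w)"
    unfolding mixed_def V_def[symmetric] W_def[symmetric] by (simp add: nn_integral_cmult nn_integral_add)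
  finally show ?thesis .
qed

lemma mixed_mono:
  assumes "0 < p" "0 < q" "\<And>z. v z \<le> w z" shows "mixed p q v \<le> mixed p q w"
  unfolding mixed_def using assms by (intro nn_integral_mono epow_mono) auto

lemma mixed_cmult:
  assumes p: "0 < p" and q: "0 < q" and "w \<in> borel_measurable (borel :: (real \<times> 'a::euclidean_space) measure)"
  shows "mixed p q (\<lambda>z. c * w z) = epow c p * mixed p q w"
proof -
  have [measurable]: "w \<in> borel_measurable (borel \<Otimes>\<^sub>M borel)" using assms(3) by (simp add: borel_prod)
  show ?thesis
    unfolding mixed_def using p q by (simp add: epow_mult nn_integral_cmult epow_powr)
qed

lemma mixed_sum_finite:
  fixes w :: "nat \<Rightarrow> real \<times> 'a::euclidean_space \<Rightarrow> ennreal"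
  assumes p: "0 < p" and q: "0 < q"
    and "\<And>n. n \<in> I \<Longrightarrow> w n \<in> borel_fun" "\<And>n. n \<in> I \<Longrightarrow> mixed p q (w n) < \<top>"
  shows "mixed p q (\<lambda>z. \<Sum>n\<in>I. w n z) < \<top>"
  using assms(3,4)
proof (induction I rule: infinite_finite_induct)
  case (insert n I)
  have "mixed p q (\<lambda>z. w n z + (\<Sum>n\<in>I. w n z)) \<le> ennreal ((2 powr q) powr (p / q) * 2 powr (p / q)) * (mixed p q (w n) + mixed p q (\<lambda>z. \<Sum>n\<in>I. w n z))"
    using insert by (intro mixed_add_le[OF p q] borel_measurable_sum) auto
  also have "\<dots> < \<top>" using insert by (simp add: ennreal_mult_less_top)
  finally show ?case unfolding sum.insert[OF insert(1,2)] .
qed (use p q in \<open>simp_all add: mixed_def ennreal_powr_def\<close>)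

definition square_sum :: "nat \<Rightarrow> (nat \<Rightarrow> 'z \<Rightarrow> 'k::real_normed_vector) \<Rightarrow> 'z \<Rightarrow> ennreal" where
  "square_sum N g z = epow (\<Sum>n=1..N. epow (enorm (g n z)) 2) (1 / 2)"

lemma square_sum_eq: "square_sum N g z = ennreal (sqrt (\<Sum>n=1..N. (norm (g n z))\<^sup>2))"
  unfolding square_sum_def
  by (simp add: epow_ennreal powr_numeral sum_nonneg powr_half_sqrt)

lemma borel_measurable_square_sum:
  fixes g :: "nat \<Rightarrow> 'z::topological_space \<Rightarrow> 'k::{real_normed_vector, second_countable_topology}"
  assumes "\<And>n. n \<in> {1..N} \<Longrightarrow> g n \<in> borel_fun"
  shows "square_sum N g \<in> borel_fun"
proof -
  have "(\<lambda>z. epow (enorm (g n z)) 2) \<in> borel_fun" if "n \<in> {1..N}" for n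
  proof -
    have [measurable]: "g n \<in> borel_fun" by (rule assms[OF that])
    show ?thesis by measurable
  qed
  then have [measurable]: "(\<lambda>z. \<Sum>n=1..N. epow (enorm (g n z)) 2) \<in> borel_fun"
    by (rule borel_measurable_sum)
  show ?thesis unfolding square_sum_def[abs_def] by measurable
qed

lemma square_sum_le_sum: "square_sum N g z \<le> (\<Sum>n=1..N. enorm (g n z))"
proof -
  have "sqrt (\<Sum>n=1..N. (norm (g n z))\<^sup>2) \<le> (\<Sum>n=1..N. norm (g n z))"
    using L2_set_le_sum[of "{1..N}" "\<lambda>n. norm (g n z)"] by (simp add: L2_set_def)
  then show ?thesis unfolding square_sum_eq by (simp add: ennreal_leI)
qed

lemma LY_add:
  assumes U: "open U" and p: "0 < p" and q: "1 < q" and f: "f \<in> vectors (LY p q U)" and g: "g \<in> vectors (LY p q U)"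
    and f': "represents U f f'" and g': "represents U g g'"
  shows "represents U (f + g) (\<lambda>z. f' z + g' z)" "f + g \<in> vectors (LY p q U)"
proof -
  have q0: "0 < q" using q by simp
  note m = representsD(1)[OF f'] representsD(1)[OF g']
  show rep: "represents U (f + g) (\<lambda>z. f' z + g' z)"
  proof (rule representsI)
    show "ae t. represents1 U ((f + g) t) (\<lambda>x. f' (t, x) + g' (t, x))"
      using representsD(3)[OF f'] representsD(3)[OF g'] unfolding plus_fun_apply[of f g]
      by eventually_elim (rule represents1_add)
  qed (use m representsD(2)[OF f'] representsD(2)[OF g'] in \<open>auto intro: borel_measurable_add\<close>)
  have "mixed p q (\<lambda>z. enorm (f' z + g' z)) \<le> mixed p q (\<lambda>z. enorm (f' z) + enorm (g' z))"
    using norm_triangle_ineq by (intro mixed_mono p q0) (simp add: ennreal_leI flip: ennreal_plus)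
  also have "\<dots> \<le> ennreal ((2 powr q) powr (p / q) * 2 powr (p / q)) * (mixed p q (\<lambda>z. enorm (f' z)) + mixed p q (\<lambda>z. enorm (g' z)))"
    using m by (intro mixed_add_le p q0) auto
  also have "\<dots> < \<top>" using nrm_LY(2)[OF U p q0 f' f] nrm_LY(2)[OF U p q0 g' g] by (simp add: ennreal_mult_less_top)
  finally have fin: "mixed p q (\<lambda>z. enorm (f' z + g' z)) < \<top>" .
  have vec: "(f + g) t \<in> vectors (LX q U)" for t
    using LX_add[OF U q vectors_LYD(1)[OF f] vectors_LYD(1)[OF g]] unfolding plus_fun_apply[of f g] .
  show "f + g \<in> vectors (LY p q U)"
    by (rule vectors_LYI[OF U p q rep vec fin])
qed

lemma scl_LY: "scl (LY p q U) c f = (\<lambda>t x. c * f t x)"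
  by (simp add: Bochner_space_def Leb_space_def)

lemma LY_cmult:
  assumes U: "open U" and p: "0 < p" and q: "1 < q" and f: "f \<in> vectors (LY p q U)" and f': "represents U f f'"
  shows "represents U (scl (LY p q U) c f) (\<lambda>z. c * f' z)" "scl (LY p q U) c f \<in> vectors (LY p q U)"
proof -
  have q0: "0 < q" using q by simp
  note m = representsD(1)[OF f']
  show rep: "represents U (scl (LY p q U) c f) (\<lambda>z. c * f' z)"
  proof (rule representsI)
    show "ae t. represents1 U (scl (LY p q U) c f t) (\<lambda>x. c * f' (t, x))"
      using representsD(3)[OF f'] unfolding scl_LY by eventually_elim (rule represents1_cmult)
  qed (use m representsD(2)[OF f'] in \<open>auto intro: borel_measurable_times\<close>)
  have "mixed p q (\<lambda>z. enorm (c * f' z)) = epow (enorm c) p * mixed p q (\<lambda>z. enorm (f' z))"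
    using m by (simp add: norm_mult ennreal_mult mixed_cmult[OF p q0])
  also have "\<dots> < \<top>" using nrm_LY(2)[OF U p q0 f' f] by (simp add: ennreal_mult_less_top epow_ennreal)
  finally have fin: "mixed p q (\<lambda>z. enorm (c * f' z)) < \<top>" .
  have vec: "scl (LY p q U) c f t \<in> vectors (LX q U)" for t
    unfolding scl_LY by (rule LX_cmult[OF U q0 vectors_LYD(1)[OF f]])
  show "scl (LY p q U) c f \<in> vectors (LY p q U)"
    by (rule vectors_LYI[OF U p q rep vec fin])
qed

lemma LY_0:
  fixes U :: "'a::euclidean_space set"
  assumes U: "open U" and p: "0 < p" and q: "1 < q"
  shows "represents U (0 :: real \<Rightarrow> 'a \<Rightarrow> 'k::{real_normed_field, euclidean_space}) (\<lambda>_. 0)"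
    "(0 :: real \<Rightarrow> 'a \<Rightarrow> 'k) \<in> vectors (LY p q U)"
proof -
  have q0: "0 < q" using q by simp
  show rep: "represents U (0 :: real \<Rightarrow> 'a \<Rightarrow> 'k) (\<lambda>_. 0)" by (intro representsI) (auto simp: represents1_0)
  have "Lq q (\<lambda>_::'a. 0::'k) = 0" by (simp add: Lq_def ennreal_powr_def)
  then have vec: "(0 :: real \<Rightarrow> 'a \<Rightarrow> 'k) t \<in> vectors (LX q U)" for t :: real
    by (simp add: vectors_LX_iff[OF U represents1_0 q0])
  show "(0 :: real \<Rightarrow> 'a \<Rightarrow> 'k) \<in> vectors (LY p q U)"
    by (rule vectors_LYI[OF U p q rep vec]) (simp add: mixed_def ennreal_powr_def)
qed

lemma LY_sum:
  fixes f :: "nat \<Rightarrow> real \<Rightarrow> 'a::euclidean_space \<Rightarrow> 'k::{real_normed_field, euclidean_space}"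
  assumes U: "open U" and p: "0 < p" and q: "1 < q"
    and f: "\<And>n. n \<in> I \<Longrightarrow> f n \<in> vectors (LY p q U)" and f': "\<And>n. n \<in> I \<Longrightarrow> represents U (f n) (f' n)"
  shows "represents U (\<Sum>n\<in>I. scl (LY p q U) (c n) (f n)) (\<lambda>z. \<Sum>n\<in>I. c n * f' n z) \<and> (\<Sum>n\<in>I. scl (LY p q U) (c n) (f n)) \<in> vectors (LY p q U)"
  using f f'
proof (induction I rule: infinite_finite_induct)
  case (insert n I)
  have IH: "represents U (\<Sum>n\<in>I. scl (LY p q U) (c n) (f n)) (\<lambda>z. \<Sum>n\<in>I. c n * f' n z)" "(\<Sum>n\<in>I. scl (LY p q U) (c n) (f n)) \<in> vectors (LY p q U)"
    using insert by auto
  have fn: "f n \<in> vectors (LY p q U)" "represents U (f n) (f' n)" using insert by auto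
  note s = LY_cmult[OF U p q fn, of "c n"]
  show ?case unfolding sum.insert[OF insert(1,2)] using LY_add[OF U p q s(2) IH(2) s(1) IH(1)] by blast
qed (use LY_0[OF U p q] in auto)

text \<open>A Borel version of the integral operator applied to f, with k a Borel version of the
  kernel and G a joint representative of T(t,s) f(s).\<close>

definition kernel_op :: "(real \<Rightarrow> 'k::{real_normed_field, euclidean_space}) \<Rightarrow> ((real \<times> real) \<times> 'a \<Rightarrow> 'k) \<Rightarrow> real \<times> 'a \<Rightarrow> 'k" where
  "kernel_op k G z = (\<integral>s. k (fst z - s) * G ((fst z, s), snd z) \<partial>lborel)"

lemma borel_measurable_kernel_op:
  fixes G :: "(real \<times> real) \<times> 'a::euclidean_space \<Rightarrow> 'k::{real_normed_field, euclidean_space}"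
  assumes [measurable]: "k \<in> borel_fun" and G: "G \<in> borel_fun"
  shows "kernel_op k G \<in> borel_fun"
proof -
  have [measurable]: "G \<in> borel_measurable ((borel \<Otimes>\<^sub>M borel) \<Otimes>\<^sub>M borel)" using G by (simp add: borel_prod)
  have "kernel_op k G \<in> borel_measurable (borel \<Otimes>\<^sub>M borel)" unfolding kernel_op_def[abs_def] by measurable
  then show ?thesis by (simp add: borel_prod)
qed

lemma norm_kernel_op_le:
  "enorm (kernel_op k G z) \<le> kernel_integral (\<lambda>x. norm (k x)) (\<lambda>(t, s, x). enorm (G ((t, s), x))) z"
proof -
  have "enorm (kernel_op k G z) \<le> (NN s. enorm (k (fst z - s) * G ((fst z, s), snd z)))"
    unfolding kernel_op_def by (rule norm_integral_le_nn_integral)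
  then show ?thesis by (simp add: kernel_integral_def case_prod_beta norm_mult ennreal_mult)
qed

section \<open>Boundedness, linearity and R-boundedness of the integral operators\<close>

context operator_family
begin

definition square_const :: "real \<Rightarrow> bool" where
  "square_const c \<longleftrightarrow> (\<forall>N k f h G. (\<forall>n\<in>{1..N}. dominated_kernel (\<lambda>x. norm (k n x)) \<and> (\<forall>s. f n s \<in> vectors X) \<and>
        represents U (f n) (h n) \<and> represents U (\<lambda>(t, s). T t s (f n s)) (G n)) \<longrightarrow>
      mixed p q (square_sum N (\<lambda>n. kernel_op (k n) (G n))) \<le> ennreal c * mixed p q (square_sum N h))"

lemma square_function_op:
  obtains C0 where "0 \<le> C0" "square_const C0"
proof -
  obtain c where c: "\<And>B. 0 \<le> c B" and wd: "\<And>f h G. (\<And>s. f s \<in> vectors X) \<Longrightarrow> represents U f h \<Longrightarrow> represents U (\<lambda>(t, s). T t s (f s)) G \<Longrightarrow>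
      weight_dominated q c (\<lambda>(t, s, x). enorm (G ((t, s), x))) (\<lambda>z. enorm (h z))"
    by (rule weight_dominated_T) blast
  show ?thesis
  proof (rule square_function_bound[where 'a = 'a, OF p q c])
    fix C0 :: real
    assume C0: "0 \<le> C0"
    and le: "\<And>(I :: nat set) \<kappa> (u :: nat \<Rightarrow> real \<times> real \<times> 'a \<Rightarrow> ennreal) v. finite I \<Longrightarrow>
      (\<And>n. n \<in> I \<Longrightarrow> dominated_kernel (\<kappa> n)) \<Longrightarrow>
      (\<And>n. n \<in> I \<Longrightarrow> u n \<in> borel_fun) \<Longrightarrow> (\<And>n. n \<in> I \<Longrightarrow> v n \<in> borel_fun) \<Longrightarrow>
      (\<And>n. n \<in> I \<Longrightarrow> weight_dominated q c (u n) (v n)) \<Longrightarrow>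
      (NN t. epow (NN x. epow (\<Sum>n\<in>I. epow (kernel_integral (\<kappa> n) (u n) (t, x)) 2) (q / 2)) (p / q))
       \<le> ennreal C0 * (NN t. epow (NN x. epow (\<Sum>n\<in>I. epow (v n (t, x)) 2) (q / 2)) (p / q))"
    have "square_const C0"
      unfolding square_const_def
    proof (intro allI impI)
      fix N and k :: "nat \<Rightarrow> real \<Rightarrow> 'k" and f h G
      assume *: "\<forall>n\<in>{1..N}. dominated_kernel (\<lambda>x. norm (k n x)) \<and> (\<forall>s. f n s \<in> vectors X) \<and>
          represents U (f n) (h n) \<and> represents U (\<lambda>(t, s). T t s (f n s)) (G n)"
      have k: "\<And>n. n \<in> {1..N} \<Longrightarrow> dominated_kernel (\<lambda>x. norm (k n x))"
        and f: "\<And>n s. n \<in> {1..N} \<Longrightarrow> f n s \<in> vectors X" and h: "\<And>n. n \<in> {1..N} \<Longrightarrow> represents U (f n) (h n)"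
        and G: "\<And>n. n \<in> {1..N} \<Longrightarrow> represents U (\<lambda>(t, s). T t s (f n s)) (G n)"
        using * by blast+
      define u where "u n = (\<lambda>(t, s, x). enorm (G n ((t, s), x)))" for n
      have um: "u n \<in> borel_fun" if n: "n \<in> {1..N}" for n
      proof -
        have "(\<lambda>z :: real \<times> real \<times> 'a. G n ((fst z, fst (snd z)), snd (snd z))) \<in> borel_fun"
          by (rule measurable_compose[OF _ representsD(1)[OF G[OF n]]]) (simp add: borel_prod[symmetric])
        then have "(\<lambda>z. enorm (G n ((fst z, fst (snd z)), snd (snd z)))) \<in> borel_measurable (borel :: (real \<times> real \<times> 'a) measure)"
          by measurable
        then show ?thesis by (simp add: u_def case_prod_beta')
      qed
      have hm: "(\<lambda>z. enorm (h n z)) \<in> borel_fun" if "n \<in> {1..N}" for n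
        using representsD(1)[OF h[OF that]] by measurable
      have "mixed p q (square_sum N (\<lambda>n. kernel_op (k n) (G n)))
        \<le> mixed p q (\<lambda>z. epow (\<Sum>n=1..N. epow (kernel_integral (\<lambda>x. norm (k n x)) (u n) z) 2) (1 / 2))"
        unfolding square_sum_def u_def
        by (intro mixed_mono p0 q0 epow_mono sum_mono norm_kernel_op_le) auto
      also have "\<dots> \<le> ennreal C0 * mixed p q (\<lambda>z. epow (\<Sum>n=1..N. epow (enorm (h n z)) 2) (1 / 2))"
        using le[of "{1..N}" "\<lambda>n x. norm (k n x)" u "\<lambda>n z. enorm (h n z)"] k um hm wd[OF f h G]
        unfolding mixed_def epow_powr u_def by simp
      finally show "mixed p q (square_sum N (\<lambda>n. kernel_op (k n) (G n))) \<le> ennreal C0 * mixed p q (square_sum N h)"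
        by (simp add: square_sum_def[abs_def])
    qed
    with C0 show ?thesis by (rule that)
  qed
qed

lemma kernel_data:
  assumes k: "k \<in> kernels" and f: "f \<in> vectors Y"
  obtains k0 h G where "k0 \<in> borel_fun" "ae x. k x = k0 x" "dominated_kernel (\<lambda>x. norm (k0 x))"
    "represents U f h" "represents U (\<lambda>(t, s). T t s (f s)) G"
proof -
  note m = vectors_LYD(2)[OF f]
  obtain k0 where k0: "k0 \<in> borel_fun" "ae x. k x = k0 x" "dominated_kernel (\<lambda>x. norm (k0 x))"
    by (rule kernel_ex_borel[OF k])
  obtain h where h: "represents U f h" by (rule strongly_measurable_represents[OF U q m])
  obtain G where G: "represents U (\<lambda>(t, s). T t s (f s)) G" by (rule ex_represents_operator[OF m])
  show ?thesis by (rule that[OF k0 h G])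
qed

lemma represents_integral_op:
  assumes k0: "k0 \<in> borel_fun" "ae x. k x = k0 x" "dominated_kernel (\<lambda>x. norm (k0 x))"
    and f: "f \<in> vectors Y" and h: "represents U f h" and G: "represents U (\<lambda>(t, s). T t s (f s)) G"
  shows "represents U (integral_op X T k f) (kernel_op k0 G)"
proof (rule representsI)
  show "kernel_op k0 G \<in> borel_fun" by (rule borel_measurable_kernel_op[OF k0(1) representsD(1)[OF G]])
  show "kernel_op k0 G (t, x) = 0" if "x \<notin> U" for t x using representsD(2)[OF G that] by (simp add: kernel_op_def)
  show "ae t. represents1 U (integral_op X T k f t) (\<lambda>x. kernel_op k0 G (t, x))"
    using AE_integral_op[OF assms] by eventually_elim (simp add: kernel_op_def)
qed

text \<open>This is the square function estimate for a single term, which also shows that the bound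
  is the same for all kernels.\<close>

lemma integral_op_bounded:
  obtains B where "\<And>k f. k \<in> kernels \<Longrightarrow> f \<in> vectors Y \<Longrightarrow> integral_op X T k f \<in> vectors Y \<and> nrm Y (integral_op X T k f) \<le> B * nrm Y f"
proof -
  obtain C0 where C0: "0 \<le> C0" and le: "square_const C0"
    by (rule square_function_op)
  have sq1: "square_sum 1 g = (\<lambda>z. enorm (g 1 z))" for g :: "nat \<Rightarrow> real \<times> 'a \<Rightarrow> 'k"
    by (simp add: square_sum_eq fun_eq_iff)
  show ?thesis
  proof (rule that[of "C0 powr (1 / p)"])
    fix k :: "real \<Rightarrow> 'k" and f assume k: "k \<in> kernels" and f: "f \<in> vectors Y"
    obtain k0 h G where k0: "k0 \<in> borel_fun" "ae x. k x = k0 x" "dominated_kernel (\<lambda>x. norm (k0 x))"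
      and h: "represents U f h" and G: "represents U (\<lambda>(t, s). T t s (f s)) G" by (rule kernel_data[OF k f])
    note rep = represents_integral_op[OF k0 f h G]
    have bd: "mixed p q (\<lambda>z. enorm (kernel_op k0 G z)) \<le> ennreal C0 * mixed p q (\<lambda>z. enorm (h z))"
      using le[unfolded square_const_def, rule_format, of 1 "\<lambda>_. k0" "\<lambda>_. f" "\<lambda>_. h" "\<lambda>_. G"] k0(3) vectors_LYD(1)[OF f] h G unfolding sq1 by simp
    also have "\<dots> < \<top>" using nrm_LY(2)[OF U p0 q0 h f] by (simp add: ennreal_mult_less_top)
    finally have v: "integral_op X T k f \<in> vectors Y" by (rule vectors_LYI[OF U p0 q rep integral_op_vec])
    have "ennreal (nrm Y (integral_op X T k f)) \<le> epow (ennreal C0 * mixed p q (\<lambda>z. enorm (h z))) (1 / p)"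
      unfolding nrm_LY(1)[OF U p0 q0 rep v] using p0 by (intro epow_mono bd) auto
    also have "\<dots> = ennreal (C0 powr (1 / p) * nrm Y f)"
      using C0 by (simp add: epow_mult epow_ennreal ennreal_mult' nrm_LY(1)[OF U p0 q0 h f, symmetric])
    finally have "nrm Y (integral_op X T k f) \<le> C0 powr (1 / p) * nrm Y f"
      by (subst (asm) ennreal_le_iff) (simp_all add: Bochner_space_def)
    with v show "integral_op X T k f \<in> vectors Y \<and> nrm Y (integral_op X T k f) \<le> C0 powr (1 / p) * nrm Y f" ..
  qed
qed

lemma nrm_Y_eq_0:
  assumes "ae t. represents1 U (F t) (u t) \<and> (ae x. u t x = 0)"
  shows "nrm Y F = 0"
proof -
  have "ae t. nrm X (F t) = 0"
    using assms
  proof eventually_elim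
    case (elim t)
    then have u: "represents1 U (F t) (u t)" "ae x. u t x = 0" by auto
    have "Lq q (u t) = Lq q (\<lambda>_::'a. 0::'k)" by (rule Lq_cong_AE, rule eventually_mono[OF u(2)]) simp
    also have "\<dots> = 0" by (simp add: Lq_def ennreal_powr_def)
    finally have 0: "Lq q (u t) = 0" .
    then have "F t \<in> vectors X" by (simp add: vectors_LX_iff[OF U u(1) q0])
    from nrm_LX[OF U u(1) q0 this] show ?case unfolding 0 by (simp add: nrm_Leb_space_nonneg)
  qed
  then have "AE t in lebesgue. nrm X (F t) powr p = 0" by (simp add: AE_completion_iff)
  then have "(\<integral>t. nrm X (F t) powr p \<partial>lebesgue) = 0" by (rule integral_eq_zero_AE)
  then show ?thesis by (simp add: Bochner_space_def)
qed

lemma integral_op_add: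
  assumes k: "k \<in> kernels" and f: "f \<in> vectors Y" and g: "g \<in> vectors Y"
  shows "nrm Y (integral_op X T k (f + g) - (integral_op X T k f + integral_op X T k g)) = 0"
proof -
  obtain k0 h G where k0: "k0 \<in> borel_fun" "ae x. k x = k0 x" "dominated_kernel (\<lambda>x. norm (k0 x))"
    and h: "represents U f h" and G: "represents U (\<lambda>(t, s). T t s (f s)) G" by (rule kernel_data[OF k f])
  obtain h' where h': "represents U g h'" by (rule strongly_measurable_represents[OF U q vectors_LYD(2)[OF g]])
  obtain G' where G': "represents U (\<lambda>(t, s). T t s (g s)) G'" by (rule ex_represents_operator[OF vectors_LYD(2)[OF g]])
  note fg = LY_add[OF U p0 q f g h h']
  have GG: "represents U (\<lambda>(t, s). T t s ((f + g) s)) (\<lambda>z. G z + G' z)"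
  proof (rule representsI)
    show "(\<lambda>z. G z + G' z) \<in> borel_fun" by (intro borel_measurable_add representsD(1)[OF G] representsD(1)[OF G'])
    show "G (y, x) + G' (y, x) = 0" if "x \<notin> U" for x y using representsD(2)[OF G that] representsD(2)[OF G' that] by simp
    show "ae y. represents1 U (case y of (t, s) \<Rightarrow> T t s ((f + g) s)) (\<lambda>x. G (y, x) + G' (y, x))"
      using representsD(3)[OF G] representsD(3)[OF G']
    proof eventually_elim
      case (elim y)
      then show ?case
        unfolding case_prod_beta plus_fun_apply[of f g]
        by (intro bounded_ops_add_represents[OF U q bdd] vectors_LYD(1)[OF f] vectors_LYD(1)[OF g])
    qed
  qed
  show ?thesis
  proof (rule nrm_Y_eq_0)
    show "ae t. represents1 U ((integral_op X T k (f + g) - (integral_op X T k f + integral_op X T k g)) t)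
        (\<lambda>x. (\<integral>s. k0 (t - s) * (G ((t, s), x) + G' ((t, s), x)) \<partial>lborel)
          - ((\<integral>s. k0 (t - s) * G ((t, s), x) \<partial>lborel) + (\<integral>s. k0 (t - s) * G' ((t, s), x) \<partial>lborel)))
      \<and> (ae x. (\<integral>s. k0 (t - s) * (G ((t, s), x) + G' ((t, s), x)) \<partial>lborel)
          - ((\<integral>s. k0 (t - s) * G ((t, s), x) \<partial>lborel) + (\<integral>s. k0 (t - s) * G' ((t, s), x) \<partial>lborel)) = 0)"
      using AE_integral_op[OF k0 f h G] AE_integral_op[OF k0 g h' G'] AE_integral_op[OF k0 fg(2,1) GG]
    proof eventually_elim
      case (elim t)
      have "ae x. integrable lborel (\<lambda>s. k0 (t - s) * G ((t, s), x))" "ae x. integrable lborel (\<lambda>s. k0 (t - s) * G' ((t, s), x))"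
        using elim by auto
      then have "ae x. (\<integral>s. k0 (t - s) * (G ((t, s), x) + G' ((t, s), x)) \<partial>lborel)
          - ((\<integral>s. k0 (t - s) * G ((t, s), x) \<partial>lborel) + (\<integral>s. k0 (t - s) * G' ((t, s), x) \<partial>lborel)) = 0"
        by eventually_elim (simp add: distrib_left)
      moreover have "(integral_op X T k (f + g) - (integral_op X T k f + integral_op X T k g)) t
        = integral_op X T k (f + g) t - (integral_op X T k f t + integral_op X T k g t)" by (simp only: minus_apply plus_fun_apply)
      moreover note represents1_diff[OF elim(3)[THEN conjunct2, THEN conjunct1]
        represents1_add[OF elim(1)[THEN conjunct2, THEN conjunct1] elim(2)[THEN conjunct2, THEN conjunct1]]]
      ultimately show ?case by (simp only:)
    qed
  qed
qed

lemma integral_op_scl: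
  assumes k: "k \<in> kernels" and f: "f \<in> vectors Y"
  shows "nrm Y (integral_op X T k (scl Y c f) - scl Y c (integral_op X T k f)) = 0"
proof -
  obtain k0 h G where k0: "k0 \<in> borel_fun" "ae x. k x = k0 x" "dominated_kernel (\<lambda>x. norm (k0 x))"
    and h: "represents U f h" and G: "represents U (\<lambda>(t, s). T t s (f s)) G" by (rule kernel_data[OF k f])
  note cf = LY_cmult[OF U p0 q f h, of c]
  have GG: "represents U (\<lambda>(t, s). T t s (scl Y c f s)) (\<lambda>z. c * G z)"
  proof (rule representsI)
    show "(\<lambda>z. c * G z) \<in> borel_fun" by (intro borel_measurable_times borel_measurable_const representsD(1)[OF G])
    show "c * G (y, x) = 0" if "x \<notin> U" for x y using representsD(2)[OF G that] by simp
    show "ae y. represents1 U (case y of (t, s) \<Rightarrow> T t s (scl Y c f s)) (\<lambda>x. c * G (y, x))"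
      using representsD(3)[OF G]
    proof eventually_elim
      case (elim y)
      then show ?case
        unfolding case_prod_beta scl_LY by (intro bounded_ops_cmult_represents[OF U q bdd] vectors_LYD(1)[OF f])
    qed
  qed
  show ?thesis
  proof (rule nrm_Y_eq_0)
    show "ae t. represents1 U ((integral_op X T k (scl Y c f) - scl Y c (integral_op X T k f)) t)
        (\<lambda>x. (\<integral>s. k0 (t - s) * (c * G ((t, s), x)) \<partial>lborel) - c * (\<integral>s. k0 (t - s) * G ((t, s), x) \<partial>lborel))
      \<and> (ae x. (\<integral>s. k0 (t - s) * (c * G ((t, s), x)) \<partial>lborel) - c * (\<integral>s. k0 (t - s) * G ((t, s), x) \<partial>lborel) = 0)"
      using AE_integral_op[OF k0 f h G] AE_integral_op[OF k0 cf(2,1) GG]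
    proof eventually_elim
      case (elim t)
      have "(\<integral>s. k0 (t - s) * (c * G ((t, s), x)) \<partial>lborel) - c * (\<integral>s. k0 (t - s) * G ((t, s), x) \<partial>lborel) = 0" for x
        by (subst integral_mult_right_zero[symmetric]) (simp add: mult.left_commute)
      then have "ae x. (\<integral>s. k0 (t - s) * (c * G ((t, s), x)) \<partial>lborel) - c * (\<integral>s. k0 (t - s) * G ((t, s), x) \<partial>lborel) = 0"
        by (intro AE_I2)
      moreover have "(integral_op X T k (scl Y c f) - scl Y c (integral_op X T k f)) t
        = integral_op X T k (scl Y c f) t - (\<lambda>x. c * integral_op X T k f t x)" by (simp only: minus_apply scl_LY)
      moreover note represents1_diff[OF elim(2)[THEN conjunct2, THEN conjunct1]
        represents1_cmult[OF elim(1)[THEN conjunct2, THEN conjunct1], of c]]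
      ultimately show ?case by (simp only:)
    qed
  qed
qed

lemma integral_op_bounded_ops: "integral_op X T ` kernels \<subseteq> bounded_ops Y"
proof -
  obtain B where B: "\<And>k f. k \<in> kernels \<Longrightarrow> f \<in> vectors Y \<Longrightarrow> integral_op X T k f \<in> vectors Y \<and> nrm Y (integral_op X T k f) \<le> B * nrm Y f"
    by (rule integral_op_bounded) blast
  show ?thesis unfolding bounded_ops_def using B integral_op_add integral_op_scl by blast
qed

text \<open>The random sum of the images is bounded by their square function, this by the square
  function of the given vectors, and this by their random sum. All three comparisons are made
  between nonnegative integrals of Borel versions and are translated back to seminorms at the
  end.\<close>

lemma R_bounded_integral_op:
  assumes "rademacher P \<epsilon>"
  shows "R_bounded P \<epsilon> Y (integral_op X T ` kernels)"
proof -
  interpret P: rademacher P \<epsilon> by fact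
  obtain C0 where C0: "0 \<le> C0" and sq: "square_const C0"
    by (rule square_function_op)
  \<comment> \<open>Any exponent above 2, p and q will do: Minkowski's inequality is applied with
    r/q and r/p, and Jensen's inequality with r/2.\<close>
  define r where "r = 2 + p + q"
  have r: "2 < r" "p < r" "q < r" "0 < r" using p q by (auto simp: r_def)
  define Cu where "Cu = ennreal (khintchine_const (real DIM('k)) r)"
  define Cl where "Cl = ennreal (2 * sqrt (2 * khintchine_const (real DIM('k)) 4))"
  define Ku where "Ku = 2 * epow (2 * epow (2 * epow Cu (q / r)) (p / q)) (2 / p)"
  define Kl where "Kl = 4 * epow (4 * Cl) 2"
  have Kfin: "Ku < \<top>" "Kl < \<top>"
  proof -
    have m: "a < \<top> \<Longrightarrow> b < \<top> \<Longrightarrow> a * b < \<top>" for a b :: ennreal by (simp add: ennreal_mult_less_top)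
    have pw: "a < \<top> \<Longrightarrow> epow a s < \<top>" for a s by (simp add: ennreal_powr_def)
    show "Ku < \<top>" unfolding Ku_def Cu_def by (intro m pw) simp_all
    show "Kl < \<top>" unfolding Kl_def Cl_def by (intro m pw) simp_all
  qed
  define W where "W N v = (\<lambda>(t :: real, x :: 'a, w). enorm (\<Sum>n=1..N. of_real (\<epsilon> n w) * (v n (t, x) :: 'k)))" for N v
  define E where "E N v = (\<integral>\<^sup>+w. epow (mixed p q (\<lambda>(t, x). W N v (t, x, w))) (2 / p) \<partial>P)" for N v
  have Wm: "W N v \<in> borel_measurable (lborel \<Otimes>\<^sub>M lborel \<Otimes>\<^sub>M P)" if v: "\<And>n. n \<in> {1..N} \<Longrightarrow> v n \<in> borel_fun" for N v
  proof -
    have "(\<lambda>z. of_real (\<epsilon> n (snd (snd z))) * v n (fst z, fst (snd z))) \<in> borel_measurable (lborel \<Otimes>\<^sub>M lborel \<Otimes>\<^sub>M P)" if n: "n \<in> {1..N}" for n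
    proof -
      have [measurable]: "\<epsilon> n \<in> borel_measurable P" using n by (intro P.rv) simp
      have [measurable]: "v n \<in> borel_measurable (borel \<Otimes>\<^sub>M borel)" using v[OF n] by (simp add: borel_prod)
      show ?thesis by measurable
    qed
    then have [measurable]: "(\<lambda>z. \<Sum>n=1..N. of_real (\<epsilon> n (snd (snd z))) * v n (fst z, fst (snd z))) \<in> borel_measurable (lborel \<Otimes>\<^sub>M lborel \<Otimes>\<^sub>M P)"
      by (rule borel_measurable_sum)
    show ?thesis unfolding W_def case_prod_beta' by measurable
  qed
  have sm: "square_sum N v \<in> borel_measurable (lborel \<Otimes>\<^sub>M lborel)" if "\<And>n. n \<in> {1..N} \<Longrightarrow> v n \<in> borel_fun" for N and v :: "nat \<Rightarrow> real \<times> 'a \<Rightarrow> 'k"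
    using borel_measurable_square_sum[of N v] that by (simp add: lborel_prod)
  have upper: "E N v \<le> Ku * epow (mixed p q (square_sum N v)) (2 / p)" if v: "\<And>n. n \<in> {1..N} \<Longrightarrow> v n \<in> borel_fun" for N v
    unfolding E_def Ku_def
  proof (rule P.mixed_moment_upper[OF p q r(1-3) Wm[OF v] sm[OF v]])
    fix t x
    show "(\<integral>\<^sup>+w. epow (W N v (t, x, w)) r \<partial>P) \<le> Cu * epow (square_sum N v (t, x)) r"
      using P.khintchine_upper[OF r(4), where N = N and a = "\<lambda>n. v n (t, x)"]
      by (simp add: W_def Cu_def square_sum_eq epow_ennreal ennreal_mult khintchine_const_def sum_nonneg)
  qed
  have lower: "epow (mixed p q (square_sum N v)) (2 / p) \<le> Kl * E N v" if v: "\<And>n. n \<in> {1..N} \<Longrightarrow> v n \<in> borel_fun" for N v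
    unfolding E_def Kl_def
  proof (rule P.mixed_moment_lower[OF p q Wm[OF v] sm[OF v]])
    fix t x
    show "square_sum N v (t, x) \<le> Cl * (\<integral>\<^sup>+w. W N v (t, x, w) \<partial>P)"
      using P.khintchine_lower[OF refl, where N = N and a = "\<lambda>n. v n (t, x)"]
      by (simp add: W_def Cl_def square_sum_eq)
  qed
  have nrm_eq: "ennreal (nrm Y (\<Sum>n=1..N. scl Y (of_real (\<epsilon> n w)) (f n)) powr 2) = epow (mixed p q (\<lambda>(t, x). W N v (t, x, w))) (2 / p)"
    if f: "\<And>n. n \<in> {1..N} \<Longrightarrow> f n \<in> vectors Y" "\<And>n. n \<in> {1..N} \<Longrightarrow> represents U (f n) (v n)" for N f v w
  proof -
    have s: "represents U (\<Sum>n=1..N. scl Y (of_real (\<epsilon> n w)) (f n)) (\<lambda>z. \<Sum>n=1..N. of_real (\<epsilon> n w) * v n z)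
      \<and> (\<Sum>n=1..N. scl Y (of_real (\<epsilon> n w)) (f n)) \<in> vectors Y"
      by (rule LY_sum[OF U p0 q]) (use f in auto)
    have "ennreal (nrm Y (\<Sum>n=1..N. scl Y (of_real (\<epsilon> n w)) (f n)) powr 2) = epow (ennreal (nrm Y (\<Sum>n=1..N. scl Y (of_real (\<epsilon> n w)) (f n)))) 2"
      by (simp add: epow_ennreal Bochner_space_def)
    also have "\<dots> = epow (mixed p q (\<lambda>z. enorm (\<Sum>n=1..N. of_real (\<epsilon> n w) * v n z))) (2 / p)"
      unfolding nrm_LY(1)[OF U p0 q0 conjunct1[OF s] conjunct2[OF s]] by (simp add: epow_powr)
    also have "(\<lambda>z. enorm (\<Sum>n=1..N. of_real (\<epsilon> n w) * v n z)) = (\<lambda>(t, x). W N v (t, x, w))"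
      by (simp add: W_def fun_eq_iff)
    finally show ?thesis .
  qed
  define K where "K = Ku * epow (ennreal C0) (2 / p) * Kl"
  have "K < \<top>" using Kfin by (simp add: K_def ennreal_mult_less_top epow_ennreal C0)
  then obtain \<kappa> where \<kappa>: "K = ennreal \<kappa>" "0 \<le> \<kappa>" by (cases K) auto
  show ?thesis
    unfolding R_bounded_def
  proof (intro exI[of _ "\<kappa> powr (1 / 2)"] allI impI)
    fix N :: nat and S :: "nat \<Rightarrow> (real \<Rightarrow> 'a \<Rightarrow> 'k) \<Rightarrow> real \<Rightarrow> 'a \<Rightarrow> 'k" and f
    assume *: "\<forall>n\<in>{1..N}. S n \<in> integral_op X T ` kernels \<and> f n \<in> vectors Y"
    have "\<exists>k. k \<in> kernels \<and> S n = integral_op X T k" if "n \<in> {1..N}" for n using * that by blast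
    then obtain k where k: "\<And>n. n \<in> {1..N} \<Longrightarrow> k n \<in> kernels" "\<And>n. n \<in> {1..N} \<Longrightarrow> S n = integral_op X T (k n)" by metis
    have f: "\<And>n. n \<in> {1..N} \<Longrightarrow> f n \<in> vectors Y" using * by blast
    define D where "D n k0 h G \<longleftrightarrow> k0 \<in> borel_fun \<and> (ae x. k n x = k0 x) \<and> dominated_kernel (\<lambda>x. norm (k0 x))
      \<and> represents U (f n) h \<and> represents U (\<lambda>(t, s). T t s (f n s)) G" for n k0 h G
    have "\<exists>k0 h G. D n k0 h G" if n: "n \<in> {1..N}" for n
      unfolding D_def by (rule kernel_data[OF k(1)[OF n] f[OF n]]) blast
    then obtain k0 h G where D: "\<And>n. n \<in> {1..N} \<Longrightarrow> D n (k0 n) (h n) (G n)" by metis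
    have k0: "\<And>n. n \<in> {1..N} \<Longrightarrow> k0 n \<in> borel_fun" "\<And>n. n \<in> {1..N} \<Longrightarrow> ae x. k n x = k0 n x"
        "\<And>n. n \<in> {1..N} \<Longrightarrow> dominated_kernel (\<lambda>x. norm (k0 n x))"
      and h: "\<And>n. n \<in> {1..N} \<Longrightarrow> represents U (f n) (h n)" and G: "\<And>n. n \<in> {1..N} \<Longrightarrow> represents U (\<lambda>(t, s). T t s (f n s)) (G n)"
      using D unfolding D_def by blast+
    define u where "u n = kernel_op (k0 n) (G n)" for n
    have Sf: "S n (f n) \<in> vectors Y" if n: "n \<in> {1..N}" for n
    proof -
      have "integral_op X T (k n) \<in> bounded_ops Y" using integral_op_bounded_ops k(1)[OF n] by blast
      then show ?thesis unfolding k(2)[OF n] bounded_ops_def using f[OF n] by blast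
    qed
    have Sr: "represents U (S n (f n)) (u n)" if n: "n \<in> {1..N}" for n
      unfolding k(2)[OF n] u_def by (rule represents_integral_op[OF k0(1)[OF n] k0(2)[OF n] k0(3)[OF n] f[OF n] h[OF n] G[OF n]])
    have um: "\<And>n. n \<in> {1..N} \<Longrightarrow> u n \<in> borel_fun" by (rule representsD(1)[OF Sr])
    have hm: "\<And>n. n \<in> {1..N} \<Longrightarrow> h n \<in> borel_fun" by (rule representsD(1)[OF h])
    define L where "L w = nrm Y (\<Sum>n=1..N. scl Y (of_real (\<epsilon> n w)) (S n (f n))) powr 2" for w
    define R where "R w = nrm Y (\<Sum>n=1..N. scl Y (of_real (\<epsilon> n w)) (f n)) powr 2" for w
    have EL: "(\<integral>\<^sup>+w. ennreal (L w) \<partial>P) = E N u" 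
      unfolding E_def L_def by (intro nn_integral_cong nrm_eq) (erule Sf, erule Sr)
    have ER: "(\<integral>\<^sup>+w. ennreal (R w) \<partial>P) = E N h" 
      unfolding E_def R_def by (intro nn_integral_cong nrm_eq) (erule f, erule h)
    have sqle: "mixed p q (square_sum N u) \<le> ennreal C0 * mixed p q (square_sum N h)"
      unfolding u_def
      by (rule sq[unfolded square_const_def, rule_format, of N k0 f h G]) (use k0(3) vectors_LYD(1)[OF f] h G in blast)
    have "E N u \<le> Ku * epow (mixed p q (square_sum N u)) (2 / p)" by (rule upper[OF um])
    also have "\<dots> \<le> Ku * epow (ennreal C0 * mixed p q (square_sum N h)) (2 / p)"
      using p0 by (intro mult_left_mono epow_mono sqle) auto
    also have "\<dots> = Ku * epow (ennreal C0) (2 / p) * epow (mixed p q (square_sum N h)) (2 / p)"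
      by (simp add: epow_mult mult.assoc)
    also have "\<dots> \<le> Ku * epow (ennreal C0) (2 / p) * (Kl * E N h)"
      by (intro mult_left_mono lower[OF hm]) auto
    finally have main: "E N u \<le> ennreal \<kappa> * E N h" by (simp add: \<kappa>(1)[symmetric] K_def mult.assoc)
    \<comment> \<open>The seminorm of \<open>Bochner_space\<close> is a Bochner integral, which
      would be 0 for a function that is not integrable. Finiteness is thus essential on the right
      side: it makes the seminorm there equal to the nonnegative integral.\<close>
    have Efin: "E N h < \<top>"
    proof -
      have "mixed p q (square_sum N h) \<le> mixed p q (\<lambda>z. \<Sum>n=1..N. enorm (h n z))"
        by (intro mixed_mono p0 q0 square_sum_le_sum)
      also have "\<dots> < \<top>"
      proof (rule mixed_sum_finite[OF p0 q0])
        show "(\<lambda>z. enorm (h n z)) \<in> borel_fun" if "n \<in> {1..N}" for n using hm[OF that] by measurable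
        show "mixed p q (\<lambda>z. enorm (h n z)) < \<top>" if "n \<in> {1..N}" for n by (rule nrm_LY(2)[OF U p0 q0 h[OF that] f[OF that]])
      qed
      finally have "epow (mixed p q (square_sum N h)) (2 / p) < \<top>" by (simp add: ennreal_powr_def)
      then have "Ku * epow (mixed p q (square_sum N h)) (2 / p) < \<top>" using Kfin by (simp add: ennreal_mult_less_top)
      with upper[OF hm] show ?thesis by (rule le_less_trans)
    qed
    have L0: "0 \<le> L w" and R0: "0 \<le> R w" for w unfolding L_def R_def by (rule powr_ge_zero)+
    have Rm: "R \<in> borel_measurable P"
    proof -
      have [measurable]: "W N h \<in> borel_measurable (lborel \<Otimes>\<^sub>M lborel \<Otimes>\<^sub>M P)" by (rule Wm[OF hm])
      have "(\<lambda>w. enn2real (epow (mixed p q (\<lambda>(t, x). W N h (t, x, w))) (2 / p))) \<in> borel_measurable P"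
        unfolding mixed_def prod.case by measurable
      also have "(\<lambda>w. enn2real (epow (mixed p q (\<lambda>(t, x). W N h (t, x, w))) (2 / p))) = R"
      proof
        fix w
        have "ennreal (R w) = epow (mixed p q (\<lambda>(t, x). W N h (t, x, w))) (2 / p)"
          unfolding R_def by (rule nrm_eq) (erule f, erule h)
        then show "enn2real (epow (mixed p q (\<lambda>(t, x). W N h (t, x, w))) (2 / p)) = R w"
          using R0[of w] by (simp flip: \<open>ennreal (R w) = _\<close>)
      qed
      finally show ?thesis .
    qed
    define IR where "IR = (\<integral>w. R w \<partial>P)"
    have "integrable P R" using Rm Efin ER by (intro integrableI_bounded) (simp_all add: abs_of_nonneg R0)
    then have IR: "E N h = ennreal IR" unfolding ER[symmetric] IR_def by (intro nn_integral_eq_integral) (auto simp: R0)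
    have IR0: "0 \<le> IR" unfolding IR_def by (intro integral_nonneg_AE) (auto simp: R0)
    \<comment> \<open>On the left side an upper bound for the nonnegative integral is enough, since
      the default value 0 can only make the seminorm smaller.\<close>
    have "(\<integral>w. L w \<partial>P) \<le> \<kappa> * IR"
    proof (rule integral_real_bounded)
      show "(\<integral>\<^sup>+w. ennreal (L w) \<partial>P) \<le> ennreal (\<kappa> * IR)" using main \<kappa>(2) IR0 unfolding EL IR by (simp add: ennreal_mult)
    qed (use \<kappa>(2) IR0 in simp)
    then have "(\<integral>w. L w \<partial>P) powr (1 / 2) \<le> (\<kappa> * IR) powr (1 / 2)"
      by (intro powr_mono2 integral_nonneg_AE) (auto simp: L0)
    also have "\<dots> = \<kappa> powr (1 / 2) * IR powr (1 / 2)" using \<kappa>(2) IR0 by (simp add: powr_mult)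
    finally show "nrm (Bochner_space P 2 Y) (\<lambda>w. \<Sum>n=1..N. scl Y (of_real (\<epsilon> n w)) (S n (f n)))
      \<le> \<kappa> powr (1 / 2) * nrm (Bochner_space P 2 Y) (\<lambda>w. \<Sum>n=1..N. scl Y (of_real (\<epsilon> n w)) (f n))"
      unfolding Bochner_space_def[of P 2] IR_def L_def R_def seminormed_space.select_convs .
  qed
qed

end

theorem theorem1p1:
  fixes \<Omega> :: "'a::euclidean_space set"
    and p q :: real
    and T :: "real \<Rightarrow> real \<Rightarrow> ('a \<Rightarrow> 'k::{real_normed_field, euclidean_space}) \<Rightarrow> ('a \<Rightarrow> 'k)"
    and C :: "real \<Rightarrow> real"
    and P :: "'p measure" and \<epsilon> :: "nat \<Rightarrow> 'p \<Rightarrow> real"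
  defines "X \<equiv> Leb_space (lebesgue_on \<Omega>) q"
  defines "Y \<equiv> Bochner_space (lebesgue :: real measure) p X"
  assumes "open \<Omega>" and "1 < p" and "1 < q"
    and "\<And>t s. T t s \<in> bounded_ops X"
    and "\<And>\<phi>. \<phi> \<in> vectors X \<Longrightarrow>
           strongly_measurable (lebesgue :: (real \<times> real) measure) X (\<lambda>(t, s). T t s \<phi>)"
    and "A_consistently_bounded q \<Omega> T C"
    and "rademacher_sequence P \<epsilon>"
  shows "(\<forall>k\<in>kernels. \<forall>f\<in>vectors Y. AE t in lebesgue.
            bochner_integrable_in lebesgue X (\<lambda>s. scl X (k (t - s)) (T t s (f s))))
         \<and> integral_op X T ` kernels \<subseteq> bounded_ops Y
         \<and> R_bounded P \<epsilon> Y (integral_op X T ` kernels)"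
proof -
  interpret F: operator_family \<Omega> p q T C
    using assms(3-8) unfolding X_def by unfold_locales
  have "rademacher P \<epsilon>"
    using assms(9) unfolding rademacher_sequence_def rademacher_def rademacher_axioms_def by auto
  then have "R_bounded P \<epsilon> Y (integral_op X T ` kernels)" unfolding Y_def X_def by (rule F.R_bounded_integral_op)
  moreover have "integral_op X T ` kernels \<subseteq> bounded_ops Y" unfolding Y_def X_def by (rule F.integral_op_bounded_ops)
  \<comment> \<open>\<open>bochner_integral_in\<close> returns 0 where there is no integral; this
    conjunct confirms that the default is met for a null set of times only.\<close>
  moreover have "AE t in lebesgue. bochner_integrable_in lebesgue X (\<lambda>s. scl X (k (t - s)) (T t s (f s)))"
    if k: "k \<in> kernels" and f: "f \<in> vectors Y" for k f
  proof (rule F.kernel_data[OF k f[unfolded Y_def X_def]])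
    fix k0 h G
    assume *: "k0 \<in> borel_measurable borel" "AE x in lborel. k x = k0 x" "dominated_kernel (\<lambda>x. norm (k0 x))"
      "represents \<Omega> f h" "represents \<Omega> (\<lambda>(t, s). T t s (f s)) G"
    have "AE t in lborel. bochner_integrable_in lebesgue X (\<lambda>s. scl X (k (t - s)) (T t s (f s)))"
      using F.AE_integral_op[OF *(1-3) f[unfolded Y_def X_def] *(4,5)] unfolding X_def by eventually_elim blast
    then show ?thesis by (simp add: AE_completion_iff)
  qed
  ultimately show ?thesis by blast
qed

end
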